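(* Let $\varphi_1,\dots,\varphi_n\in H^\infty(\mathbb P)$ and let $\epsilon>0$. Then the following statements are equivalent: (1) there exist $f_1,\dots,f_n\in H^\infty(\mathbb P)$ such that $\begin{bmatrix} f_1&\cdots&f_n\end{bmatrix}^t\in\frac1\epsilon SA_{\mathbb P}(\mathbb C,\mathbb C^n)$, i.e. $$\left\|\begin{bmatrix} f_1(\underline T)\\ \vdots\\ f_n(\underline T)\end{bmatrix}\right\|\le\frac1\epsilon\quad\text{for every }\underline T\in\mathfrak M_{\mathbb P},$$ and $\varphi_1(z)f_1(z)+\dots+\varphi_n(z)f_n(z)=1$ for every $z\in\mathbb P$; (2) the map $(z,w)\mapsto\Big(\sum_{j=1}^n\varphi_j(z)\overline{\varphi_j(w)}-\epsilon^2\Big)k(z,w)$ on $\mathbb P\times\mathbb P$ is positive semi-definite for every $k\in AK(\mathbb P)$; (3) there exist positive kernels $\xi,\nabla:\mathbb P\times\mathbb P\to C(\overline{\mathbb D})^*$ and a weak kernel $\delta:\mathbb P\times\mathbb P\to\mathbb C$ such that for all $z,w\in\mathbb P$, $$\sum_{j=1}^n\varphi_j(z)\overline{\varphi_j(w)}-\epsilon^2=\xi(z,w)\big(1-\mathrm J(z)\overline{\mathrm J(w)}\big)+\nabla(z,w)\big(1-\mathrm j(z)\overline{\mathrm j(w)}\big)+\Big(1-\frac{z^{(2)}\overline{w}^{(2)}}{4}\Big)\delta(z,w).$$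
   Context: All Hilbert spaces are complex and separable; operators are bounded and linear. $\mathbb D$ is the open unit disc in $\mathbb C$, $\overline{\mathbb D}$ its closure, and $C(\overline{\mathbb D})$ is the space of continuous complex functions on $\overline{\mathbb D}$ with dual $C(\overline{\mathbb D})^*$. $H^\infty(\Omega)$ is the algebra of bounded holomorphic functions on $\Omega$. The pentablock is $\mathbb P=\{(a_{21},\operatorname{tr}A,\det A)\in\mathbb C^3: A=[a_{ij}]\in M_2(\mathbb C),\ \|A\|<1\}$; points are written $z=(z^{(1)},z^{(2)},z^{(3)})$. For $\alpha\in\overline{\mathbb D}$ put $$\Phi_\alpha(z^{(2)},z^{(3)})=\frac{2\alpha z^{(3)}-z^{(2)}}{2-\alpha z^{(2)}},\qquad \psi_\alpha(z^{(1)},z^{(2)},z^{(3)})=\frac{(1-|\alpha|^2)z^{(1)}}{1-\alpha z^{(2)}+\alpha^2z^{(3)}}.$$ For $z\in\mathbb P$ define the continuous functions $\mathrm J(z),\mathrm j(z)\in C(\overline{\mathbb D})$ by $\mathrm J(z)(\alpha)=\psi_\alpha(z)$ and $\mathrm j(z)(\alpha)=\Phi_\alpha(z^{(2)},z^{(3)})$; both have supremum norm $<1$. $\mathfrak M_{\mathbb P}$ is the class of all commuting triples $\underline T=(T_1,T_2,T_3)$ of operators on a Hilbert space with $\|T_2\|<2$ and, for all $\alpha\in\overline{\mathbb D}$, $\|\Phi_\alpha(T_2,T_3)\|<1$ and $\|\psi_\alpha(T_1,T_2,T_3)\|<1$, where $\Phi_\alpha(T_2,T_3)=(2\alpha T_3-T_2)(2-\alpha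 T_2)^{-1}$ and $\psi_\alpha(\underline T)=(1-|\alpha|^2)T_1(I-\alpha T_2+\alpha^2T_3)^{-1}$. For such $\underline T$ the Taylor joint spectrum satisfies $\sigma_T(\underline T)\subseteq\mathbb P$, so $f(\underline T)$ is defined by the holomorphic functional calculus for every holomorphic $f$ on $\mathbb P$; for a matrix-valued $f=[f_{ij}]$, $f(\underline T)=[f_{ij}(\underline T)]$. $SA_{\mathbb P}(\mathbb C,\mathbb C^n)$ is the set of holomorphic $f:\mathbb P\to\mathcal B(\mathbb C,\mathbb C^n)$ with $\|f(\underline T)\|\le1$ for all $\underline T\in\mathfrak M_{\mathbb P}$. A function $k:\mathbb P\times\mathbb P\to\mathbb C$ is positive semi-definite (a weak kernel) if $\sum_{i,j=1}^N k(z_i,z_j)c_j\overline{c_i}\ge0$ for all $N$, $z_1,\dots,z_N\in\mathbb P$, $c_1,\dots,c_N\in\mathbb C$; it is a kernel if moreover $k(z,z)\ne0$ for all $z$. $AK(\mathbb P)$ is the set of (scalar) admissible kernels: kernels $k$ on $\mathbb P$ such that for all $\alpha\in\overline{\mathbb D}$ the functions $(1-\tfrac{z^{(2)}\overline{w}^{(2)}}{4})k(z,w)$, $(1-\Phi_\alpha(z^{(2)},z^{(3)})\overline{\Phi_\alpha(w^{(2)},w^{(3)})})k(z,w)$ and $(1-\psi_\alpha(z)\overline{\psi_\alpha(w)})k(z,w)$ are positive semi-definite in $(z,w)$. A positive kernel is a map $\xi:\mathbb P\times\mathbb P\to C(\overline{\mathbb D})^*$ such that $\sum_{i,j=1}^N\xi(z_i,z_j)(h_i\overline{h_j})c_j\overline{c_i}\ge0$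 for all $N$, $z_i\in\mathbb P$, $h_i\in C(\overline{\mathbb D})$, $c_i\in\mathbb C$. *)

theory Defs
  imports "HOL-Analysis.Analysis" "HOL-Library.Function_Algebras"
begin

section \<open>Holomorphic functions and the pentablock\<close>

text \<open>Meant for open \<open>U\<close>: the real Frechet derivative exists and is complex linear.\<close>

definition holo_on :: "(complex ^ 'n \<Rightarrow> complex) \<Rightarrow> (complex ^ 'n) set \<Rightarrow> bool" where
  "holo_on f U \<longleftrightarrow>
     (\<forall>z\<in>U. \<exists>D. (f has_derivative D) (at z) \<and> (\<forall>c v. D (c *s v) = c * D v))"

definition Hinf :: "(complex ^ 'n) set \<Rightarrow> (complex ^ 'n \<Rightarrow> complex) set" where
  "Hinf U = {f. holo_on f U \<and> bounded (f ` U)}"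

definition pentablock :: "(complex ^ 3) set" where
  "pentablock =
     {vector [A $ 2 $ 1, trace A, det A] | A :: complex ^ 2 ^ 2. onorm ((*v) A) < 1}"

definition Phi :: "complex \<Rightarrow> complex \<Rightarrow> complex \<Rightarrow> complex" where
  "Phi \<alpha> z2 z3 = (2 * \<alpha> * z3 - z2) / (2 - \<alpha> * z2)"

definition psi :: "complex \<Rightarrow> complex ^ 3 \<Rightarrow> complex" where
  "psi \<alpha> z = (1 - of_real ((cmod \<alpha>)\<^sup>2)) * z $ 1 / (1 - \<alpha> * z $ 2 + \<alpha>\<^sup>2 * z $ 3)"

definition J_fun :: "complex ^ 3 \<Rightarrow> complex \<Rightarrow> complex" where
  "J_fun z = (\<lambda>\<alpha>. psi \<alpha> z)"

definition j_fun :: "complex ^ 3 \<Rightarrow> complex \<Rightarrow> complex" where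
  "j_fun z = (\<lambda>\<alpha>. Phi \<alpha> (z $ 2) (z $ 3))"


section \<open>Separable complex Hilbert spaces and their operators\<close>

text \<open>
  HOL cannot quantify over types inside a formula, so Hilbert spaces are values: a linear
  subspace of the vector space of all complex sequences, with an arbitrary inner product that
  makes it complete and separable.  Coordinates with respect to an orthonormal basis show that
  every separable complex Hilbert space (of finite or infinite dimension) is unitarily
  equivalent to one of these.  Addition and subtraction of sequences are pointwise.
\<close>

type_synonym cseq = "nat \<Rightarrow> complex"

record hspace =
  hcarrier :: "cseq set"
  hinner :: "cseq \<Rightarrow> cseq \<Rightarrow> complex"

definition cscale :: "complex \<Rightarrow> cseq \<Rightarrow> cseq" where
  "cscale c x = (\<lambda>n. c * x n)"

definition hnorm :: "hspace \<Rightarrow> cseq \<Rightarrow> real" where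
  "hnorm H x = sqrt (Re (hinner H x x))"

definition inner_product_space :: "hspace \<Rightarrow> bool" where
  "inner_product_space H \<longleftrightarrow>
     0 \<in> hcarrier H \<and>
     (\<forall>x\<in>hcarrier H. \<forall>y\<in>hcarrier H. x + y \<in> hcarrier H) \<and>
     (\<forall>c. \<forall>x\<in>hcarrier H. cscale c x \<in> hcarrier H) \<and>
     (\<forall>x\<in>hcarrier H. \<forall>y\<in>hcarrier H. hinner H y x = cnj (hinner H x y)) \<and>
     (\<forall>x\<in>hcarrier H. \<forall>y\<in>hcarrier H. \<forall>z\<in>hcarrier H.
        hinner H (x + y) z = hinner H x z + hinner H y z) \<and>
     (\<forall>c. \<forall>x\<in>hcarrier H. \<forall>y\<in>hcarrier H. hinner H (cscale c x) y = c * hinner H x y) \<and>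
     (\<forall>x\<in>hcarrier H. x \<noteq> 0 \<longrightarrow> 0 < Re (hinner H x x))"

definition hilbert_space :: "hspace \<Rightarrow> bool" where
  "hilbert_space H \<longleftrightarrow>
     inner_product_space H \<and>
     (\<forall>X. (\<forall>n. X n \<in> hcarrier H) \<and>
          (\<forall>e>0. \<exists>N::nat. \<forall>m\<ge>N. \<forall>n\<ge>N. hnorm H (X m - X n) < e) \<longrightarrow>
          (\<exists>x\<in>hcarrier H. (\<lambda>n. hnorm H (X n - x)) \<longlonglongrightarrow> 0)) \<and>
     (\<exists>D. countable D \<and> D \<subseteq> hcarrier H \<and>
          (\<forall>x\<in>hcarrier H. \<forall>e>0. \<exists>d\<in>D. hnorm H (x - d) < e))"

text \<open>Only the values of an operator on the carrier matter.\<close>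

definition bounded_op :: "hspace \<Rightarrow> (cseq \<Rightarrow> cseq) \<Rightarrow> bool" where
  "bounded_op H A \<longleftrightarrow>
     (\<forall>x\<in>hcarrier H. A x \<in> hcarrier H) \<and>
     (\<forall>x\<in>hcarrier H. \<forall>y\<in>hcarrier H. A (x + y) = A x + A y) \<and>
     (\<forall>c. \<forall>x\<in>hcarrier H. A (cscale c x) = cscale c (A x)) \<and>
     (\<exists>B. \<forall>x\<in>hcarrier H. hnorm H (A x) \<le> B * hnorm H x)"

definition op_norm :: "hspace \<Rightarrow> (cseq \<Rightarrow> cseq) \<Rightarrow> real" where
  "op_norm H A = (SUP x\<in>{x \<in> hcarrier H. hnorm H x \<le> 1}. hnorm H (A x))"

text \<open>
  The norm of the column operator \<open>x \<mapsto> (A 1 x, \<dots>, A n x)\<close> from \<open>H\<close> into the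
  Hilbert space direct sum of \<open>n\<close> copies of \<open>H\<close>.
\<close>

definition column_norm :: "hspace \<Rightarrow> nat \<Rightarrow> (nat \<Rightarrow> cseq \<Rightarrow> cseq) \<Rightarrow> real" where
  "column_norm H n A =
     (SUP x\<in>{x \<in> hcarrier H. hnorm H x \<le> 1}. sqrt (\<Sum>i=1..n. (hnorm H (A i x))\<^sup>2))"

definition op_inverse :: "hspace \<Rightarrow> (cseq \<Rightarrow> cseq) \<Rightarrow> cseq \<Rightarrow> cseq" where
  "op_inverse H A = inv_into (hcarrier H) A"

definition op_invertible :: "hspace \<Rightarrow> (cseq \<Rightarrow> cseq) \<Rightarrow> bool" where
  "op_invertible H A \<longleftrightarrow>
     bij_betw A (hcarrier H) (hcarrier H) \<and> bounded_op H (op_inverse H A)"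

definition commuting_ops :: "hspace \<Rightarrow> ('n \<Rightarrow> cseq \<Rightarrow> cseq) \<Rightarrow> bool" where
  "commuting_ops H T \<longleftrightarrow>
     (\<forall>i. bounded_op H (T i)) \<and>
     (\<forall>i j. \<forall>x\<in>hcarrier H. T i (T j x) = T j (T i x))"


section \<open>Taylor spectrum and holomorphic functional calculus\<close>

text \<open>
  Exactness of the Koszul complex \<open>0 \<rightarrow> H \<rightarrow> H\<^sup>3 \<rightarrow> H\<^sup>3 \<rightarrow> H \<rightarrow> 0\<close> of a commuting triple
  \<open>(A, B, C)\<close>, at each of its four places; the second \<open>H\<^sup>3\<close> has the components
  \<open>12\<close>, \<open>13\<close>, \<open>23\<close>.
\<close>

definition koszul_exact ::
    "hspace \<Rightarrow> (cseq \<Rightarrow> cseq) \<Rightarrow> (cseq \<Rightarrow> cseq) \<Rightarrow> (cseq \<Rightarrow> cseq) \<Rightarrow> bool" where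
  "koszul_exact H A B C \<longleftrightarrow>
     (let V = hcarrier H in
       (\<forall>x\<in>V. A x = 0 \<and> B x = 0 \<and> C x = 0 \<longrightarrow> x = 0) \<and>
       (\<forall>x\<in>V. \<forall>y\<in>V. \<forall>z\<in>V.
          A y - B x = 0 \<and> A z - C x = 0 \<and> B z - C y = 0 \<longrightarrow>
          (\<exists>u\<in>V. x = A u \<and> y = B u \<and> z = C u)) \<and>
       (\<forall>p\<in>V. \<forall>q\<in>V. \<forall>r\<in>V.
          A r - B q + C p = 0 \<longrightarrow>
          (\<exists>x\<in>V. \<exists>y\<in>V. \<exists>z\<in>V. p = A y - B x \<and> q = A z - C x \<and> r = B z - C y)) \<and>
       (\<forall>v\<in>V. \<exists>p\<in>V. \<exists>q\<in>V. \<exists>r\<in>V. v = A r - B q + C p))"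

definition taylor_spectrum :: "hspace \<Rightarrow> (3 \<Rightarrow> cseq \<Rightarrow> cseq) \<Rightarrow> (complex ^ 3) set" where
  "taylor_spectrum H T =
     {l. \<not> koszul_exact H (\<lambda>x. T 1 x - cscale (l $ 1) x)
                          (\<lambda>x. T 2 x - cscale (l $ 2) x)
                          (\<lambda>x. T 3 x - cscale (l $ 3) x)}"

text \<open>
  \<open>\<Theta>\<close> is the holomorphic functional calculus \<open>f \<mapsto> f(T)\<close> on an open set \<open>U\<close> that contains the
  Taylor spectrum of \<open>T\<close>: a unital algebra homomorphism from the holomorphic functions on \<open>U\<close>
  to the bounded operators that maps the coordinate functions to the members of \<open>T\<close> and is
  continuous from the (metrizable) topology of locally uniform convergence to the norm topology.
  It exists by Taylor's theorem.  For the pentablock it is unique (as an operator on the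
  carrier), because the weighted action \<open>(t z\<^sub>1, t z\<^sub>2, t\<^sup>2 z\<^sub>3)\<close>, \<open>|t| \<le> 1\<close>, preserves it
  and hence polynomials are dense.  Continuity forces \<open>\<Theta> f\<close> to depend only on the values of
  \<open>f\<close> on \<open>U\<close>.
\<close>

definition hol_calculus ::
    "hspace \<Rightarrow> (3 \<Rightarrow> cseq \<Rightarrow> cseq) \<Rightarrow> (complex ^ 3) set \<Rightarrow>
     ((complex ^ 3 \<Rightarrow> complex) \<Rightarrow> cseq \<Rightarrow> cseq) \<Rightarrow> bool" where
  "hol_calculus H T U \<Theta> \<longleftrightarrow>
     taylor_spectrum H T \<subseteq> U \<and>
     (\<forall>f. holo_on f U \<longrightarrow> bounded_op H (\<Theta> f)) \<and>
     (\<forall>x\<in>hcarrier H. \<Theta> (\<lambda>z. 1) x = x) \<and>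
     (\<forall>i. \<forall>x\<in>hcarrier H. \<Theta> (\<lambda>z. z $ i) x = T i x) \<and>
     (\<forall>f g. holo_on f U \<and> holo_on g U \<longrightarrow>
        (\<forall>x\<in>hcarrier H. \<Theta> (\<lambda>z. f z + g z) x = \<Theta> f x + \<Theta> g x)) \<and>
     (\<forall>c f. holo_on f U \<longrightarrow> (\<forall>x\<in>hcarrier H. \<Theta> (\<lambda>z. c * f z) x = cscale c (\<Theta> f x))) \<and>
     (\<forall>f g. holo_on f U \<and> holo_on g U \<longrightarrow>
        (\<forall>x\<in>hcarrier H. \<Theta> (\<lambda>z. f z * g z) x = \<Theta> f (\<Theta> g x))) \<and>
     (\<forall>F f. (\<forall>m. holo_on (F m) U) \<and> holo_on f U \<and>
        (\<forall>K. compact K \<and> K \<subseteq> U \<longrightarrow> uniform_limit K F f sequentially) \<longrightarrow>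
        (\<lambda>m. op_norm H (\<lambda>x. \<Theta> (F m) x - \<Theta> f x)) \<longlonglongrightarrow> 0)"


section \<open>The operator class and the Schur--Agler class\<close>

definition Phi_op ::
    "hspace \<Rightarrow> complex \<Rightarrow> (cseq \<Rightarrow> cseq) \<Rightarrow> (cseq \<Rightarrow> cseq) \<Rightarrow> cseq \<Rightarrow> cseq" where
  "Phi_op H \<alpha> T2 T3 =
     (\<lambda>y. cscale (2 * \<alpha>) (T3 y) - T2 y) \<circ>
     op_inverse H (\<lambda>x. cscale 2 x - cscale \<alpha> (T2 x))"

definition psi_denom :: "complex \<Rightarrow> (3 \<Rightarrow> cseq \<Rightarrow> cseq) \<Rightarrow> cseq \<Rightarrow> cseq" where
  "psi_denom \<alpha> T = (\<lambda>x. x - cscale \<alpha> (T 2 x) + cscale (\<alpha>\<^sup>2) (T 3 x))"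

definition psi_op :: "hspace \<Rightarrow> complex \<Rightarrow> (3 \<Rightarrow> cseq \<Rightarrow> cseq) \<Rightarrow> cseq \<Rightarrow> cseq" where
  "psi_op H \<alpha> T =
     (\<lambda>y. cscale (1 - of_real ((cmod \<alpha>)\<^sup>2)) (T 1 y)) \<circ> op_inverse H (psi_denom \<alpha> T)"

text \<open>The bound on \<open>T 2\<close> makes the inverse in \<open>Phi_op\<close> exist.\<close>

definition M_class :: "hspace \<Rightarrow> (3 \<Rightarrow> cseq \<Rightarrow> cseq) \<Rightarrow> bool" where
  "M_class H T \<longleftrightarrow>
     commuting_ops H T \<and> op_norm H (T 2) < 2 \<and>
     (\<forall>\<alpha>\<in>cball 0 1.
        op_norm H (Phi_op H \<alpha> (T 2) (T 3)) < 1 \<and>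
        op_invertible H (psi_denom \<alpha> T) \<and> op_norm H (psi_op H \<alpha> T) < 1)"

definition SA :: "nat \<Rightarrow> (nat \<Rightarrow> complex ^ 3 \<Rightarrow> complex) set" where
  "SA n =
     {f. (\<forall>i\<in>{1..n}. holo_on (f i) pentablock) \<and>
         (\<forall>H T \<Theta>. hilbert_space H \<and> M_class H T \<and> hol_calculus H T pentablock \<Theta> \<longrightarrow>
            column_norm H n (\<lambda>i. \<Theta> (f i)) \<le> 1)}"


section \<open>Kernels\<close>

definition weak_kernel :: "(complex ^ 3 \<Rightarrow> complex ^ 3 \<Rightarrow> complex) \<Rightarrow> bool" where
  "weak_kernel k \<longleftrightarrow>
     (\<forall>(N::nat) z c. (\<forall>i<N. z i \<in> pentablock) \<longrightarrow>
        (\<Sum>i<N. \<Sum>j<N. k (z i) (z j) * c j * cnj (c i)) \<in> \<real>\<^sub>\<ge>\<^sub>0)"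

definition AK :: "(complex ^ 3 \<Rightarrow> complex ^ 3 \<Rightarrow> complex) set" where
  "AK =
     {k. weak_kernel k \<and> (\<forall>z\<in>pentablock. k z z \<noteq> 0) \<and>
         weak_kernel (\<lambda>z w. (1 - z $ 2 * cnj (w $ 2) / 4) * k z w) \<and>
         (\<forall>\<alpha>\<in>cball 0 1.
            weak_kernel (\<lambda>z w. (1 - Phi \<alpha> (z $ 2) (z $ 3) * cnj (Phi \<alpha> (w $ 2) (w $ 3))) * k z w) \<and>
            weak_kernel (\<lambda>z w. (1 - psi \<alpha> z * cnj (psi \<alpha> w)) * k z w))}"

text \<open>
  Elements of \<open>C(\<D>)\<close>, \<open>\<D>\<close> the closed unit disc, are functions continuous on \<open>cball 0 1\<close>;
  boundedness by the supremum norm makes a functional blind to their values elsewhere.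
\<close>

definition disc_dual :: "((complex \<Rightarrow> complex) \<Rightarrow> complex) \<Rightarrow> bool" where
  "disc_dual L \<longleftrightarrow>
     (\<forall>g h. continuous_on (cball 0 1) g \<and> continuous_on (cball 0 1) h \<longrightarrow>
        L (\<lambda>\<alpha>. g \<alpha> + h \<alpha>) = L g + L h) \<and>
     (\<forall>c h. continuous_on (cball 0 1) h \<longrightarrow> L (\<lambda>\<alpha>. c * h \<alpha>) = c * L h) \<and>
     (\<exists>B. \<forall>h. continuous_on (cball 0 1) h \<longrightarrow> cmod (L h) \<le> B * (SUP \<alpha>\<in>cball 0 1. cmod (h \<alpha>)))"

definition positive_kernel ::
    "(complex ^ 3 \<Rightarrow> complex ^ 3 \<Rightarrow> (complex \<Rightarrow> complex) \<Rightarrow> complex) \<Rightarrow> bool" where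
  "positive_kernel \<xi> \<longleftrightarrow>
     (\<forall>z\<in>pentablock. \<forall>w\<in>pentablock. disc_dual (\<xi> z w)) \<and>
     (\<forall>(N::nat) z h c.
        (\<forall>i<N. z i \<in> pentablock \<and> continuous_on (cball 0 1) (h i)) \<longrightarrow>
        (\<Sum>i<N. \<Sum>j<N. \<xi> (z i) (z j) (\<lambda>\<alpha>. h i \<alpha> * cnj (h j \<alpha>)) * c j * cnj (c i)) \<in> \<real>\<^sub>\<ge>\<^sub>0)"

end

theory Submission
  imports Defs "HOL-Complex_Analysis.Great_Picard"
begin

text \<open>
  Write \<open>M z w = (\<Sum>j. \<phi>\<^sub>j z * cnj (\<phi>\<^sub>j w)) - \<epsilon>\<^sup>2\<close>.  Everything passes through finite subsets \<open>F\<close> of the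
  pentablock and the statement that, for each \<open>\<delta> > 0\<close>, \<open>M + \<delta> I\<close> is on \<open>F\<close> a finite sum of matrices
  \<open>g z * cnj (g w) * (1 - h z * cnj (h w))\<close> with test functions \<open>h\<close> among \<open>\<psi>\<^sub>\<alpha>\<close>, \<open>\<Phi>\<^sub>\<alpha>\<close> and \<open>z\<^sub>2 / 2\<close>.

  If this fails, a hyperplane separates \<open>M\<close> from the cone of such sums; it is a matrix that,
  after a small multiple of the identity is added, extends by the Kronecker delta to an admissible
  kernel violating (2).  Conversely, the finite sums have cluster points along the finite subsets
  by Tychonoff's theorem, which gives (3), and (3) gives (2) by Schur products.

  From a finite sum a lurking isometry yields a transfer function with finitely many test
  functions, which solves the corona problem on \<open>F\<close> up to \<open>sqrt \<delta>\<close> and is contractive under every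
  functional calculus; Montel's theorem along finite subsets of a countable dense set gives (1).
  Finally (1) gives (2) by applying \<open>f\<close> to the diagonal multiplication operators on the finite
  dimensional space with reproducing kernel \<open>k\<close>, dilated by \<open>r < 1\<close> to make the norm bounds strict.
\<close>

section \<open>Positive semi-definite forms\<close>

text \<open>The cone of finite sums is not shown to be closed, so separation only brings
  \<open>M\<close> within any given distance of it. The term \<delta> I repairs this: every positive
  semi-definite matrix on \<open>F\<close> lies in the cone, since it may be divided by
  \<open>1 - h z * cnj (h w)\<close> with \<open>h = z\<^sub>2 / 2\<close> (a geometric series, as
  test functions are strictly below 1 in modulus); so a small Hermitian error plus \<delta> I is
  absorbed exactly. The same strictness, uniform in \<alpha> by compactness of the disc, bounds the
  coefficients independently of \<open>F\<close>. With finitely many test functions the lurking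
  isometry is a finite matrix, and the loops of the transfer function can be closed one after
  another, each by a scalar division. The matrix \<delta> I enters as one additional row for each
  point of \<open>F\<close>; dropping these rows costs sqrt \<delta>. The dilation answers the
  strict inequalities of \<open>M_class\<close>: an admissible kernel yields contractions only, and
  (r z1, r z2, r^2 z3) turns each test function into a factor at most r times a test function with
  parameter r \<alpha>.\<close>

lemma sum_in_nonneg_Reals:
  fixes f :: "'i \<Rightarrow> complex"
  assumes "\<And>i. i \<in> I \<Longrightarrow> f i \<in> \<real>\<^sub>\<ge>\<^sub>0" shows "sum f I \<in> \<real>\<^sub>\<ge>\<^sub>0"
  using assms by (induction I rule: infinite_finite_induct) (auto intro: nonneg_Reals_add_I)

text \<open>The sesquilinear form of \<open>P\<close>, linear in \<open>x\<close>. The order of the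
  indices is that of \<open>weak_kernel\<close>.\<close>

definition qform :: "nat \<Rightarrow> (nat \<Rightarrow> nat \<Rightarrow> complex) \<Rightarrow> (nat \<Rightarrow> complex) \<Rightarrow> (nat \<Rightarrow> complex) \<Rightarrow> complex" where
  "qform N P x y = (\<Sum>i<N. \<Sum>j<N. P i j * x j * cnj (y i))"

definition psd :: "nat \<Rightarrow> (nat \<Rightarrow> nat \<Rightarrow> complex) \<Rightarrow> bool" where
  "psd N P \<longleftrightarrow> (\<forall>x. qform N P x x \<in> \<real>\<^sub>\<ge>\<^sub>0)"

lemma qform_add_left: "qform N P (\<lambda>i. x i + y i) z = qform N P x z + qform N P y z"
  by (simp add: qform_def algebra_simps sum.distrib)

lemma qform_add_right: "qform N P z (\<lambda>i. x i + y i) = qform N P z x + qform N P z y"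
  by (simp add: qform_def algebra_simps sum.distrib)

lemma qform_diff_left: "qform N P (\<lambda>i. x i - y i) z = qform N P x z - qform N P y z"
  by (simp add: qform_def algebra_simps sum_subtractf)

lemma qform_diff_right: "qform N P z (\<lambda>i. x i - y i) = qform N P z x - qform N P z y"
  by (simp add: qform_def algebra_simps sum_subtractf)

lemma qform_scale_left: "qform N P (\<lambda>i. c * x i) z = c * qform N P x z"
  by (simp add: qform_def algebra_simps sum_distrib_left)

lemma qform_scale_right: "qform N P z (\<lambda>i. c * x i) = cnj c * qform N P z x"
  by (simp add: qform_def algebra_simps sum_distrib_left)

lemma qform_zero_left: "qform N P (\<lambda>i. 0) z = 0"
  by (simp add: qform_def)

lemma qform_sum_left: "qform N P (\<lambda>i. \<Sum>s\<in>S. f s i) z = (\<Sum>s\<in>S. qform N P (f s) z)"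
  by (induction S rule: infinite_finite_induct) (auto simp: qform_zero_left qform_add_left)

lemma qform_basis:
  assumes "a < N" "b < N"
  shows "qform N P (\<lambda>i. of_bool (i = b)) (\<lambda>i. of_bool (i = a)) = P a b"
proof -
  have "qform N P (\<lambda>i. of_bool (i = b)) (\<lambda>i. of_bool (i = a)) =
    (\<Sum>i<N. if i = a then (\<Sum>j<N. if j = b then P i j else 0) else 0)"
    unfolding qform_def by (rule sum.cong[OF refl]) (auto intro!: sum.cong)
  also have "\<dots> = P a b" using assms by simp
  finally show ?thesis .
qed

lemma qform_cong: 
  assumes "\<And>i j. i < N \<Longrightarrow> j < N \<Longrightarrow> P i j = P' i j" "\<And>i. i < N \<Longrightarrow> x i = x' i" "\<And>i. i < N \<Longrightarrow> y i = y' i"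
  shows "qform N P x y = qform N P' x' y'"
  unfolding qform_def using assms by (intro sum.cong refl) auto

text \<open>Polarization: the form is real at \<open>x + y\<close> and at \<open>x + \<i> y\<close>,
  which fixes the real and the imaginary part of the mixed terms.\<close>

lemma psd_qform_hermitian:
  assumes "psd N P"
  shows "qform N P y x = cnj (qform N P x y)"
proof -
  let ?B = "qform N P"
  have 1: "Im (?B z z) = 0" for z using assms by (auto simp: psd_def complex_nonneg_Reals_iff)
  have "Im (?B (\<lambda>i. x i + y i) (\<lambda>i. x i + y i)) = 0" 
       "Im (?B (\<lambda>i. x i + \<i> * y i) (\<lambda>i. x i + \<i> * y i)) = 0" by (rule 1)+
  then show ?thesis
    using 1[of x] 1[of y]
    by (auto simp: qform_add_left qform_add_right qform_scale_left qform_scale_right complex_eq_iff algebra_simps)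
qed

lemma psd_hermitian:
  assumes "psd N P" "i < N" "j < N"
  shows "P j i = cnj (P i j)"
  using psd_qform_hermitian[OF assms(1), of "\<lambda>k. of_bool (k = i)" "\<lambda>k. of_bool (k = j)"]
  by (simp add: qform_basis assms)

lemma psd_qform_real:
  assumes "psd N P" shows "qform N P x x = of_real (Re (qform N P x x))" "0 \<le> Re (qform N P x x)"
  using assms by (auto simp: psd_def complex_nonneg_Reals_iff complex_eq_iff)

lemma psd_cauchy_schwarz:
  assumes "psd N P"
  shows "(cmod (qform N P x y))\<^sup>2 \<le> Re (qform N P x x) * Re (qform N P y y)"
proof -
  let ?B = "qform N P"
  define b where "b = ?B x y"
  define X where "X = Re (?B x x)"
  define Y where "Y = Re (?B y y)"
  have nn: "X \<ge> 0" "Y \<ge> 0" using psd_qform_real(2)[OF assms] by (auto simp: X_def Y_def)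
  \<comment> \<open>Nonnegativity at \<open>x - t b y\<close>; multiplying \<open>y\<close> by
    \<open>b\<close> makes both mixed terms equal to the real number \<open>t |b|^2\<close>.\<close>
  have key: "0 \<le> X - 2 * t * (cmod b)\<^sup>2 + t\<^sup>2 * (cmod b)\<^sup>2 * Y" for t :: real
  proof -
    have "0 \<le> Re (?B (\<lambda>i. x i - (of_real t * b) * y i) (\<lambda>i. x i - (of_real t * b) * y i))"
      by (rule psd_qform_real(2)[OF assms])
    also have "\<dots> = Re (?B x x - cnj (of_real t * b) * b - of_real t * b * cnj b + (of_real t * b) * cnj (of_real t * b) * ?B y y)"
      unfolding qform_diff_left qform_diff_right qform_scale_left qform_scale_right
        b_def[symmetric] psd_qform_hermitian[OF assms, of y x] by (simp add: algebra_simps)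
    also have "\<dots> = X - 2 * t * (cmod b)\<^sup>2 + t\<^sup>2 * (cmod b)\<^sup>2 * Y"
      unfolding X_def Y_def cmod_power2 by (subst psd_qform_real(1)[OF assms, of y]) (simp add: algebra_simps power2_eq_square)
    finally show ?thesis .
  qed
  have "(cmod b)\<^sup>2 \<le> X * Y"
  proof (cases "Y = 0")
    case True
    show ?thesis
    proof (rule ccontr)
      assume "\<not> ?thesis"
      then have "(cmod b)\<^sup>2 > 0" using True by auto
      \<comment> \<open>For \<open>Y = 0\<close> the quadratic in \<open>t\<close> degenerates to an
        affine function, and this \<open>t\<close> makes it negative.\<close>
      then have "X - 2 * ((X + 1) / (cmod b)\<^sup>2) * (cmod b)\<^sup>2 = - X - 2" by simp
      then show False using key[of "(X + 1) / (cmod b)\<^sup>2"] True nn by simp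
    qed
  next
    case False
    then have "Y > 0" using nn by auto
    then show ?thesis using key[of "1 / Y"] by (simp add: field_simps power2_eq_square)
  qed
  then show ?thesis by (simp add: b_def X_def Y_def)
qed

lemma psd_null:
  assumes "psd N P" "qform N P x x = 0"
  shows "qform N P x y = 0" "qform N P y x = 0"
proof -
  show "qform N P x y = 0" using psd_cauchy_schwarz[OF assms(1), of x y] assms(2) by simp
  then show "qform N P y x = 0" using psd_qform_hermitian[OF assms(1), of x y] by simp
qed

section \<open>Orthonormal systems for a degenerate positive form\<close>

text \<open>The form may have null vectors, so \<open>v k\<close> is recovered from the system only
  as seen by the form, against every \<open>y\<close>. A residual of length zero is orthogonal to
  everything by Cauchy-Schwarz and adds no vector to the system; any other residual is normalized
  and appended.\<close>

lemma psd_gram_schmidt: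
  assumes "psd N P"
  shows "\<exists>(S::nat) e. (\<forall>s<S. \<forall>t<S. qform N P (e s) (e t) = of_bool (s = t)) \<and>
     (\<forall>k<(m::nat). \<forall>y. qform N P (v k) y = (\<Sum>s<S. qform N P (v k) (e s) * qform N P (e s) y))"
proof (induction m)
  case 0
  show ?case by (rule exI[of _ "0::nat"]) auto
next
  case (Suc m)
  let ?B = "qform N P"
  obtain S :: nat and e where on: "\<forall>s<S. \<forall>t<S. ?B (e s) (e t) = of_bool (s = t)"
    and sp: "\<forall>k<m. \<forall>y. ?B (v k) y = (\<Sum>s<S. ?B (v k) (e s) * ?B (e s) y)"
    using Suc by (elim exE conjE) (rule that)
  note on = on[rule_format] and sp = sp[rule_format]
  define r where "r = (\<lambda>i. v m i - (\<Sum>s<S. ?B (v m) (e s) * e s i))"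
  have r: "?B r y = ?B (v m) y - (\<Sum>s<S. ?B (v m) (e s) * ?B (e s) y)" for y
    unfolding r_def qform_diff_left qform_sum_left qform_scale_left ..
  have orth: "?B r (e t) = 0" if "t < S" for t
  proof -
    have "(\<Sum>s<S. ?B (v m) (e s) * ?B (e s) (e t)) = (\<Sum>s<S. if s = t then ?B (v m) (e t) else 0)"
      by (intro sum.cong) (auto simp: on that)
    then show ?thesis using that by (simp add: r)
  qed
  have orth': "?B (e t) r = 0" if "t < S" for t
    using orth[OF that] psd_qform_hermitian[OF assms, of "e t" r] by simp
  show ?case
  proof (cases "?B r r = 0")
    case True
    have "?B (v m) y = (\<Sum>s<S. ?B (v m) (e s) * ?B (e s) y)" for y
      using r[of y] psd_null(1)[OF assms True, of y] by simp
    then have "\<forall>k<Suc m. \<forall>y. ?B (v k) y = (\<Sum>s<S. ?B (v k) (e s) * ?B (e s) y)"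
      using sp less_Suc_eq by metis
    then show ?thesis using on by blast
  next
    case False
    define \<rho> where "\<rho> = Re (?B r r)"
    have rho: "?B r r = of_real \<rho>" "\<rho> > 0"
      using psd_qform_real[OF assms, of r] False by (auto simp: \<rho>_def order_less_le)
    define u where "u = (\<lambda>i. of_real (1 / sqrt \<rho>) * r i)"
    define e' where "e' = e(S := u)"
    have uu: "?B u u = 1"
    proof -
      have "(1 / sqrt \<rho>) * ((1 / sqrt \<rho>) * \<rho>) = 1" using rho(2) by (simp add: divide_simps)
      then show ?thesis
        unfolding u_def qform_scale_left qform_scale_right rho complex_cnj_complex_of_real
          of_real_mult[symmetric] by (simp only: of_real_1)
    qed
    have u_left: "?B u y = of_real (1 / sqrt \<rho>) * ?B r y" for y
      unfolding u_def by (rule qform_scale_left)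
    have u_right: "?B y u = cnj (of_real (1 / sqrt \<rho>)) * ?B y r" for y
      unfolding u_def by (rule qform_scale_right)
    have ue: "?B u (e t) = 0" if "t < S" for t
      unfolding u_left orth[OF that] by (rule mult_zero_right)
    have eu: "?B (e t) u = 0" if "t < S" for t
      unfolding u_right orth'[OF that] by (rule mult_zero_right)
    have on': "?B (e' s) (e' t) = of_bool (s = t)" if "s < Suc S" "t < Suc S" for s t
      using that unfolding less_Suc_eq e'_def by (elim disjE) (simp_all add: on uu ue eu)
    have su: "(\<Sum>s<Suc S. ?B x (e' s) * ?B (e' s) y) = (\<Sum>s<S. ?B x (e s) * ?B (e s) y) + ?B x u * ?B u y" for x y
      by (simp add: e'_def)
    have vu: "?B (v k) u = 0" if "k < m" for k
      using sp[OF that, of u] by (simp add: eu)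
    have vmu: "?B (v m) u = of_real (sqrt \<rho>)"
    proof -
      have "?B r u = ?B (v m) u" using r[of u] by (simp add: eu)
      moreover have "?B r u = of_real (1 / sqrt \<rho>) * of_real \<rho>"
        unfolding u_def qform_scale_right rho by simp
      moreover have "of_real (1 / sqrt \<rho>) * of_real \<rho> = (of_real (sqrt \<rho>) :: complex)"
      proof -
        have "(1 / sqrt \<rho>) * \<rho> = sqrt \<rho>" using rho(2) by (simp add: divide_simps)
        then show ?thesis unfolding of_real_mult[symmetric] by (simp only:)
      qed
      ultimately show ?thesis by simp
    qed
    have vm: "?B (v m) y = (\<Sum>s<S. ?B (v m) (e s) * ?B (e s) y) + ?B (v m) u * ?B u y" for y
    proof -
      have "?B u y = of_real (1 / sqrt \<rho>) * ?B r y" unfolding u_def qform_scale_left ..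
      moreover have "of_real (sqrt \<rho>) * of_real (1 / sqrt \<rho>) = (1::complex)"
        unfolding of_real_mult[symmetric] using rho(2) by simp
      ultimately have "?B (v m) u * ?B u y = ?B r y"
        unfolding vmu by (metis mult.assoc mult_1)
      then show ?thesis using r[of y] by simp
    qed
    show ?thesis
    proof (intro exI[of _ "Suc S"] exI[of _ e'] conjI allI impI)
      fix k y assume "k < Suc m"
      then show "?B (v k) y = (\<Sum>s<Suc S. ?B (v k) (e' s) * ?B (e' s) y)"
      proof (cases "k = m")
        case True
        then show ?thesis using vm[of y] unfolding su by simp
      next
        case False
        with \<open>k < Suc m\<close> have "k < m" by simp
        then show ?thesis unfolding su using sp[of k y] vu[of k] by simp
      qed
    qed (rule on')
  qed
qed

lemma psd_orthonormal_basis: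
  assumes "psd N P"
  obtains S :: nat and e where
    "\<forall>s<S. \<forall>t<S. qform N P (e s) (e t) = of_bool (s = t)"
    "\<forall>k<N. \<forall>y. qform N P (\<lambda>i. of_bool (i = k)) y =
       (\<Sum>s<S. qform N P (\<lambda>i. of_bool (i = k)) (e s) * qform N P (e s) y)"
  using psd_gram_schmidt[OF assms, of N "\<lambda>k i. of_bool (i = k)"] by (elim exE conjE) (rule that)

text \<open>The entry \<open>P i j\<close> is the form at two unit vectors; expanding one of them in
  an orthonormal system writes \<open>P\<close> as a sum of rank one matrices.\<close>

lemma psd_decomposition:
  assumes "psd N P"
  obtains S :: nat and p where "\<forall>i<N. \<forall>j<N. P i j = (\<Sum>s<S. p s i * cnj (p s j))"
proof -
  let ?B = "qform N P" and ?d = "\<lambda>k i. of_bool (i = k) :: complex"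
  obtain S :: nat and e where on: "\<forall>s<S. \<forall>t<S. ?B (e s) (e t) = of_bool (s = t)"
    and sp: "\<forall>k<N. \<forall>y. ?B (?d k) y = (\<Sum>s<S. ?B (?d k) (e s) * ?B (e s) y)"
    by (rule psd_orthonormal_basis[OF assms])
  note on = on[rule_format] and sp = sp[rule_format]
  show ?thesis
  proof (rule that, intro allI impI)
    fix i j assume ij: "i < N" "j < N"
    have "P i j = ?B (?d j) (?d i)" using ij by (simp add: qform_basis)
    also have "\<dots> = (\<Sum>s<S. ?B (e s) (?d i) * cnj (?B (e s) (?d j)))"
      unfolding sp[OF ij(2), of "?d i"]
      by (rule sum.cong[OF refl]) (subst psd_qform_hermitian[OF assms, of "?d j"], simp)
    finally show "P i j = (\<Sum>s<S. ?B (e s) (?d i) * cnj (?B (e s) (?d j)))" .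
  qed
qed

text \<open>Gram-Schmidt is run on coefficient vectors, so that it applies to both families at once.\<close>

lemma isometry_extension:
  fixes X Y :: "nat \<Rightarrow> nat \<Rightarrow> complex"
  assumes "\<And>i j. i < N \<Longrightarrow> j < N \<Longrightarrow>
    (\<Sum>a<p. X i a * cnj (X j a)) = (\<Sum>b<q. Y i b * cnj (Y j b))"
  obtains W where "\<And>i b. i < N \<Longrightarrow> b < q \<Longrightarrow> (\<Sum>a<p. X i a * W a b) = Y i b"
    and "\<And>x. (\<Sum>a<p. (cmod (\<Sum>b<q. W a b * x b))\<^sup>2) \<le> (\<Sum>b<q. (cmod (x b))\<^sup>2)"
proof -
  \<comment> \<open>The transposed Gram matrix: \<open>?B c c'\<close> becomes the inner product of
    the combinations of the rows of \<open>X\<close> with coefficients \<open>c\<close> and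
    \<open>c'\<close>, and by assumption also that of the rows of \<open>Y\<close>.\<close>
  define P where "P = (\<lambda>j i. \<Sum>a<p. X i a * cnj (X j a))"
  let ?B = "qform N P" and ?d = "\<lambda>k i. of_bool (i = k) :: complex"
  define cX where "cX = (\<lambda>c a. \<Sum>i<N. c i * X i a)"
  define cY where "cY = (\<lambda>c b. \<Sum>i<N. c i * Y i b)"
  have BX: "?B c c' = (\<Sum>a<p. cX c a * cnj (cX c' a))" for c c'
  proof -
    have "(\<Sum>a<p. cX c a * cnj (cX c' a)) = (\<Sum>a<p. \<Sum>j<N. \<Sum>i<N. c j * X j a * cnj (c' i * X i a))"
      unfolding cX_def cnj_sum sum_product ..
    also have "\<dots> = (\<Sum>j<N. \<Sum>i<N. \<Sum>a<p. c j * X j a * cnj (c' i * X i a))"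
      by (subst sum.swap, rule sum.cong[OF refl], rule sum.swap)
    also have "\<dots> = (\<Sum>i<N. \<Sum>j<N. \<Sum>a<p. c j * X j a * cnj (c' i * X i a))"
      by (rule sum.swap)
    also have "\<dots> = ?B c c'" unfolding qform_def P_def sum_distrib_right
      by (intro sum.cong refl) (simp add: algebra_simps)
    finally show ?thesis by simp
  qed
  have BY: "?B c c' = (\<Sum>b<q. cY c b * cnj (cY c' b))" for c c'
  proof -
    have "(\<Sum>a<q. cY c a * cnj (cY c' a)) = (\<Sum>a<q. \<Sum>j<N. \<Sum>i<N. c j * Y j a * cnj (c' i * Y i a))"
      unfolding cY_def cnj_sum sum_product ..
    also have "\<dots> = (\<Sum>j<N. \<Sum>i<N. \<Sum>a<q. c j * Y j a * cnj (c' i * Y i a))"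
      by (subst sum.swap, rule sum.cong[OF refl], rule sum.swap)
    also have "\<dots> = (\<Sum>i<N. \<Sum>j<N. \<Sum>a<q. c j * Y j a * cnj (c' i * Y i a))"
      by (rule sum.swap)
    also have "\<dots> = (\<Sum>i<N. \<Sum>j<N. (\<Sum>b<q. Y j b * cnj (Y i b)) * c j * cnj (c' i))" 
      unfolding sum_distrib_right
      by (intro sum.cong refl) (simp add: algebra_simps)
    also have "\<dots> = ?B c c'" unfolding qform_def P_def
      by (intro sum.cong refl) (simp add: assms)
    finally show ?thesis by simp
  qed
  have sq: "z * cnj z = of_real ((cmod z)\<^sup>2)" for z by (simp add: complex_norm_square flip: of_real_power)
  have "?B x x = of_real (\<Sum>a<p. (cmod (cX x a))\<^sup>2)" for x
    by (simp only: BX sq of_real_sum)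
  then have psd: "psd N P" unfolding psd_def by (metis nonneg_Reals_of_real_iff sum_nonneg zero_le_power2)
  obtain S :: nat and e where on: "\<forall>s<S. \<forall>t<S. ?B (e s) (e t) = of_bool (s = t)"
    and sp: "\<forall>k<N. \<forall>y. ?B (?d k) y = (\<Sum>s<S. ?B (?d k) (e s) * ?B (e s) y)"
    by (rule psd_orthonormal_basis[OF psd])
  note on = on[rule_format] and sp = sp[rule_format]
  \<comment> \<open>The partial isometry that takes the orthonormal vectors \<open>cX (e s)\<close>
    to \<open>cY (e s)\<close> and vanishes on the orthogonal complement; it acts on row vectors
    from the right.\<close>
  define W where "W = (\<lambda>a b. \<Sum>s<S. cnj (cX (e s) a) * cY (e s) b)"
  have dX: "cX (?d k) a = X k a" and dY: "cY (?d k) b = Y k b" if "k < N" for k a b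
    using that by (simp_all add: cX_def cY_def)
  have Wk: "(\<Sum>a<p. X k a * W a b) = Y k b" if k: "k < N" and b: "b < q" for k b
  proof -
    \<comment> \<open>The residual of a unit vector is null for the form, so its combination of the
      rows of \<open>Y\<close> has norm 0 and vanishes entry by entry.\<close>
    define r where "r = (\<lambda>i. ?d k i - (\<Sum>s<S. ?B (?d k) (e s) * e s i))"
    have r: "?B r y = 0" for y
      unfolding r_def qform_diff_left qform_sum_left qform_scale_left using sp[OF k, of y] by simp
    have "(\<Sum>b<q. (cmod (cY r b))\<^sup>2) = 0"
      using r[of r] unfolding BY sq of_real_sum[symmetric] of_real_eq_0_iff .
    then have "cY r b = 0" using b by (simp add: sum_nonneg_eq_0_iff)
    moreover have "cY r b = Y k b - (\<Sum>s<S. ?B (?d k) (e s) * cY (e s) b)"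
    proof -
      have "cY r b = cY (?d k) b - (\<Sum>i<N. \<Sum>s<S. ?B (?d k) (e s) * e s i * Y i b)"
        by (simp only: cY_def r_def left_diff_distrib sum_subtractf sum_distrib_right)
      also have "(\<Sum>i<N. \<Sum>s<S. ?B (?d k) (e s) * e s i * Y i b) = (\<Sum>s<S. ?B (?d k) (e s) * cY (e s) b)"
        by (subst sum.swap) (simp add: cY_def sum_distrib_left mult.assoc)
      finally show ?thesis using dY[OF k] by simp
    qed
    moreover have "(\<Sum>a<p. X k a * W a b) = (\<Sum>s<S. ?B (?d k) (e s) * cY (e s) b)"
    proof -
      have "(\<Sum>a<p. X k a * W a b) = (\<Sum>s<S. \<Sum>a<p. cX (?d k) a * cnj (cX (e s) a) * cY (e s) b)"
        unfolding W_def sum_distrib_left dX[OF k] by (subst sum.swap) (simp add: mult.assoc)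
      then show ?thesis by (simp only: BX sum_distrib_right)
    qed
    ultimately show ?thesis by simp
  qed
  have contr: "(\<Sum>a<p. (cmod (\<Sum>b<q. W a b * x b))\<^sup>2) \<le> (\<Sum>b<q. (cmod (x b))\<^sup>2)" for x
  proof -
    define y where "y = (\<lambda>s. \<Sum>b<q. cY (e s) b * x b)"
    have Wx: "(\<Sum>b<q. W a b * x b) = (\<Sum>s<S. cnj (cX (e s) a) * y s)" for a
      unfolding W_def y_def sum_distrib_right sum_distrib_left
      by (subst sum.swap) (simp add: algebra_simps)
    have onX: "(\<Sum>a<p. cnj (cX (e s) a) * cX (e t) a) = of_bool (s = t)" if "s < S" "t < S" for s t
      using on[OF that(2,1)] unfolding BX by (auto simp: mult.commute)
    have onY: "(\<Sum>a<q. cY (e s) a * cnj (cY (e t) a)) = of_bool (s = t)" if "s < S" "t < S" for s t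
      using on[OF that] unfolding BY by auto
    have "of_real (\<Sum>a<p. (cmod (\<Sum>b<q. W a b * x b))\<^sup>2) = (\<Sum>a<p. \<Sum>s<S. \<Sum>t<S. cnj (cX (e s) a) * y s * cnj (cnj (cX (e t) a) * y t))"
      unfolding of_real_sum sq[symmetric] Wx cnj_sum sum_product ..
    also have "\<dots> = (\<Sum>s<S. \<Sum>a<p. \<Sum>t<S. cnj (cX (e s) a) * y s * cnj (cnj (cX (e t) a) * y t))"
      by (rule sum.swap)
    also have "\<dots> = (\<Sum>s<S. \<Sum>t<S. \<Sum>a<p. cnj (cX (e s) a) * y s * cnj (cnj (cX (e t) a) * y t))"
      by (rule sum.cong[OF refl], rule sum.swap)
    also have "\<dots> = (\<Sum>s<S. \<Sum>t<S. (\<Sum>a<p. cnj (cX (e s) a) * cX (e t) a) * (y s * cnj (y t)))"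
      unfolding sum_distrib_right by (intro sum.cong refl) (simp add: algebra_simps)
    also have "\<dots> = (\<Sum>s<S. y s * cnj (y s))"
    proof (rule sum.cong[OF refl])
      fix s assume s: "s \<in> {..<S}"
      have "(\<Sum>t<S. (\<Sum>a<p. cnj (cX (e s) a) * cX (e t) a) * (y s * cnj (y t))) =
        (\<Sum>t<S. if t = s then y s * cnj (y s) else 0)"
        using s by (intro sum.cong) (auto simp: onX)
      then show "(\<Sum>t<S. (\<Sum>a<p. cnj (cX (e s) a) * cX (e t) a) * (y s * cnj (y t))) = y s * cnj (y s)"
        using s by simp
    qed
    finally have 1: "(\<Sum>a<p. (cmod (\<Sum>b<q. W a b * x b))\<^sup>2) = (\<Sum>s<S. (cmod (y s))\<^sup>2)"
      unfolding sq of_real_sum[symmetric] of_real_eq_iff .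
    \<comment> \<open>The orthogonal projection of \<open>x\<close> to the span of the conjugates of
      the vectors \<open>cY (e s)\<close>. Expanding \<open>|x - w|^2 \<ge> 0\<close> is Bessel's
      inequality for the coefficients \<open>y s\<close>.\<close>
    define w where "w = (\<lambda>b. \<Sum>s<S. y s * cnj (cY (e s) b))"
    have xw: "(\<Sum>b<q. x b * cnj (w b)) = (\<Sum>s<S. y s * cnj (y s))"
    proof -
      have "(\<Sum>b<q. x b * cnj (w b)) = (\<Sum>b<q. \<Sum>s<S. x b * (cnj (y s) * cY (e s) b))"
        unfolding w_def cnj_sum sum_distrib_left by simp
      also have "\<dots> = (\<Sum>s<S. \<Sum>b<q. x b * (cnj (y s) * cY (e s) b))" by (rule sum.swap)
      also have "\<dots> = (\<Sum>s<S. y s * cnj (y s))"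
        unfolding y_def sum_distrib_right by (intro sum.cong refl) (simp add: algebra_simps)
      finally show ?thesis .
    qed
    have ww: "(\<Sum>b<q. w b * cnj (w b)) = (\<Sum>s<S. y s * cnj (y s))"
    proof -
      have "(\<Sum>b<q. w b * cnj (w b)) = (\<Sum>b<q. \<Sum>s<S. \<Sum>t<S. y s * cnj (cY (e s) b) * cnj (y t * cnj (cY (e t) b)))"
        unfolding w_def cnj_sum sum_product ..
      also have "\<dots> = (\<Sum>s<S. \<Sum>b<q. \<Sum>t<S. y s * cnj (cY (e s) b) * cnj (y t * cnj (cY (e t) b)))"
        by (rule sum.swap)
      also have "\<dots> = (\<Sum>s<S. \<Sum>t<S. \<Sum>b<q. y s * cnj (cY (e s) b) * cnj (y t * cnj (cY (e t) b)))"
        by (rule sum.cong[OF refl], rule sum.swap)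
      also have "\<dots> = (\<Sum>s<S. \<Sum>t<S. (\<Sum>b<q. cY (e t) b * cnj (cY (e s) b)) * (y s * cnj (y t)))"
        unfolding sum_distrib_right by (intro sum.cong refl) (simp add: algebra_simps)
      also have "\<dots> = (\<Sum>s<S. y s * cnj (y s))"
      proof (rule sum.cong[OF refl])
        fix s assume s: "s \<in> {..<S}"
        have "(\<Sum>t<S. (\<Sum>b<q. cY (e t) b * cnj (cY (e s) b)) * (y s * cnj (y t))) =
          (\<Sum>t<S. if t = s then y s * cnj (y s) else 0)"
          using s by (intro sum.cong) (auto simp: onY)
        then show "(\<Sum>t<S. (\<Sum>b<q. cY (e t) b * cnj (cY (e s) b)) * (y s * cnj (y t))) = y s * cnj (y s)"
          using s by simp
      qed
      finally show ?thesis .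
    qed
    have "0 \<le> (\<Sum>b<q. (cmod (x b - w b))\<^sup>2)" by (intro sum_nonneg) auto
    also have "\<dots> = Re (\<Sum>b<q. x b * cnj (x b) - x b * cnj (w b) - cnj (x b * cnj (w b)) + w b * cnj (w b))"
      unfolding Re_sum by (rule sum.cong[OF refl]) (simp only: cmod_power2, simp add: algebra_simps power2_eq_square)
    also have "\<dots> = Re (\<Sum>b<q. x b * cnj (x b)) - Re (\<Sum>b<q. x b * cnj (w b)) - Re (\<Sum>b<q. x b * cnj (w b)) + Re (\<Sum>b<q. w b * cnj (w b))"
      by (simp add: sum.distrib sum_subtractf)
    also have "\<dots> = (\<Sum>b<q. (cmod (x b))\<^sup>2) - (\<Sum>s<S. (cmod (y s))\<^sup>2)"
      unfolding xw ww unfolding sq of_real_sum[symmetric] Re_complex_of_real by simp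
    finally show ?thesis using 1 by simp
  qed
  show ?thesis by (rule that[OF Wk contr])
qed

section \<open>The pentablock and its test functions\<close>

text \<open>All three kinds of test function in one family. Every index above 1 gives the last kind,
  where \<open>\<alpha>\<close> is a dummy, so \<open>t\<close> can range over all naturals.\<close>

definition test_fun :: "nat \<Rightarrow> complex \<Rightarrow> complex ^ 3 \<Rightarrow> complex" where
  "test_fun t \<alpha> z = (if t = 0 then psi \<alpha> z else if t = 1 then Phi \<alpha> (z $ 2) (z $ 3) else z $ 2 / 2)"

definition pent_of :: "complex ^ 2 ^ 2 \<Rightarrow> complex ^ 3" where
  "pent_of A = vector [A $ 2 $ 1, trace A, det A]"

lemma pent_of_nth:
  "pent_of A $ 1 = A $ 2 $ 1" "pent_of A $ 2 = A $ 1 $ 1 + A $ 2 $ 2"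
  "pent_of A $ 3 = A $ 1 $ 1 * A $ 2 $ 2 - A $ 1 $ 2 * A $ 2 $ 1"
  by (simp_all add: pent_of_def trace_def sum_2 det_2)

lemma norm_complex2_sq: "(norm (x :: complex ^ 2))\<^sup>2 = (cmod (x $ 1))\<^sup>2 + (cmod (x $ 2))\<^sup>2"
  by (simp add: norm_vec_def L2_set_def sum_2)

lemma matrix2_vector: "(A *v x) $ i = A $ i $ 1 * x $ 1 + A $ i $ (2::2) * x $ (2::2)"
  by (simp add: matrix_vector_mult_def sum_2)

lemma bounded_linear_complex_matrix2: "bounded_linear ((*v) (A :: complex ^ 2 ^ 2))"
proof -
  have "linear ((*v) A)"
    by (rule linearI) (simp_all add: vec_eq_iff matrix2_vector algebra_simps)
  then show ?thesis by (simp add: linear_conv_bounded_linear)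
qed

text \<open>The explicit constant \<open>c < 1\<close> leaves the room \<open>1 - c\<close> that
  perturbation arguments use.\<close>

lemma pentablock_iff:
  "z \<in> pentablock \<longleftrightarrow> (\<exists>A c. z = pent_of A \<and> 0 \<le> c \<and> c < 1 \<and> (\<forall>x. norm (A *v x) \<le> c * norm x))"
proof
  assume "z \<in> pentablock"
  then obtain A :: "complex ^ 2 ^ 2" where A: "z = pent_of A" "onorm ((*v) A) < 1"
    unfolding pentablock_def pent_of_def by auto
  show "\<exists>A c. z = pent_of A \<and> 0 \<le> c \<and> c < 1 \<and> (\<forall>x. norm (A *v x) \<le> c * norm x)"
    using A onorm[OF bounded_linear_complex_matrix2[of A]] onorm_pos_le[OF bounded_linear_complex_matrix2[of A]]
    by blast
next
  assume "\<exists>A c. z = pent_of A \<and> 0 \<le> c \<and> c < 1 \<and> (\<forall>x. norm (A *v x) \<le> c * norm x)"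
  then obtain A c where A: "z = pent_of A" "0 \<le> c" "c < 1" "\<And>x. norm (A *v x) \<le> c * norm x" by blast
  have "onorm ((*v) A) \<le> c" using A by (intro onorm_bound) auto
  then show "z \<in> pentablock" using A unfolding pentablock_def pent_of_def by fastforce
qed

lemma matrix2_entry_bound:
  fixes B :: "complex ^ 2 ^ 2"
  assumes "\<And>i j. cmod (B $ i $ j) \<le> \<eta>" "0 \<le> \<eta>"
  shows "norm (B *v x) \<le> 4 * \<eta> * norm x"
proof -
  have 1: "cmod (x $ i) \<le> norm x" for i by (rule Finite_Cartesian_Product.norm_nth_le)
  have 2: "cmod ((B *v x) $ i) \<le> 2 * \<eta> * norm x" for i
  proof -
    have "cmod ((B *v x) $ i) \<le> cmod (B $ i $ 1) * cmod (x $ 1) + cmod (B $ i $ 2) * cmod (x $ 2)"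
      unfolding matrix2_vector by (metis norm_mult norm_triangle_ineq)
    also have "\<dots> \<le> \<eta> * norm x + \<eta> * norm x"
      using assms 1 by (intro add_mono mult_mono) auto
    finally show ?thesis by simp
  qed
  have "(norm (B *v x))\<^sup>2 \<le> (2 * \<eta> * norm x)\<^sup>2 + (2 * \<eta> * norm x)\<^sup>2"
    unfolding norm_complex2_sq using 2 by (intro add_mono power_mono) auto
  also have "\<dots> \<le> (4 * \<eta> * norm x)\<^sup>2"
    by (simp add: power_mult_distrib)
  finally show ?thesis using assms(2) by (auto intro: power2_le_imp_le)
qed

text \<open>By \<open>matrix2_entry_bound\<close> entries below \<open>(1 - c) / 8\<close> change
  the norm by at most \<open>(1 - c) / 2\<close>, so the midpoint between \<open>c\<close> and 1 is
  a bound for \<open>B\<close>.\<close>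

lemma pent_of_perturb:
  assumes A: "0 \<le> c" "c < 1" "\<And>x. norm (A *v x) \<le> c * norm x"
    and B: "\<And>i j. cmod (B $ i $ j - A $ i $ j) \<le> (1 - c) / 8"
  shows "pent_of B \<in> pentablock"
proof -
  have "norm (B *v x) \<le> (c + (1 - c) / 2) * norm x" for x
  proof -
    have "B *v x = A *v x + (B - A) *v x" by (simp add: matrix_vector_mult_diff_rdistrib)
    then have "norm (B *v x) \<le> norm (A *v x) + norm ((B - A) *v x)" by (metis norm_triangle_ineq)
    also have "\<dots> \<le> c * norm x + 4 * ((1 - c) / 8) * norm x"
      using A B by (intro add_mono matrix2_entry_bound) auto
    also have "\<dots> = (c + (1 - c) / 2) * norm x" by (simp add: field_simps)
    finally show ?thesis .
  qed
  then show ?thesis unfolding pentablock_iff using A by (intro exI[of _ B] exI[of _ "c + (1 - c) / 2"]) (auto simp: field_simps)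
qed

text \<open>The product of \<open>t - t0\<close> and \<open>t + t0\<close> is
  \<open>s - t0^2\<close>, and the smaller factor squared is at most the product in modulus. This is
  continuity of a suitably chosen root even at \<open>t0 = 0\<close>, where no continuous branch
  exists.\<close>

lemma sqrt_near:
  fixes s t0 :: complex
  shows "\<exists>t. t\<^sup>2 = s \<and> (cmod (t - t0))\<^sup>2 \<le> cmod (s - t0\<^sup>2)"
proof -
  define t where "t = csqrt s"
  have t: "t\<^sup>2 = s" by (simp add: t_def)
  have pr: "cmod (t - t0) * cmod (t + t0) = cmod (s - t0\<^sup>2)"
    by (simp add: t[symmetric] power2_eq_square algebra_simps flip: norm_mult)
  show ?thesis
  proof (cases "cmod (t - t0) \<le> cmod (t + t0)")
    case True
    then have "cmod (t - t0) * cmod (t - t0) \<le> cmod (t - t0) * cmod (t + t0)"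
      by (intro mult_left_mono) auto
    then show ?thesis using t pr by (intro exI[of _ t]) (simp add: power2_eq_square)
  next
    case False
    have e: "cmod (- t - t0) = cmod (t + t0)" by (metis minus_add_distrib norm_minus_cancel uminus_add_conv_diff add.commute)
    from False have "cmod (t + t0) * cmod (t + t0) \<le> cmod (t - t0) * cmod (t + t0)"
      by (intro mult_right_mono) auto
    then show ?thesis using t pr e by (intro exI[of _ "- t"]) (simp add: power2_eq_square)
  qed
qed

lemma vec3_eqI: 
  fixes z w :: "complex ^ 3"
  assumes "z $ 1 = w $ 1" "z $ 2 = w $ 2" "z $ 3 = w $ 3" shows "z = w"
  using assms by (simp add: vec_eq_iff forall_3)

text \<open>Near a matrix with \<open>a\<^sub>2\<^sub>1 \<noteq> 0\<close> the remaining entries are continuous functions of the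
  point; if \<open>a\<^sub>2\<^sub>1 = 0\<close>, the entry \<open>a\<^sub>1\<^sub>2\<close> is irrelevant and the diagonal is recovered up to a
  square root.\<close>

lemma open_pentablock: "open pentablock"
proof (subst open_subopen, intro ballI)
  fix z assume "z \<in> pentablock"
  then obtain A c where A: "z = pent_of A" "0 \<le> c" "c < 1" "\<And>x. norm (A *v x) \<le> c * norm x"
    unfolding pentablock_iff by blast
  have "eventually (\<lambda>w. w \<in> pentablock) (nhds z)"
  proof (cases "A $ 2 $ 1 = 0")
    case False
    \<comment> \<open>The entry \<open>a\<^sub>2\<^sub>2\<close> is kept, the trace determines
      \<open>a\<^sub>1\<^sub>1\<close>, and the determinant is solved for
      \<open>a\<^sub>1\<^sub>2\<close>, which divides by \<open>w $ 1\<close>.\<close>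
    define M :: "complex ^ 3 \<Rightarrow> complex ^ 2 ^ 2" where
      "M = (\<lambda>w. vector [vector [A $ 1 $ 1 + (w $ 2 - z $ 2), ((A $ 1 $ 1 + (w $ 2 - z $ 2)) * A $ 2 $ 2 - w $ 3) / w $ 1],
                    vector [w $ 1, A $ 2 $ 2]])"
    have z: "z $ 1 = A $ 2 $ 1" "z $ 2 = A $ 1 $ 1 + A $ 2 $ 2"
      "z $ 3 = A $ 1 $ 1 * A $ 2 $ 2 - A $ 1 $ 2 * A $ 2 $ 1" using A(1) pent_of_nth by auto
    have n1: "((\<lambda>w. w $ i) \<longlongrightarrow> z $ i) (nhds z)" for i by (intro tendsto_intros filterlim_ident)
    have nz: "eventually (\<lambda>w. w $ 1 \<noteq> 0) (nhds z)"
      using tendsto_imp_eventually_ne[OF n1[of 1]] False z by auto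
    have t12: "((\<lambda>w. M w $ 1 $ 2) \<longlongrightarrow> A $ 1 $ 2) (nhds z)"
    proof -
      have "((\<lambda>w. ((A $ 1 $ 1 + (w $ 2 - z $ 2)) * A $ 2 $ 2 - w $ 3) / w $ 1) \<longlongrightarrow>
         ((A $ 1 $ 1 + (z $ 2 - z $ 2)) * A $ 2 $ 2 - z $ 3) / z $ 1) (nhds z)"
        using False z by (intro tendsto_intros n1) auto
      moreover have "((A $ 1 $ 1 + (z $ 2 - z $ 2)) * A $ 2 $ 2 - z $ 3) / z $ 1 = A $ 1 $ 2"
        using False z by simp
      ultimately show ?thesis by (simp add: M_def)
    qed
    have t11: "((\<lambda>w. M w $ 1 $ 1) \<longlongrightarrow> A $ 1 $ 1) (nhds z)"
    proof -
      have "((\<lambda>w. A $ 1 $ 1 + (w $ 2 - z $ 2)) \<longlongrightarrow> A $ 1 $ 1 + (z $ 2 - z $ 2)) (nhds z)"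
        by (intro tendsto_intros n1)
      then show ?thesis by (simp add: M_def)
    qed
    have t21: "((\<lambda>w. M w $ 2 $ 1) \<longlongrightarrow> A $ 2 $ 1) (nhds z)" using n1[of 1] z by (simp add: M_def)
    have t22: "((\<lambda>w. M w $ 2 $ 2) \<longlongrightarrow> A $ 2 $ 2) (nhds z)" by (simp add: M_def)
    have pos: "(1 - c) / 8 > 0" using A by simp
    have ev: "eventually (\<lambda>w. cmod (M w $ i $ j - A $ i $ j) < (1 - c) / 8) (nhds z)" for i j
      using tendstoD[OF t11 pos] tendstoD[OF t12 pos] tendstoD[OF t21 pos] tendstoD[OF t22 pos]
        exhaust_2[of i] exhaust_2[of j] by (auto simp: dist_norm)
    have "eventually (\<lambda>w. \<forall>i j. cmod (M w $ i $ j - A $ i $ j) < (1 - c) / 8) (nhds z)"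
      using ev by (intro eventually_all_finite) auto
    with nz show ?thesis
    proof eventually_elim
      case (elim w)
      have "pent_of (M w) = w"
        using elim(1) z by (intro vec3_eqI) (simp_all add: pent_of_nth M_def)
      moreover have "pent_of (M w) \<in> pentablock"
        by (rule pent_of_perturb[OF A(2-4)]) (use elim(2) in \<open>auto intro: less_imp_le\<close>)
      ultimately show ?case by simp
    qed
  next
    case True
    \<comment> \<open>With \<open>a\<^sub>2\<^sub>1 = 0\<close> the entry
      \<open>a\<^sub>1\<^sub>2\<close> does not affect the point and may be set to 0; the bound
      \<open>c\<close> survives because diagonal entries are at most the norm.\<close>
    define A' :: "complex ^ 2 ^ 2" where "A' = vector [vector [A $ 1 $ 1, 0], vector [0, A $ 2 $ 2]]"
    have diag: "cmod (A $ i $ i) \<le> c" for i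
    proof -
      have "cmod ((A *v axis i 1) $ i) \<le> norm (A *v axis i 1)" by (rule Finite_Cartesian_Product.norm_nth_le)
      also have "\<dots> \<le> c" using A(4)[of "axis i 1"] by simp
      also have "(A *v axis i 1) $ i = A $ i $ i"
        using exhaust_2[of i] by (auto simp: matrix2_vector axis_def)
      finally show ?thesis .
    qed
    have A': "norm (A' *v x) \<le> c * norm x" for x
    proof (rule power2_le_imp_le)
      have "(norm (A' *v x))\<^sup>2 = (cmod (A $ 1 $ 1))\<^sup>2 * (cmod (x $ 1))\<^sup>2 + (cmod (A $ 2 $ 2))\<^sup>2 * (cmod (x $ 2))\<^sup>2"
        unfolding norm_complex2_sq by (simp add: matrix2_vector A'_def norm_mult power_mult_distrib)
      also have "\<dots> \<le> c\<^sup>2 * (cmod (x $ 1))\<^sup>2 + c\<^sup>2 * (cmod (x $ 2))\<^sup>2"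
        using diag by (intro add_mono mult_right_mono power_mono) auto
      also have "\<dots> = (c * norm x)\<^sup>2" unfolding power_mult_distrib norm_complex2_sq by (simp add: algebra_simps)
      finally show "(norm (A' *v x))\<^sup>2 \<le> (c * norm x)\<^sup>2" .
    qed (use A in auto)
    \<comment> \<open>The diagonal entries are \<open>z $ 2 / 2 + t0\<close> and
      \<open>z $ 2 / 2 - t0\<close>, and \<open>t0^2\<close> is a quarter of the discriminant, the
      value of \<open>D\<close> at \<open>z\<close>.\<close>
    define t0 where "t0 = (A $ 1 $ 1 - A $ 2 $ 2) / 2"
    obtain t where t: "\<And>s. (t s)\<^sup>2 = s" "\<And>s. (cmod (t s - t0))\<^sup>2 \<le> cmod (s - t0\<^sup>2)"
      using sqrt_near[of _ t0] by metis
    define D where "D = (\<lambda>w::complex^3. (w $ 2)\<^sup>2 / 4 - w $ 3)"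
    have z: "z $ 1 = 0" "z $ 2 = A $ 1 $ 1 + A $ 2 $ 2"
      "z $ 3 = A $ 1 $ 1 * A $ 2 $ 2" using A(1) pent_of_nth[of A] True by auto
    have n1: "((\<lambda>w. w $ i) \<longlongrightarrow> z $ i) (nhds z)" for i by (intro tendsto_intros filterlim_ident)
    have "(D \<longlongrightarrow> (z $ 2)\<^sup>2 / 4 - z $ 3) (nhds z)" unfolding D_def by (intro tendsto_intros n1) auto
    moreover have "(z $ 2)\<^sup>2 / 4 - z $ 3 = t0\<^sup>2" unfolding z t0_def by (simp add: power2_eq_square field_simps)
    ultimately have "((\<lambda>w. cmod (D w - t0\<^sup>2)) \<longlongrightarrow> cmod (t0\<^sup>2 - t0\<^sup>2)) (nhds z)"
      by (intro tendsto_intros) auto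
    then have "((\<lambda>w. sqrt (cmod (D w - t0\<^sup>2))) \<longlongrightarrow> sqrt 0) (nhds z)" by (intro tendsto_real_sqrt) simp
    then have "((\<lambda>w. sqrt (cmod (D w - t0\<^sup>2))) \<longlongrightarrow> 0) (nhds z)" by simp
    then have "((\<lambda>w. t (D w) - t0) \<longlongrightarrow> 0) (nhds z)"
      by (rule Lim_null_comparison[rotated]) (intro always_eventually allI real_le_rsqrt t(2))
    then have tt: "((\<lambda>w. t (D w)) \<longlongrightarrow> t0) (nhds z)" using LIM_zero_iff by blast
    define M :: "complex ^ 3 \<Rightarrow> complex ^ 2 ^ 2" where
      "M = (\<lambda>w. vector [vector [w $ 2 / 2 + t (D w), 0], vector [w $ 1, w $ 2 / 2 - t (D w)]])"
    have e: "z $ 2 / 2 + t0 = A $ 1 $ 1" "z $ 2 / 2 - t0 = A $ 2 $ 2"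
      by (simp_all add: z t0_def field_simps)
    have "((\<lambda>w. w $ 2 / 2 + t (D w)) \<longlongrightarrow> z $ 2 / 2 + t0) (nhds z)" 
         "((\<lambda>w. w $ 2 / 2 - t (D w)) \<longlongrightarrow> z $ 2 / 2 - t0) (nhds z)" by (intro tendsto_intros n1 tt; simp)+
    then have t11: "((\<lambda>w. M w $ 1 $ 1) \<longlongrightarrow> A' $ 1 $ 1) (nhds z)"
      and t22: "((\<lambda>w. M w $ 2 $ 2) \<longlongrightarrow> A' $ 2 $ 2) (nhds z)" by (simp_all add: M_def A'_def e)
    have t12: "((\<lambda>w. M w $ 1 $ 2) \<longlongrightarrow> A' $ 1 $ 2) (nhds z)" by (simp add: M_def A'_def)
    have t21: "((\<lambda>w. M w $ 2 $ 1) \<longlongrightarrow> A' $ 2 $ 1) (nhds z)" using n1[of 1] z by (simp add: M_def A'_def)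
    have pos: "(1 - c) / 8 > 0" using A by simp
    have ev: "eventually (\<lambda>w. cmod (M w $ i $ j - A' $ i $ j) < (1 - c) / 8) (nhds z)" for i j
      using tendstoD[OF t11 pos] tendstoD[OF t12 pos] tendstoD[OF t21 pos] tendstoD[OF t22 pos]
        exhaust_2[of i] exhaust_2[of j] by (auto simp: dist_norm)
    have "eventually (\<lambda>w. \<forall>i j. cmod (M w $ i $ j - A' $ i $ j) < (1 - c) / 8) (nhds z)"
      using ev by (intro eventually_all_finite) auto
    then show ?thesis
    proof eventually_elim
      case (elim w)
      have "(w $ 2 / 2 + t (D w)) * (w $ 2 / 2 - t (D w)) = (w $ 2)\<^sup>2 / 4 - (t (D w))\<^sup>2"
        by (simp add: power2_eq_square field_simps)
      then have "(w $ 2 / 2 + t (D w)) * (w $ 2 / 2 - t (D w)) = w $ 3"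
        unfolding t(1) by (simp add: D_def)
      then have "pent_of (M w) = w"
        by (intro vec3_eqI) (simp_all add: pent_of_nth M_def)
      moreover have "pent_of (M w) \<in> pentablock"
        by (rule pent_of_perturb[OF A(2,3) A']) (use elim in \<open>auto intro: less_imp_le\<close>)
      ultimately show ?case by simp
    qed
  qed
  then show "\<exists>T. open T \<and> z \<in> T \<and> T \<subseteq> pentablock" unfolding eventually_nhds by blast
qed

section \<open>Dilations, eigenvalues and bounds for the test functions\<close>

text \<open>The action on points that comes from replacing the matrix \<open>A\<close> by
  \<open>r A\<close>: the determinant scales with \<open>r^2\<close>.\<close>

definition dilate :: "real \<Rightarrow> complex ^ 3 \<Rightarrow> complex ^ 3" where
  "dilate r z = vector [of_real r * z $ 1, of_real r * z $ 2, (of_real r)\<^sup>2 * z $ 3]"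

lemma dilate_nth [simp]:
  "dilate r z $ 1 = of_real r * z $ 1" "dilate r z $ 2 = of_real r * z $ 2"
  "dilate r z $ 3 = (of_real r)\<^sup>2 * z $ 3"
  by (simp_all add: dilate_def)

lemma dilate_pentablock:
  assumes "z \<in> pentablock" "0 \<le> r" "r \<le> 1" shows "dilate r z \<in> pentablock"
proof -
  obtain A c where A: "z = pent_of A" "0 \<le> c" "c < 1" "\<And>x. norm (A *v x) \<le> c * norm x"
    using assms(1) unfolding pentablock_iff by blast
  define B :: "complex ^ 2 ^ 2" where "B = (\<chi> i j. complex_of_real r * A $ i $ j)"
  have B: "B $ i $ j = of_real r * A $ i $ j" for i j by (simp only: B_def vec_lambda_beta)
  have "norm (B *v x) \<le> c * norm x" for x
  proof -
    have "B *v x = r *\<^sub>R (A *v x)"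
      unfolding vec_eq_iff vector_scaleR_component matrix2_vector B
      by (simp add: scaleR_conv_of_real algebra_simps)
    then have "norm (B *v x) \<le> norm (A *v x)" using assms by (simp add: mult_left_le_one_le)
    then show ?thesis using A(4)[of x] by linarith
  qed
  moreover have "dilate r z = pent_of B"
    by (rule vec3_eqI) (simp_all add: A(1) pent_of_nth B power2_eq_square algebra_simps)
  ultimately show ?thesis unfolding pentablock_iff using A by blast
qed

text \<open>\<open>l\<close> and \<open>m\<close> are the eigenvalues of a representing matrix; a
  root of the characteristic polynomial has an eigenvector and is therefore bounded by the
  norm.\<close>

lemma pentablock_eigenvalues:
  assumes "z \<in> pentablock"
  obtains l m where "cmod l < 1" "cmod m < 1" "z $ 2 = l + m" "z $ 3 = l * m"
proof -
  obtain A c where A: "z = pent_of A" "0 \<le> c" "c < 1" "\<And>x. norm (A *v x) \<le> c * norm x"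
    using assms(1) unfolding pentablock_iff by blast
  have root: "cmod l < 1" if l: "l\<^sup>2 - z $ 2 * l + z $ 3 = 0" for l
  proof -
    define p q r s where "p = A $ 1 $ 1 - l" "q = A $ 1 $ 2" "r = A $ 2 $ 1" "s = A $ 2 $ 2 - l"
    have d: "p * s = q * r"
      using l unfolding p_q_r_s_def A(1) pent_of_nth by (simp add: power2_eq_square algebra_simps)
    \<comment> \<open>A nonzero kernel vector of the singular matrix \<open>A - l\<close>, read off
      from whichever row is nonzero.\<close>
    obtain x1 x2 where x: "(x1, x2) \<noteq> (0, 0)" "p * x1 + q * x2 = 0" "r * x1 + s * x2 = 0"
    proof (cases "p = 0 \<and> q = 0")
      case False
      then show ?thesis using d by (intro that[of q "- p"]) (auto simp: algebra_simps)
    next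
      case True
      show ?thesis
      proof (cases "r = 0 \<and> s = 0")
        case False
        then show ?thesis using True by (intro that[of s "- r"]) (auto simp: algebra_simps)
      qed (use True in \<open>auto intro: that[of 1 0]\<close>)
    qed
    define v :: "complex ^ 2" where "v = vector [x1, x2]"
    have "v \<noteq> 0" using x(1) by (auto simp: v_def vec_eq_iff forall_2)
    have "A *v v = l *s v"
      using x(2,3) by (auto simp: vec_eq_iff forall_2 matrix2_vector v_def p_q_r_s_def algebra_simps)
    then have "(norm (A *v v))\<^sup>2 = (cmod l * norm v)\<^sup>2"
      by (simp add: norm_complex2_sq norm_mult power_mult_distrib algebra_simps)
    then have "norm (A *v v) = cmod l * norm v" by (simp add: power2_eq_iff_nonneg)
    then have "cmod l * norm v \<le> c * norm v" using A(4)[of v] by simp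
    then show ?thesis using \<open>v \<noteq> 0\<close> A(3) by simp
  qed
  define d where "d = csqrt ((z $ 2)\<^sup>2 / 4 - z $ 3)"
  have d: "d\<^sup>2 = (z $ 2)\<^sup>2 / 4 - z $ 3" by (simp add: d_def)
  show ?thesis
  proof (rule that[of "z $ 2 / 2 + d" "z $ 2 / 2 - d"])
    have "(z $ 2 / 2 + d)\<^sup>2 - z $ 2 * (z $ 2 / 2 + d) + z $ 3 = d\<^sup>2 - ((z $ 2)\<^sup>2 / 4 - z $ 3)"
      by (simp add: power2_eq_square field_simps)
    then show "cmod (z $ 2 / 2 + d) < 1" by (intro root) (simp add: d)
    have "(z $ 2 / 2 - d)\<^sup>2 - z $ 2 * (z $ 2 / 2 - d) + z $ 3 = d\<^sup>2 - ((z $ 2)\<^sup>2 / 4 - z $ 3)"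
      by (simp add: power2_eq_square field_simps)
    then show "cmod (z $ 2 / 2 - d) < 1" by (intro root) (simp add: d)
    have "(z $ 2 / 2 + d) * (z $ 2 / 2 - d) = (z $ 2)\<^sup>2 / 4 - d\<^sup>2"
      by (simp add: power2_eq_square field_simps)
    then show "z $ 3 = (z $ 2 / 2 + d) * (z $ 2 / 2 - d)" by (simp add: d)
  qed simp
qed

lemma one_minus_mult_nonzero:
  fixes a l :: complex assumes "cmod a \<le> 1" "cmod l < 1" shows "1 - a * l \<noteq> 0"
proof
  assume "1 - a * l = 0"
  then have "cmod a * cmod l = 1" by (metis norm_mult norm_one right_minus_eq)
  moreover have "cmod a * cmod l \<le> cmod l" using assms by (simp add: mult_left_le_one_le)
  ultimately show False using assms by simp
qed

text \<open>In terms of the eigenvalues the last denominator factors as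
  \<open>(1 - \<alpha> l) (1 - \<alpha> m)\<close>, and the other is twice
  \<open>1 - \<alpha>\<close> times their mean.\<close>

lemma pentablock_denominators:
  assumes "z \<in> pentablock" "cmod \<alpha> \<le> 1"
  shows "cmod (z $ 2) < 2" "2 - \<alpha> * z $ 2 \<noteq> 0" "1 - \<alpha> * z $ 2 + \<alpha>\<^sup>2 * z $ 3 \<noteq> 0"
proof -
  obtain l m where lm: "cmod l < 1" "cmod m < 1" "z $ 2 = l + m" "z $ 3 = l * m"
    using pentablock_eigenvalues[OF assms(1)] by blast
  show 1: "cmod (z $ 2) < 2" unfolding lm using norm_triangle_ineq[of l m] lm by linarith
  have "1 - \<alpha> * (z $ 2 / 2) \<noteq> 0" using assms(2) 1 by (intro one_minus_mult_nonzero) (auto simp: norm_divide)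
  then show "2 - \<alpha> * z $ 2 \<noteq> 0" by (simp add: field_simps)
  have "(1 - \<alpha> * l) * (1 - \<alpha> * m) \<noteq> 0" using one_minus_mult_nonzero[OF assms(2)] lm by simp
  then show "1 - \<alpha> * z $ 2 + \<alpha>\<^sup>2 * z $ 3 \<noteq> 0" unfolding lm by (simp add: algebra_simps power2_eq_square)
qed

text \<open>With \<open>X = 1 / (1 - \<alpha> l)\<close> the disc \<open>cmod l < 1\<close> becomes the convex set
  \<open>cmod (X - 1) < cmod \<alpha> * cmod X\<close>, and \<open>Phi\<close> becomes the arithmetic mean.\<close>

lemma Phi_eigenvalue_bound:
  fixes \<alpha> l m :: complex
  assumes "cmod \<alpha> \<le> 1" "cmod l < 1" "cmod m < 1"
  shows "cmod (2 * \<alpha> * (l * m) - (l + m)) < cmod (2 - \<alpha> * (l + m))"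
proof (cases "\<alpha> = 0")
  case True
  then show ?thesis using assms norm_triangle_ineq[of l m] by (simp add: norm_minus_commute) (metis minus_add_distrib norm_minus_cancel uminus_add_conv_diff add.commute add_strict_mono le_less_trans one_add_one)
next
  case False
  define k where "k = (cmod \<alpha>)\<^sup>2"
  have k: "0 < k" "k \<le> 1" using assms False by (auto simp: k_def power_le_one)
  define u v where "u = 1 - \<alpha> * l" "v = 1 - \<alpha> * m"
  have nz: "u \<noteq> 0" "v \<noteq> 0" using one_minus_mult_nonzero[OF assms(1)] assms by (auto simp: u_v_def)
  define X Y where "X = 1 / u" "Y = 1 / v"
  \<comment> \<open>Membership in the set is negativity of
    \<open>(1 - k) |Z|^2 - 2 Re Z + 1\<close>, a convex function because
    \<open>k \<le> 1\<close>.\<close>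
  have sc: "(cmod (Z - 1))\<^sup>2 - k * (cmod Z)\<^sup>2 = (1 - k) * (cmod Z)\<^sup>2 - 2 * Re Z + 1" for Z
    unfolding cmod_power2 by (simp add: power2_eq_square algebra_simps)
  have one: "(cmod (1 / (1 - \<alpha> * t) - 1))\<^sup>2 - k * (cmod (1 / (1 - \<alpha> * t)))\<^sup>2 < 0" if t: "cmod t < 1" for t
  proof -
    have nz: "1 - \<alpha> * t \<noteq> 0" using one_minus_mult_nonzero[OF assms(1) t] .
    have "1 / (1 - \<alpha> * t) - 1 = \<alpha> * t * (1 / (1 - \<alpha> * t))" using nz by (simp add: field_simps)
    then have "(cmod (1 / (1 - \<alpha> * t) - 1))\<^sup>2 = k * (cmod t)\<^sup>2 * (cmod (1 / (1 - \<alpha> * t)))\<^sup>2"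
      by (simp add: norm_mult power_mult_distrib k_def norm_divide power_divide)
    moreover have "k * (cmod t)\<^sup>2 * (cmod (1 / (1 - \<alpha> * t)))\<^sup>2 < k * 1 * (cmod (1 / (1 - \<alpha> * t)))\<^sup>2"
      using k nz t by (intro mult_strict_right_mono mult_strict_left_mono) (auto simp: power_less_one_iff abs_square_less_1)
    ultimately show ?thesis by simp
  qed
  have XY: "(1 - k) * (cmod X)\<^sup>2 - 2 * Re X + 1 < 0" "(1 - k) * (cmod Y)\<^sup>2 - 2 * Re Y + 1 < 0"
    using one[OF assms(2)] one[OF assms(3)] unfolding sc X_Y_def u_v_def by auto
  define Z where "Z = (X + Y) / 2"
  have "4 * (cmod Z)\<^sup>2 \<le> 2 * ((cmod X)\<^sup>2 + (cmod Y)\<^sup>2)"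
  proof -
    have "4 * (cmod Z)\<^sup>2 = (cmod (X + Y))\<^sup>2" by (simp add: Z_def norm_divide power_divide)
    also have "\<dots> = 2 * ((cmod X)\<^sup>2 + (cmod Y)\<^sup>2) - (cmod (X - Y))\<^sup>2"
      unfolding cmod_power2 by (simp add: power2_eq_square algebra_simps)
    finally show ?thesis by simp
  qed
  then have "(1 - k) * (2 * (cmod Z)\<^sup>2) \<le> (1 - k) * ((cmod X)\<^sup>2 + (cmod Y)\<^sup>2)"
    using k by (intro mult_left_mono) auto
  moreover have "2 * Re Z = Re X + Re Y" by (simp add: Z_def)
  ultimately have "(1 - k) * (cmod Z)\<^sup>2 - 2 * Re Z + 1 < 0" using XY by (simp add: algebra_simps)
  then have "(cmod (Z - 1))\<^sup>2 < (cmod \<alpha> * cmod Z)\<^sup>2" using sc[of Z] by (simp add: power_mult_distrib k_def)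
  then have "cmod (Z - 1) < cmod \<alpha> * cmod Z" by (rule power_less_imp_less_base) simp
  \<comment> \<open>Multiplication by \<open>2 u v\<close> clears the denominators of the mean
    \<open>Z\<close>; what remains is a common factor \<open>cmod \<alpha>\<close>, hence the
    separate case of 0.\<close>
  then have "cmod (2 * u * v) * cmod (Z - 1) < cmod (2 * u * v) * (cmod \<alpha> * cmod Z)"
    using nz by (intro mult_strict_left_mono) auto
  moreover have "2 * u * v * (Z - 1) = u + v - 2 * u * v" "2 * u * v * Z = u + v"
    using nz by (auto simp: Z_def X_Y_def field_simps)
  ultimately have "cmod (u + v - 2 * u * v) < cmod \<alpha> * cmod (u + v)"
    by (metis norm_mult mult.left_commute)
  moreover have "u + v - 2 * u * v = - \<alpha> * (2 * \<alpha> * (l * m) - (l + m))" "u + v = 2 - \<alpha> * (l + m)"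
    by (simp_all add: u_v_def algebra_simps)
  ultimately have "cmod \<alpha> * cmod (2 * \<alpha> * (l * m) - (l + m)) < cmod \<alpha> * cmod (2 - \<alpha> * (l + m))"
    by (simp only: norm_mult norm_minus_cancel)
  then show ?thesis using False by simp
qed

text \<open>\<open>psi\<close> is the lower left entry of the strict contraction \<open>(A - cnj \<alpha>) (1 - \<alpha> A)\<^sup>-\<^sup>1\<close>.\<close>

lemma psi_bound:
  assumes "z \<in> pentablock" "cmod \<alpha> \<le> 1"
  shows "cmod (psi \<alpha> z) < 1"
proof (cases "cmod \<alpha> = 1")
  case True
  then show ?thesis by (simp add: psi_def)
next
  case False
  obtain A c where A: "z = pent_of A" "0 \<le> c" "c < 1" "\<And>x. norm (A *v x) \<le> c * norm x"
    using assms(1) unfolding pentablock_iff by blast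
  define k where "k = (cmod \<alpha>)\<^sup>2"
  have k: "k < 1" using assms False by (auto simp: k_def power_less_one_iff abs_square_less_1)
  have ka: "\<alpha> * cnj \<alpha> = of_real k" by (simp add: k_def complex_norm_square[symmetric])
  define D where "D = 1 - \<alpha> * z $ 2 + \<alpha>\<^sup>2 * z $ 3"
  have D: "D \<noteq> 0" using pentablock_denominators(3)[OF assms] by (simp add: D_def)
  \<comment> \<open>The first column of the adjugate of \<open>1 - \<alpha> A\<close>: this matrix
    sends \<open>x\<close> to \<open>(D, 0)\<close>, while the second entry of
    \<open>(A - cnj \<alpha>) x\<close> is the numerator of \<open>psi\<close>.\<close>
  define x :: "complex ^ 2" where "x = vector [1 - \<alpha> * A $ 2 $ 2, \<alpha> * A $ 2 $ 1]"
  define y where "y = A *v x"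
  have y1: "x $ 1 - \<alpha> * y $ 1 = D" 
    by (simp add: y_def x_def matrix2_vector D_def A(1) pent_of_nth power2_eq_square algebra_simps)
  have y2: "x $ 2 - \<alpha> * y $ 2 = 0"
    by (simp add: y_def x_def matrix2_vector D_def A(1) pent_of_nth power2_eq_square algebra_simps)
  have y3: "y $ 2 - cnj \<alpha> * x $ 2 = (1 - of_real k) * z $ 1"
    unfolding y_def x_def A(1) ka[symmetric] by (simp add: matrix2_vector pent_of_nth algebra_simps)
  \<comment> \<open>Summed over both entries, this identity compares
    \<open>(1 - \<alpha> A) x\<close> with \<open>(A - cnj \<alpha>) x\<close> through
    \<open>|x|^2 - |y|^2\<close>, which is positive.\<close>
  have sc: "(cmod (a - \<alpha> * b))\<^sup>2 - (cmod (b - cnj \<alpha> * a))\<^sup>2 = (1 - k) * ((cmod a)\<^sup>2 - (cmod b)\<^sup>2)" for a b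
    unfolding k_def cmod_power2 by (simp add: power2_eq_square algebra_simps)
  have "x \<noteq> 0" using y1 y2 D y_def by (auto simp: matrix2_vector)
  have "norm y < norm x"
  proof -
    have "norm y \<le> c * norm x" using A(4) by (simp add: y_def)
    also have "\<dots> < 1 * norm x" using A(3) \<open>x \<noteq> 0\<close> by (intro mult_strict_right_mono) auto
    finally show ?thesis by simp
  qed
  then have "(norm y)\<^sup>2 < (norm x)\<^sup>2" by (intro power_strict_mono) auto
  then have "0 < (1 - k) * ((norm x)\<^sup>2 - (norm y)\<^sup>2)" using k by simp
  also have "\<dots> = (1 - k) * ((cmod (x $ 1))\<^sup>2 - (cmod (y $ 1))\<^sup>2) + (1 - k) * ((cmod (x $ 2))\<^sup>2 - (cmod (y $ 2))\<^sup>2)"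
    unfolding norm_complex2_sq by (simp add: algebra_simps)
  also have "\<dots> = (cmod D)\<^sup>2 - (cmod (y $ 1 - cnj \<alpha> * x $ 1))\<^sup>2 - (cmod (y $ 2 - cnj \<alpha> * x $ 2))\<^sup>2"
    unfolding sc[symmetric] y1 y2 by simp
  also have "\<dots> \<le> (cmod D)\<^sup>2 - (cmod ((1 - of_real k) * z $ 1))\<^sup>2" unfolding y3 by simp
  finally have "cmod ((1 - of_real k) * z $ 1) < cmod D" by (simp add: power_less_imp_less_base)
  then show ?thesis using D unfolding psi_def D_def[symmetric] k_def[symmetric] norm_divide by simp
qed

lemma test_fun_bound:
  assumes "z \<in> pentablock" "cmod \<alpha> \<le> 1"
  shows "cmod (test_fun t \<alpha> z) < 1"
proof -
  obtain l m where lm: "cmod l < 1" "cmod m < 1" "z $ 2 = l + m" "z $ 3 = l * m"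
    using pentablock_eigenvalues[OF assms(1)] by blast
  have "cmod (Phi \<alpha> (z $ 2) (z $ 3)) < 1"
    using Phi_eigenvalue_bound[OF assms(2) lm(1,2)] pentablock_denominators(2)[OF assms]
    by (simp add: Phi_def norm_divide lm)
  then show ?thesis
    using psi_bound[OF assms] pentablock_denominators(1)[OF assms] by (simp add: test_fun_def norm_divide)
qed

lemma continuous_on_test_fun:
  assumes "z \<in> pentablock"
  shows "continuous_on (cball 0 1) (\<lambda>\<alpha>. test_fun t \<alpha> z)"
proof -
  have "continuous_on (cball 0 1) (\<lambda>\<alpha>. psi \<alpha> z)" 
    unfolding psi_def using pentablock_denominators(3)[OF assms] by (intro continuous_intros) auto
  moreover have "continuous_on (cball 0 1) (\<lambda>\<alpha>. Phi \<alpha> (z $ 2) (z $ 3))" 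
    unfolding Phi_def using pentablock_denominators(2)[OF assms] by (intro continuous_intros) auto
  ultimately show ?thesis unfolding test_fun_def by (cases "t = 0"; cases "t = 1") simp_all
qed

text \<open>The parameter moves to \<open>r \<alpha>\<close>, still in the disc, and a factor
  \<open>r\<close> comes out; this factor later makes contractions strict.\<close>

lemma Phi_dilate:
  assumes "z \<in> pentablock" "cmod \<alpha> \<le> 1" "0 \<le> r" "r \<le> 1"
  shows "Phi \<alpha> (dilate r z $ 2) (dilate r z $ 3) = of_real r * Phi (of_real r * \<alpha>) (z $ 2) (z $ 3)"
  unfolding Phi_def dilate_nth by (simp add: algebra_simps power2_eq_square)

text \<open>The weight of \<open>psi\<close> depends on the modulus of the parameter, so its two
  values leave a quotient, which is at most 1. The assumption \<open>r < 1\<close> keeps its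
  denominator nonzero when \<alpha> lies on the circle.\<close>

lemma psi_dilate:
  assumes "0 \<le> r" "r < 1" "cmod \<alpha> \<le> 1"
  shows "psi \<alpha> (dilate r z) = of_real (r * (1 - (cmod \<alpha>)\<^sup>2) / (1 - (r * cmod \<alpha>)\<^sup>2)) * psi (of_real r * \<alpha>) z"
proof -
  have "r * cmod \<alpha> < 1" using assms by (metis less_le_trans mult_left_le mult_le_one not_less norm_ge_zero linorder_not_le mult.commute mult_less_cancel_left2 order_le_less_trans)
  then have "(r * cmod \<alpha>)\<^sup>2 < 1" using assms by (simp add: abs_square_less_1)
  then have "1 - (complex_of_real (r * cmod \<alpha>))\<^sup>2 \<noteq> 0"
    by (metis less_irrefl of_real_1 of_real_eq_iff of_real_power right_minus_eq)
  moreover have "(cmod (of_real r * \<alpha>))\<^sup>2 = (r * cmod \<alpha>)\<^sup>2" using assms by (simp add: norm_mult)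
  ultimately show ?thesis unfolding psi_def dilate_nth
    by (simp add: power_mult_distrib mult.assoc mult.left_commute)
qed

section \<open>Holomorphic functions of several variables\<close>

lemma holo_onI:
  assumes "\<And>z. z \<in> U \<Longrightarrow> (f has_derivative D z) (at z)"
    "\<And>z c v. z \<in> U \<Longrightarrow> D z (c *s v) = c * D z v"
  shows "holo_on f U"
  unfolding holo_on_def using assms by blast

lemma holo_onE:
  assumes "holo_on f U"
  obtains D where "\<And>z. z \<in> U \<Longrightarrow> (f has_derivative D z) (at z)"
    "\<And>z c v. z \<in> U \<Longrightarrow> D z (c *s v) = c * D z v"
proof -
  have "\<exists>D. \<forall>z. z \<in> U \<longrightarrow> (f has_derivative D z) (at z) \<and> (\<forall>c v. D z (c *s v) = c * D z v)"
    using assms unfolding holo_on_def by (intro choice) blast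
  then show ?thesis using that by blast
qed

lemma holo_on_const: "holo_on (\<lambda>z. c) U"
  by (rule holo_onI[of U _ "\<lambda>z v. 0"]) auto

lemma holo_on_nth: "holo_on (\<lambda>z. z $ i) U"
  by (rule holo_onI[of U _ "\<lambda>z v. v $ i"])
    (auto intro: bounded_linear_imp_has_derivative bounded_linear_vec_nth)

lemma holo_on_add:
  assumes "holo_on f U" "holo_on g U" shows "holo_on (\<lambda>z. f z + g z) U"
proof -
  obtain D E where "\<And>z. z \<in> U \<Longrightarrow> (f has_derivative D z) (at z)"
    "\<And>z c v. z \<in> U \<Longrightarrow> D z (c *s v) = c * D z v" "\<And>z. z \<in> U \<Longrightarrow> (g has_derivative E z) (at z)"
    "\<And>z c v. z \<in> U \<Longrightarrow> E z (c *s v) = c * E z v"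
    using assms by (metis holo_onE)
  then show ?thesis
    by (intro holo_onI[of U _ "\<lambda>z v. D z v + E z v"] has_derivative_add) (auto simp: algebra_simps)
qed

lemma holo_on_mult:
  assumes "holo_on f U" "holo_on g U" shows "holo_on (\<lambda>z. f z * g z) U"
proof -
  obtain D E where "\<And>z. z \<in> U \<Longrightarrow> (f has_derivative D z) (at z)"
    "\<And>z c v. z \<in> U \<Longrightarrow> D z (c *s v) = c * D z v" "\<And>z. z \<in> U \<Longrightarrow> (g has_derivative E z) (at z)"
    "\<And>z c v. z \<in> U \<Longrightarrow> E z (c *s v) = c * E z v"
    using assms by (metis holo_onE)
  then show ?thesis
    by (intro holo_onI[of U _ "\<lambda>z v. f z * E z v + D z v * g z"] has_derivative_mult) (auto simp: algebra_simps)
qed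

lemma holo_on_inverse:
  assumes "holo_on f U" "\<And>z. z \<in> U \<Longrightarrow> f z \<noteq> 0" shows "holo_on (\<lambda>z. inverse (f z)) U"
proof -
  obtain D where "\<And>z. z \<in> U \<Longrightarrow> (f has_derivative D z) (at z)"
    "\<And>z c v. z \<in> U \<Longrightarrow> D z (c *s v) = c * D z v"
    using assms by (metis holo_onE)
  then show ?thesis using assms(2)
    by (intro holo_onI[of U _ "\<lambda>z v. - (inverse (f z) * D z v * inverse (f z))"] Deriv.has_derivative_inverse) (auto simp: algebra_simps)
qed

lemma holo_on_cmult: "holo_on f U \<Longrightarrow> holo_on (\<lambda>z. c * f z) U"
  by (intro holo_on_mult holo_on_const)

lemma holo_on_diff:
  assumes "holo_on f U" "holo_on g U" shows "holo_on (\<lambda>z. f z - g z) U"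
  using holo_on_add[OF assms(1) holo_on_cmult[OF assms(2), of "-1"]] by simp

lemma holo_on_divide:
  assumes "holo_on f U" "holo_on g U" "\<And>z. z \<in> U \<Longrightarrow> g z \<noteq> 0" shows "holo_on (\<lambda>z. f z / g z) U"
  using holo_on_mult[OF assms(1) holo_on_inverse[OF assms(2,3)]] by (simp add: divide_inverse)

lemma holo_on_imp_continuous_on:
  assumes "holo_on f U" shows "continuous_on U f"
proof -
  have "\<forall>z\<in>U. isCont f z"
    using assms unfolding holo_on_def by (metis has_derivative_continuous)
  then show ?thesis by (simp add: continuous_at_imp_continuous_on)
qed

lemma holo_on_test_fun:
  assumes "cmod \<alpha> \<le> 1" shows "holo_on (test_fun t \<alpha>) pentablock"
proof -
  have "holo_on (psi \<alpha>) pentablock" unfolding psi_def[abs_def]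
    using pentablock_denominators(3)[OF _ assms]
    by (intro holo_on_divide holo_on_mult holo_on_const holo_on_nth holo_on_add holo_on_diff)
  moreover have "holo_on (\<lambda>z. Phi \<alpha> (z $ 2) (z $ 3)) pentablock" unfolding Phi_def
    using pentablock_denominators(2)[OF _ assms]
    by (intro holo_on_divide holo_on_mult holo_on_const holo_on_nth holo_on_add holo_on_diff)
  moreover have "holo_on (\<lambda>z. z $ 2 / 2) pentablock"
    by (intro holo_on_divide holo_on_const holo_on_nth) simp
  ultimately show ?thesis unfolding test_fun_def[abs_def] by (cases "t = 0"; cases "t = 1") simp_all
qed

section \<open>Cauchy estimates, uniform limits and Montel's theorem in several variables\<close>

lemma norm_vector_smult: "norm (c *s (v :: complex ^ 'n)) = cmod c * norm v"
proof -
  have "norm (c *s v) = sqrt ((cmod c)\<^sup>2 * (\<Sum>i\<in>UNIV. (cmod (v $ i))\<^sup>2))"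
    by (simp add: norm_vec_def L2_set_def norm_mult power_mult_distrib sum_distrib_left)
  then show ?thesis by (simp add: real_sqrt_mult norm_vec_def L2_set_def)
qed

text \<open>On the complex line through \<open>z\<close> in direction \<open>v\<close> the function
  is holomorphic in one variable on a disc of radius \<open>r / norm v\<close>, and the one variable
  Cauchy inequality bounds its derivative at 0, which is \<open>D v\<close>.\<close>

lemma holo_on_cauchy_estimate:
  fixes f :: "complex ^ 'n \<Rightarrow> complex"
  assumes "holo_on f U" "cball z r \<subseteq> U" "0 < r" "\<And>w. w \<in> cball z r \<Longrightarrow> cmod (f w) \<le> B"
    and D: "(f has_derivative D) (at z)"
  shows "cmod (D v) \<le> B / r * norm v"
proof (cases "v = 0")
  case True
  have "D 0 = 0" using D by (metis has_derivative_bounded_linear bounded_linear.linear linear_0)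
  then show ?thesis using True by simp
next
  case False
  define s where "s = r / norm v"
  have s: "s > 0" "s * norm v = r" using False assms(3) by (auto simp: s_def)
  define g where "g = (\<lambda>t. f (z + t *s v))"
  obtain D' where D': "\<And>z. z \<in> U \<Longrightarrow> (f has_derivative D' z) (at z)"
    "\<And>z c v. z \<in> U \<Longrightarrow> D' z (c *s v) = c * D' z v"
    using assms(1) by (metis holo_onE)
  have inU: "z + t *s v \<in> cball z r" if "t \<in> cball 0 s" for t
  proof -
    have "norm (t *s v) \<le> s * norm v" using that by (simp add: norm_vector_smult mult_right_mono)
    then show ?thesis using s by (simp add: dist_norm)
  qed
  have bl: "bounded_linear (\<lambda>t. t *s v)"
  proof -
    have "linear (\<lambda>t::complex. t *s v)" by (rule linearI) (auto simp: vec_eq_iff algebra_simps)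
    then show ?thesis by (simp add: linear_conv_bounded_linear)
  qed
  have der: "(g has_field_derivative D' (z + t *s v) v) (at t)" if "t \<in> cball 0 s" for t
  proof -
    have "((\<lambda>t. z + t *s v) has_derivative (\<lambda>t. 0 + t *s v)) (at t)"
      by (intro has_derivative_add has_derivative_const bounded_linear_imp_has_derivative bl)
    then have "((\<lambda>t. z + t *s v) has_derivative (\<lambda>t. t *s v)) (at t)" by simp
    moreover have "(f has_derivative D' (z + t *s v)) (at (z + t *s v))"
      using D'(1) inU[OF that] assms(2) by blast
    ultimately have "(g has_derivative (\<lambda>h. D' (z + t *s v) (h *s v))) (at t)"
      unfolding g_def using diff_chain_at[of "\<lambda>t. z + t *s v" "\<lambda>t. t *s v" t f] by (simp add: o_def)
    moreover have "(\<lambda>h. D' (z + t *s v) (h *s v)) = (*) (D' (z + t *s v) v)"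
    proof
      fix h
      have "z + t *s v \<in> U" using inU[OF that] assms(2) by blast
      then show "D' (z + t *s v) (h *s v) = D' (z + t *s v) v * h"
        using D'(2) by (simp add: mult.commute)
    qed
    ultimately show ?thesis by (simp add: has_field_derivative_def)
  qed
  have "g holomorphic_on ball 0 s"
    by (intro holomorphic_onI) (meson der ball_subset_cball field_differentiable_at_within field_differentiable_def subsetD)
  moreover have "continuous_on (cball 0 s) g"
    by (intro continuous_at_imp_continuous_on ballI) (use der DERIV_isCont in blast)
  ultimately have "norm ((deriv ^^ 1) g 0) \<le> fact 1 * B / s ^ 1"
    using s inU assms(4) by (intro Cauchy_inequality) (auto simp: g_def)
  moreover have "deriv g 0 = D' z v" using der[of 0] s DERIV_imp_deriv by fastforce
  ultimately have "cmod (D' z v) \<le> B / r * norm v" by (simp add: s_def)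
  moreover have "D' z = D"
    using D'(1)[of z] D assms(2,3) has_derivative_unique by (metis centre_in_cball less_imp_le subsetD)
  ultimately show ?thesis by simp
qed

text \<open>Cauchy estimates for the differences make the derivatives uniformly Cauchy near each
  point, so the limit is differentiable with the limit derivative; complex linearity is preserved
  pointwise.\<close>

lemma holo_on_uniform_limit:
  fixes F :: "nat \<Rightarrow> complex ^ 'n \<Rightarrow> complex"
  assumes "\<And>m. holo_on (F m) U" "open U"
    and loc: "\<And>z. z \<in> U \<Longrightarrow> \<exists>r>0. cball z r \<subseteq> U \<and> uniform_limit (cball z r) F f sequentially"
  shows "holo_on f U"
  unfolding holo_on_def
proof
  fix z assume "z \<in> U"
  then obtain r where r: "r > 0" "cball z r \<subseteq> U" "uniform_limit (cball z r) F f sequentially"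
    using loc by blast
  have "\<forall>m. \<exists>D. (\<forall>z\<in>U. (F m has_derivative D z) (at z) \<and> (\<forall>c v. D z (c *s v) = c * D z v))"
    using assms(1) by (metis holo_onE)
  then obtain D where D: "\<And>m z. z \<in> U \<Longrightarrow> (F m has_derivative D m z) (at z)"
    "\<And>m z c v. z \<in> U \<Longrightarrow> D m z (c *s v) = c * D m z v" by metis
  \<comment> \<open>Half the radius: balls of radius \<open>r / 2\<close> about points of
    \<open>S\<close> stay where the convergence is uniform.\<close>
  define S where "S = ball z (r / 2)"
  have SU: "cball x (r / 2) \<subseteq> cball z r" if "x \<in> S" for x
  proof
    fix y assume "y \<in> cball x (r / 2)"
    then show "y \<in> cball z r" using that dist_triangle[of z y x] by (auto simp: S_def dist_commute)
  qed
  have SU': "x \<in> U" if "x \<in> S" for x using SU[OF that] r by (meson centre_in_cball half_gt_zero less_imp_le subsetD)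
  have est: "\<exists>N. \<forall>m\<ge>N. \<forall>k\<ge>N. \<forall>x\<in>S. \<forall>h. cmod (D m x h - D k x h) \<le> e * norm h" if "e > 0" for e
  proof -
    have "uniformly_Cauchy_on (cball z r) F"
      using r(3) unfolding uniformly_convergent_Cauchy by (metis uniformly_convergentI uniformly_convergent_Cauchy)
    moreover have "e * (r / 2) > 0" using that r(1) by simp
    ultimately obtain N where "\<forall>x\<in>cball z r. \<forall>m\<ge>N. \<forall>k\<ge>N. dist (F m x) (F k x) < e * (r / 2)"
      unfolding uniformly_Cauchy_on_def by blast
    then have N: "\<And>x m k. x \<in> cball z r \<Longrightarrow> m \<ge> N \<Longrightarrow> k \<ge> N \<Longrightarrow> dist (F m x) (F k x) < e * (r / 2)"
      by blast
    have "cmod (D m x h - D k x h) \<le> e * norm h" if mk: "m \<ge> N" "k \<ge> N" and x: "x \<in> S" for m k x h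
    proof -
      have "((\<lambda>x. F m x - F k x) has_derivative (\<lambda>h. D m x h - D k x h)) (at x)"
        using D(1) SU'[OF x] by (intro has_derivative_diff) auto
      then have "cmod (D m x h - D k x h) \<le> (e * (r / 2)) / (r / 2) * norm h"
        using SU[OF x] r(1,2) N[OF _ mk]
        by (intro holo_on_cauchy_estimate[OF holo_on_diff[OF assms(1) assms(1)]])
          (auto simp: dist_norm subset_iff less_imp_le)
      then show ?thesis using r(1) by simp
    qed
    then show ?thesis by blast
  qed
  have conv: "convergent (\<lambda>m. D m x h)" if "x \<in> S" for x h
  proof (rule Cauchy_convergent, rule metric_CauchyI)
    fix e :: real assume e: "e > 0"
    define e' where "e' = e / (norm h + 1)"
    have n: "norm h + 1 > 0" using norm_ge_zero[of h] by linarith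
    then have e': "e' > 0" "e' * norm h < e" using e by (auto simp: e'_def field_simps)
    then obtain N where N: "\<forall>m\<ge>N. \<forall>k\<ge>N. \<forall>x\<in>S. \<forall>h. cmod (D m x h - D k x h) \<le> e' * norm h"
      using est by blast
    show "\<exists>M. \<forall>m\<ge>M. \<forall>n\<ge>M. dist (D m x h) (D n x h) < e"
    proof (intro exI[of _ N] allI impI)
      fix m n assume "N \<le> m" "N \<le> n"
      then have "cmod (D m x h - D n x h) \<le> e' * norm h" using N \<open>x \<in> S\<close> by blast
      then show "dist (D m x h) (D n x h) < e" using e'(2) by (simp add: dist_norm)
    qed
  qed
  define g' where "g' = (\<lambda>x h. lim (\<lambda>m. D m x h))"
  have g': "(\<lambda>m. D m x h) \<longlonglongrightarrow> g' x h" if "x \<in> S" for x h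
    using conv[OF that] by (simp add: g'_def convergent_LIMSEQ_iff)
  have "\<exists>g. \<forall>x\<in>S. (\<lambda>n. F n x) \<longlonglongrightarrow> g x \<and> (g has_derivative g' x) (at x within S)"
  proof (rule has_derivative_sequence[of S F D g' z "f z"])
    show "convex S" by (simp add: S_def)
    show "z \<in> S" using r by (simp add: S_def)
    show "(\<lambda>n. F n z) \<longlonglongrightarrow> f z" using r(1,3) by (intro tendsto_uniform_limitI) auto
    show "(F n has_derivative D n x) (at x within S)" if "x \<in> S" for n x
      using D(1)[OF SU'[OF that]] by (rule has_derivative_at_withinI)
    show "\<forall>\<^sub>F n in sequentially. \<forall>x\<in>S. \<forall>h. norm (D n x h - g' x h) \<le> e * norm h" if e: "e > 0" for e
    proof -
      obtain N where N: "\<forall>m\<ge>N. \<forall>k\<ge>N. \<forall>x\<in>S. \<forall>h. cmod (D m x h - D k x h) \<le> e * norm h" using est[OF e] by blast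
      have "cmod (D m x h - g' x h) \<le> e * norm h" if m: "m \<ge> N" "x \<in> S" for m x h
      proof (rule tendsto_upperbound[OF _ _ sequentially_bot])
        show "(\<lambda>k. cmod (D m x h - D k x h)) \<longlonglongrightarrow> cmod (D m x h - g' x h)"
          using g'[OF m(2)] by (intro tendsto_intros)
        show "\<forall>\<^sub>F k in sequentially. cmod (D m x h - D k x h) \<le> e * norm h"
          unfolding eventually_sequentially using N m by blast
      qed
      then show ?thesis by (auto simp: eventually_sequentially)
    qed
  qed
  then obtain g where g: "\<And>x. x \<in> S \<Longrightarrow> (\<lambda>n. F n x) \<longlonglongrightarrow> g x" "\<And>x. x \<in> S \<Longrightarrow> (g has_derivative g' x) (at x within S)"
    by blast
  have zS: "z \<in> S" "open S" using r by (auto simp: S_def)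
  have "g x = f x" if "x \<in> S" for x
  proof (rule LIMSEQ_unique[OF g(1)[OF that]])
    show "(\<lambda>n. F n x) \<longlonglongrightarrow> f x"
      by (rule tendsto_uniform_limitI[OF r(3)]) (use that r(1) in \<open>auto simp: S_def\<close>)
  qed
  moreover have "(g has_derivative g' z) (at z)"
    using g(2)[OF zS(1)] unfolding at_within_open[OF zS] .
  ultimately have "(f has_derivative g' z) (at z)"
    using has_derivative_transform_within_open zS by blast
  moreover have "g' z (c *s v) = c * g' z v" for c v
  proof (rule LIMSEQ_unique[OF g'[OF zS(1)]])
    show "(\<lambda>m. D m z (c *s v)) \<longlonglongrightarrow> c * g' z v"
      unfolding D(2)[OF \<open>z \<in> U\<close>] by (intro tendsto_intros g' zS)
  qed
  ultimately show "\<exists>D. (f has_derivative D) (at z) \<and> (\<forall>c v. D (c *s v) = c * D v)" by blast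
qed

lemma uniform_limit_on_compact_local:
  fixes F :: "nat \<Rightarrow> 'a::metric_space \<Rightarrow> 'b::metric_space"
  assumes loc: "\<And>z. z \<in> U \<Longrightarrow> \<exists>r>0. uniform_limit (cball z r) F f sequentially"
    and K: "compact K" "K \<subseteq> U"
  shows "uniform_limit K F f sequentially"
proof -
  obtain r where r: "\<And>z. z \<in> U \<Longrightarrow> r z > 0" "\<And>z. z \<in> U \<Longrightarrow> uniform_limit (cball z (r z)) F f sequentially"
    using loc by metis
  have cov: "K \<subseteq> (\<Union>z\<in>K. ball z (r z))" using r(1) K(2) centre_in_ball by blast
  obtain T where T: "T \<subseteq> K" "finite T" "K \<subseteq> (\<Union>z\<in>T. ball z (r z))"
    by (rule compactE_image[OF K(1), of K "\<lambda>z. ball z (r z)"]) (use cov in auto)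
  have "uniform_limit (\<Union>z\<in>T. cball z (r z)) F f sequentially"
  proof (rule uniform_limit_on_UNION[OF T(2)])
    fix z assume "z \<in> T"
    then have "z \<in> U" using T(1) K(2) by blast
    then show "uniform_limit (cball z (r z)) F f sequentially" by (rule r(2))
  qed
  moreover have "(\<Union>z\<in>T. ball z (r z)) \<subseteq> (\<Union>z\<in>T. cball z (r z))" by (intro UN_mono) auto
  then have "K \<subseteq> (\<Union>z\<in>T. cball z (r z))" using T(3) by blast
  ultimately show ?thesis by (rule uniform_limit_on_subset)
qed

text \<open>Balls of radius \<open>r\<close> about points of \<open>cball z r\<close> stay inside
  \<open>U\<close>, so the Cauchy estimate bounds the derivative by \<open>B / r\<close> there. The
  constant depends only on \<open>B\<close> and \<open>r\<close>: this is the equicontinuity in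
  Montel's theorem.\<close>

lemma holo_on_lipschitz:
  fixes f :: "complex ^ 'n \<Rightarrow> complex"
  assumes "holo_on f U" "cball z (2 * r) \<subseteq> U" "0 < r" "\<And>w. w \<in> U \<Longrightarrow> cmod (f w) \<le> B"
    "x \<in> cball z r" "y \<in> cball z r"
  shows "cmod (f x - f y) \<le> B / r * norm (x - y)"
proof -
  obtain D where D: "\<And>z. z \<in> U \<Longrightarrow> (f has_derivative D z) (at z)"
    using assms(1) by (metis holo_onE)
  have sub: "cball w r \<subseteq> U" if "w \<in> cball z r" for w
  proof
    fix u assume "u \<in> cball w r"
    then have "u \<in> cball z (2 * r)" using that dist_triangle[of z u w] by (auto simp: dist_commute)
    then show "u \<in> U" using assms(2) by blast
  qed
  have inU: "w \<in> U" if "w \<in> cball z r" for w using sub[OF that] assms(3) by (meson centre_in_cball less_imp_le subsetD)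
  show ?thesis
  proof (rule differentiable_bound[of "cball z r" f D])
    show "(f has_derivative D w) (at w within cball z r)" if "w \<in> cball z r" for w
      using D[OF inU[OF that]] by (rule has_derivative_at_withinI)
    show "onorm (D w) \<le> B / r" if "w \<in> cball z r" for w
      by (rule onorm_le) (use holo_on_cauchy_estimate[OF assms(1) sub[OF that] assms(3) _ D[OF inU[OF that]]] sub[OF that] assms(4) in blast)
  qed (use assms in auto)
qed

text \<open>A diagonal subsequence converges on a countable dense set, for all of the countably many
  components \<open>j\<close> at once; the common Lipschitz constant upgrades this to locally
  uniform convergence.\<close>

lemma montel_holo_on:
  fixes F :: "nat \<Rightarrow> 'j::countable \<Rightarrow> complex ^ 'n \<Rightarrow> complex"
  assumes hol: "\<And>m j. holo_on (F m j) U" and U: "open U"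
    and B: "\<And>m j z. z \<in> U \<Longrightarrow> cmod (F m j z) \<le> B"
  obtains k f where "strict_mono (k :: nat \<Rightarrow> nat)" "\<And>j. holo_on (f j) U"
    "\<And>j K. compact K \<Longrightarrow> K \<subseteq> U \<Longrightarrow> uniform_limit K (\<lambda>m. F (k m) j) (f j) sequentially"
proof -
  obtain Q where Q: "countable Q" "Q \<subseteq> U" "U \<subseteq> closure Q" by (rule separable)
  obtain k where k: "strict_mono (k :: nat \<Rightarrow> nat)"
    "\<And>x. x \<in> UNIV \<times> Q \<Longrightarrow> \<exists>l. (\<lambda>n. (\<lambda>m x. F m (fst x) (snd x)) (k n) x) \<longlonglongrightarrow> l"
    by (rule function_convergent_subsequence[of "(UNIV :: 'j set) \<times> Q" "\<lambda>m x. F m (fst x) (snd x)" B])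
      (use Q B in auto)
  have cau: "Cauchy (\<lambda>n. F (k n) j q)" if "q \<in> Q" for j q
    using k(2)[of "(j, q)"] that LIMSEQ_imp_Cauchy by auto
  have loc: "\<exists>r>0. cball z r \<subseteq> U \<and> uniformly_Cauchy_on (cball z r) (\<lambda>m. F (k m) j)" if z: "z \<in> U" for z j
  proof -
    obtain R where R: "R > 0" "cball z R \<subseteq> U" using U z open_contains_cball by blast
    define r where "r = R / 2"
    have r: "r > 0" "cball z (2 * r) \<subseteq> U" using R by (auto simp: r_def)
    have rU: "cball z r \<subseteq> U" using r by (meson dual_order.trans less_imp_le mult_le_cancel_right1 one_le_numeral subset_cball not_less order_less_imp_le)
    have B0: "B \<ge> 0" using B[OF z] norm_ge_zero order_trans by blast
    define L where "L = B / r"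
    have L: "L \<ge> 0" using B0 r by (simp add: L_def)
    have lip: "cmod (F m j x - F m j y) \<le> L * norm (x - y)" if "x \<in> cball z r" "y \<in> cball z r" for m x y
      unfolding L_def by (rule holo_on_lipschitz[OF hol r(2,1) B that])
    have "uniformly_Cauchy_on (cball z (r / 2)) (\<lambda>m. F (k m) j)"
      unfolding uniformly_Cauchy_on_def
    proof (intro allI impI)
      fix e :: real assume e: "e > 0"
      \<comment> \<open>Moving by \<open>d\<close> costs less than \<open>e / 3\<close>, leaving a
        third for the points of the net; \<open>d \<le> r / 2\<close> keeps the relevant centres
        inside \<open>cball z r\<close>.\<close>
      define d where "d = min (r / 2) (e / (3 * (L + 1)))"
      have d: "d > 0" "d \<le> r / 2" "L * d < e / 3"
      proof -
        show "d > 0" using r e L by (auto simp: d_def)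
        show "d \<le> r / 2" unfolding d_def by (rule min.cobounded1)
        have "L * d \<le> L * (e / (3 * (L + 1)))" using L by (intro mult_left_mono) (auto simp: d_def)
        also have "\<dots> < (L + 1) * (e / (3 * (L + 1)))" using L e by (intro mult_strict_right_mono) auto
        also have "\<dots> = e / 3" using L by (simp add: field_simps)
        finally show "L * d < e / 3" .
      qed
      have cov: "cball z (r / 2) \<subseteq> (\<Union>q\<in>Q. ball q d)"
      proof
        fix x assume "x \<in> cball z (r / 2)"
        then have "x \<in> closure Q" using rU Q(3) r by (auto simp: subset_iff)
        then show "x \<in> (\<Union>q\<in>Q. ball q d)" using d(1) by (auto simp: closure_approachable)
      qed
      obtain T where T: "T \<subseteq> Q" "finite T" "cball z (r / 2) \<subseteq> (\<Union>q\<in>T. ball q d)"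
        by (rule compactE_image[OF compact_cball, of Q "\<lambda>q. ball q d" z "r / 2"]) (use cov in auto)
      have "\<forall>q\<in>T. \<exists>M. \<forall>m\<ge>M. \<forall>n\<ge>M. dist (F (k m) j q) (F (k n) j q) < e / 3"
        using cau T(1) e unfolding Cauchy_def by (meson divide_pos_pos subsetD zero_less_numeral)
      then obtain M where M: "\<And>q m n. q \<in> T \<Longrightarrow> m \<ge> M q \<Longrightarrow> n \<ge> M q \<Longrightarrow> dist (F (k m) j q) (F (k n) j q) < e / 3"
        by metis
      show "\<exists>M. \<forall>x\<in>cball z (r / 2). \<forall>m\<ge>M. \<forall>n\<ge>M. dist (F (k m) j x) (F (k n) j x) < e"
      proof (intro exI[of _ "Max (insert 0 (M ` T))"] ballI allI impI)
        fix x m n assume x: "x \<in> cball z (r / 2)" and mn: "m \<ge> Max (insert 0 (M ` T))" "n \<ge> Max (insert 0 (M ` T))"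
        obtain q where q: "q \<in> T" "dist q x < d" using T(3) x by auto
        have xr: "x \<in> cball z r" using x r by auto
        have qr: "q \<in> cball z r" using x q(2) d(2) dist_triangle[of z q x] by (auto simp: dist_commute)
        have "m \<ge> M q" "n \<ge> M q" using mn q(1) T(2) by auto
        then have 1: "cmod (F (k m) j q - F (k n) j q) < e / 3" using M[OF q(1)] by (simp add: dist_norm)
        have "L * norm (x - q) \<le> L * d" using q(2) L by (intro mult_left_mono) (auto simp: dist_norm norm_minus_commute)
        then have 2: "cmod (F (k m') j x - F (k m') j q) < e / 3" for m' using lip[OF xr qr, of "k m'"] d(3) by simp
        have "F (k m) j x - F (k n) j x = (F (k m) j x - F (k m) j q) + (F (k m) j q - F (k n) j q) - (F (k n) j x - F (k n) j q)" by simp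
        then have "cmod (F (k m) j x - F (k n) j x) \<le> cmod (F (k m) j x - F (k m) j q) + cmod (F (k m) j q - F (k n) j q) + cmod (F (k n) j x - F (k n) j q)"
          by (metis norm_triangle_ineq norm_triangle_ineq4 add_right_mono order_trans)
        then show "dist (F (k m) j x) (F (k n) j x) < e" using 1 2[of m] 2[of n] by (simp add: dist_norm)
      qed
    qed
    moreover have "cball z (r / 2) \<subseteq> U" using rU r by (auto simp: subset_iff)
    ultimately show ?thesis using r(1) by (intro exI[of _ "r / 2"]) auto
  qed
  define f where "f = (\<lambda>j z. lim (\<lambda>m. F (k m) j z))"
  have loc': "\<exists>r>0. cball z r \<subseteq> U \<and> uniform_limit (cball z r) (\<lambda>m. F (k m) j) (f j) sequentially" if z: "z \<in> U" for z j
    using loc[OF z, of j] Cauchy_uniformly_convergent unfolding uniformly_convergent_uniform_limit_iff f_def by blast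
  show ?thesis
  proof (rule that[OF k(1)])
    show "holo_on (f j) U" for j by (rule holo_on_uniform_limit[OF hol U loc'])
    show "uniform_limit K (\<lambda>m. F (k m) j) (f j) sequentially" if "compact K" "K \<subseteq> U" for j K
      by (rule uniform_limit_on_compact_local[OF _ that]) (use loc' in blast)
  qed
qed

section \<open>Duality between admissible kernels and sums of squares\<close>

text \<open>The form indexed by points instead of numbers. Compared with \<open>qform\<close> the
  coefficients are conjugated: \<open>x\<close> stands for \<open>cnj c\<close>.\<close>

definition kform :: "'a set \<Rightarrow> ('a \<Rightarrow> 'a \<Rightarrow> complex) \<Rightarrow> ('a \<Rightarrow> complex) \<Rightarrow> complex" where
  "kform F Q x = (\<Sum>p\<in>F. \<Sum>q\<in>F. Q p q * x p * cnj (x q))"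

lemma kform_cong:
  assumes "\<And>p q. p \<in> F \<Longrightarrow> q \<in> F \<Longrightarrow> Q p q = Q' p q" "\<And>p. p \<in> F \<Longrightarrow> x p = x' p"
  shows "kform F Q x = kform F Q' x'"
  unfolding kform_def using assms by (intro sum.cong refl) auto

text \<open>Points that occur repeatedly in the list are merged by adding their coefficients, so
  positivity only has to be tested on sets.\<close>

lemma kform_reindex:
  assumes "finite F" "\<And>i. i < (N::nat) \<Longrightarrow> z i \<in> F"
  shows "(\<Sum>i<N. \<Sum>j<N. Q (z i) (z j) * c j * cnj (c i)) = kform F Q (\<lambda>p. \<Sum>i | i < N \<and> z i = p. cnj (c i))"
proof -
  have 1: "(\<Sum>i<N. g i (z i)) = (\<Sum>p\<in>F. \<Sum>i | i < N \<and> z i = p. g i p)" for g :: "nat \<Rightarrow> 'a \<Rightarrow> complex"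
  proof -
    have "(\<Sum>i<N. g i (z i)) = (\<Sum>p\<in>F. \<Sum>i\<in>{i \<in> {..<N}. z i = p}. g i (z i))"
      by (rule sum.group[symmetric]) (use assms in auto)
    also have "\<dots> = (\<Sum>p\<in>F. \<Sum>i | i < N \<and> z i = p. g i p)"
      by (intro sum.cong) auto
    finally show ?thesis .
  qed
  have "(\<Sum>i<N. \<Sum>j<N. Q (z i) (z j) * c j * cnj (c i)) = 
    (\<Sum>p\<in>F. \<Sum>i | i < N \<and> z i = p. \<Sum>j<N. Q p (z j) * c j * cnj (c i))" by (rule 1)
  also have "\<dots> = (\<Sum>p\<in>F. \<Sum>i | i < N \<and> z i = p. \<Sum>q\<in>F. \<Sum>j | j < N \<and> z j = q. Q p q * c j * cnj (c i))"
    by (intro sum.cong refl 1)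
  also have "\<dots> = (\<Sum>p\<in>F. \<Sum>q\<in>F. \<Sum>i | i < N \<and> z i = p. \<Sum>j | j < N \<and> z j = q. Q p q * c j * cnj (c i))"
    by (intro sum.cong refl sum.swap)
  also have "\<dots> = kform F Q (\<lambda>p. \<Sum>i | i < N \<and> z i = p. cnj (c i))"
  proof -
    have "(\<Sum>i\<in>A. \<Sum>j\<in>B. a * c j * cnj (c i)) = a * (\<Sum>i\<in>A. cnj (c i)) * cnj (\<Sum>j\<in>B. cnj (c j))" for a A B
    proof -
      have "(\<Sum>i\<in>A. \<Sum>j\<in>B. a * c j * cnj (c i)) = a * (\<Sum>i\<in>A. \<Sum>j\<in>B. cnj (c i) * c j)"
        unfolding sum_distrib_left by (intro sum.cong refl) (simp add: mult_ac)
      then show ?thesis unfolding sum_product[symmetric] by (simp add: cnj_sum mult.assoc)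
    qed
    then show ?thesis unfolding kform_def by (intro sum.cong refl)
  qed
  finally show ?thesis .
qed

lemma enumerate_finite:
  assumes "finite F"
  obtains N and z :: "nat \<Rightarrow> 'a" where "bij_betw z {..<N} F"
  using ex_bij_betw_nat_finite[OF assms] by (metis atLeast0LessThan)

lemma kform_enumerate:
  assumes "bij_betw z {..<N} F"
  shows "kform F Q x = (\<Sum>i<N. \<Sum>j<N. Q (z i) (z j) * x (z i) * cnj (x (z j)))"
  unfolding kform_def by (subst sum.reindex_bij_betw[OF assms, symmetric],
    rule sum.cong[OF refl], subst sum.reindex_bij_betw[OF assms, symmetric], rule refl)

lemma weak_kernel_iff_kform:
  "weak_kernel k \<longleftrightarrow> (\<forall>F x. finite F \<and> F \<subseteq> pentablock \<longrightarrow> kform F k x \<in> \<real>\<^sub>\<ge>\<^sub>0)"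
proof (intro iffI allI impI)
  fix F x assume k: "weak_kernel k" and F: "finite F \<and> F \<subseteq> pentablock"
  obtain N and z :: "nat \<Rightarrow> complex ^ 3" where z: "bij_betw z {..<N} F"
    using enumerate_finite[of F] F by (metis (no_types))
  have "\<forall>i<N. z i \<in> pentablock" using z F by (auto simp: bij_betw_def)
  then have "(\<Sum>i<N. \<Sum>j<N. k (z i) (z j) * cnj (x (z j)) * cnj (cnj (x (z i)))) \<in> \<real>\<^sub>\<ge>\<^sub>0"
    using k[unfolded weak_kernel_def, rule_format, of N z "\<lambda>i. cnj (x (z i))"] by blast
  then show "kform F k x \<in> \<real>\<^sub>\<ge>\<^sub>0" unfolding kform_enumerate[OF z] by (simp add: mult_ac)
next
  assume k: "\<forall>F x. finite F \<and> F \<subseteq> pentablock \<longrightarrow> kform F k x \<in> \<real>\<^sub>\<ge>\<^sub>0"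
  show "weak_kernel k" unfolding weak_kernel_def
  proof (intro allI impI)
    fix N :: nat and z c assume z: "\<forall>i<N. z i \<in> pentablock"
    have "finite (z ` {..<N})" "z ` {..<N} \<subseteq> pentablock" using z by auto
    then show "(\<Sum>i<N. \<Sum>j<N. k (z i) (z j) * c j * cnj (c i)) \<in> \<real>\<^sub>\<ge>\<^sub>0"
      using kform_reindex[of "z ` {..<N}" N z k c] k by auto
  qed
qed

lemma kform_add: "kform F (\<lambda>p q. Q p q + R p q) x = kform F Q x + kform F R x"
  by (simp add: kform_def algebra_simps sum.distrib)

lemma kform_diagonal:
  assumes "finite F"
  shows "kform F (\<lambda>p q. of_bool (p = q) * d p) x = (\<Sum>p\<in>F. d p * of_real ((cmod (x p))\<^sup>2))"
proof -
  have "(\<Sum>q\<in>F. of_bool (p = q) * d p * x p * cnj (x q)) = d p * of_real ((cmod (x p))\<^sup>2)" if "p \<in> F" for p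
  proof -
    have "(\<Sum>q\<in>F. of_bool (p = q) * d p * x p * cnj (x q)) = (\<Sum>q\<in>F. if p = q then d p * x p * cnj (x p) else 0)"
      by (intro sum.cong) auto
    then show ?thesis using that assms by (simp add: complex_norm_square mult.assoc del: of_real_power)
  qed
  then show ?thesis unfolding kform_def by (intro sum.cong) auto
qed

lemma weak_kernel_add: "weak_kernel k \<Longrightarrow> weak_kernel l \<Longrightarrow> weak_kernel (\<lambda>z w. k z w + l z w)"
  unfolding weak_kernel_iff_kform kform_add by (metis nonneg_Reals_add_I)

lemma weak_kernel_diagonal:
  assumes "\<And>z. z \<in> pentablock \<Longrightarrow> 0 \<le> d z"
  shows "weak_kernel (\<lambda>z w. of_bool (z = w) * of_real (d z))"
  unfolding weak_kernel_iff_kform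
proof (intro allI impI)
  fix F x assume "finite F \<and> F \<subseteq> pentablock"
  then show "kform F (\<lambda>z w. of_bool (z = w) * of_real (d z)) x \<in> \<real>\<^sub>\<ge>\<^sub>0"
    using assms by (simp only: kform_diagonal of_real_mult[symmetric] of_real_sum[symmetric] nonneg_Reals_of_real_iff)
      (intro sum_nonneg mult_nonneg_nonneg; auto)
qed

lemma weak_kernel_supported:
  assumes "finite F" "\<And>x. kform F Q x \<in> \<real>\<^sub>\<ge>\<^sub>0"
  shows "weak_kernel (\<lambda>z w. if z \<in> F \<and> w \<in> F then Q z w else 0)"
  unfolding weak_kernel_iff_kform
proof (intro allI impI)
  fix G x assume G: "finite G \<and> G \<subseteq> pentablock"
  have 1: "(\<Sum>p\<in>G. if p \<in> F then g p else 0) = (\<Sum>p\<in>F. if p \<in> G then g p else 0)" for g :: "complex ^ 3 \<Rightarrow> complex"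
    using G assms(1) by (simp add: sum.inter_restrict[symmetric] Int_commute)
  have "kform G (\<lambda>z w. if z \<in> F \<and> w \<in> F then Q z w else 0) x =
    (\<Sum>p\<in>G. if p \<in> F then (\<Sum>q\<in>G. if q \<in> F then Q p q * x p * cnj (x q) else 0) else 0)"
    unfolding kform_def by (intro sum.cong) (auto intro!: sum.cong)
  also have "\<dots> = kform F Q (\<lambda>p. if p \<in> G then x p else 0)"
    unfolding kform_def 1 by (intro sum.cong) (auto intro!: sum.cong)
  finally show "kform G (\<lambda>z w. if z \<in> F \<and> w \<in> F then Q z w else 0) x \<in> \<real>\<^sub>\<ge>\<^sub>0" using assms(2) by simp
qed

lemma kform_decomposition:
  fixes F :: "'a set"
  assumes "finite F" "\<And>x. kform F Q x \<in> \<real>\<^sub>\<ge>\<^sub>0"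
  obtains S :: nat and g where "\<forall>z\<in>F. \<forall>w\<in>F. Q z w = (\<Sum>s<S. g s z * cnj (g s w))"
proof -
  obtain N and z :: "nat \<Rightarrow> 'a" where z: "bij_betw z {..<N} F"
    by (rule enumerate_finite[OF assms(1)])
  define y where "y = inv_into {..<N} z"
  have y: "z (y p) = p" "y p < N" if "p \<in> F" for p
    using bij_betw_inv_into_right[OF z that] bij_betw_apply[OF bij_betw_inv_into[OF z] that]
    by (simp_all add: y_def)
  have "psd N (\<lambda>i j. Q (z i) (z j))" unfolding psd_def
  proof
    fix c
    have "qform N (\<lambda>i j. Q (z i) (z j)) c c = (\<Sum>i<N. \<Sum>j<N. Q (z i) (z j) * c j * cnj (c i))"
      by (simp add: qform_def)
    also have "\<dots> = kform F Q (\<lambda>p. \<Sum>i | i < N \<and> z i = p. cnj (c i))"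
      by (rule kform_reindex) (use assms z in \<open>auto dest: bij_betwE\<close>)
    finally show "qform N (\<lambda>i j. Q (z i) (z j)) c c \<in> \<real>\<^sub>\<ge>\<^sub>0" using assms(2) by simp
  qed
  then obtain S :: nat and p where p: "\<forall>i<N. \<forall>j<N. Q (z i) (z j) = (\<Sum>s<S. p s i * cnj (p s j))"
    by (rule psd_decomposition)
  show ?thesis
  proof (rule that, intro ballI)
    fix q w assume "q \<in> F" "w \<in> F"
    then show "Q q w = (\<Sum>s<S. p s (y q) * cnj (p s (y w)))"
      using p[rule_format, of "y q" "y w"] y by simp
  qed
qed

text \<open>\<open>Q\<close> is recovered by multiplication with the geometric series of \<open>a p * cnj (a q)\<close>.\<close>

lemma kform_geometric:
  assumes "finite F" "\<And>p. p \<in> F \<Longrightarrow> cmod (a p) < 1"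
    and pos: "\<And>x. kform F (\<lambda>p q. (1 - a p * cnj (a q)) * Q p q) x \<in> \<real>\<^sub>\<ge>\<^sub>0"
  shows "kform F Q x \<in> \<real>\<^sub>\<ge>\<^sub>0"
proof -
  have tel: "kform F (\<lambda>p q. (1 - (a p * cnj (a q)) ^ L) * Q p q) x \<in> \<real>\<^sub>\<ge>\<^sub>0" for L
  proof (induction L)
    case 0
    show ?case by (simp add: kform_def)
  next
    case (Suc L)
    \<comment> \<open>Telescoping with \<open>1 - s^(L+1) = (1 - s^L) + s^L (1 - s)\<close>; the
      factor \<open>s^L\<close> is moved into the coefficients.\<close>
    have "kform F (\<lambda>p q. (1 - (a p * cnj (a q)) ^ Suc L) * Q p q) x =
      kform F (\<lambda>p q. (1 - (a p * cnj (a q)) ^ L) * Q p q) x + 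
      kform F (\<lambda>p q. (1 - a p * cnj (a q)) * Q p q) (\<lambda>p. (a p) ^ L * x p)"
      unfolding kform_def sum.distrib[symmetric]
      by (intro sum.cong refl) (simp add: algebra_simps power_mult_distrib)
    then show ?case using Suc pos by (simp add: nonneg_Reals_add_I)
  qed
  have "(\<lambda>L. kform F (\<lambda>p q. (1 - (a p * cnj (a q)) ^ L) * Q p q) x) \<longlonglongrightarrow> kform F (\<lambda>p q. (1 - 0) * Q p q) x"
    unfolding kform_def
  proof (intro tendsto_intros LIMSEQ_power_zero)
    fix p q assume "p \<in> F" "q \<in> F"
    then have "cmod (a p) * cmod (a q) < 1 * 1"
      using assms(2) by (intro mult_strict_mono') auto
    then show "norm (a p * cnj (a q)) < 1" by (simp add: norm_mult)
  qed
  then show ?thesis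
    using closed_sequentially[OF closed_nonneg_Reals_complex, OF tel] by simp
qed

section \<open>Separation from a convex cone\<close>

text \<open>The projection argument: along a minimizing sequence the errors \<open>M - c k\<close>
  converge to some \<open>E'\<close>, even if the points of a nonclosed cone do not approach a point
  of it. This \<open>E'\<close> is a functional that is nonpositive on the cone and equals
  \<open>|E'|^2\<close> or more at \<open>M\<close>, so \<open>sep\<close> forces the distance to be
  0.\<close>

lemma cone_separation:
  fixes M :: "'a \<Rightarrow> complex" and C :: "('a \<Rightarrow> complex) set"
  assumes I: "finite I" and zero: "(\<lambda>i. 0) \<in> C"
    and add: "\<And>c d. c \<in> C \<Longrightarrow> d \<in> C \<Longrightarrow> (\<lambda>i. c i + d i) \<in> C"
    and scale: "\<And>c t. c \<in> C \<Longrightarrow> 0 \<le> t \<Longrightarrow> (\<lambda>i. of_real t * c i) \<in> C"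
    and sep: "\<And>E. (\<And>c. c \<in> C \<Longrightarrow> Re (\<Sum>i\<in>I. c i * cnj (E i)) \<le> 0) \<Longrightarrow> Re (\<Sum>i\<in>I. M i * cnj (E i)) \<le> 0"
    and \<eta>: "\<eta> > 0"
  shows "\<exists>c\<in>C. \<forall>i\<in>I. cmod (M i - c i) < \<eta>"
proof -
  define nn where "nn = (\<lambda>x::'a\<Rightarrow>complex. \<Sum>i\<in>I. (cmod (x i))\<^sup>2)"
  define ip where "ip = (\<lambda>x y::'a\<Rightarrow>complex. Re (\<Sum>i\<in>I. x i * cnj (y i)))"
  have nn0: "nn x \<ge> 0" for x unfolding nn_def by (intro sum_nonneg) auto
  have coord: "(cmod (x i))\<^sup>2 \<le> nn x" if "i \<in> I" for x i
    unfolding nn_def using that I by (intro member_le_sum) auto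
  have expand: "nn (\<lambda>i. x i + of_real t * y i) = nn x + 2 * t * ip y x + t\<^sup>2 * nn y" for x y t
    unfolding nn_def ip_def Re_sum sum_distrib_left sum.distrib[symmetric] cmod_power2
    by (intro sum.cong refl) (simp add: power2_eq_square algebra_simps)
  define d where "d = (INF c\<in>C. nn (\<lambda>i. M i - c i))"
  have bdd: "bdd_below ((\<lambda>c. nn (\<lambda>i. M i - c i)) ` C)" by (rule bdd_belowI[of _ 0]) (use nn0 in auto)
  have dle: "d \<le> nn (\<lambda>i. M i - c i)" if "c \<in> C" for c
    unfolding d_def using that bdd by (intro cINF_lower)
  have d0: "d \<ge> 0" unfolding d_def by (rule cINF_greatest) (use zero nn0 in auto)
  have near: "\<exists>c\<in>C. nn (\<lambda>i. M i - c i) < d + e" if "e > 0" for e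
  proof (rule ccontr)
    assume "\<not> ?thesis"
    then have "d + e \<le> (INF c\<in>C. nn (\<lambda>i. M i - c i))"
      by (intro cINF_greatest) (use zero in auto)
    then have "d + e \<le> d" by (simp only: d_def)
    then show False using that by simp
  qed
  have "d = 0"
  proof (rule ccontr)
    assume "d \<noteq> 0"
    then have dpos: "d > 0" using d0 by simp
    have "\<forall>k::nat. \<exists>c\<in>C. nn (\<lambda>i. M i - c i) < d + 1 / (real k + 1)" using near by simp
    then obtain c where c: "\<And>k::nat. c k \<in> C" "\<And>k. nn (\<lambda>i. M i - c k i) < d + 1 / (real k + 1)" by metis
    define E where "E = (\<lambda>k i. M i - c k i)"
    have par: "nn (\<lambda>i. E k i - E l i) \<le> 2 / (real k + 1) + 2 / (real l + 1)" for k l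
    proof -
      \<comment> \<open>Parallelogram law; the midpoint of \<open>c k\<close> and \<open>c l\<close>
        is again in the cone, so its squared distance from \<open>M\<close> is at least
        \<open>d\<close>.\<close>
      have "nn (\<lambda>i. E k i - E l i) = 2 * nn (E k) + 2 * nn (E l) - 4 * nn (\<lambda>i. M i - of_real (1/2) * (c k i + c l i))"
        unfolding nn_def E_def sum_distrib_left sum.distrib[symmetric] sum_subtractf[symmetric] cmod_power2
        by (intro sum.cong refl) (simp add: power2_eq_square field_simps)
      moreover have "d \<le> nn (\<lambda>i. M i - of_real (1/2) * (c k i + c l i))"
        by (rule dle[of "\<lambda>i. of_real (1/2) * (c k i + c l i)"]) (intro scale add c(1); simp)
      ultimately show ?thesis using c(2)[of k] c(2)[of l] by (simp add: E_def)
    qed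
    have cau: "Cauchy (\<lambda>k. E k i)" if "i \<in> I" for i
    proof (rule metric_CauchyI)
      fix e :: real assume e: "e > 0"
      obtain n :: nat where n: "4 / e\<^sup>2 < real n" using reals_Archimedean2 by blast
      show "\<exists>M. \<forall>m\<ge>M. \<forall>n\<ge>M. dist (E m i) (E n i) < e"
      proof (intro exI[of _ n] allI impI)
        fix k l assume kl: "n \<le> k" "n \<le> l"
        have n0: "real n > 0" using n e by (meson less_trans divide_pos_pos zero_less_numeral zero_less_power)
        have "(cmod (E k i - E l i))\<^sup>2 \<le> 2 / (real k + 1) + 2 / (real l + 1)"
          using coord[OF that, of "\<lambda>i. E k i - E l i"] par[of k l] by simp
        also have "\<dots> \<le> 2 / real n + 2 / real n"
          using kl n0 by (intro add_mono divide_left_mono) auto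
        also have "\<dots> < e\<^sup>2" using n n0 e by (simp add: field_simps)
        finally show "dist (E k i) (E l i) < e" using e by (simp add: dist_norm power_less_imp_less_base)
      qed
    qed
    define E' where "E' = (\<lambda>i. lim (\<lambda>k. E k i))"
    have lim: "(\<lambda>k. E k i) \<longlonglongrightarrow> E' i" if "i \<in> I" for i
      unfolding E'_def using cau[OF that] Cauchy_convergent convergent_LIMSEQ_iff by blast
    \<comment> \<open>Minimality passes to the limit: \<open>E'\<close> minus a limit of admissible
      changes of \<open>c k\<close> is never shorter than \<open>E'\<close> itself.\<close>
    have cl: "d \<le> nn (\<lambda>i. E' i - f i)"
      if "\<And>k. (\<lambda>i. c k i + g k i) \<in> C" "\<And>i. i \<in> I \<Longrightarrow> (\<lambda>k. g k i) \<longlonglongrightarrow> f i" for f g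
    proof (rule tendsto_lowerbound[OF _ _ sequentially_bot])
      show "(\<lambda>k. nn (\<lambda>i. E k i - g k i)) \<longlonglongrightarrow> nn (\<lambda>i. E' i - f i)"
        unfolding nn_def by (intro tendsto_intros lim that)
      have "d \<le> nn (\<lambda>i. E k i - g k i)" for k
        using dle[OF that(1)[of k]] by (simp add: E_def diff_diff_eq)
      then show "\<forall>\<^sub>F k in sequentially. d \<le> nn (\<lambda>i. E k i - g k i)" by simp
    qed
    have nnE: "nn E' = d"
    proof (rule antisym)
      show "d \<le> nn E'" using cl[of "\<lambda>k i. 0" "\<lambda>i. 0"] c(1) by simp
      show "nn E' \<le> d"
      proof (rule LIMSEQ_le[of "\<lambda>k. nn (E k)" _ "\<lambda>k. d + 1 / (real k + 1)"])
        show "(\<lambda>k. nn (E k)) \<longlonglongrightarrow> nn E'" unfolding nn_def by (intro tendsto_intros lim)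
        have "(\<lambda>k. 1 / (real k + 1)) \<longlonglongrightarrow> 0" using LIMSEQ_inverse_real_of_nat by (simp add: inverse_eq_divide add.commute)
        then show "(\<lambda>k. d + 1 / (real k + 1)) \<longlonglongrightarrow> d" using tendsto_add[OF tendsto_const[of d]] by fastforce
        show "\<exists>N. \<forall>n\<ge>N. nn (E n) \<le> d + 1 / (real n + 1)" using c(2) by (auto simp: E_def less_imp_le)
      qed
    qed
    \<comment> \<open>The first variation at a minimum. The constant \<open>t\<close> balances the
      linear term against the quadratic one, with 1 added to avoid division by 0.\<close>
    have first_order: "0 \<le> ip y E'" if y: "\<And>t. 0 < t \<Longrightarrow> t \<le> 1 \<Longrightarrow> d \<le> nn (\<lambda>i. E' i + of_real t * y i)" for y
    proof (rule ccontr)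
      assume neg: "\<not> 0 \<le> ip y E'"
      define t where "t = min 1 (- ip y E' / (nn y + 1))"
      have t: "0 < t" "t \<le> 1" "t \<le> - ip y E' / (nn y + 1)" using neg nn0[of y] by (auto simp: t_def divide_neg_pos)
      then have "t * (nn y + 1) \<le> - ip y E'" using nn0[of y] by (simp add: field_simps)
      then have "t * nn y < - 2 * ip y E'" using t neg by (simp add: algebra_simps)
      moreover have "0 \<le> 2 * t * ip y E' + t\<^sup>2 * nn y" using y[OF t(1,2)] unfolding expand nnE by simp
      then have "0 \<le> t * (2 * ip y E' + t * nn y)" by (simp add: algebra_simps power2_eq_square)
      then have "0 \<le> 2 * ip y E' + t * nn y" using t(1) by (simp add: zero_le_mult_iff)
      ultimately show False by simp
    qed
    have ip_minus: "ip (\<lambda>i. - x i) y = - ip x y" for x y by (simp add: ip_def flip: sum_negf)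
    have "ip x E' \<le> 0" if "x \<in> C" for x
    proof -
      have "0 \<le> ip (\<lambda>i. - x i) E'"
      proof (rule first_order)
        fix t :: real assume "0 < t"
        then show "d \<le> nn (\<lambda>i. E' i + of_real t * - x i)"
          using cl[of "\<lambda>k i. of_real t * x i" "\<lambda>i. of_real t * x i"] that c(1) add scale by simp
      qed
      then show ?thesis by (simp add: ip_minus)
    qed
    then have "ip M E' \<le> 0" using sep unfolding ip_def by blast
    moreover have "0 \<le> ip (\<lambda>i. M i - E' i) E'"
    proof (rule first_order)
      fix t :: real assume t: "0 < t" "t \<le> 1"
      \<comment> \<open>Moving the error towards \<open>M\<close> by the fraction \<open>t\<close>
        means replacing \<open>c k\<close> by \<open>(1 - t) c k\<close>, which stays in the
        cone.\<close>
      have "d \<le> nn (\<lambda>i. E' i - of_real (- t) * (M i - E' i))"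
      proof (rule cl)
        show "(\<lambda>i. c k i + of_real (- t) * (M i - E k i)) \<in> C" for k
        proof -
          have "(\<lambda>i. c k i + of_real (- t) * (M i - E k i)) = (\<lambda>i. of_real (1 - t) * c k i)"
            by (simp add: E_def algebra_simps)
          then show ?thesis using scale[OF c(1), of "1 - t" k] t by simp
        qed
      qed (intro tendsto_intros lim)
      then show "d \<le> nn (\<lambda>i. E' i + of_real t * (M i - E' i))" by simp
    qed
    moreover have "ip (\<lambda>i. M i - E' i) E' = ip M E' - nn E'"
      unfolding ip_def nn_def cmod_power2 by (simp add: algebra_simps sum_subtractf power2_eq_square sum.distrib)
    ultimately show False using dpos nnE by simp
  qed
  then obtain c where "c \<in> C" "nn (\<lambda>i. M i - c i) < \<eta>\<^sup>2" using near[of "\<eta>\<^sup>2"] \<eta> by auto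
  then show ?thesis using coord[of _ "\<lambda>i. M i - c i"] \<eta>
    by (meson le_less_trans less_imp_le power_less_imp_less_base)
qed

section \<open>The cone generated by the test functions\<close>

text \<open>Membership of the restriction to \<open>F\<close> in the cone. The number of terms is
  not bounded in advance, which makes the cone closed under sums by concatenation.\<close>

definition certified :: "(complex ^ 3) set \<Rightarrow> (complex ^ 3 \<Rightarrow> complex ^ 3 \<Rightarrow> complex) \<Rightarrow> bool" where
  "certified F Q \<longleftrightarrow> (\<exists>(L::nat) g t \<alpha>. (\<forall>m. \<alpha> m \<in> cball 0 1) \<and> (\<forall>z\<in>F. \<forall>w\<in>F. Q z w =
     (\<Sum>m<L. g m z * cnj (g m w) * (1 - test_fun (t m) (\<alpha> m) z * cnj (test_fun (t m) (\<alpha> m) w)))))"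

lemma certified_zero: "certified F (\<lambda>z w. 0)"
  unfolding certified_def by (rule exI[of _ "0::nat"]) (auto intro: exI[of _ "\<lambda>_. 0"])

lemma certified_cong:
  assumes "certified F Q" "\<And>z w. z \<in> F \<Longrightarrow> w \<in> F \<Longrightarrow> Q z w = Q' z w" shows "certified F Q'"
  using assms unfolding certified_def by auto

lemma sum_lessThan_add: "(\<Sum>m<L + (K::nat). f m) = (\<Sum>m<L. f m) + (\<Sum>m<K. f (L + m) :: complex)"
  by (induction K) (auto simp: algebra_simps)

lemma certified_add:
  assumes "certified F Q" "certified F R" shows "certified F (\<lambda>z w. Q z w + R z w)"
proof -
  obtain L1 :: nat and g1 t1 \<alpha>1 where 1: "\<forall>m. \<alpha>1 m \<in> cball 0 1" "\<forall>z\<in>F. \<forall>w\<in>F. Q z w =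
     (\<Sum>m<L1. g1 m z * cnj (g1 m w) * (1 - test_fun (t1 m) (\<alpha>1 m) z * cnj (test_fun (t1 m) (\<alpha>1 m) w)))"
    using assms(1) unfolding certified_def by blast
  obtain L2 :: nat and g2 t2 \<alpha>2 where 2: "\<forall>m. \<alpha>2 m \<in> cball 0 1" "\<forall>z\<in>F. \<forall>w\<in>F. R z w =
     (\<Sum>m<L2. g2 m z * cnj (g2 m w) * (1 - test_fun (t2 m) (\<alpha>2 m) z * cnj (test_fun (t2 m) (\<alpha>2 m) w)))"
    using assms(2) unfolding certified_def by blast
  show ?thesis unfolding certified_def
    by (rule exI[of _ "L1 + L2"], rule exI[of _ "\<lambda>m. if m < L1 then g1 m else g2 (m - L1)"],
        rule exI[of _ "\<lambda>m. if m < L1 then t1 m else t2 (m - L1)"],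
        rule exI[of _ "\<lambda>m. if m < L1 then \<alpha>1 m else \<alpha>2 (m - L1)"])
      (use 1 2 in \<open>simp add: sum_lessThan_add\<close>)
qed

lemma certified_scale:
  assumes "certified F Q" "0 \<le> s" shows "certified F (\<lambda>z w. of_real s * Q z w)"
proof -
  obtain L :: nat and g t \<alpha> where 1: "\<forall>m. \<alpha> m \<in> cball 0 1" "\<forall>z\<in>F. \<forall>w\<in>F. Q z w =
     (\<Sum>m<L. g m z * cnj (g m w) * (1 - test_fun (t m) (\<alpha> m) z * cnj (test_fun (t m) (\<alpha> m) w)))"
    using assms(1) unfolding certified_def by blast
  have s: "complex_of_real s = of_real (sqrt s) * of_real (sqrt s)" using assms(2) by (simp flip: of_real_mult)
  show ?thesis unfolding certified_def
    by (rule exI[of _ L], rule exI[of _ "\<lambda>m z. of_real (sqrt s) * g m z"], rule exI[of _ t], rule exI[of _ \<alpha>])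
      (use 1 in \<open>auto simp: s sum_distrib_left mult_ac\<close>)
qed

lemma certified_rank_one:
  assumes "cmod a \<le> 1"
  shows "certified F (\<lambda>z w. g z * cnj (g w) * (1 - test_fun t a z * cnj (test_fun t a w)))"
  unfolding certified_def
  by (rule exI[of _ 1], rule exI[of _ "\<lambda>_. g"], rule exI[of _ "\<lambda>_. t"], rule exI[of _ "\<lambda>_. a"]) (use assms in auto)

lemma certified_sum:
  assumes "\<And>i. i \<in> I \<Longrightarrow> certified F (Q i)" shows "certified F (\<lambda>z w. \<Sum>i\<in>I. Q i z w)"
  using assms by (induction I rule: infinite_finite_induct) (auto intro: certified_zero certified_add)

lemma certified_hermitian:
  assumes "certified F Q" "z \<in> F" "w \<in> F" shows "Q w z = cnj (Q z w)"
proof -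
  obtain L :: nat and g t \<alpha> where 1: "\<forall>m. \<alpha> m \<in> cball 0 1" "\<forall>z\<in>F. \<forall>w\<in>F. Q z w =
     (\<Sum>m<L. g m z * cnj (g m w) * (1 - test_fun (t m) (\<alpha> m) z * cnj (test_fun (t m) (\<alpha> m) w)))"
    using assms(1) unfolding certified_def by blast
  then show ?thesis using assms by (simp add: cnj_sum mult_ac)
qed

lemma test_fun_2: "test_fun 2 \<alpha> z = z $ 2 / 2"
  by (simp add: test_fun_def)

text \<open>Division by \<open>1 - a z * cnj (a w)\<close> with \<open>a = z $ 2 / 2\<close>
  preserves positivity (\<open>kform_geometric\<close>); decomposing the quotient into rank one
  terms and multiplying back gives a sum with a single test function.\<close>

lemma psd_certified:
  assumes "finite F" "F \<subseteq> pentablock" "\<And>x. kform F R x \<in> \<real>\<^sub>\<ge>\<^sub>0"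
  shows "certified F R"
proof -
  define a where "a = test_fun 2 0"
  have a: "cmod (a p) < 1" if "p \<in> F" for p
    unfolding a_def using assms(2) that by (intro test_fun_bound) auto
  define Q where "Q = (\<lambda>p q. R p q / (1 - a p * cnj (a q)))"
  have nz: "1 - a p * cnj (a q) \<noteq> 0" if "p \<in> F" "q \<in> F" for p q
    using one_minus_mult_nonzero[of "a p" "cnj (a q)"] a[OF that(1)] a[OF that(2)] by simp
  have QR: "kform F (\<lambda>p q. (1 - a p * cnj (a q)) * Q p q) x = kform F R x" for x
    by (rule kform_cong) (use nz in \<open>auto simp: Q_def\<close>)
  have "kform F Q x \<in> \<real>\<^sub>\<ge>\<^sub>0" for x
  proof (rule kform_geometric[OF assms(1) a])
    show "kform F (\<lambda>p q. (1 - a p * cnj (a q)) * Q p q) x \<in> \<real>\<^sub>\<ge>\<^sub>0" for x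
      unfolding QR by (rule assms(3))
  qed
  then obtain S :: nat and g where g: "\<forall>z\<in>F. \<forall>w\<in>F. Q z w = (\<Sum>s<S. g s z * cnj (g s w))"
    by (rule kform_decomposition[OF assms(1)])
  note g = g[rule_format]
  have "certified F (\<lambda>z w. \<Sum>s<S. g s z * cnj (g s w) * (1 - a z * cnj (a w)))"
    unfolding a_def by (intro certified_sum certified_rank_one) simp
  then show ?thesis
  proof (rule certified_cong)
    fix z w assume "z \<in> F" "w \<in> F"
    then show "(\<Sum>s<S. g s z * cnj (g s w) * (1 - a z * cnj (a w))) = R z w"
      unfolding sum_distrib_right[symmetric] g[symmetric, OF \<open>z \<in> F\<close> \<open>w \<in> F\<close>]
      using nz[of z w] by (simp add: Q_def)
  qed
qed

text \<open>The multiple of the Kronecker delta makes the diagonal nonzero at every point, also off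
  \<open>F\<close>. It is admissible itself: multiplied by the factor of a test function
  \<open>h\<close> it stays diagonal, with entries \<open>\<eta> (1 - |h|^2)\<close>.\<close>

lemma kernel_in_AK:
  assumes F: "finite F" "F \<subseteq> pentablock" and \<eta>: "0 < \<eta>"
    and pos: "\<And>t \<alpha> x. cmod \<alpha> \<le> 1 \<Longrightarrow> kform F (\<lambda>z w. (1 - test_fun t \<alpha> z * cnj (test_fun t \<alpha> w)) * K z w) x \<in> \<real>\<^sub>\<ge>\<^sub>0"
  shows "(\<lambda>z w. (if z \<in> F \<and> w \<in> F then K z w else 0) + of_bool (z = w) * of_real \<eta>) \<in> AK" (is "?k \<in> AK")
proof -
  have K: "kform F K x \<in> \<real>\<^sub>\<ge>\<^sub>0" for x
    by (rule kform_geometric[OF F(1), of "test_fun 2 0"]) (use F pos test_fun_bound in auto)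
  have weak: "weak_kernel ?k"
    using \<eta> by (intro weak_kernel_add weak_kernel_supported[OF F(1) K] weak_kernel_diagonal) simp
  have test: "weak_kernel (\<lambda>z w. (1 - test_fun t \<alpha> z * cnj (test_fun t \<alpha> w)) * ?k z w)" if "cmod \<alpha> \<le> 1" for t \<alpha>
  proof -
    have "weak_kernel (\<lambda>z w. (if z \<in> F \<and> w \<in> F then (1 - test_fun t \<alpha> z * cnj (test_fun t \<alpha> w)) * K z w else 0)
      + of_bool (z = w) * of_real (\<eta> * (1 - (cmod (test_fun t \<alpha> z))\<^sup>2)))"
    proof (intro weak_kernel_add weak_kernel_supported[OF F(1) pos[OF that]] weak_kernel_diagonal)
      fix z assume "z \<in> pentablock"
      then have "(cmod (test_fun t \<alpha> z))\<^sup>2 < 1" using test_fun_bound[OF _ that] by (simp add: power_less_one_iff abs_square_less_1)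
      then show "0 \<le> \<eta> * (1 - (cmod (test_fun t \<alpha> z))\<^sup>2)" using \<eta> by simp
    qed
    moreover have "(if z \<in> F \<and> w \<in> F then (1 - test_fun t \<alpha> z * cnj (test_fun t \<alpha> w)) * K z w else 0)
      + of_bool (z = w) * of_real (\<eta> * (1 - (cmod (test_fun t \<alpha> z))\<^sup>2)) = 
      (1 - test_fun t \<alpha> z * cnj (test_fun t \<alpha> w)) * ?k z w" for z w
      by (auto simp: of_bool_def complex_norm_square algebra_simps simp del: of_real_power)
    ultimately show ?thesis by simp
  qed
  have "weak_kernel (\<lambda>z w. (1 - z $ 2 * cnj (w $ 2) / 4) * ?k z w)"
    using test[of 0 2] by (simp add: test_fun_2)
  moreover have "weak_kernel (\<lambda>z w. (1 - psi \<alpha> z * cnj (psi \<alpha> w)) * ?k z w)" if "cmod \<alpha> \<le> 1" for \<alpha>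
    using test[OF that, of 0] by (simp add: test_fun_def)
  moreover have "weak_kernel (\<lambda>z w. (1 - Phi \<alpha> (z $ 2) (z $ 3) * cnj (Phi \<alpha> (w $ 2) (w $ 3))) * ?k z w)" if "cmod \<alpha> \<le> 1" for \<alpha>
    using test[OF that, of 1] by (simp add: test_fun_def)
  moreover have "?k z z \<noteq> 0" if "z \<in> pentablock" for z
  proof (cases "z \<in> F")
    case True
    have "kform F K (\<lambda>p. of_bool (p = z)) = K z z"
    proof -
      have "kform F K (\<lambda>p. of_bool (p = z)) = (\<Sum>p\<in>F. if p = z then (\<Sum>q\<in>F. if q = z then K p q else 0) else 0)"
        unfolding kform_def by (intro sum.cong refl) (auto intro!: sum.cong)
      then show ?thesis using True F(1) by simp
    qed
    then have "0 \<le> Re (K z z)" using K[of "\<lambda>p. of_bool (p = z)"] by (simp add: complex_nonneg_Reals_iff)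
    then show ?thesis using True \<eta> by (auto simp: complex_eq_iff)
  qed (use \<eta> in auto)
  ultimately show ?thesis using weak unfolding AK_def by auto
qed

lemma certificate:
  assumes herm: "\<And>z w. M w z = cnj (M z w)"
    and hyp: "\<And>k. k \<in> AK \<Longrightarrow> weak_kernel (\<lambda>z w. M z w * k z w)"
    and F: "finite F" "F \<subseteq> pentablock" and \<delta>: "0 < \<delta>"
  shows "certified F (\<lambda>z w. M z w + of_bool (z = w) * of_real \<delta>)"
proof -
  define C where "C = {c :: (complex ^ 3) \<times> (complex ^ 3) \<Rightarrow> complex. certified F (\<lambda>z w. c (z, w))}"
  \<comment> \<open>Entries below \<eta> give a form of size at most \<open>\<eta> * card F\<close>
    times the squared norm; the 1 covers the empty set.\<close>
  define \<eta> where "\<eta> = \<delta> / (real (card F) + 1)"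
  have \<eta>: "\<eta> > 0" "\<eta> * real (card F) \<le> \<delta>" using \<delta> by (auto simp: \<eta>_def field_simps)
  have "\<exists>c\<in>C. \<forall>i\<in>F \<times> F. cmod ((\<lambda>(z, w). M z w) i - c i) < \<eta>"
  proof (rule cone_separation)
    show "finite (F \<times> F)" using F by simp
    show "(\<lambda>i. 0) \<in> C" using certified_zero by (simp add: C_def)
    show "(\<lambda>i. c i + d i) \<in> C" if "c \<in> C" "d \<in> C" for c d using that certified_add by (simp add: C_def)
    show "(\<lambda>i. of_real s * c i) \<in> C" if "c \<in> C" "0 \<le> s" for c s using that certified_scale by (simp add: C_def)
    show "\<eta> > 0" by (rule \<eta>)
    fix E assume E: "\<And>c. c \<in> C \<Longrightarrow> Re (\<Sum>i\<in>F \<times> F. c i * cnj (E i)) \<le> 0"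
    \<comment> \<open>The Hermitian part of \<open>-E\<close>, conjugated: paired with a Hermitian
      matrix it returns minus the real part of the pairing with \<open>E\<close>, so the separating
      functional becomes a candidate kernel.\<close>
    define K where "K = (\<lambda>z w. - (cnj (E (z, w)) + E (w, z)) / 2)"
    have pair: "(\<Sum>z\<in>F. \<Sum>w\<in>F. c z w * K z w) = - of_real (Re (\<Sum>i\<in>F \<times> F. (case i of (z, w) \<Rightarrow> c z w) * cnj (E i)))"
      if c: "\<And>z w. z \<in> F \<Longrightarrow> w \<in> F \<Longrightarrow> c w z = cnj (c z w)" for c
    proof -
      define s where "s = (\<Sum>z\<in>F. \<Sum>w\<in>F. c z w * cnj (E (z, w)))"
      have "(\<Sum>z\<in>F. \<Sum>w\<in>F. c z w * E (w, z)) = (\<Sum>w\<in>F. \<Sum>z\<in>F. c z w * E (w, z))" by (rule sum.swap)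
      also have "\<dots> = cnj s" unfolding s_def cnj_sum
      proof (intro sum.cong refl)
        fix w z assume "w \<in> F" "z \<in> F"
        then show "c z w * E (w, z) = cnj (c w z * cnj (E (w, z)))" using c[of w z] by simp
      qed
      finally have "(\<Sum>z\<in>F. \<Sum>w\<in>F. c z w * E (w, z)) = cnj s" .
      moreover have "(\<Sum>z\<in>F. \<Sum>w\<in>F. c z w * K z w) = (s + (\<Sum>z\<in>F. \<Sum>w\<in>F. c z w * E (w, z))) * (- 1 / 2)"
        unfolding K_def s_def sum.distrib[symmetric] sum_distrib_right
        by (intro sum.cong refl) (simp add: field_simps)
      ultimately have "(\<Sum>z\<in>F. \<Sum>w\<in>F. c z w * K z w) = (s + cnj s) * (- 1 / 2)" by (simp only:)
      also have "\<dots> = - of_real (Re s)" unfolding complex_add_cnj by simp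
      finally have "(\<Sum>z\<in>F. \<Sum>w\<in>F. c z w * K z w) = - of_real (Re s)" .
      moreover have "(\<Sum>i\<in>F \<times> F. (case i of (z, w) \<Rightarrow> c z w) * cnj (E i)) = s"
        unfolding s_def sum.cartesian_product by (intro sum.cong) auto
      ultimately show ?thesis by simp
    qed
    have pos: "kform F (\<lambda>z w. (1 - test_fun t \<alpha> z * cnj (test_fun t \<alpha> w)) * K z w) x \<in> \<real>\<^sub>\<ge>\<^sub>0" if "cmod \<alpha> \<le> 1" for t \<alpha> x
    proof -
      define c where "c = (\<lambda>z w. x z * cnj (x w) * (1 - test_fun t \<alpha> z * cnj (test_fun t \<alpha> w)))"
      have cert: "certified F c" unfolding c_def by (rule certified_rank_one[OF that])
      have pc: "(\<Sum>z\<in>F. \<Sum>w\<in>F. c z w * K z w) = - of_real (Re (\<Sum>i\<in>F \<times> F. (case i of (z, w) \<Rightarrow> c z w) * cnj (E i)))"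
        by (rule pair) (rule certified_hermitian[OF cert])
      have "(\<lambda>i. case i of (z, w) \<Rightarrow> c z w) \<in> C" using cert by (simp add: C_def)
      from E[OF this] have "(\<Sum>z\<in>F. \<Sum>w\<in>F. c z w * K z w) \<in> \<real>\<^sub>\<ge>\<^sub>0"
        unfolding pc of_real_minus[symmetric] nonneg_Reals_of_real_iff
        by linarith
      moreover have "(\<Sum>z\<in>F. \<Sum>w\<in>F. c z w * K z w) = kform F (\<lambda>z w. (1 - test_fun t \<alpha> z * cnj (test_fun t \<alpha> w)) * K z w) x"
        unfolding kform_def c_def by (intro sum.cong refl) (simp add: mult_ac)
      ultimately show ?thesis by simp
    qed
    define m where "m = Re (\<Sum>i\<in>F \<times> F. (case i of (z, w) \<Rightarrow> M z w) * cnj (E i))"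
    define s where "s = Re (\<Sum>p\<in>F. M p p)"
    \<comment> \<open>The hypothesis on admissible kernels, evaluated at the constant vector 1,
      where the form is the sum of all entries; the delta part contributes \<open>e\<close> times
      the trace of \<open>M\<close> on \<open>F\<close>.\<close>
    have le: "m \<le> e * s" if e: "e > 0" for e
    proof -
      let ?k = "\<lambda>z w. (if z \<in> F \<and> w \<in> F then K z w else 0) + of_bool (z = w) * of_real e"
      have "?k \<in> AK" by (rule kernel_in_AK[OF F e pos])
      then have "kform F (\<lambda>z w. M z w * ?k z w) (\<lambda>_. 1) \<in> \<real>\<^sub>\<ge>\<^sub>0"
        using hyp F unfolding weak_kernel_iff_kform by blast
      moreover have "kform F (\<lambda>z w. M z w * ?k z w) (\<lambda>_. 1) = 
        (\<Sum>z\<in>F. \<Sum>w\<in>F. M z w * K z w) + kform F (\<lambda>z w. of_bool (z = w) * (of_real e * M z z)) (\<lambda>_. 1)"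
        unfolding kform_def sum.distrib[symmetric] by (intro sum.cong refl) (auto simp: algebra_simps)
      ultimately show ?thesis
        unfolding pair[OF herm] kform_diagonal[OF F(1)] m_def s_def
        by (simp add: complex_nonneg_Reals_iff sum_distrib_left)
    qed
    have "m \<le> 0"
    proof (rule ccontr)
      assume "\<not> m \<le> 0"
      then have m: "m > 0" by simp
      \<comment> \<open>This value of \<open>e\<close> makes the contribution of the trace at most
        \<open>m / 2\<close>.\<close>
      have "m \<le> m / (2 * (\<bar>s\<bar> + 1)) * s" using m by (intro le) (auto intro!: divide_pos_pos add_nonneg_pos)
      also have "\<dots> \<le> m / (2 * (\<bar>s\<bar> + 1)) * (\<bar>s\<bar> + 1)" using m by (intro mult_left_mono) auto
      also have "\<dots> = m / 2" by (simp add: field_simps)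
      finally show False using m by simp
    qed
    then show "Re (\<Sum>i\<in>F \<times> F. (\<lambda>(z, w). M z w) i * cnj (E i)) \<le> 0" unfolding m_def .
  qed
  then obtain c0 where c0: "c0 \<in> C" "\<forall>i\<in>F \<times> F. cmod ((\<lambda>(z, w). M z w) i - c0 i) < \<eta>" by blast
  define c where "c = (\<lambda>z w. c0 (z, w))"
  have c: "certified F c" "\<And>z w. z \<in> F \<Longrightarrow> w \<in> F \<Longrightarrow> cmod (M z w - c z w) < \<eta>"
    using c0 by (auto simp: C_def c_def)
  define D where "D = (\<lambda>z w. M z w - c z w)"
  \<comment> \<open>Needed because a form with small entries is real, and hence comparable with
    \<delta> times the identity, only if it is Hermitian.\<close>
  have Dh: "D w z = cnj (D z w)" if "z \<in> F" "w \<in> F" for z w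
    unfolding D_def using herm[of w z] certified_hermitian[OF c(1) that] by simp
  have R: "kform F (\<lambda>z w. D z w + of_bool (z = w) * of_real \<delta>) x \<in> \<real>\<^sub>\<ge>\<^sub>0" for x
  proof -
    define S where "S = (\<Sum>p\<in>F. (cmod (x p))\<^sup>2)"
    have "cnj (kform F D x) = (\<Sum>p\<in>F. \<Sum>q\<in>F. D q p * x q * cnj (x p))"
      unfolding kform_def cnj_sum
    proof (intro sum.cong refl)
      fix p q assume "p \<in> F" "q \<in> F"
      then show "cnj (D p q * x p * cnj (x q)) = D q p * x q * cnj (x p)" using Dh[of p q] by simp
    qed
    also have "\<dots> = kform F D x" unfolding kform_def by (rule sum.swap)
    finally have real: "Im (kform F D x) = 0" by (metis Reals_cnj_iff complex_is_Real_iff)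
    have "cmod (kform F D x) \<le> (\<Sum>p\<in>F. \<Sum>q\<in>F. \<eta> * (((cmod (x p))\<^sup>2 + (cmod (x q))\<^sup>2) / 2))"
      unfolding kform_def
    proof (intro order_trans[OF norm_sum] sum_mono)
      fix p q assume pq: "p \<in> F" "q \<in> F"
      have "cmod (D p q * x p * cnj (x q)) = cmod (D p q) * (cmod (x p) * cmod (x q))" by (simp add: norm_mult)
      also have "\<dots> \<le> \<eta> * (((cmod (x p))\<^sup>2 + (cmod (x q))\<^sup>2) / 2)"
      proof (rule mult_mono)
        show "cmod (x p) * cmod (x q) \<le> ((cmod (x p))\<^sup>2 + (cmod (x q))\<^sup>2) / 2"
          using zero_le_power2[of "cmod (x p) - cmod (x q)"] by (simp add: power2_diff)
      qed (use c(2)[OF pq] \<eta> in \<open>auto simp: D_def\<close>)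
      finally show "cmod (D p q * x p * cnj (x q)) \<le> \<eta> * (((cmod (x p))\<^sup>2 + (cmod (x q))\<^sup>2) / 2)" .
    qed
    also have "\<dots> = \<eta> * real (card F) * S"
      unfolding sum_distrib_left[symmetric] sum_divide_distrib[symmetric] sum.distrib S_def
      by (simp add: algebra_simps sum_distrib_left[symmetric])
    also have "\<dots> \<le> \<delta> * S" using \<eta>(2) by (intro mult_right_mono) (auto simp: S_def intro: sum_nonneg)
    finally have "- (\<delta> * S) \<le> Re (kform F D x)" using abs_Re_le_cmod[of "kform F D x"] by linarith
    moreover have "kform F (\<lambda>z w. D z w + of_bool (z = w) * of_real \<delta>) x = kform F D x + of_real (\<delta> * S)"
      unfolding kform_add kform_diagonal[OF F(1)] S_def by (simp add: sum_distrib_left)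
    ultimately show ?thesis using real by (simp add: complex_nonneg_Reals_iff)
  qed
  have "certified F (\<lambda>z w. c z w + (D z w + of_bool (z = w) * of_real \<delta>))"
    by (rule certified_add[OF c(1) psd_certified[OF F R]])
  then show ?thesis by (simp add: D_def)
qed

section \<open>From finite sets to positive kernels\<close>

text \<open>The modulus attains its maximum over the compact disc and is below 1 there; only three
  functions occur as \<open>t\<close> varies, so one constant serves all.\<close>

lemma test_fun_gap:
  assumes "z \<in> pentablock"
  shows "\<exists>\<kappa>>0. \<forall>t. \<forall>\<alpha>\<in>cball 0 1. \<kappa> \<le> 1 - (cmod (test_fun t \<alpha> z))\<^sup>2"
proof -
  have "\<exists>\<kappa>>0. \<forall>\<alpha>\<in>cball 0 1. \<kappa> \<le> 1 - (cmod (test_fun t \<alpha> z))\<^sup>2" for t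
  proof -
    have "continuous_on (cball 0 1) (\<lambda>\<alpha>. 1 - (cmod (test_fun t \<alpha> z))\<^sup>2)"
      by (intro continuous_intros continuous_on_test_fun assms)
    then obtain a where a: "a \<in> cball 0 1" "\<forall>\<alpha>\<in>cball 0 1. 1 - (cmod (test_fun t a z))\<^sup>2 \<le> 1 - (cmod (test_fun t \<alpha> z))\<^sup>2"
      using continuous_attains_inf[of "cball (0::complex) 1" "\<lambda>\<alpha>. 1 - (cmod (test_fun t \<alpha> z))\<^sup>2"] by auto
    have "cmod (test_fun t a z) < 1" using a(1) assms by (intro test_fun_bound) auto
    then have "0 < 1 - (cmod (test_fun t a z))\<^sup>2" by (simp add: power_less_one_iff abs_square_less_1)
    then show ?thesis using a(2) by blast
  qed
  then obtain \<kappa> where \<kappa>: "\<And>t. \<kappa> t > 0" "\<And>t \<alpha>. \<alpha> \<in> cball 0 1 \<Longrightarrow> \<kappa> t \<le> 1 - (cmod (test_fun t \<alpha> z))\<^sup>2" by metis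
  have "min (\<kappa> 0) (min (\<kappa> 1) (\<kappa> 2)) \<le> 1 - (cmod (test_fun t \<alpha> z))\<^sup>2" if "\<alpha> \<in> cball 0 1" for t \<alpha>
  proof -
    have "test_fun t \<alpha> z = test_fun 0 \<alpha> z \<or> test_fun t \<alpha> z = test_fun 1 \<alpha> z \<or> test_fun t \<alpha> z = test_fun 2 \<alpha> z"
      by (simp add: test_fun_def)
    then show ?thesis using \<kappa>(2)[OF that, of 0] \<kappa>(2)[OF that, of 1] \<kappa>(2)[OF that, of 2] by auto
  qed
  then show ?thesis using \<kappa>(1) by (intro exI[of _ "min (\<kappa> 0) (min (\<kappa> 1) (\<kappa> 2))"]) auto
qed

lemma compact_product_discs: "compact {x :: 'i \<Rightarrow> complex. \<forall>i. cmod (x i) \<le> R i}"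
proof -
  have "compactin (product_topology (\<lambda>_. euclidean) UNIV) (PiE UNIV (\<lambda>i. cball (0::complex) (R i)))"
    unfolding compactin_PiE by simp
  moreover have "PiE UNIV (\<lambda>i. cball 0 (R i)) = {x. \<forall>i. cmod (x i) \<le> R i}" by auto
  ultimately show ?thesis by (simp add: euclidean_product_topology)
qed

text \<open>A substitute for an ultrafilter limit: along a suitable finer filter all coordinates of a
  bounded family converge simultaneously.\<close>

lemma simultaneous_limit:
  fixes G :: "'a \<Rightarrow> 'i \<Rightarrow> complex"
  assumes "A \<noteq> bot" "\<And>a i. cmod (G a i) \<le> R i"
  obtains B x where "B \<le> A" "B \<noteq> bot" "\<forall>i. ((\<lambda>a. G a i) \<longlongrightarrow> x i) B" "\<forall>i. cmod (x i) \<le> R i"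
proof -
  let ?U = "{x :: 'i \<Rightarrow> complex. \<forall>i. cmod (x i) \<le> R i}"
  have "filtermap G A \<noteq> bot" "eventually (\<lambda>x. x \<in> ?U) (filtermap G A)"
    using assms by (auto simp: filtermap_bot_iff eventually_filtermap)
  then obtain x where x: "x \<in> ?U" "inf (nhds x) (filtermap G A) \<noteq> bot"
    using compact_product_discs[of R] unfolding compact_filter by blast
  \<comment> \<open>The trace of \<open>A\<close> on the neighbourhoods of the cluster point
    \<open>x\<close>, pulled back along \<open>G\<close>; clustering is what keeps this filter
    proper.\<close>
  define B where "B = inf (filtercomap G (nhds x)) A"
  have "B \<noteq> bot"
  proof
    assume "B = bot"
    then have "eventually (\<lambda>_. False) B" by simp
    then obtain P Q where PQ: "eventually P (filtercomap G (nhds x))" "eventually Q A" "\<And>a. P a \<Longrightarrow> Q a \<Longrightarrow> False"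
      unfolding B_def eventually_inf by blast
    then obtain S where S: "eventually S (nhds x)" "\<And>a. S (G a) \<Longrightarrow> P a"
      unfolding eventually_filtercomap by blast
    have "eventually (\<lambda>y. \<not> S y) (filtermap G A)"
      unfolding eventually_filtermap using PQ(2) by (rule eventually_mono) (use PQ(3) S(2) in blast)
    with S(1) have "eventually (\<lambda>_. False) (inf (nhds x) (filtermap G A))"
      unfolding eventually_inf by blast
    then show False using x(2) by (simp add: trivial_limit_def)
  qed
  moreover have "B \<le> A" by (simp add: B_def)
  moreover have "((\<lambda>a. G a i) \<longlongrightarrow> x i) B" for i
  proof -
    have "filterlim G (nhds x) B"
      unfolding B_def by (rule filterlim_mono[OF filterlim_filtercomap order_refl inf_le1])
    then show ?thesis
      by (rule continuous_on_tendsto_compose[where f = "\<lambda>y. y i" and s = UNIV, OF continuous_on_product_coordinates]) auto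
  qed
  ultimately show ?thesis using that x(1) by blast
qed

lemma cmod_le_SUP_disc:
  fixes h :: "complex \<Rightarrow> complex"
  assumes "continuous_on (cball 0 1) h" "\<alpha> \<in> cball 0 1"
  shows "cmod (h \<alpha>) \<le> (SUP \<alpha>\<in>cball 0 1. cmod (h \<alpha>))"
proof (rule cSUP_upper[OF assms(2)])
  have "compact ((\<lambda>\<alpha>. cmod (h \<alpha>)) ` cball 0 1)"
    by (intro compact_continuous_image continuous_intros assms compact_cball)
  then show "bdd_above ((\<lambda>\<alpha>. cmod (h \<alpha>)) ` cball 0 1)"
    by (intro bounded_imp_bdd_above compact_imp_bounded)
qed

text \<open>A finite sum with parameters \<open>\<alpha> m\<close> acts on continuous functions as a
  discrete measure on the disc, one for each kind of test function. The gap \<kappa> bounds these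
  functionals at each pair of points independently of the finite set, so they converge along a
  common filter.\<close>

lemma certified_imp_decomposition:
  assumes cert: "\<And>F \<delta>. finite F \<Longrightarrow> F \<subseteq> pentablock \<Longrightarrow> 0 < \<delta> \<Longrightarrow>
    certified F (\<lambda>z w. M z w + of_bool (z = w) * of_real \<delta>)"
  shows "\<exists>\<xi> \<eta> \<delta>. positive_kernel \<xi> \<and> positive_kernel \<eta> \<and> weak_kernel \<delta> \<and>
         (\<forall>z\<in>pentablock. \<forall>w\<in>pentablock. M z w =
              \<xi> z w (\<lambda>\<alpha>. 1 - J_fun z \<alpha> * cnj (J_fun w \<alpha>)) +
              \<eta> z w (\<lambda>\<alpha>. 1 - j_fun z \<alpha> * cnj (j_fun w \<alpha>)) +
              (1 - z $ 2 * cnj (w $ 2) / 4) * \<delta> z w)"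
proof -
  define good where "good = (\<lambda>F. finite F \<and> F \<subseteq> pentablock)"
  have "\<forall>a. \<exists>r. good (fst a) \<longrightarrow> (case r of (L::nat, g, t, \<alpha>) \<Rightarrow>
     (\<forall>m. \<alpha> m \<in> cball 0 1) \<and> (\<forall>z\<in>fst a. \<forall>w\<in>fst a. M z w + of_bool (z = w) * of_real (1 / (real (snd a) + 1)) =
     (\<Sum>m<L. g m z * cnj (g m w) * (1 - test_fun (t m) (\<alpha> m) z * cnj (test_fun (t m) (\<alpha> m) w)))))"
  proof
    fix a :: "(complex ^ 3) set \<times> nat"
    show "\<exists>r. good (fst a) \<longrightarrow> (case r of (L::nat, g, t, \<alpha>) \<Rightarrow>
     (\<forall>m. \<alpha> m \<in> cball 0 1) \<and> (\<forall>z\<in>fst a. \<forall>w\<in>fst a. M z w + of_bool (z = w) * of_real (1 / (real (snd a) + 1)) =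
     (\<Sum>m<L. g m z * cnj (g m w) * (1 - test_fun (t m) (\<alpha> m) z * cnj (test_fun (t m) (\<alpha> m) w)))))"
    proof (cases "good (fst a)")
      case True
      then have "certified (fst a) (\<lambda>z w. M z w + of_bool (z = w) * of_real (1 / (real (snd a) + 1)))"
        unfolding good_def by (intro cert) auto
      then show ?thesis unfolding certified_def by auto
    qed simp
  qed
  from choice[OF this] obtain r where "\<forall>a. good (fst a) \<longrightarrow> (case r a of (L::nat, g, t, \<alpha>) \<Rightarrow>
     (\<forall>m. \<alpha> m \<in> cball 0 1) \<and> (\<forall>z\<in>fst a. \<forall>w\<in>fst a. M z w + of_bool (z = w) * of_real (1 / (real (snd a) + 1)) =
     (\<Sum>m<L. g m z * cnj (g m w) * (1 - test_fun (t m) (\<alpha> m) z * cnj (test_fun (t m) (\<alpha> m) w)))))" ..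
  note r = this[rule_format]
  define L g t \<alpha> where "L = (\<lambda>a. fst (r a))" "g = (\<lambda>a. fst (snd (r a)))" "t = (\<lambda>a. fst (snd (snd (r a))))"
    "\<alpha> = (\<lambda>a. snd (snd (snd (r a))))"
  have alpha: "\<alpha> a m \<in> cball 0 1" if "good (fst a)" for a m
    using r[OF that] by (auto simp: L_g_t_\<alpha>_def split: prod.splits)
  have ident: "M z w + of_bool (z = w) * of_real (1 / (real (snd a) + 1)) =
     (\<Sum>m<L a. g a m z * cnj (g a m w) * (1 - test_fun (t a m) (\<alpha> a m) z * cnj (test_fun (t a m) (\<alpha> a m) w)))"
    if "good (fst a)" "z \<in> fst a" "w \<in> fst a" for a z w
    unfolding L_g_t_\<alpha>_def using r[OF that(1)] that(2,3) unfolding case_prod_beta by blast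
  \<comment> \<open>All indices above 1 name the same test function; after the cut three kinds
    remain, one for each summand of the decomposition.\<close>
  define tt where "tt = (\<lambda>a m. min (t a m) 2)"
  have tt: "test_fun (tt a m) = test_fun (t a m)" "tt a m < 3" for a m
    by (auto simp: tt_def test_fun_def fun_eq_iff)
  obtain \<kappa> where \<kappa>: "\<And>z. z \<in> pentablock \<Longrightarrow> \<kappa> z > 0"
    "\<And>z t \<alpha>. z \<in> pentablock \<Longrightarrow> \<alpha> \<in> cball 0 1 \<Longrightarrow> \<kappa> z \<le> 1 - (cmod (test_fun t \<alpha> z))\<^sup>2"
    using test_fun_gap by metis
  \<comment> \<open>On the diagonal the certificate equals \<open>M z z\<close> plus at most 1, and
    each weight \<open>1 - |h|^2\<close> is at least \<open>\<kappa> z\<close>; so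
    \<open>b z\<close> bounds the sum of the squares of the coefficients at
    \<open>z\<close>.\<close>
  define b where "b = (\<lambda>z. (Re (M z z) + 1) / \<kappa> z)"
  have gb: "(\<Sum>m<L a. (cmod (g a m z))\<^sup>2) \<le> b z" if a: "good (fst a)" "z \<in> fst a" for a z
  proof -
    have z: "z \<in> pentablock" using a by (auto simp: good_def)
    have "\<kappa> z * (\<Sum>m<L a. (cmod (g a m z))\<^sup>2) \<le> (\<Sum>m<L a. (cmod (g a m z))\<^sup>2 * (1 - (cmod (test_fun (t a m) (\<alpha> a m) z))\<^sup>2))"
      unfolding sum_distrib_left using \<kappa>(2)[OF z alpha[OF a(1)]]
      by (intro sum_mono) (subst mult.commute, intro mult_left_mono, auto)
    also have "\<dots> = Re (\<Sum>m<L a. g a m z * cnj (g a m z) * (1 - test_fun (t a m) (\<alpha> a m) z * cnj (test_fun (t a m) (\<alpha> a m) z)))"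
      unfolding complex_norm_square[symmetric] Re_sum by (intro sum.cong refl) (simp flip: of_real_power of_real_mult of_real_diff add: Re_power2)
    also have "\<dots> = Re (M z z) + 1 / (real (snd a) + 1)" unfolding ident[OF a(1,2,2), symmetric] by simp
    also have "\<dots> \<le> Re (M z z) + 1" by simp
    finally show ?thesis using \<kappa>(1)[OF z] by (simp add: b_def field_simps)
  qed
  \<comment> \<open>One coordinate for each kind \<open>s\<close>, pair of points and continuous
    function. The value 0 for finite sets that miss \<open>z\<close> or \<open>w\<close> keeps the
    bound valid everywhere and disappears in the limit.\<close>
  define G where "G = (\<lambda>a (s::nat, z, w, h). if good (fst a) \<and> z \<in> fst a \<and> w \<in> fst a \<and> continuous_on (cball 0 1) h
    then (\<Sum>m<L a. of_bool (tt a m = s) * (g a m z * cnj (g a m w)) * h (\<alpha> a m)) else 0)"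
  define S where "S = (\<lambda>h::complex\<Rightarrow>complex. SUP \<alpha>\<in>cball 0 1. cmod (h \<alpha>))"
  define R where "R = (\<lambda>(s::nat, z, w, h). \<bar>(b z + b w) / 2\<bar> * \<bar>S h\<bar>)"
  have GR: "cmod (G a i) \<le> R i" for a i
  proof -
    obtain s z w h where i: "i = (s, z, w, h)" by (metis prod.collapse)
    show ?thesis
    proof (cases "good (fst a) \<and> z \<in> fst a \<and> w \<in> fst a \<and> continuous_on (cball 0 1) h")
      case True
      then have G: "G a i = (\<Sum>m<L a. of_bool (tt a m = s) * (g a m z * cnj (g a m w)) * h (\<alpha> a m))" by (simp add: G_def i)
      have Sh: "cmod (h (\<alpha> a m)) \<le> S h" for m
        unfolding S_def using True alpha by (intro cmod_le_SUP_disc) auto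
      then have S0: "0 \<le> S h" using norm_ge_zero order_trans by blast
      have "cmod (G a i) \<le> (\<Sum>m<L a. ((cmod (g a m z))\<^sup>2 + (cmod (g a m w))\<^sup>2) / 2 * S h)"
        unfolding G
      proof (intro order_trans[OF norm_sum] sum_mono)
        fix m
        have "cmod (of_bool (tt a m = s) * (g a m z * cnj (g a m w)) * h (\<alpha> a m)) \<le> (cmod (g a m z) * cmod (g a m w)) * cmod (h (\<alpha> a m))"
          by (simp add: norm_mult)
        also have "\<dots> \<le> ((cmod (g a m z))\<^sup>2 + (cmod (g a m w))\<^sup>2) / 2 * S h"
          using Sh zero_le_power2[of "cmod (g a m z) - cmod (g a m w)"]
          by (intro mult_mono) (auto simp: power2_diff)
        finally show "cmod (of_bool (tt a m = s) * (g a m z * cnj (g a m w)) * h (\<alpha> a m)) \<le> ((cmod (g a m z))\<^sup>2 + (cmod (g a m w))\<^sup>2) / 2 * S h" .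
      qed
      also have "\<dots> = ((\<Sum>m<L a. (cmod (g a m z))\<^sup>2) + (\<Sum>m<L a. (cmod (g a m w))\<^sup>2)) / 2 * S h"
        by (simp only: sum_distrib_right[symmetric] sum_divide_distrib[symmetric] sum.distrib)
      also have "\<dots> \<le> (b z + b w) / 2 * S h"
        using gb[of a z] gb[of a w] True S0 by (intro mult_right_mono) auto
      also have "\<dots> \<le> R i" unfolding R_def i prod.case by (metis abs_ge_self abs_mult)
      finally show ?thesis .
    qed (auto simp: G_def i R_def)
  qed
  \<comment> \<open>Two limits at once: growing finite sets, and \<delta> running through
    \<open>1 / (k + 1)\<close>.\<close>
  define A where "A = finite_subsets_at_top pentablock \<times>\<^sub>F sequentially"
  have "A \<noteq> bot" unfolding A_def by (simp add: prod_filter_eq_bot finite_subsets_at_top_neq_bot)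
  then obtain B x where B: "B \<le> A" "B \<noteq> bot" and lim: "\<forall>i. ((\<lambda>a. G a i) \<longlongrightarrow> x i) B" and xR: "\<forall>i. cmod (x i) \<le> R i"
    by (rule simultaneous_limit[of A G R, OF _ GR])
  note lim = lim[rule_format] and xR = xR[rule_format]
  have ev: "eventually (\<lambda>a. good (fst a) \<and> X \<subseteq> fst a) B" if "finite X" "X \<subseteq> pentablock" for X
  proof -
    have "eventually (\<lambda>F. good F \<and> X \<subseteq> F) (finite_subsets_at_top pentablock)"
      unfolding eventually_finite_subsets_at_top good_def using that by blast
    then have "eventually (\<lambda>a. good (fst a) \<and> X \<subseteq> fst a) A"
      unfolding A_def using filterlim_fst eventually_compose_filterlim by blast
    then show ?thesis using B(1) filter_leD by blast
  qed
  have Gval: "G a (s, z, w, h) = (\<Sum>m<L a. of_bool (tt a m = s) * (g a m z * cnj (g a m w)) * h (\<alpha> a m))"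
    if "good (fst a)" "z \<in> fst a" "w \<in> fst a" "continuous_on (cball 0 1) h" for a s z w h
    using that by (simp add: G_def)
  define \<xi> where "\<xi> = (\<lambda>s z w h. x (s, z, w, h))"
  have tend: "((\<lambda>a. G a (s, z, w, h)) \<longlongrightarrow> \<xi> s z w h) B" for s z w h using lim by (simp add: \<xi>_def)
  have dual: "disc_dual (\<xi> s z w)" if zw: "z \<in> pentablock" "w \<in> pentablock" for s z w
    unfolding disc_dual_def
  proof (intro conjI allI impI)
    have e: "eventually (\<lambda>a. good (fst a) \<and> {z, w} \<subseteq> fst a) B" using zw by (intro ev) auto
    fix h k :: "complex \<Rightarrow> complex" assume hk: "continuous_on (cball 0 1) h \<and> continuous_on (cball 0 1) k"
    have "((\<lambda>a. G a (s, z, w, h) + G a (s, z, w, k)) \<longlongrightarrow> \<xi> s z w h + \<xi> s z w k) B"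
      by (intro tendsto_add tend)
    moreover have "eventually (\<lambda>a. G a (s, z, w, h) + G a (s, z, w, k) = G a (s, z, w, \<lambda>\<alpha>. h \<alpha> + k \<alpha>)) B"
      using e by (rule eventually_mono)
        (use hk in \<open>simp add: Gval continuous_on_add sum.distrib[symmetric] algebra_simps\<close>)
    ultimately have "((\<lambda>a. G a (s, z, w, \<lambda>\<alpha>. h \<alpha> + k \<alpha>)) \<longlongrightarrow> \<xi> s z w h + \<xi> s z w k) B"
      by (rule Lim_transform_eventually)
    then show "\<xi> s z w (\<lambda>\<alpha>. h \<alpha> + k \<alpha>) = \<xi> s z w h + \<xi> s z w k"
      using tendsto_unique[OF B(2) tend] by blast
  next
    have e: "eventually (\<lambda>a. good (fst a) \<and> {z, w} \<subseteq> fst a) B" using zw by (intro ev) auto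
    fix c :: complex and h :: "complex \<Rightarrow> complex" assume h: "continuous_on (cball 0 1) h"
    have "((\<lambda>a. c * G a (s, z, w, h)) \<longlongrightarrow> c * \<xi> s z w h) B"
      by (intro tendsto_intros tend)
    moreover have "eventually (\<lambda>a. c * G a (s, z, w, h) = G a (s, z, w, \<lambda>\<alpha>. c * h \<alpha>)) B"
      using e by (rule eventually_mono)
        (use h in \<open>simp add: Gval continuous_on_mult sum_distrib_left mult_ac\<close>)
    ultimately have "((\<lambda>a. G a (s, z, w, \<lambda>\<alpha>. c * h \<alpha>)) \<longlongrightarrow> c * \<xi> s z w h) B"
      by (rule Lim_transform_eventually)
    then show "\<xi> s z w (\<lambda>\<alpha>. c * h \<alpha>) = c * \<xi> s z w h"
      using tendsto_unique[OF B(2) tend] by blast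
  next
    have "cmod (\<xi> s z w h) \<le> \<bar>(b z + b w) / 2\<bar> * (SUP \<alpha>\<in>cball 0 1. cmod (h \<alpha>))" if h: "continuous_on (cball 0 1) h" for h :: "complex \<Rightarrow> complex"
    proof -
      have "0 \<le> S h" unfolding S_def
        by (rule order_trans[OF norm_ge_zero cmod_le_SUP_disc[OF h, of 0]]) simp
      then show ?thesis using xR[of "(s, z, w, h)"] by (simp add: \<xi>_def R_def S_def)
    qed
    then show "\<exists>B. \<forall>h. continuous_on (cball 0 1) h \<longrightarrow> cmod (\<xi> s z w h) \<le> B * (SUP \<alpha>\<in>cball 0 1. cmod (h \<alpha>))"
      by blast
  qed
  have pos: "(\<Sum>i<N. \<Sum>j<N. \<xi> s (z i) (z j) (\<lambda>\<alpha>. h i \<alpha> * cnj (h j \<alpha>)) * c j * cnj (c i)) \<in> \<real>\<^sub>\<ge>\<^sub>0"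
    if z: "\<And>i. i < (N::nat) \<Longrightarrow> z i \<in> pentablock" and h: "\<And>i. i < N \<Longrightarrow> continuous_on (cball 0 1) (h i)" for N z c s
    and h :: "nat \<Rightarrow> complex \<Rightarrow> complex"
  proof (rule Lim_in_closed_set[OF closed_nonneg_Reals_complex _ B(2)])
    show "((\<lambda>a. \<Sum>i<N. \<Sum>j<N. G a (s, z i, z j, \<lambda>\<alpha>. h i \<alpha> * cnj (h j \<alpha>)) * c j * cnj (c i)) \<longlongrightarrow>
      (\<Sum>i<N. \<Sum>j<N. \<xi> s (z i) (z j) (\<lambda>\<alpha>. h i \<alpha> * cnj (h j \<alpha>)) * c j * cnj (c i))) B"
      by (intro tendsto_intros tend)
    have "eventually (\<lambda>a. good (fst a) \<and> z ` {..<N} \<subseteq> fst a) B" using z by (intro ev) auto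
    then show "eventually (\<lambda>a. (\<Sum>i<N. \<Sum>j<N. G a (s, z i, z j, \<lambda>\<alpha>. h i \<alpha> * cnj (h j \<alpha>)) * c j * cnj (c i)) \<in> \<real>\<^sub>\<ge>\<^sub>0) B"
    proof (rule eventually_mono)
      fix a :: "(complex ^ 3) set \<times> nat" assume a: "good (fst a) \<and> z ` {..<N} \<subseteq> fst a"
      have "(\<Sum>i<N. \<Sum>j<N. G a (s, z i, z j, \<lambda>\<alpha>. h i \<alpha> * cnj (h j \<alpha>)) * c j * cnj (c i)) =
        (\<Sum>i<N. \<Sum>j<N. \<Sum>m<L a. of_bool (tt a m = s) * ((g a m (z i) * h i (\<alpha> a m) * cnj (c i)) * cnj (g a m (z j) * h j (\<alpha> a m) * cnj (c j))))"
      proof (intro sum.cong refl)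
        fix i j assume ij: "i \<in> {..<N}" "j \<in> {..<N}"
        have "G a (s, z i, z j, \<lambda>\<alpha>. h i \<alpha> * cnj (h j \<alpha>)) = (\<Sum>m<L a. of_bool (tt a m = s) * (g a m (z i) * cnj (g a m (z j))) * (h i (\<alpha> a m) * cnj (h j (\<alpha> a m))))"
          by (rule Gval) (use a ij h in \<open>auto intro!: continuous_intros\<close>)
        then show "G a (s, z i, z j, \<lambda>\<alpha>. h i \<alpha> * cnj (h j \<alpha>)) * c j * cnj (c i) =
          (\<Sum>m<L a. of_bool (tt a m = s) * ((g a m (z i) * h i (\<alpha> a m) * cnj (c i)) * cnj (g a m (z j) * h j (\<alpha> a m) * cnj (c j))))"
          by (simp add: sum_distrib_left mult_ac)
      qed
      also have "\<dots> = (\<Sum>i<N. \<Sum>m<L a. \<Sum>j<N. of_bool (tt a m = s) * ((g a m (z i) * h i (\<alpha> a m) * cnj (c i)) * cnj (g a m (z j) * h j (\<alpha> a m) * cnj (c j))))"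
        by (intro sum.cong refl sum.swap)
      also have "\<dots> = (\<Sum>m<L a. \<Sum>i<N. \<Sum>j<N. of_bool (tt a m = s) * ((g a m (z i) * h i (\<alpha> a m) * cnj (c i)) * cnj (g a m (z j) * h j (\<alpha> a m) * cnj (c j))))"
        by (rule sum.swap)
      also have "\<dots> = (\<Sum>m<L a. of_bool (tt a m = s) * of_real ((cmod (\<Sum>i<N. g a m (z i) * h i (\<alpha> a m) * cnj (c i)))\<^sup>2))"
        by (simp only: complex_norm_square cnj_sum sum_product) (simp only: sum_distrib_left)
      also have "\<dots> \<in> \<real>\<^sub>\<ge>\<^sub>0"
        by (intro sum_in_nonneg_Reals) (auto simp: of_bool_def)
      finally show "(\<Sum>i<N. \<Sum>j<N. G a (s, z i, z j, \<lambda>\<alpha>. h i \<alpha> * cnj (h j \<alpha>)) * c j * cnj (c i)) \<in> \<real>\<^sub>\<ge>\<^sub>0" .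
    qed
  qed
  have pk: "positive_kernel (\<xi> s)" for s
    unfolding positive_kernel_def using dual pos by blast
  \<comment> \<open>The third kind of test function is constant in \<alpha>, so its functional is
    needed only at the constant function 1, and that value is a scalar weak kernel.\<close>
  have wk: "weak_kernel (\<lambda>z w. \<xi> 2 z w (\<lambda>\<alpha>. 1))"
    unfolding weak_kernel_def
  proof (intro allI impI)
    fix N :: nat and z :: "nat \<Rightarrow> complex ^ 3" and c assume "\<forall>i<N. z i \<in> pentablock"
    then show "(\<Sum>i<N. \<Sum>j<N. \<xi> 2 (z i) (z j) (\<lambda>\<alpha>. 1) * c j * cnj (c i)) \<in> \<real>\<^sub>\<ge>\<^sub>0"
      using pos[of N z "\<lambda>i \<alpha>. 1" 2 c] by (simp add: continuous_on_const)
  qed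
  have main: "M z w = \<xi> 0 z w (\<lambda>\<alpha>. 1 - J_fun z \<alpha> * cnj (J_fun w \<alpha>)) +
              \<xi> 1 z w (\<lambda>\<alpha>. 1 - j_fun z \<alpha> * cnj (j_fun w \<alpha>)) +
              (1 - z $ 2 * cnj (w $ 2) / 4) * \<xi> 2 z w (\<lambda>\<alpha>. 1)" if zw: "z \<in> pentablock" "w \<in> pentablock" for z w
  proof -
    define H where "H = (\<lambda>s \<alpha>. 1 - test_fun s \<alpha> z * cnj (test_fun s \<alpha> w))"
    have Hc: "continuous_on (cball 0 1) (H s)" for s
      unfolding H_def by (intro continuous_intros continuous_on_test_fun zw)
    have e: "eventually (\<lambda>a. good (fst a) \<and> {z, w} \<subseteq> fst a) B" using zw by (intro ev) auto
    have "((\<lambda>a. \<Sum>s<3. G a (s, z, w, H s)) \<longlongrightarrow> (\<Sum>s<3. \<xi> s z w (H s))) B" by (intro tendsto_intros tend)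
    moreover have "eventually (\<lambda>a. (\<Sum>s<3. G a (s, z, w, H s)) = M z w + of_bool (z = w) * of_real (1 / (real (snd a) + 1))) B"
      using e
    proof (rule eventually_mono)
      fix a :: "(complex ^ 3) set \<times> nat" assume a: "good (fst a) \<and> {z, w} \<subseteq> fst a"
      have "(\<Sum>s<3. G a (s, z, w, H s)) = (\<Sum>s<3. \<Sum>m<L a. of_bool (tt a m = s) * (g a m z * cnj (g a m w)) * H s (\<alpha> a m))"
        using a Hc by (intro sum.cong refl Gval) auto
      also have "\<dots> = (\<Sum>m<L a. \<Sum>s<3. of_bool (tt a m = s) * (g a m z * cnj (g a m w)) * H s (\<alpha> a m))"
        by (rule sum.swap)
      also have "\<dots> = (\<Sum>m<L a. g a m z * cnj (g a m w) * H (tt a m) (\<alpha> a m))"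
      proof (intro sum.cong refl)
        fix m
        have "(\<Sum>s<3. of_bool (tt a m = s) * (g a m z * cnj (g a m w)) * H s (\<alpha> a m)) =
          (\<Sum>s<3. if s = tt a m then g a m z * cnj (g a m w) * H (tt a m) (\<alpha> a m) else 0)"
          by (intro sum.cong refl) auto
        then show "(\<Sum>s<3. of_bool (tt a m = s) * (g a m z * cnj (g a m w)) * H s (\<alpha> a m)) = g a m z * cnj (g a m w) * H (tt a m) (\<alpha> a m)"
          using tt(2)[of a m] by simp
      qed
      also have "\<dots> = M z w + of_bool (z = w) * of_real (1 / (real (snd a) + 1))"
        unfolding H_def tt using ident[of a z w] a by simp
      finally show "(\<Sum>s<3. G a (s, z, w, H s)) = M z w + of_bool (z = w) * of_real (1 / (real (snd a) + 1))" .
    qed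
    ultimately have 1: "((\<lambda>a. M z w + of_bool (z = w) * of_real (1 / (real (snd a) + 1))) \<longlongrightarrow> (\<Sum>s<3. \<xi> s z w (H s))) B"
      by (rule Lim_transform_eventually)
    have "(\<lambda>k. 1 / (real k + 1)) \<longlonglongrightarrow> 0" using LIMSEQ_inverse_real_of_nat by (simp add: inverse_eq_divide add.commute)
    then have "((\<lambda>a. 1 / (real (snd a) + 1)) \<longlongrightarrow> 0) A" unfolding A_def by (rule filterlim_compose) (rule filterlim_snd)
    then have "((\<lambda>a. 1 / (real (snd a) + 1)) \<longlongrightarrow> 0) B" using B(1) tendsto_mono by blast
    then have "((\<lambda>a. M z w + of_bool (z = w) * of_real (1 / (real (snd a) + 1))) \<longlongrightarrow> M z w + of_bool (z = w) * of_real 0) B"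
      by (intro tendsto_intros)
    with 1 have "(\<Sum>s<3. \<xi> s z w (H s)) = M z w" using tendsto_unique[OF B(2)] by fastforce
    moreover have "\<xi> 2 z w (H 2) = (1 - z $ 2 * cnj (w $ 2) / 4) * \<xi> 2 z w (\<lambda>\<alpha>. 1)"
    proof -
      have "\<forall>c h. continuous_on (cball 0 1) h \<longrightarrow> \<xi> 2 z w (\<lambda>\<alpha>. c * h \<alpha>) = c * \<xi> 2 z w h"
        using dual[OF zw, of 2] unfolding disc_dual_def by blast
      from this[rule_format, of "\<lambda>\<alpha>. 1" "1 - z $ 2 * cnj (w $ 2) / 4"]
      show ?thesis by (simp add: H_def test_fun_2 continuous_on_const)
    qed
    moreover have "H 0 = (\<lambda>\<alpha>. 1 - J_fun z \<alpha> * cnj (J_fun w \<alpha>))" "H 1 = (\<lambda>\<alpha>. 1 - j_fun z \<alpha> * cnj (j_fun w \<alpha>))"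
      by (simp_all add: H_def test_fun_def J_fun_def j_fun_def)
    ultimately show ?thesis by (simp add: numeral_3_eq_3 numeral_2_eq_2)
  qed
  show ?thesis using pk[of 0] pk[of 1] wk main by blast
qed

section \<open>From positive kernels to admissible kernels\<close>

lemma kform_sum: "kform F (\<lambda>p q. \<Sum>i\<in>I. Q i p q) x = (\<Sum>i\<in>I. kform F (Q i) x)"
proof (induction I rule: infinite_finite_induct)
  case (insert i I)
  then show ?case by (simp add: kform_add)
qed (simp_all add: kform_def)

text \<open>For \<open>R\<close> of rank one the product is \<open>Q\<close> with rescaled
  coefficients; the general case is a sum of these.\<close>

lemma kform_schur:
  assumes "finite F" "\<And>x. kform F Q x \<in> \<real>\<^sub>\<ge>\<^sub>0" "\<And>x. kform F R x \<in> \<real>\<^sub>\<ge>\<^sub>0"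
  shows "kform F (\<lambda>p q. Q p q * R p q) x \<in> \<real>\<^sub>\<ge>\<^sub>0"
proof -
  obtain S :: nat and g where g: "\<forall>z\<in>F. \<forall>w\<in>F. R z w = (\<Sum>s<S. g s z * cnj (g s w))"
    by (rule kform_decomposition[OF assms(1,3)])
  have "kform F (\<lambda>p q. Q p q * R p q) x = kform F (\<lambda>p q. \<Sum>s<S. Q p q * (g s p * cnj (g s q))) x"
    by (rule kform_cong) (simp_all add: g sum_distrib_left)
  also have "\<dots> = (\<Sum>s<S. kform F Q (\<lambda>p. g s p * x p))"
    unfolding kform_sum by (intro sum.cong refl) (simp add: kform_def mult_ac)
  finally show ?thesis using assms(2) by (simp add: sum_in_nonneg_Reals)
qed

lemma disc_dual_sum:
  assumes L: "disc_dual L" and f: "\<And>i. i \<in> I \<Longrightarrow> continuous_on (cball 0 1) (f i)"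
  shows "L (\<lambda>\<alpha>. \<Sum>i\<in>I. f i \<alpha>) = (\<Sum>i\<in>I. L (f i))"
proof -
  have scale: "L (\<lambda>\<alpha>. c * h \<alpha>) = c * L h" if "continuous_on (cball 0 1) h" for c h
    using L that unfolding disc_dual_def by blast
  have add: "L (\<lambda>\<alpha>. g \<alpha> + h \<alpha>) = L g + L h" if "continuous_on (cball 0 1) g" "continuous_on (cball 0 1) h" for g h
    using L that unfolding disc_dual_def by blast
  have zero: "L (\<lambda>\<alpha>. 0) = 0" using scale[of "\<lambda>\<alpha>. 0" 0] by (simp add: continuous_on_const)
  show ?thesis using f
  proof (induction I rule: infinite_finite_induct)
    case (insert i I)
    then show ?case by (simp add: add continuous_on_sum)
  qed (simp_all add: zero)
qed

lemma positive_kernel_kform: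
  assumes "positive_kernel \<xi>" "finite F" "F \<subseteq> pentablock" "\<And>p. p \<in> F \<Longrightarrow> continuous_on (cball 0 1) (h p)"
  shows "kform F (\<lambda>p q. \<xi> p q (\<lambda>\<alpha>. h p \<alpha> * cnj (h q \<alpha>))) x \<in> \<real>\<^sub>\<ge>\<^sub>0"
proof -
  obtain N and z :: "nat \<Rightarrow> complex ^ 3" where z: "bij_betw z {..<N} F"
    by (rule enumerate_finite[OF assms(2)])
  have zF: "\<forall>i<N. z i \<in> F" using z by (auto simp: bij_betw_def)
  have "\<forall>(N::nat) z h c. (\<forall>i<N. z i \<in> pentablock \<and> continuous_on (cball 0 1) (h i)) \<longrightarrow>
        (\<Sum>i<N. \<Sum>j<N. \<xi> (z i) (z j) (\<lambda>\<alpha>. h i \<alpha> * cnj (h j \<alpha>)) * c j * cnj (c i)) \<in> \<real>\<^sub>\<ge>\<^sub>0"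
    using assms(1) unfolding positive_kernel_def by blast
  from this[rule_format, of N z "\<lambda>i. h (z i)" "\<lambda>i. cnj (x (z i))"]
  have "(\<Sum>i<N. \<Sum>j<N. \<xi> (z i) (z j) (\<lambda>\<alpha>. h (z i) \<alpha> * cnj (h (z j) \<alpha>)) * cnj (x (z j)) * cnj (cnj (x (z i)))) \<in> \<real>\<^sub>\<ge>\<^sub>0"
    using zF assms(3,4) by blast
  then show ?thesis unfolding kform_enumerate[OF z] by (simp add: mult_ac)
qed

text \<open>A continuous function with values in the positive matrices is approximated uniformly by
  finite sums of positive constant matrices times squares of continuous functions.\<close>

lemma positive_kernel_matrix:
  assumes \<xi>: "positive_kernel \<xi>" and F: "finite F" "F \<subseteq> pentablock"
    and cont: "\<And>p q. p \<in> F \<Longrightarrow> q \<in> F \<Longrightarrow> continuous_on (cball 0 1) (V p q)"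
    and pos: "\<And>\<alpha> x. \<alpha> \<in> cball 0 1 \<Longrightarrow> kform F (\<lambda>p q. V p q \<alpha>) x \<in> \<real>\<^sub>\<ge>\<^sub>0"
  shows "kform F (\<lambda>p q. \<xi> p q (V p q)) x \<in> \<real>\<^sub>\<ge>\<^sub>0"
proof -
  have dual: "disc_dual (\<xi> p q)" if "p \<in> F" "q \<in> F" for p q
    using \<xi> that F unfolding positive_kernel_def by blast
  have "\<forall>p q. \<exists>B. p \<in> F \<and> q \<in> F \<longrightarrow> (\<forall>h. continuous_on (cball 0 1) h \<longrightarrow> cmod (\<xi> p q h) \<le> B * (SUP \<alpha>\<in>cball 0 1. cmod (h \<alpha>)))"
    using dual unfolding disc_dual_def by meson
  then obtain B where B: "\<And>p q h. p \<in> F \<Longrightarrow> q \<in> F \<Longrightarrow> continuous_on (cball 0 1) h \<Longrightarrow>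
      cmod (\<xi> p q h) \<le> B p q * (SUP \<alpha>\<in>cball 0 1. cmod (h \<alpha>))" by metis
  \<comment> \<open>Bounds the change of the form when every entry of \<open>V\<close> is altered by
    at most 1 in supremum norm.\<close>
  define C where "C = (\<Sum>p\<in>F. \<Sum>q\<in>F. \<bar>B p q\<bar> * cmod (x p) * cmod (x q))"
  have C0: "C \<ge> 0" unfolding C_def by (intro sum_nonneg) auto
  have approx: "\<exists>y\<in>\<real>\<^sub>\<ge>\<^sub>0. cmod (kform F (\<lambda>p q. \<xi> p q (V p q)) x - y) \<le> \<omega> * C" if \<omega>: "\<omega> > 0" for \<omega>
  proof -
    have "\<exists>d>0. \<forall>\<alpha>\<in>cball 0 1. \<forall>\<beta>\<in>cball 0 1. dist \<beta> \<alpha> < d \<longrightarrow> dist (V p q \<beta>) (V p q \<alpha>) < \<omega>" if "p \<in> F" "q \<in> F" for p q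
      using compact_uniformly_continuous[OF cont[OF that] compact_cball] \<omega>
      unfolding uniformly_continuous_on_def by blast
    then obtain dd where dd: "\<And>p q. p \<in> F \<Longrightarrow> q \<in> F \<Longrightarrow> dd p q > 0"
      "\<And>p q \<alpha> \<beta>. p \<in> F \<Longrightarrow> q \<in> F \<Longrightarrow> \<alpha> \<in> cball 0 1 \<Longrightarrow> \<beta> \<in> cball 0 1 \<Longrightarrow> dist \<beta> \<alpha> < dd p q \<Longrightarrow> dist (V p q \<beta>) (V p q \<alpha>) < \<omega>"
      by metis
    define d where "d = Min (insert 1 ((\<lambda>(p, q). dd p q) ` (F \<times> F)))"
    have d: "d > 0" "\<And>p q. p \<in> F \<Longrightarrow> q \<in> F \<Longrightarrow> d \<le> dd p q"
      unfolding d_def using F(1) dd(1) by (auto intro!: Min_le)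
    have cov: "cball (0::complex) 1 \<subseteq> (\<Union>a\<in>cball 0 1. ball a d)" using d(1) by fastforce
    obtain T where T: "T \<subseteq> cball (0::complex) 1" "finite T" "cball 0 1 \<subseteq> (\<Union>a\<in>T. ball a d)"
      by (rule compactE_image[OF compact_cball, of "cball (0::complex) 1" "\<lambda>a. ball a d" 0 1]) (use cov in auto)
    \<comment> \<open>Tent functions supported in balls of radius \<open>d\<close>; divided by their
      sum they form a partition of unity on the disc.\<close>
    define \<tau> where "\<tau> = (\<lambda>a (\<alpha>::complex). max 0 (d - dist a \<alpha>))"
    define s where "s = (\<lambda>\<alpha>. \<Sum>a\<in>T. \<tau> a \<alpha>)"
    define u where "u = (\<lambda>a \<alpha>. \<tau> a \<alpha> / s \<alpha>)"
    have \<tau>0: "\<tau> a \<alpha> \<ge> 0" for a \<alpha> by (simp add: \<tau>_def)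
    have s: "s \<alpha> > 0" if "\<alpha> \<in> cball 0 1" for \<alpha>
    proof -
      obtain a where "a \<in> T" "dist a \<alpha> < d" using T(3) \<open>\<alpha> \<in> cball 0 1\<close> by (meson UN_E mem_ball subsetD)
      then show ?thesis unfolding s_def using T(2) \<tau>0 by (intro sum_pos2[of T a]) (auto simp: \<tau>_def)
    qed
    have u0: "u a \<alpha> \<ge> 0" if "\<alpha> \<in> cball 0 1" for a \<alpha> using \<tau>0 s[OF that] by (simp add: u_def)
    have u1: "(\<Sum>a\<in>T. u a \<alpha>) = 1" if "\<alpha> \<in> cball 0 1" for \<alpha>
      unfolding u_def sum_divide_distrib[symmetric] using s[OF that] by (simp add: s_def)
    have cont_u: "continuous_on (cball 0 1) (u a)" for a
    proof -
      have "continuous_on (cball 0 1) s" "continuous_on (cball 0 1) (\<tau> a)" unfolding s_def \<tau>_def by (intro continuous_intros)+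
      moreover have "\<forall>\<alpha>\<in>cball 0 1. s \<alpha> \<noteq> 0" using s by fastforce
      ultimately show ?thesis unfolding u_def by (intro continuous_on_divide)
    qed
    have "\<forall>a. \<exists>r. a \<in> cball 0 1 \<longrightarrow> (\<forall>p\<in>F. \<forall>q\<in>F. V p q a = (\<Sum>s<(fst r :: nat). snd r s p * cnj (snd r s q)))"
    proof
      fix a
      show "\<exists>r. a \<in> cball 0 1 \<longrightarrow> (\<forall>p\<in>F. \<forall>q\<in>F. V p q a = (\<Sum>s<(fst r :: nat). snd r s p * cnj (snd r s q)))"
      proof (cases "a \<in> cball 0 1")
        case True
        obtain S :: nat and g where "\<forall>z\<in>F. \<forall>w\<in>F. V z w a = (\<Sum>s<S. g s z * cnj (g s w))"
          by (rule kform_decomposition[OF F(1) pos[OF True]])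
        then show ?thesis by (intro exI[of _ "(S, g)"]) auto
      qed blast
    qed
    from choice[OF this] obtain r where r: "\<forall>a. a \<in> cball 0 1 \<longrightarrow> (\<forall>p\<in>F. \<forall>q\<in>F. V p q a = (\<Sum>s<(fst (r a) :: nat). snd (r a) s p * cnj (snd (r a) s q)))" ..
    \<comment> \<open>Square root of the partition function times a rank one vector of the positive
      matrix \<open>V\<close> at \<open>a\<close>: in this shape the products are what
      \<open>positive_kernel\<close> can be applied to.\<close>
    define h where "h = (\<lambda>a s p \<alpha>. complex_of_real (sqrt (u a \<alpha>)) * snd (r a) s p)"
    have conth: "continuous_on (cball 0 1) (h a s p)" for a s p
      unfolding h_def by (intro continuous_intros continuous_on_compose2[OF continuous_on_of_real] cont_u) auto
    define W where "W = (\<lambda>p q \<alpha>. \<Sum>a\<in>T. \<Sum>s<fst (r a). h a s p \<alpha> * cnj (h a s q \<alpha>))"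
    have W: "W p q \<alpha> = (\<Sum>a\<in>T. of_real (u a \<alpha>) * V p q a)" if "p \<in> F" "q \<in> F" "\<alpha> \<in> cball 0 1" for p q \<alpha>
      unfolding W_def
    proof (intro sum.cong refl)
      fix a assume "a \<in> T"
      then have a: "a \<in> cball 0 1" using T(1) by blast
      have "complex_of_real (sqrt (u a \<alpha>)) * of_real (sqrt (u a \<alpha>)) = of_real (u a \<alpha>)"
        unfolding of_real_mult[symmetric] using u0[OF that(3), of a] by simp
      then have "h a s p \<alpha> * cnj (h a s q \<alpha>) = of_real (u a \<alpha>) * (snd (r a) s p * cnj (snd (r a) s q))" for s
        unfolding h_def by (simp add: mult_ac)
      then show "(\<Sum>s<fst (r a). h a s p \<alpha> * cnj (h a s q \<alpha>)) = of_real (u a \<alpha>) * V p q a"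
        using r a that by (simp add: sum_distrib_left)
    qed
    have contW: "continuous_on (cball 0 1) (W p q)" for p q
      unfolding W_def by (intro continuous_intros conth)
    have close: "cmod (V p q \<alpha> - W p q \<alpha>) \<le> \<omega>" if pq: "p \<in> F" "q \<in> F" and \<alpha>: "\<alpha> \<in> cball 0 1" for p q \<alpha>
    proof -
      have "V p q \<alpha> = (\<Sum>a\<in>T. of_real (u a \<alpha>) * V p q \<alpha>)"
        unfolding sum_distrib_right[symmetric] of_real_sum[symmetric] u1[OF \<alpha>] by simp
      then have "V p q \<alpha> - W p q \<alpha> = (\<Sum>a\<in>T. of_real (u a \<alpha>) * (V p q \<alpha> - V p q a))"
        unfolding W[OF pq \<alpha>] by (simp add: right_diff_distrib sum_subtractf)
      also have "cmod \<dots> \<le> (\<Sum>a\<in>T. u a \<alpha> * \<omega>)"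
      proof (intro order_trans[OF norm_sum] sum_mono)
        fix a assume "a \<in> T"
        then have a: "a \<in> cball 0 1" using T(1) by blast
        show "cmod (of_real (u a \<alpha>) * (V p q \<alpha> - V p q a)) \<le> u a \<alpha> * \<omega>"
        proof (cases "dist a \<alpha> < d")
          case True
          then have "dist \<alpha> a < dd p q" using d(2)[OF pq] by (simp add: dist_commute)
          then have "cmod (V p q \<alpha> - V p q a) \<le> \<omega>"
            using dd(2)[OF pq a \<alpha>] by (simp add: dist_norm)
          then show ?thesis using u0[OF \<alpha>, of a] by (simp add: norm_mult mult_left_mono)
        next
          case False
          then have "u a \<alpha> = 0" by (simp add: u_def \<tau>_def)
          then show ?thesis by simp
        qed
      qed
      also have "\<dots> = \<omega>" unfolding sum_distrib_right[symmetric] u1[OF \<alpha>] by simp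
      finally show ?thesis .
    qed
    have "kform F (\<lambda>p q. \<xi> p q (W p q)) x = (\<Sum>a\<in>T. \<Sum>s<fst (r a). kform F (\<lambda>p q. \<xi> p q (\<lambda>\<alpha>. h a s p \<alpha> * cnj (h a s q \<alpha>))) x)"
    proof -
      have "kform F (\<lambda>p q. \<xi> p q (W p q)) x = kform F (\<lambda>p q. \<Sum>a\<in>T. \<Sum>s<fst (r a). \<xi> p q (\<lambda>\<alpha>. h a s p \<alpha> * cnj (h a s q \<alpha>))) x"
      proof (rule kform_cong)
        fix p q assume pq: "p \<in> F" "q \<in> F"
        show "\<xi> p q (W p q) = (\<Sum>a\<in>T. \<Sum>s<fst (r a). \<xi> p q (\<lambda>\<alpha>. h a s p \<alpha> * cnj (h a s q \<alpha>)))"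
          unfolding W_def
          by (subst disc_dual_sum[OF dual[OF pq]], intro continuous_intros conth, rule sum.cong[OF refl],
              subst disc_dual_sum[OF dual[OF pq]], intro continuous_intros conth, rule refl)
      qed (rule refl)
      then show ?thesis by (simp only: kform_sum)
    qed
    also have "\<dots> \<in> \<real>\<^sub>\<ge>\<^sub>0"
      by (intro sum_in_nonneg_Reals positive_kernel_kform \<xi> F conth)
    finally have y: "kform F (\<lambda>p q. \<xi> p q (W p q)) x \<in> \<real>\<^sub>\<ge>\<^sub>0" .
    have diff: "cmod (\<xi> p q (V p q) - \<xi> p q (W p q)) \<le> \<bar>B p q\<bar> * \<omega>" if pq: "p \<in> F" "q \<in> F" for p q
    proof -
      \<comment> \<open>The difference is written with the factor -1 to match the additivity and
        homogeneity in \<open>disc_dual\<close>.\<close>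
      let ?D = "\<lambda>\<alpha>. V p q \<alpha> + (-1) * W p q \<alpha>"
      have c: "continuous_on (cball 0 1) ?D" by (intro continuous_intros cont[OF pq] contW)
      have cm: "continuous_on (cball 0 1) (\<lambda>\<alpha>. (-1) * W p q \<alpha>)" by (intro continuous_intros contW)
      have "\<xi> p q ?D = \<xi> p q (V p q) + \<xi> p q (\<lambda>\<alpha>. (-1) * W p q \<alpha>)"
        by (rule dual[OF pq, unfolded disc_dual_def, THEN conjunct1, rule_format, OF conjI[OF cont[OF pq] cm]])
      also have "\<xi> p q (\<lambda>\<alpha>. (-1) * W p q \<alpha>) = (-1) * \<xi> p q (W p q)"
        by (rule dual[OF pq, unfolded disc_dual_def, THEN conjunct2, THEN conjunct1, rule_format, OF contW])
      finally have e: "\<xi> p q (V p q) - \<xi> p q (W p q) = \<xi> p q ?D" by simp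
      have S: "(SUP \<alpha>\<in>cball 0 1. cmod (?D \<alpha>)) \<le> \<omega>"
        by (intro cSUP_least) (use close[OF pq] in auto)
      have S0: "0 \<le> (SUP \<alpha>\<in>cball 0 1. cmod (?D \<alpha>))"
      proof (rule cSUP_upper2[of _ _ 0])
        show "bdd_above ((\<lambda>\<alpha>. cmod (?D \<alpha>)) ` cball 0 1)"
          by (rule bdd_aboveI2[of _ _ \<omega>]) (use close[OF pq] in auto)
      qed auto
      have "cmod (\<xi> p q ?D) \<le> B p q * (SUP \<alpha>\<in>cball 0 1. cmod (?D \<alpha>))" by (rule B[OF pq c])
      also have "\<dots> \<le> \<bar>B p q\<bar> * \<omega>" using S S0 by (intro mult_mono) auto
      finally show ?thesis unfolding e .
    qed
    have "cmod (kform F (\<lambda>p q. \<xi> p q (V p q)) x - kform F (\<lambda>p q. \<xi> p q (W p q)) x) \<le>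
      (\<Sum>p\<in>F. \<Sum>q\<in>F. \<omega> * (\<bar>B p q\<bar> * cmod (x p) * cmod (x q)))"
      unfolding kform_def sum_subtractf[symmetric]
    proof (intro order_trans[OF norm_sum] sum_mono)
      fix p q assume pq: "p \<in> F" "q \<in> F"
      have "cmod (\<xi> p q (V p q) * x p * cnj (x q) - \<xi> p q (W p q) * x p * cnj (x q)) = cmod (\<xi> p q (V p q) - \<xi> p q (W p q)) * (cmod (x p) * cmod (x q))"
        unfolding left_diff_distrib[symmetric] by (simp add: norm_mult)
      also have "\<dots> \<le> (\<bar>B p q\<bar> * \<omega>) * (cmod (x p) * cmod (x q))"
        by (intro mult_right_mono diff pq) auto
      finally show "cmod (\<xi> p q (V p q) * x p * cnj (x q) - \<xi> p q (W p q) * x p * cnj (x q)) \<le> \<omega> * (\<bar>B p q\<bar> * cmod (x p) * cmod (x q))"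
        by (simp add: mult_ac)
    qed
    also have "\<dots> = \<omega> * C" by (simp add: C_def sum_distrib_left)
    finally show ?thesis using y by blast
  qed
  have "kform F (\<lambda>p q. \<xi> p q (V p q)) x \<in> closure \<real>\<^sub>\<ge>\<^sub>0"
    unfolding closure_approachable
  proof (intro allI impI)
    fix e :: real assume e: "0 < e"
    have "e / (C + 1) * C < e" using e C0 by (simp add: field_simps)
    moreover obtain y where "y \<in> \<real>\<^sub>\<ge>\<^sub>0" "cmod (kform F (\<lambda>p q. \<xi> p q (V p q)) x - y) \<le> e / (C + 1) * C"
      using approx[of "e / (C + 1)"] e C0 by (auto simp: divide_pos_pos)
    ultimately show "\<exists>y\<in>\<real>\<^sub>\<ge>\<^sub>0. dist y (kform F (\<lambda>p q. \<xi> p q (V p q)) x) < e"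
      by (intro bexI[of _ y]) (auto simp: dist_norm norm_minus_commute)
  qed
  then show ?thesis by (simp add: closure_closed closed_nonneg_Reals_complex)
qed

text \<open>By linearity the scalar \<open>k p q\<close> moves inside the functionals, where it
  meets \<open>1 - h p * cnj (h q)\<close>. Admissibility says that this product is a positive
  matrix for every \<alpha>, so the first two summands fall to \<open>positive_kernel_matrix\<close>
  and the third to the Schur product.\<close>

lemma decomposition_imp_weak_kernel:
  assumes \<xi>: "positive_kernel \<xi>" and \<eta>: "positive_kernel \<eta>" and \<delta>: "weak_kernel \<delta>"
    and M: "\<And>z w. z \<in> pentablock \<Longrightarrow> w \<in> pentablock \<Longrightarrow> M z w =
              \<xi> z w (\<lambda>\<alpha>. 1 - J_fun z \<alpha> * cnj (J_fun w \<alpha>)) +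
              \<eta> z w (\<lambda>\<alpha>. 1 - j_fun z \<alpha> * cnj (j_fun w \<alpha>)) +
              (1 - z $ 2 * cnj (w $ 2) / 4) * \<delta> z w"
    and k: "k \<in> AK"
  shows "weak_kernel (\<lambda>z w. M z w * k z w)"
  unfolding weak_kernel_iff_kform
proof (intro allI impI)
  fix F x assume F: "finite F \<and> F \<subseteq> pentablock"
  define V where "V = (\<lambda>t p q \<alpha>. k p q * (1 - test_fun t \<alpha> p * cnj (test_fun t \<alpha> q)))"
  have cont0: "continuous_on (cball 0 1) (\<lambda>\<alpha>. 1 - test_fun t \<alpha> p * cnj (test_fun t \<alpha> q))" if "p \<in> F" "q \<in> F" for t p q
    using F that by (intro continuous_intros continuous_on_test_fun) auto
  have cont: "continuous_on (cball 0 1) (V t p q)" if "p \<in> F" "q \<in> F" for t p q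
    unfolding V_def by (intro continuous_on_mult continuous_on_const cont0 that)
  have AK: "kform F (\<lambda>z w. (1 - z $ 2 * cnj (w $ 2) / 4) * k z w) x \<in> \<real>\<^sub>\<ge>\<^sub>0"
    "\<alpha> \<in> cball 0 1 \<Longrightarrow> kform F (\<lambda>z w. (1 - psi \<alpha> z * cnj (psi \<alpha> w)) * k z w) x \<in> \<real>\<^sub>\<ge>\<^sub>0"
    "\<alpha> \<in> cball 0 1 \<Longrightarrow> kform F (\<lambda>z w. (1 - Phi \<alpha> (z $ 2) (z $ 3) * cnj (Phi \<alpha> (w $ 2) (w $ 3))) * k z w) x \<in> \<real>\<^sub>\<ge>\<^sub>0"
    for x \<alpha>
  proof -
    have w: "weak_kernel (\<lambda>z w. (1 - z $ 2 * cnj (w $ 2) / 4) * k z w)"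
      "\<alpha> \<in> cball 0 1 \<Longrightarrow> weak_kernel (\<lambda>z w. (1 - psi \<alpha> z * cnj (psi \<alpha> w)) * k z w)"
      "\<alpha> \<in> cball 0 1 \<Longrightarrow> weak_kernel (\<lambda>z w. (1 - Phi \<alpha> (z $ 2) (z $ 3) * cnj (Phi \<alpha> (w $ 2) (w $ 3))) * k z w)"
      using k unfolding AK_def by blast+
    show "kform F (\<lambda>z w. (1 - z $ 2 * cnj (w $ 2) / 4) * k z w) x \<in> \<real>\<^sub>\<ge>\<^sub>0"
      using w(1)[unfolded weak_kernel_iff_kform, rule_format, OF F] .
    show "kform F (\<lambda>z w. (1 - psi \<alpha> z * cnj (psi \<alpha> w)) * k z w) x \<in> \<real>\<^sub>\<ge>\<^sub>0" if "\<alpha> \<in> cball 0 1"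
      using w(2)[OF that, unfolded weak_kernel_iff_kform, rule_format, OF F] .
    show "kform F (\<lambda>z w. (1 - Phi \<alpha> (z $ 2) (z $ 3) * cnj (Phi \<alpha> (w $ 2) (w $ 3))) * k z w) x \<in> \<real>\<^sub>\<ge>\<^sub>0" if "\<alpha> \<in> cball 0 1"
      using w(3)[OF that, unfolded weak_kernel_iff_kform, rule_format, OF F] .
  qed
  have V: "kform F (\<lambda>p q. V t p q \<alpha>) x \<in> \<real>\<^sub>\<ge>\<^sub>0" if "\<alpha> \<in> cball 0 1" "t < 2" for t \<alpha> x
  proof -
    have "t = 0 \<or> t = 1" using that(2) by auto
    then show ?thesis using AK(2,3)[OF that(1), of x] by (auto simp: V_def test_fun_def mult.commute)
  qed
  have d: "kform F (\<lambda>p q. ((1 - p $ 2 * cnj (q $ 2) / 4) * k p q) * \<delta> p q) x \<in> \<real>\<^sub>\<ge>\<^sub>0"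
    by (rule kform_schur) (use F AK(1) \<delta> in \<open>auto simp: weak_kernel_iff_kform\<close>)
  have "kform F (\<lambda>z w. M z w * k z w) x = kform F (\<lambda>p q. (\<xi> p q (V 0 p q) + \<eta> p q (V 1 p q)) + 
    ((1 - p $ 2 * cnj (q $ 2) / 4) * k p q) * \<delta> p q) x"
  proof (rule kform_cong)
    fix p q assume pq: "p \<in> F" "q \<in> F"
    have dual: "disc_dual (\<xi> p q)" "disc_dual (\<eta> p q)" using \<xi> \<eta> pq F unfolding positive_kernel_def by blast+
    have scale: "L (\<lambda>\<alpha>. c * h \<alpha>) = c * L h" if "disc_dual L" "continuous_on (cball 0 1) h" for L c h
      using that unfolding disc_dual_def by blast
    have "\<xi> p q (V 0 p q) = k p q * \<xi> p q (\<lambda>\<alpha>. 1 - test_fun 0 \<alpha> p * cnj (test_fun 0 \<alpha> q))"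
      "\<eta> p q (V 1 p q) = k p q * \<eta> p q (\<lambda>\<alpha>. 1 - test_fun 1 \<alpha> p * cnj (test_fun 1 \<alpha> q))"
      unfolding V_def by (rule scale[OF dual(1) cont0[OF pq]], rule scale[OF dual(2) cont0[OF pq]])
    moreover have "p \<in> pentablock" "q \<in> pentablock" using pq F by auto
    ultimately show "M p q * k p q = (\<xi> p q (V 0 p q) + \<eta> p q (V 1 p q)) + 
      ((1 - p $ 2 * cnj (q $ 2) / 4) * k p q) * \<delta> p q"
      by (simp add: M test_fun_def J_fun_def j_fun_def algebra_simps)
  qed (rule refl)
  also have "\<dots> = kform F (\<lambda>p q. \<xi> p q (V 0 p q)) x + kform F (\<lambda>p q. \<eta> p q (V 1 p q)) x +
    kform F (\<lambda>p q. ((1 - p $ 2 * cnj (q $ 2) / 4) * k p q) * \<delta> p q) x"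
    by (simp only: kform_add)
  also have "\<dots> \<in> \<real>\<^sub>\<ge>\<^sub>0"
  proof (intro nonneg_Reals_add_I d)
    have F': "finite F" "F \<subseteq> pentablock" using F by auto
    show "kform F (\<lambda>p q. \<xi> p q (V 0 p q)) x \<in> \<real>\<^sub>\<ge>\<^sub>0"
      by (rule positive_kernel_matrix[OF \<xi> F' cont V]) simp_all
    show "kform F (\<lambda>p q. \<eta> p q (V 1 p q)) x \<in> \<real>\<^sub>\<ge>\<^sub>0"
      by (rule positive_kernel_matrix[OF \<eta> F' cont V]) simp_all
  qed
  finally show "kform F (\<lambda>z w. M z w * k z w) x \<in> \<real>\<^sub>\<ge>\<^sub>0" .
qed

section \<open>Transfer functions\<close>

locale ips =
  fixes H :: hspace
  assumes ips: "inner_product_space H"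
begin

lemma zero_mem [simp]: "0 \<in> hcarrier H"
  and add_mem [simp]: "x \<in> hcarrier H \<Longrightarrow> y \<in> hcarrier H \<Longrightarrow> x + y \<in> hcarrier H"
  and scale_mem [simp]: "x \<in> hcarrier H \<Longrightarrow> cscale c x \<in> hcarrier H"
  and inner_commute: "x \<in> hcarrier H \<Longrightarrow> y \<in> hcarrier H \<Longrightarrow> hinner H y x = cnj (hinner H x y)"
  and inner_add_left: "x \<in> hcarrier H \<Longrightarrow> y \<in> hcarrier H \<Longrightarrow> z \<in> hcarrier H \<Longrightarrow>
    hinner H (x + y) z = hinner H x z + hinner H y z"
  and inner_scale_left: "x \<in> hcarrier H \<Longrightarrow> y \<in> hcarrier H \<Longrightarrow> hinner H (cscale c x) y = c * hinner H x y"
  and inner_pos: "x \<in> hcarrier H \<Longrightarrow> x \<noteq> 0 \<Longrightarrow> 0 < Re (hinner H x x)"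
  subgoal by (rule ips[unfolded inner_product_space_def, THEN conjunct1, rule_format])
  subgoal by (rule ips[unfolded inner_product_space_def, THEN conjunct2, THEN conjunct1, rule_format])
  subgoal by (rule ips[unfolded inner_product_space_def, THEN conjunct2, THEN conjunct2, THEN conjunct1, rule_format])
  subgoal by (rule ips[unfolded inner_product_space_def, THEN conjunct2, THEN conjunct2, THEN conjunct2, THEN conjunct1, rule_format])
  subgoal by (rule ips[unfolded inner_product_space_def, THEN conjunct2, THEN conjunct2, THEN conjunct2, THEN conjunct2, THEN conjunct1, rule_format])
  subgoal by (rule ips[unfolded inner_product_space_def, THEN conjunct2, THEN conjunct2, THEN conjunct2, THEN conjunct2, THEN conjunct2, THEN conjunct1, rule_format])
  subgoal by (rule ips[unfolded inner_product_space_def, THEN conjunct2, THEN conjunct2, THEN conjunct2, THEN conjunct2, THEN conjunct2, THEN conjunct2, rule_format])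
  done

lemma cscale_zero: "cscale 0 x = 0"
  by (simp add: cscale_def fun_eq_iff)

lemma cscale_one: "cscale 1 x = x"
  by (simp add: cscale_def)

lemma diff_eq: "x - y = x + cscale (-1) y" for x y :: cseq
  by (simp add: cscale_def fun_eq_iff)

lemma diff_mem [simp]: "x \<in> hcarrier H \<Longrightarrow> y \<in> hcarrier H \<Longrightarrow> x - y \<in> hcarrier H"
  by (simp add: diff_eq)

lemma inner_zero_left [simp]: "y \<in> hcarrier H \<Longrightarrow> hinner H 0 y = 0"
  using inner_scale_left[of 0 y 0] by (simp add: cscale_zero)

lemma inner_add_right: "x \<in> hcarrier H \<Longrightarrow> y \<in> hcarrier H \<Longrightarrow> z \<in> hcarrier H \<Longrightarrow>
    hinner H z (x + y) = hinner H z x + hinner H z y"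
  using inner_commute[of "x + y" z] inner_commute[of x z] inner_commute[of y z] by (simp add: inner_add_left)

lemma inner_scale_right: "x \<in> hcarrier H \<Longrightarrow> y \<in> hcarrier H \<Longrightarrow> hinner H y (cscale c x) = cnj c * hinner H y x"
  using inner_commute[of "cscale c x" y] inner_commute[of x y] by (simp add: inner_scale_left)

lemma inner_zero_right [simp]: "y \<in> hcarrier H \<Longrightarrow> hinner H y 0 = 0"
  using inner_commute[of 0 y] by simp

lemma inner_self: assumes "x \<in> hcarrier H"
  shows "hinner H x x = of_real ((hnorm H x)\<^sup>2)" "0 \<le> hnorm H x"
proof -
  have "Re (hinner H x x) \<ge> 0" using inner_pos[OF assms] assms by (cases "x = 0") auto
  moreover have "Im (hinner H x x) = 0" using inner_commute[OF assms assms] by (simp add: complex_eq_iff)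
  ultimately show "hinner H x x = of_real ((hnorm H x)\<^sup>2)" "0 \<le> hnorm H x"
    by (simp_all add: hnorm_def complex_eq_iff)
qed

lemma hnorm_zero [simp]: "hnorm H 0 = 0"
  by (simp add: hnorm_def)

lemma hnorm_eq_0: "x \<in> hcarrier H \<Longrightarrow> hnorm H x = 0 \<Longrightarrow> x = 0"
  using inner_pos[of x] by (auto simp: hnorm_def)

lemma hnorm_scale: assumes "x \<in> hcarrier H" shows "hnorm H (cscale c x) = cmod c * hnorm H x"
proof -
  have "hinner H (cscale c x) (cscale c x) = of_real ((cmod c)\<^sup>2) * of_real ((hnorm H x)\<^sup>2)"
    using assms by (simp add: inner_scale_left inner_scale_right complex_norm_square inner_self(1)[symmetric] mult_ac del: of_real_power)
  then have "hnorm H (cscale c x) = sqrt ((cmod c)\<^sup>2 * (hnorm H x)\<^sup>2)" unfolding hnorm_def[of H "cscale c x"]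
    by (simp only: of_real_mult[symmetric] Re_complex_of_real)
  then show ?thesis using inner_self(2)[OF assms] by (simp add: real_sqrt_mult)
qed

lemma sum_mem: "(\<And>i. i \<in> I \<Longrightarrow> v i \<in> hcarrier H) \<Longrightarrow> (\<Sum>i\<in>I. v i) \<in> hcarrier H"
  by (induction I rule: infinite_finite_induct) auto

lemma inner_sum_left: "(\<And>i. i \<in> I \<Longrightarrow> v i \<in> hcarrier H) \<Longrightarrow> y \<in> hcarrier H \<Longrightarrow>
  hinner H (\<Sum>i\<in>I. v i) y = (\<Sum>i\<in>I. hinner H (v i) y)"
  by (induction I rule: infinite_finite_induct) (auto simp: inner_add_left sum_mem)

lemma inner_sum_right: "(\<And>i. i \<in> I \<Longrightarrow> v i \<in> hcarrier H) \<Longrightarrow> y \<in> hcarrier H \<Longrightarrow>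
  hinner H y (\<Sum>i\<in>I. v i) = (\<Sum>i\<in>I. hinner H y (v i))"
  by (induction I rule: infinite_finite_induct) (auto simp: inner_add_right sum_mem)

text \<open>Finitely many vectors of \<open>H\<close> are modelled by vectors of a finite
  dimensional coordinate space with the same Gram matrix, which reduces norm inequalities for their
  combinations to scalar ones.\<close>

lemma gram_decomposition:
  fixes v :: "nat \<Rightarrow> cseq"
  assumes v: "\<And>j. j < q \<Longrightarrow> v j \<in> hcarrier H"
  obtains S :: nat and p where "\<forall>c. (hnorm H (\<Sum>j<q. cscale (c j) (v j)))\<^sup>2 = (\<Sum>s<S. (cmod (\<Sum>j<q. c j * p s j))\<^sup>2)"
proof -
  define P where "P = (\<lambda>i j. hinner H (v j) (v i))"
  have comb: "hinner H (\<Sum>j<q. cscale (c j) (v j)) (\<Sum>j<q. cscale (d j) (v j)) = qform q P c d" for c d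
  proof -
    have "hinner H (\<Sum>j<q. cscale (c j) (v j)) (\<Sum>j<q. cscale (d j) (v j)) =
      (\<Sum>j<q. hinner H (cscale (c j) (v j)) (\<Sum>i<q. cscale (d i) (v i)))"
      by (rule inner_sum_left) (use v in \<open>auto intro: sum_mem\<close>)
    also have "\<dots> = (\<Sum>j<q. \<Sum>i<q. hinner H (cscale (c j) (v j)) (cscale (d i) (v i)))"
      by (intro sum.cong refl inner_sum_right) (use v in auto)
    also have "\<dots> = (\<Sum>j<q. \<Sum>i<q. P i j * c j * cnj (d i))"
      by (intro sum.cong refl) (use v in \<open>simp add: inner_scale_left inner_scale_right P_def mult_ac\<close>)
    also have "\<dots> = qform q P c d" unfolding qform_def by (rule sum.swap)
    finally show ?thesis .
  qed
  have mem: "(\<Sum>j<q. cscale (c j) (v j)) \<in> hcarrier H" for c by (rule sum_mem) (use v in auto)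
  have "psd q P" unfolding psd_def comb[symmetric] inner_self(1)[OF mem] nonneg_Reals_of_real_iff by simp
  then obtain S :: nat and p where p: "\<forall>i<q. \<forall>j<q. P i j = (\<Sum>s<S. p s i * cnj (p s j))"
    by (rule psd_decomposition)
  have key: "(hnorm H (\<Sum>j<q. cscale (c j) (v j)))\<^sup>2 = (\<Sum>s<S. (cmod (\<Sum>j<q. c j * cnj (p s j)))\<^sup>2)" for c
  proof -
    have "complex_of_real ((hnorm H (\<Sum>j<q. cscale (c j) (v j)))\<^sup>2) = qform q P c c"
      using comb inner_self(1)[OF mem] by metis
    also have "\<dots> = (\<Sum>i<q. \<Sum>j<q. \<Sum>s<S. (p s i * cnj (c i)) * (c j * cnj (p s j)))"
      unfolding qform_def by (intro sum.cong refl) (simp add: p sum_distrib_left sum_distrib_right mult_ac)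
    also have "\<dots> = (\<Sum>i<q. \<Sum>s<S. \<Sum>j<q. (p s i * cnj (c i)) * (c j * cnj (p s j)))"
      by (intro sum.cong refl sum.swap)
    also have "\<dots> = (\<Sum>s<S. \<Sum>i<q. \<Sum>j<q. (p s i * cnj (c i)) * (c j * cnj (p s j)))"
      by (rule sum.swap)
    also have "\<dots> = (\<Sum>s<S. cnj (\<Sum>j<q. c j * cnj (p s j)) * (\<Sum>j<q. c j * cnj (p s j)))"
      unfolding cnj_sum sum_product by (simp add: mult_ac)
    also have "\<dots> = of_real (\<Sum>s<S. (cmod (\<Sum>j<q. c j * cnj (p s j)))\<^sup>2)"
      unfolding of_real_sum complex_norm_square by (simp add: mult.commute)
    finally show ?thesis unfolding of_real_eq_iff .
  qed
  show ?thesis by (rule that, rule allI, rule key)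
qed

text \<open>Minkowski's inequality for finite sums, in coordinates for the two vectors.\<close>

lemma hnorm_triangle:
  assumes "x \<in> hcarrier H" "y \<in> hcarrier H"
  shows "hnorm H (x + y) \<le> hnorm H x + hnorm H y"
proof -
  define v where "v = (\<lambda>j::nat. if j = 0 then x else y)"
  have "v j \<in> hcarrier H" if "j < 2" for j using assms by (simp add: v_def)
  then obtain S :: nat and p where p: "\<forall>c. (hnorm H (\<Sum>j<2. cscale (c j) (v j)))\<^sup>2 = (\<Sum>s<S. (cmod (\<Sum>j<2. c j * p s j))\<^sup>2)"
    by (rule gram_decomposition)
  have e: "hnorm H (\<Sum>j<2. cscale (c j) (v j)) = L2_set (\<lambda>s. cmod (c 0 * p s 0 + c 1 * p s 1)) {..<S}" for c
  proof -
    have "0 \<le> hnorm H (\<Sum>j<2. cscale (c j) (v j))" by (intro inner_self(2) sum_mem) (use assms in \<open>auto simp: v_def\<close>)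
    then show ?thesis using p[rule_format, of c]
      by (simp add: L2_set_def numeral_2_eq_2 real_sqrt_unique[symmetric])
  qed
  have "hnorm H (x + y) = L2_set (\<lambda>s. cmod (p s 0 + p s 1)) {..<S}"
    using e[of "\<lambda>_. 1"] by (simp add: numeral_2_eq_2 v_def cscale_one)
  also have "\<dots> \<le> L2_set (\<lambda>s. cmod (p s 0) + cmod (p s 1)) {..<S}"
    by (intro L2_set_mono norm_triangle_ineq) auto
  also have "\<dots> \<le> L2_set (\<lambda>s. cmod (p s 0)) {..<S} + L2_set (\<lambda>s. cmod (p s 1)) {..<S}"
    by (rule L2_set_triangle_ineq)
  also have "L2_set (\<lambda>s. cmod (p s 0)) {..<S} = hnorm H x"
    using e[of "\<lambda>j. if j = 0 then 1 else 0"] by (simp add: numeral_2_eq_2 v_def cscale_one cscale_zero)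
  also have "L2_set (\<lambda>s. cmod (p s 1)) {..<S} = hnorm H y"
    using e[of "\<lambda>j. if j = 0 then 0 else 1"] by (simp add: numeral_2_eq_2 v_def cscale_one cscale_zero)
  finally show ?thesis .
qed

text \<open>A supremum of reals bounds its members only if the set is bounded above;
  \<open>B\<close> serves that purpose and does not appear in the result.\<close>

lemma op_norm_bound:
  assumes A: "\<And>x. x \<in> hcarrier H \<Longrightarrow> A x \<in> hcarrier H"
    and hom: "\<And>c x. x \<in> hcarrier H \<Longrightarrow> A (cscale c x) = cscale c (A x)"
    and B: "\<And>x. x \<in> hcarrier H \<Longrightarrow> hnorm H (A x) \<le> B * hnorm H x" and x: "x \<in> hcarrier H"
  shows "hnorm H (A x) \<le> op_norm H A * hnorm H x"
proof (cases "hnorm H x = 0")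
  case True
  then show ?thesis using B[OF x] by simp
next
  case False
  then have pos: "hnorm H x > 0" using inner_self(2)[OF x] by simp
  have bdd: "bdd_above ((\<lambda>x. hnorm H (A x)) ` {x \<in> hcarrier H. hnorm H x \<le> 1})"
  proof (rule bdd_aboveI2[of _ _ "\<bar>B\<bar>"])
    fix y assume y: "y \<in> {x \<in> hcarrier H. hnorm H x \<le> 1}"
    then have "hnorm H (A y) \<le> \<bar>B\<bar> * hnorm H y"
      using B[of y] mult_right_mono[OF abs_ge_self[of B] inner_self(2)[of y]] by simp
    also have "\<dots> \<le> \<bar>B\<bar> * 1" using y by (intro mult_left_mono) auto
    finally show "hnorm H (A y) \<le> \<bar>B\<bar>" by simp
  qed
  define y where "y = cscale (of_real (1 / hnorm H x)) x"
  have y: "y \<in> {x \<in> hcarrier H. hnorm H x \<le> 1}" using x pos by (simp add: y_def hnorm_scale norm_divide)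
  have "hnorm H (A y) \<le> op_norm H A" unfolding op_norm_def by (rule cSUP_upper[OF y bdd])
  moreover have "hnorm H (A y) = hnorm H (A x) / hnorm H x"
    using x A pos by (simp add: y_def hom hnorm_scale norm_divide)
  ultimately show ?thesis using pos by (simp add: field_simps)
qed

end

text \<open>The part of a functional calculus that is needed for the contractivity of the
  realization; it also covers evaluation at a point of the domain.\<close>

definition contractive_rep :: "hspace \<Rightarrow> ((complex ^ 3 \<Rightarrow> complex) \<Rightarrow> cseq \<Rightarrow> cseq) \<Rightarrow> bool" where
  "contractive_rep H \<Theta> \<longleftrightarrow> inner_product_space H \<and>
     (\<forall>f. holo_on f pentablock \<longrightarrow> (\<forall>x\<in>hcarrier H. \<Theta> f x \<in> hcarrier H) \<and>
        (\<forall>x\<in>hcarrier H. \<forall>y\<in>hcarrier H. \<Theta> f (x + y) = \<Theta> f x + \<Theta> f y)) \<and>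
     (\<forall>x\<in>hcarrier H. \<Theta> (\<lambda>z. 1) x = x) \<and>
     (\<forall>f g. holo_on f pentablock \<and> holo_on g pentablock \<longrightarrow>
        (\<forall>x\<in>hcarrier H. \<Theta> (\<lambda>z. f z + g z) x = \<Theta> f x + \<Theta> g x)) \<and>
     (\<forall>c f. holo_on f pentablock \<longrightarrow> (\<forall>x\<in>hcarrier H. \<Theta> (\<lambda>z. c * f z) x = cscale c (\<Theta> f x))) \<and>
     (\<forall>f g. holo_on f pentablock \<and> holo_on g pentablock \<longrightarrow>
        (\<forall>x\<in>hcarrier H. \<Theta> (\<lambda>z. f z * g z) x = \<Theta> f (\<Theta> g x))) \<and>
     (\<forall>f g. holo_on f pentablock \<and> holo_on g pentablock \<and> (\<forall>z\<in>pentablock. f z = g z) \<longrightarrow>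
        (\<forall>x\<in>hcarrier H. \<Theta> f x = \<Theta> g x)) \<and>
     (\<forall>t \<alpha>. \<forall>x\<in>hcarrier H. cmod \<alpha> \<le> 1 \<longrightarrow> hnorm H (\<Theta> (test_fun t \<alpha>) x) \<le> hnorm H x)"

locale crep = ips +
  fixes \<Theta> :: "(complex ^ 3 \<Rightarrow> complex) \<Rightarrow> cseq \<Rightarrow> cseq"
  assumes crep: "contractive_rep H \<Theta>"
begin

lemma rep_mem [simp]: "holo_on f pentablock \<Longrightarrow> x \<in> hcarrier H \<Longrightarrow> \<Theta> f x \<in> hcarrier H"
  and rep_vadd: "holo_on f pentablock \<Longrightarrow> x \<in> hcarrier H \<Longrightarrow> y \<in> hcarrier H \<Longrightarrow> \<Theta> f (x + y) = \<Theta> f x + \<Theta> f y"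
  and rep_one: "x \<in> hcarrier H \<Longrightarrow> \<Theta> (\<lambda>z. 1) x = x"
  and rep_add: "holo_on f pentablock \<Longrightarrow> holo_on g pentablock \<Longrightarrow> x \<in> hcarrier H \<Longrightarrow> \<Theta> (\<lambda>z. f z + g z) x = \<Theta> f x + \<Theta> g x"
  and rep_cmult: "holo_on f pentablock \<Longrightarrow> x \<in> hcarrier H \<Longrightarrow> \<Theta> (\<lambda>z. c * f z) x = cscale c (\<Theta> f x)"
  and rep_mult: "holo_on f pentablock \<Longrightarrow> holo_on g pentablock \<Longrightarrow> x \<in> hcarrier H \<Longrightarrow> \<Theta> (\<lambda>z. f z * g z) x = \<Theta> f (\<Theta> g x)"
  and rep_cong: "holo_on f pentablock \<Longrightarrow> holo_on g pentablock \<Longrightarrow> (\<And>z. z \<in> pentablock \<Longrightarrow> f z = g z) \<Longrightarrow> x \<in> hcarrier H \<Longrightarrow> \<Theta> f x = \<Theta> g x"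
  and rep_test: "cmod \<alpha> \<le> 1 \<Longrightarrow> x \<in> hcarrier H \<Longrightarrow> hnorm H (\<Theta> (test_fun t \<alpha>) x) \<le> hnorm H x"
  subgoal by (rule crep[unfolded contractive_rep_def, THEN conjunct2, THEN conjunct1, rule_format, THEN conjunct1, rule_format]) auto
  subgoal by (rule crep[unfolded contractive_rep_def, THEN conjunct2, THEN conjunct1, rule_format, THEN conjunct2, rule_format]) auto
  subgoal by (rule crep[unfolded contractive_rep_def, THEN conjunct2, THEN conjunct2, THEN conjunct1, rule_format]) auto
  subgoal by (rule crep[unfolded contractive_rep_def, THEN conjunct2, THEN conjunct2, THEN conjunct2, THEN conjunct1, rule_format]) auto
  subgoal by (rule crep[unfolded contractive_rep_def, THEN conjunct2, THEN conjunct2, THEN conjunct2, THEN conjunct2, THEN conjunct1, rule_format]) auto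
  subgoal by (rule crep[unfolded contractive_rep_def, THEN conjunct2, THEN conjunct2, THEN conjunct2, THEN conjunct2, THEN conjunct2, THEN conjunct1, rule_format]) auto
  subgoal by (rule crep[unfolded contractive_rep_def, THEN conjunct2, THEN conjunct2, THEN conjunct2, THEN conjunct2, THEN conjunct2, THEN conjunct2, THEN conjunct1, rule_format]) auto
  subgoal by (rule crep[unfolded contractive_rep_def, THEN conjunct2, THEN conjunct2, THEN conjunct2, THEN conjunct2, THEN conjunct2, THEN conjunct2, THEN conjunct2, rule_format]) auto
  done

lemma rep_const: "x \<in> hcarrier H \<Longrightarrow> \<Theta> (\<lambda>z. c) x = cscale c x"
  using rep_cmult[of "\<lambda>z. 1" x c] by (simp add: holo_on_const rep_one)

lemma rep_zero: "holo_on f pentablock \<Longrightarrow> \<Theta> f 0 = 0"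
  using rep_vadd[of f 0 0] by simp

lemma rep_vsum: "holo_on f pentablock \<Longrightarrow> (\<And>i. i \<in> I \<Longrightarrow> v i \<in> hcarrier H) \<Longrightarrow> \<Theta> f (\<Sum>i\<in>I. v i) = (\<Sum>i\<in>I. \<Theta> f (v i))"
  by (induction I rule: infinite_finite_induct) (auto simp: rep_vadd rep_zero sum_mem)

end

lemma crepI: "contractive_rep H \<Theta> \<Longrightarrow> crep H \<Theta>"
  by (simp add: crep_def ips_def crep_axioms_def contractive_rep_def)

section \<open>Matrices of functions and their feedback loops\<close>

text \<open>The unit ball of the matrix-valued Schur-Agler class, tested on all contractive
  representations at once. Rows are outputs and columns are inputs.\<close>

definition matrix_contraction :: "nat \<Rightarrow> nat \<Rightarrow> (nat \<Rightarrow> nat \<Rightarrow> complex ^ 3 \<Rightarrow> complex) \<Rightarrow> bool" where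
  "matrix_contraction p q W \<longleftrightarrow> (\<forall>i<p. \<forall>j<q. holo_on (W i j) pentablock) \<and>
     (\<forall>H \<Theta> v. contractive_rep H \<Theta> \<and> (\<forall>j<q. v j \<in> hcarrier H) \<longrightarrow>
        (\<Sum>i<p. (hnorm H (\<Sum>j<q. \<Theta> (W i j) (v j)))\<^sup>2) \<le> (\<Sum>j<q. (hnorm H (v j))\<^sup>2))"

text \<open>A contractive scalar matrix tensored with the identity of \<open>H\<close> is
  contractive: in the coordinates of \<open>gram_decomposition\<close> it acts on each coordinate
  separately.\<close>

lemma matrix_contraction_const:
  assumes "\<And>x. (\<Sum>i<p. (cmod (\<Sum>j<q. W i j * x j))\<^sup>2) \<le> (\<Sum>j<q. (cmod (x j))\<^sup>2)"
  shows "matrix_contraction p q (\<lambda>i j z. W i j)"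
  unfolding matrix_contraction_def
proof (intro conjI allI impI holo_on_const)
  fix H \<Theta> v assume a: "contractive_rep H \<Theta> \<and> (\<forall>j<q. v j \<in> hcarrier H)"
  interpret crep H \<Theta> using a by (intro crepI) simp
  have v: "\<And>j. j < q \<Longrightarrow> v j \<in> hcarrier H" using a by simp
  obtain S :: nat and p' where p: "\<forall>c. (hnorm H (\<Sum>j<q. cscale (c j) (v j)))\<^sup>2 = (\<Sum>s<S. (cmod (\<Sum>j<q. c j * p' s j))\<^sup>2)"
    by (rule gram_decomposition[OF v])
  have nv: "(hnorm H (v j))\<^sup>2 = (\<Sum>s<S. (cmod (p' s j))\<^sup>2)" if "j < q" for j
  proof -
    have "(\<Sum>k<q. cscale (of_bool (k = j)) (v k)) = (\<Sum>k<q. if k = j then v k else 0)"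
      by (intro sum.cong refl) (simp add: cscale_one cscale_zero)
    then have "(\<Sum>k<q. cscale (of_bool (k = j)) (v k)) = v j" using that by simp
    moreover have "(\<Sum>k<q. of_bool (k = j) * p' s k) = p' s j" for s
    proof -
      have "(\<Sum>k<q. of_bool (k = j) * p' s k) = (\<Sum>k<q. if k = j then p' s k else 0)" by (intro sum.cong) auto
      then show ?thesis using that by simp
    qed
    ultimately show ?thesis using p[rule_format, of "\<lambda>k. of_bool (k = j)"] by simp
  qed
  have "(\<Sum>i<p. (hnorm H (\<Sum>j<q. \<Theta> (\<lambda>z. W i j) (v j)))\<^sup>2) = (\<Sum>i<p. \<Sum>s<S. (cmod (\<Sum>j<q. W i j * p' s j))\<^sup>2)"
    using v by (simp add: rep_const p)
  also have "\<dots> = (\<Sum>s<S. \<Sum>i<p. (cmod (\<Sum>j<q. W i j * p' s j))\<^sup>2)" by (rule sum.swap)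
  also have "\<dots> \<le> (\<Sum>s<S. \<Sum>j<q. (cmod (p' s j))\<^sup>2)" by (intro sum_mono assms)
  also have "\<dots> = (\<Sum>j<q. \<Sum>s<S. (cmod (p' s j))\<^sup>2)" by (rule sum.swap)
  also have "\<dots> = (\<Sum>j<q. (hnorm H (v j))\<^sup>2)" by (intro sum.cong) (simp_all add: nv)
  finally show "(\<Sum>i<p. (hnorm H (\<Sum>j<q. \<Theta> (\<lambda>z. W i j) (v j)))\<^sup>2) \<le> (\<Sum>j<q. (hnorm H (v j))\<^sup>2)" .
qed

text \<open>The one dimensional Hilbert space; evaluation at a point of the pentablock acts on it by
  scalars.\<close>

definition line_space :: hspace where
  "line_space = \<lparr>hcarrier = {x. \<forall>i\<ge>1. x i = 0}, hinner = (\<lambda>x y. x 0 * cnj (y 0))\<rparr>"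

lemma evaluation_rep:
  assumes "z \<in> pentablock" shows "contractive_rep line_space (\<lambda>f. cscale (f z))"
proof -
  have nz: "x 0 \<noteq> 0" if "\<forall>i\<ge>1. x i = 0" "x \<noteq> 0" for x :: cseq
  proof
    assume "x 0 = 0"
    then have "x i = 0" for i using that(1) by (cases "i = 0") auto
    then show False using that(2) by (auto simp: fun_eq_iff)
  qed
  have "0 < Re (x 0 * cnj (x 0))" if "\<forall>i\<ge>1. x i = 0" "x \<noteq> 0" for x :: cseq
    using nz[OF that] by (simp add: complex_norm_square[symmetric] del: of_real_power)
  then have "inner_product_space line_space"
    unfolding inner_product_space_def line_space_def by (simp add: cscale_def algebra_simps)
  moreover have "hnorm line_space (cscale (test_fun t \<alpha> z) x) \<le> hnorm line_space x" if "cmod \<alpha> \<le> 1" for t \<alpha> x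
  proof -
    have "hnorm line_space y = cmod (y 0)" for y
      by (simp add: hnorm_def line_space_def complex_norm_square[symmetric] del: of_real_power)
    then show ?thesis using test_fun_bound[OF assms that, of t] by (simp add: cscale_def norm_mult mult_left_le_one_le)
  qed
  ultimately show ?thesis using assms
    unfolding contractive_rep_def by (auto simp: line_space_def cscale_def algebra_simps fun_eq_iff)
qed

text \<open>Evaluation at \<open>z\<close> is a contractive representation, and a unit vector in
  input \<open>j\<close> isolates the column of the entry.\<close>

lemma matrix_contraction_bound:
  assumes "matrix_contraction p q W" "z \<in> pentablock" "i < p" "j < q"
  shows "cmod (W i j z) \<le> 1"
proof -
  interpret crep line_space "\<lambda>f. cscale (f z)" using evaluation_rep[OF assms(2)] by (rule crepI)
  define e :: cseq where "e = (\<lambda>i. of_bool (i = 0))"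
  define v where "v = (\<lambda>k. if k = j then e else 0)"
  have e: "e \<in> hcarrier line_space" by (auto simp: line_space_def e_def)
  have ne: "hnorm line_space (cscale c e) = cmod c" for c
    by (simp add: hnorm_def line_space_def e_def cscale_def complex_norm_square[symmetric] del: of_real_power)
  have v: "\<forall>k<q. v k \<in> hcarrier line_space" using e by (auto simp: v_def)
  have sv: "(\<Sum>k<q. cscale (W i k z) (v k)) = cscale (W i j z) e" for i
  proof -
    have "(\<Sum>k<q. cscale (W i k z) (v k)) = (\<Sum>k<q. if k = j then cscale (W i j z) e else 0)"
      by (intro sum.cong refl) (simp add: v_def, simp add: cscale_def fun_eq_iff)
    then show ?thesis using assms(4) by simp
  qed
  have "(\<Sum>i<p. (hnorm line_space (\<Sum>k<q. cscale (W i k z) (v k)))\<^sup>2) \<le> (\<Sum>k<q. (hnorm line_space (v k))\<^sup>2)"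
    using assms(1) v evaluation_rep[OF assms(2)] unfolding matrix_contraction_def by blast
  moreover have "(\<Sum>k<q. (hnorm line_space (v k))\<^sup>2) = 1"
  proof -
    have "(\<Sum>k<q. (hnorm line_space (v k))\<^sup>2) = (\<Sum>k<q. if k = j then 1 else 0)"
      using ne[of 1] by (intro sum.cong refl) (simp add: v_def cscale_one)
    then show ?thesis using assms(4) by simp
  qed
  ultimately have "(\<Sum>i<p. (cmod (W i j z))\<^sup>2) \<le> 1" unfolding sv ne by simp
  moreover have "(cmod (W i j z))\<^sup>2 \<le> (\<Sum>i<p. (cmod (W i j z))\<^sup>2)"
    by (rule member_le_sum) (use assms(3) in auto)
  ultimately have "(cmod (W i j z))\<^sup>2 \<le> 1\<^sup>2" by simp
  then show ?thesis by (rule power2_le_imp_le) simp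
qed

text \<open>Closing one feedback loop: the last output, multiplied with a test function, is fed back
  into the last input.\<close>

definition feedback :: "nat \<Rightarrow> nat \<Rightarrow> (complex ^ 3 \<Rightarrow> complex) \<Rightarrow> (nat \<Rightarrow> nat \<Rightarrow> complex ^ 3 \<Rightarrow> complex) \<Rightarrow> 
   nat \<Rightarrow> nat \<Rightarrow> complex ^ 3 \<Rightarrow> complex" where
  "feedback p q g W i j z = W i j z + W i q z * (g z / (1 - g z * W p q z) * W p j z)"

lemma feedback_denominator:
  assumes W: "matrix_contraction (Suc p) (Suc q) W" and "cmod \<alpha> \<le> 1" "z \<in> pentablock"
  shows "1 - test_fun t \<alpha> z * W p q z \<noteq> 0"
  using one_minus_mult_nonzero[of "W p q z" "test_fun t \<alpha> z"]
    matrix_contraction_bound[OF W assms(3), of p q] test_fun_bound[OF assms(3,2), of t] by (simp add: mult.commute)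

text \<open>An energy balance: contractivity of \<open>W\<close> bounds the outputs together with
  the last output \<open>y\<close> by the inputs together with the last input \<open>u\<close>, and
  \<open>u = \<Theta> g y\<close> is no longer than \<open>y\<close>, so both cancel.\<close>

lemma matrix_contraction_feedback:
  assumes W: "matrix_contraction (Suc p) (Suc q) W" and \<alpha>: "cmod \<alpha> \<le> 1"
  shows "matrix_contraction p q (feedback p q (test_fun t \<alpha>) W)"
proof -
  define g where "g = test_fun t \<alpha>"
  define h where "h = (\<lambda>z. g z / (1 - g z * W p q z))"
  have holW: "holo_on (W i j) pentablock" if "i < Suc p" "j < Suc q" for i j
    using W that unfolding matrix_contraction_def by blast
  have holg: "holo_on g pentablock" unfolding g_def by (rule holo_on_test_fun[OF \<alpha>])
  have nz: "1 - g z * W p q z \<noteq> 0" if "z \<in> pentablock" for z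
    unfolding g_def by (rule feedback_denominator[OF W \<alpha> that])
  have holh: "holo_on h pentablock" unfolding h_def
    by (intro holo_on_divide holg holo_on_diff holo_on_const holo_on_mult holW nz) auto
  have fb: "feedback p q g W i j = (\<lambda>z. W i j z + W i q z * (h z * W p j z))" for i j
    by (simp add: feedback_def h_def fun_eq_iff)
  show ?thesis unfolding matrix_contraction_def g_def[symmetric]
  proof (intro conjI allI impI)
    fix i j assume "i < p" "j < q"
    then show "holo_on (feedback p q g W i j) pentablock"
      unfolding fb by (intro holo_on_add holo_on_mult holW holh) auto
  next
    fix H \<Theta> v assume a: "contractive_rep H \<Theta> \<and> (\<forall>j<q. v j \<in> hcarrier H)"
    interpret crep H \<Theta> using a by (intro crepI) simp
    have v: "v j \<in> hcarrier H" if "j < q" for j using a that by simp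
    define y0 where "y0 = (\<Sum>j<q. \<Theta> (W p j) (v j))"
    define u where "u = \<Theta> h y0"
    define y where "y = y0 + \<Theta> (W p q) u"
    have y0: "y0 \<in> hcarrier H" unfolding y0_def by (rule sum_mem) (use v holW in auto)
    have u: "u \<in> hcarrier H" unfolding u_def using y0 holh by simp
    have y: "y \<in> hcarrier H" unfolding y_def using y0 u holW by simp
    have "u = \<Theta> g y"
    proof -
      \<comment> \<open>The loop equation \<open>h = g + g W\<^sub>p\<^sub>q h\<close> of functions,
        transported by the representation; in this way no operator has to be inverted.\<close>
      have "\<Theta> h y0 = \<Theta> (\<lambda>z. g z + g z * (W p q z * h z)) y0"
      proof (rule rep_cong[OF holh _ _ y0])
        show "holo_on (\<lambda>z. g z + g z * (W p q z * h z)) pentablock"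
          by (intro holo_on_add holg holo_on_mult holW holh) auto
        show "h z = g z + g z * (W p q z * h z)" if "z \<in> pentablock" for z
          using nz[OF that] by (simp add: h_def field_simps)
      qed
      also have "\<dots> = \<Theta> g y0 + \<Theta> g (\<Theta> (W p q) (\<Theta> h y0))"
        using y0 by (simp add: rep_add rep_mult holg holh holW holo_on_mult)
      also have "\<dots> = \<Theta> g y" unfolding y_def u_def using y0 holg holh holW by (simp add: rep_vadd)
      finally show ?thesis by (simp add: u_def)
    qed
    then have uy: "hnorm H u \<le> hnorm H y" using rep_test[OF \<alpha> y] by (simp add: g_def)
    define v' where "v' = v(q := u)"
    have v': "\<forall>j<Suc q. v' j \<in> hcarrier H" using v u by (auto simp: v'_def less_Suc_eq)
    have "(\<Sum>i<Suc p. (hnorm H (\<Sum>j<Suc q. \<Theta> (W i j) (v' j)))\<^sup>2) \<le> (\<Sum>j<Suc q. (hnorm H (v' j))\<^sup>2)"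
      using W v' a unfolding matrix_contraction_def by blast
    moreover have s: "(\<Sum>j<Suc q. \<Theta> (W i j) (v' j)) = (\<Sum>j<q. \<Theta> (W i j) (v j)) + \<Theta> (W i q) u" for i
      by (simp add: v'_def)
    moreover have "(\<Sum>j<Suc q. (hnorm H (v' j))\<^sup>2) = (\<Sum>j<q. (hnorm H (v j))\<^sup>2) + (hnorm H u)\<^sup>2"
      by (simp add: v'_def)
    ultimately have "(\<Sum>i<p. (hnorm H ((\<Sum>j<q. \<Theta> (W i j) (v j)) + \<Theta> (W i q) u))\<^sup>2) + (hnorm H y)\<^sup>2
      \<le> (\<Sum>j<q. (hnorm H (v j))\<^sup>2) + (hnorm H u)\<^sup>2"
      unfolding s by (simp add: y_def y0_def)
    moreover have "(hnorm H u)\<^sup>2 \<le> (hnorm H y)\<^sup>2" using uy inner_self(2)[OF u] by (intro power_mono)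
    moreover have "(\<Sum>j<q. \<Theta> (feedback p q g W i j) (v j)) = (\<Sum>j<q. \<Theta> (W i j) (v j)) + \<Theta> (W i q) u" if i: "i < p" for i
    proof -
      have "\<Theta> (feedback p q g W i j) (v j) = \<Theta> (W i j) (v j) + \<Theta> (W i q) (\<Theta> h (\<Theta> (W p j) (v j)))" if "j < q" for j
        unfolding fb using that i v by (simp add: rep_add rep_mult holh holW holo_on_mult)
      then have "(\<Sum>j<q. \<Theta> (feedback p q g W i j) (v j)) = (\<Sum>j<q. \<Theta> (W i j) (v j)) + (\<Sum>j<q. \<Theta> (W i q) (\<Theta> h (\<Theta> (W p j) (v j))))"
        by (simp add: sum.distrib)
      also have "(\<Sum>j<q. \<Theta> (W i q) (\<Theta> h (\<Theta> (W p j) (v j)))) = \<Theta> (W i q) (\<Sum>j<q. \<Theta> h (\<Theta> (W p j) (v j)))"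
        using i v by (intro rep_vsum[symmetric]) (auto simp: holh holW)
      also have "(\<Sum>j<q. \<Theta> h (\<Theta> (W p j) (v j))) = u" unfolding u_def y0_def
        using v by (intro rep_vsum[symmetric]) (auto simp: holh holW)
      finally show ?thesis .
    qed
    ultimately show "(\<Sum>i<p. (hnorm H (\<Sum>j<q. \<Theta> (feedback p q g W i j) (v j)))\<^sup>2) \<le> (\<Sum>j<q. (hnorm H (v j))\<^sup>2)"
      by simp
  qed
qed

text \<open>The last column of the relation \<open>X W = Y\<close> determines the product of the
  remaining row with that column as \<open>c (1 - g W\<^sub>p\<^sub>q)\<close>. This cancels the
  loop denominator, and the correction supplies exactly the term missing in the other
  columns.\<close>

lemma feedback_interpolation:
  assumes nz: "1 - g z * W p q z \<noteq> 0"
    and X: "X p = c * g z" and Y: "Y q = c"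
    and eq: "\<And>j. j < Suc q \<Longrightarrow> (\<Sum>i<Suc p. X i * W i j z) = Y j" and j: "j < q"
  shows "(\<Sum>i<p. X i * feedback p q g W i j z) = Y j"
proof -
  have "(\<Sum>i<p. X i * W i q z) = c * (1 - g z * W p q z)"
    using eq[of q] X Y by (simp add: algebra_simps)
  moreover have "(\<Sum>i<p. X i * W i j z) = Y j - c * g z * W p j z"
    using eq[of j] X j by (simp add: algebra_simps)
  moreover have "(\<Sum>i<p. X i * feedback p q g W i j z) = (\<Sum>i<p. X i * W i j z) + 
    (\<Sum>i<p. X i * W i q z) * (g z / (1 - g z * W p q z) * W p j z)"
    unfolding feedback_def distrib_left sum.distrib sum_distrib_right mult.assoc ..
  moreover have "c * (1 - g z * W p q z) * (g z / (1 - g z * W p q z) * W p j z) = c * g z * W p j z"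
    using nz by simp
  ultimately show ?thesis by simp
qed

text \<open>The open system maps the row \<open>(a, \<gamma> h)\<close> to
  \<open>(e, \<gamma>)\<close>, where \<open>h\<close> are the test functions. Each induction step
  closes the last loop and removes one pair of entries, until the row \<open>a\<close> is mapped to
  \<open>e\<close>. The hypotheses on \<open>W\<close> stand in the conclusion because
  \<open>W\<close> changes in each step.\<close>

lemma realization:
  assumes \<alpha>: "\<And>m. cmod (\<alpha> m) \<le> 1" and F: "F \<subseteq> pentablock"
  shows "\<lbrakk>matrix_contraction (p + L) (Suc L) W;
     \<And>z j. z \<in> F \<Longrightarrow> j < Suc L \<Longrightarrow>
       (\<Sum>i<p + L. (if i < p then a i z else \<gamma> (i - p) z * test_fun (t (i - p)) (\<alpha> (i - p)) z) * W i j z) =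
       (case j of 0 \<Rightarrow> e | Suc m \<Rightarrow> \<gamma> m z)\<rbrakk> \<Longrightarrow>
   \<exists>f. matrix_contraction p 1 (\<lambda>i j. f i) \<and> (\<forall>z\<in>F. (\<Sum>i<p. a i z * f i z) = e)"
proof (induction L arbitrary: W)
  case 0
  have "matrix_contraction p 1 (\<lambda>i j. W i 0)"
    using 0(1) unfolding matrix_contraction_def by simp
  moreover have "(\<Sum>i<p. a i z * W i 0 z) = e" if "z \<in> F" for z
    using 0(2)[OF that, of 0] by simp
  ultimately show ?case by (intro exI[of _ "\<lambda>i. W i 0"]) simp
next
  case (Suc L)
  let ?g = "test_fun (t L) (\<alpha> L)"
  let ?W = "feedback (p + L) (Suc L) ?g W"
  have W: "matrix_contraction (Suc (p + L)) (Suc (Suc L)) W" using Suc.prems(1) by simp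
  show ?case
  proof (rule Suc.IH)
    show "matrix_contraction (p + L) (Suc L) ?W" by (rule matrix_contraction_feedback[OF W \<alpha>])
    fix z j assume z: "z \<in> F" and j: "j < Suc L"
    define X where "X = (\<lambda>i. if i < p then a i z else \<gamma> (i - p) z * test_fun (t (i - p)) (\<alpha> (i - p)) z)"
    define Y where "Y = (\<lambda>j. case j of 0 \<Rightarrow> e | Suc m \<Rightarrow> \<gamma> m z)"
    have "(\<Sum>i<p + L. X i * ?W i j z) = Y j"
    proof (rule feedback_interpolation[of ?g z W "p + L" "Suc L" X "\<gamma> L z" Y j])
      show "1 - ?g z * W (p + L) (Suc L) z \<noteq> 0" using feedback_denominator[OF W \<alpha>] z F by blast
      show "X (p + L) = \<gamma> L z * ?g z" by (simp add: X_def)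
      show "Y (Suc L) = \<gamma> L z" by (simp add: Y_def)
      show "(\<Sum>i<Suc (p + L). X i * W i j z) = Y j" if "j < Suc (Suc L)" for j
        using Suc.prems(2)[OF z that] unfolding X_def Y_def by (simp only: add_Suc_right)
    qed (rule j)
    then show "(\<Sum>i<p + L. (if i < p then a i z else \<gamma> (i - p) z * test_fun (t (i - p)) (\<alpha> (i - p)) z) * ?W i j z) =
       (case j of 0 \<Rightarrow> e | Suc m \<Rightarrow> \<gamma> m z)" unfolding X_def Y_def .
  qed
qed

section \<open>From finite sets to a solution of the corona problem\<close>

lemma matrix_contraction_rows:
  assumes "matrix_contraction p q W" "p' \<le> p" shows "matrix_contraction p' q W"
  unfolding matrix_contraction_def
proof (intro conjI allI impI)
  show "holo_on (W i j) pentablock" if "i < p'" "j < q" for i j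
    using assms that unfolding matrix_contraction_def by simp
  fix H \<Theta> v assume a: "contractive_rep H \<Theta> \<and> (\<forall>j<q. v j \<in> hcarrier H)"
  have "(\<Sum>i<p'. (hnorm H (\<Sum>j<q. \<Theta> (W i j) (v j)))\<^sup>2) \<le> (\<Sum>i<p. (hnorm H (\<Sum>j<q. \<Theta> (W i j) (v j)))\<^sup>2)"
    using assms(2) by (intro sum_mono2) auto
  also have "\<dots> \<le> (\<Sum>j<q. (hnorm H (v j))\<^sup>2)" using assms(1) a unfolding matrix_contraction_def by blast
  finally show "(\<Sum>i<p'. (hnorm H (\<Sum>j<q. \<Theta> (W i j) (v j)))\<^sup>2) \<le> (\<Sum>j<q. (hnorm H (v j))\<^sup>2)" .
qed

text \<open>Sorting the certificate by sign equates two Gram matrices, and a contraction relating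
  the two families of rows is the open system of the realization.\<close>

lemma certified_imp_column:
  fixes \<phi> :: "nat \<Rightarrow> complex ^ 3 \<Rightarrow> complex" and n :: nat
  assumes F: "finite F" "F \<subseteq> pentablock" and \<delta>: "0 < \<delta>"
    and cert: "certified F (\<lambda>z w. (\<Sum>j=1..n. \<phi> j z * cnj (\<phi> j w)) - of_real (\<epsilon>\<^sup>2) + of_bool (z = w) * of_real \<delta>)"
  shows "\<exists>f. matrix_contraction n 1 (\<lambda>i j. f i) \<and> (\<forall>z\<in>F. cmod ((\<Sum>i<n. \<phi> (Suc i) z * f i z) - of_real \<epsilon>) \<le> sqrt \<delta>)"
proof -
  obtain L :: nat and g t \<alpha> where \<alpha>: "\<forall>m. \<alpha> m \<in> cball 0 1" and id: "\<forall>z\<in>F. \<forall>w\<in>F. 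
     (\<Sum>j=1..n. \<phi> j z * cnj (\<phi> j w)) - of_real (\<epsilon>\<^sup>2) + of_bool (z = w) * of_real \<delta> =
     (\<Sum>m<L. g m z * cnj (g m w) * (1 - test_fun (t m) (\<alpha> m) z * cnj (test_fun (t m) (\<alpha> m) w)))"
    using cert unfolding certified_def by blast
  obtain N and zz :: "nat \<Rightarrow> complex ^ 3" where zz: "bij_betw zz {..<N} F"
    by (rule enumerate_finite[OF F(1)])
  have zF: "zz k \<in> F" if "k < N" for k using zz that by (auto simp: bij_betw_def)
  have zinj: "zz k = zz l \<longleftrightarrow> k = l" if "k < N" "l < N" for k l
    using zz that by (auto simp: bij_betw_def inj_on_def)
  \<comment> \<open>The rows from \<open>n\<close> on represent \<delta> times the identity: the one
    numbered \<open>n + k\<close> is \<open>sqrt \<delta>\<close> at the point \<open>zz k\<close>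
    and 0 at the others, so at each point a single one of them is felt.\<close>
  define a where "a = (\<lambda>i z. if i < n then \<phi> (Suc i) z else of_real (sqrt \<delta>) * of_bool (z = zz (i - n)))"
  define p where "p = n + N"
  define X where "X = (\<lambda>k i. if i < p then a i (zz k) else g (i - p) (zz k) * test_fun (t (i - p)) (\<alpha> (i - p)) (zz k))"
  define Y where "Y = (\<lambda>k j. case j of 0 \<Rightarrow> complex_of_real \<epsilon> | Suc m \<Rightarrow> g m (zz k))"
  have gram: "(\<Sum>i<p + L. X k i * cnj (X l i)) = (\<Sum>j<Suc L. Y k j * cnj (Y l j))" if kl: "k < N" "l < N" for k l
  proof -
    have "(\<Sum>i<N. a (n + i) (zz k) * cnj (a (n + i) (zz l))) = (\<Sum>i<N. if i = k then of_bool (k = l) * of_real \<delta> else 0)"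
    proof (intro sum.cong refl)
      fix i assume "i \<in> {..<N}"
      moreover have "complex_of_real (sqrt \<delta>) * of_real (sqrt \<delta>) = of_real \<delta>"
        using \<delta> by (simp flip: of_real_mult)
      ultimately show "a (n + i) (zz k) * cnj (a (n + i) (zz l)) = (if i = k then of_bool (k = l) * of_real \<delta> else 0)"
        using kl by (auto simp: a_def zinj)
    qed
    also have "\<dots> = of_bool (zz k = zz l) * of_real \<delta>" using kl by (simp add: zinj)
    finally have d: "(\<Sum>i<N. a (n + i) (zz k) * cnj (a (n + i) (zz l))) = of_bool (zz k = zz l) * of_real \<delta>" .
    have "(\<Sum>i<p + L. X k i * cnj (X l i)) = (\<Sum>i<p. a i (zz k) * cnj (a i (zz l))) + 
      (\<Sum>m<L. g m (zz k) * test_fun (t m) (\<alpha> m) (zz k) * cnj (g m (zz l) * test_fun (t m) (\<alpha> m) (zz l)))"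
      unfolding sum_lessThan_add by (simp add: X_def)
    also have "(\<Sum>i<p. a i (zz k) * cnj (a i (zz l))) = (\<Sum>j=1..n. \<phi> j (zz k) * cnj (\<phi> j (zz l))) + of_bool (zz k = zz l) * of_real \<delta>"
      unfolding p_def sum_lessThan_add d by (simp add: a_def sum.atLeast1_atMost_eq)
    also have "\<dots> = of_real (\<epsilon>\<^sup>2) + (\<Sum>m<L. g m (zz k) * cnj (g m (zz l)) * (1 - test_fun (t m) (\<alpha> m) (zz k) * cnj (test_fun (t m) (\<alpha> m) (zz l))))"
      unfolding id[rule_format, OF zF[OF kl(1)] zF[OF kl(2)], symmetric] by simp
    also have "\<dots> + (\<Sum>m<L. g m (zz k) * test_fun (t m) (\<alpha> m) (zz k) * cnj (g m (zz l) * test_fun (t m) (\<alpha> m) (zz l))) =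
      of_real (\<epsilon>\<^sup>2) + (\<Sum>m<L. g m (zz k) * cnj (g m (zz l)))"
      unfolding add.assoc sum.distrib[symmetric] by (intro arg_cong2[of _ _ _ _ "(+)"] sum.cong refl) (simp add: algebra_simps)
    also have "\<dots> = (\<Sum>j<Suc L. Y k j * cnj (Y l j))"
      by (subst sum.lessThan_Suc_shift) (simp add: Y_def power2_eq_square)
    finally show ?thesis .
  qed
  have "\<exists>W. (\<forall>i<N. \<forall>b<Suc L. (\<Sum>a<p + L. X i a * W a b) = Y i b) \<and> 
    (\<forall>x. (\<Sum>a<p + L. (cmod (\<Sum>b<Suc L. W a b * x b))\<^sup>2) \<le> (\<Sum>b<Suc L. (cmod (x b))\<^sup>2))"
    by (rule isometry_extension[where N = N and p = "p + L" and q = "Suc L" and X = X and Y = Y, OF gram]) blast+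
  then obtain W where W: "\<forall>i<N. \<forall>b<Suc L. (\<Sum>a<p + L. X i a * W a b) = Y i b"
    "\<forall>x. (\<Sum>a<p + L. (cmod (\<Sum>b<Suc L. W a b * x b))\<^sup>2) \<le> (\<Sum>b<Suc L. (cmod (x b))\<^sup>2)" by blast
  have "\<exists>f. matrix_contraction p 1 (\<lambda>i j. f i) \<and> (\<forall>z\<in>F. (\<Sum>i<p. a i z * f i z) = of_real \<epsilon>)"
  proof (rule realization[of \<alpha> F p L "\<lambda>i j z. W i j" a g t])
    show "cmod (\<alpha> m) \<le> 1" for m using \<alpha> by simp
    show "matrix_contraction (p + L) (Suc L) (\<lambda>i j z. W i j)" by (rule matrix_contraction_const) (use W(2) in blast)
    fix z j assume z: "z \<in> F" and j: "j < Suc L"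
    obtain k where k: "k < N" "zz k = z" using zz z unfolding bij_betw_def by (metis imageE lessThan_iff)
    show "(\<Sum>i<p + L. (if i < p then a i z else g (i - p) z * test_fun (t (i - p)) (\<alpha> (i - p)) z) * W i j) =
       (case j of 0 \<Rightarrow> complex_of_real \<epsilon> | Suc m \<Rightarrow> g m z)"
      using W(1)[rule_format, OF k(1) j] unfolding X_def Y_def k(2) .
  qed (rule F(2))
  then obtain f where f: "matrix_contraction p 1 (\<lambda>i j. f i)" "\<And>z. z \<in> F \<Longrightarrow> (\<Sum>i<p. a i z * f i z) = of_real \<epsilon>" by blast
  have "cmod ((\<Sum>i<n. \<phi> (Suc i) z * f i z) - of_real \<epsilon>) \<le> sqrt \<delta>" if z: "z \<in> F" for z
  proof -
    obtain k where k: "k < N" "zz k = z" using zz z unfolding bij_betw_def by (metis imageE lessThan_iff)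
    have "(\<Sum>i<N. a (n + i) z * f (n + i) z) = (\<Sum>i<N. if i = k then of_real (sqrt \<delta>) * f (n + k) z else 0)"
      by (intro sum.cong refl) (use k zinj in \<open>auto simp: a_def\<close>)
    then have "(\<Sum>i<N. a (n + i) z * f (n + i) z) = of_real (sqrt \<delta>) * f (n + k) z" using k(1) by simp
    moreover have "(\<Sum>i<n. a i z * f i z) = (\<Sum>i<n. \<phi> (Suc i) z * f i z)" by (simp add: a_def)
    ultimately have "(\<Sum>i<n. \<phi> (Suc i) z * f i z) - of_real \<epsilon> = - (of_real (sqrt \<delta>) * f (n + k) z)"
      using f(2)[OF z] unfolding p_def sum_lessThan_add by (simp add: algebra_simps)
    moreover have "cmod (f (n + k) z) \<le> 1"
      using matrix_contraction_bound[OF f(1), of z "n + k" 0] z F(2) k(1) by (auto simp: p_def)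
    ultimately show ?thesis using \<delta> by (simp add: norm_mult mult_left_le)
  qed
  moreover have "matrix_contraction n 1 (\<lambda>i j. f i)" by (rule matrix_contraction_rows[OF f(1)]) (simp add: p_def)
  ultimately show ?thesis by blast
qed

section \<open>The functional calculus of a triple in the operator class\<close>

locale pent_calculus =
  fixes H T \<Theta>
  assumes hs: "hilbert_space H" and M: "M_class H T" and cal: "hol_calculus H T pentablock \<Theta>"
begin

sublocale ips H
  using hs by unfold_locales (simp add: hilbert_space_def)

lemma bop: "holo_on f pentablock \<Longrightarrow> bounded_op H (\<Theta> f)"
  and cone: "x \<in> hcarrier H \<Longrightarrow> \<Theta> (\<lambda>z. 1) x = x"
  and ccoord: "x \<in> hcarrier H \<Longrightarrow> \<Theta> (\<lambda>z. z $ i) x = T i x"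
  and cadd: "holo_on f pentablock \<and> holo_on g pentablock \<Longrightarrow> x \<in> hcarrier H \<Longrightarrow> \<Theta> (\<lambda>z. f z + g z) x = \<Theta> f x + \<Theta> g x"
  and ccmult: "holo_on f pentablock \<Longrightarrow> x \<in> hcarrier H \<Longrightarrow> \<Theta> (\<lambda>z. c * f z) x = cscale c (\<Theta> f x)"
  and cmult: "holo_on f pentablock \<and> holo_on g pentablock \<Longrightarrow> x \<in> hcarrier H \<Longrightarrow> \<Theta> (\<lambda>z. f z * g z) x = \<Theta> f (\<Theta> g x)"
  and climit: "(\<forall>m. holo_on (F m) pentablock) \<and> holo_on f pentablock \<and>
        (\<forall>K. compact K \<and> K \<subseteq> pentablock \<longrightarrow> uniform_limit K F f sequentially) \<Longrightarrow>
        (\<lambda>m. op_norm H (\<lambda>x. \<Theta> (F m) x - \<Theta> f x)) \<longlonglongrightarrow> 0"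
  using cal unfolding hol_calculus_def by (elim conjE; simp)+

lemma bop_mem: "holo_on f pentablock \<Longrightarrow> x \<in> hcarrier H \<Longrightarrow> \<Theta> f x \<in> hcarrier H"
  and bop_add: "holo_on f pentablock \<Longrightarrow> x \<in> hcarrier H \<Longrightarrow> y \<in> hcarrier H \<Longrightarrow> \<Theta> f (x + y) = \<Theta> f x + \<Theta> f y"
  and bop_scale: "holo_on f pentablock \<Longrightarrow> x \<in> hcarrier H \<Longrightarrow> \<Theta> f (cscale c x) = cscale c (\<Theta> f x)"
  and bop_bound: "holo_on f pentablock \<Longrightarrow> \<exists>B. \<forall>x\<in>hcarrier H. hnorm H (\<Theta> f x) \<le> B * hnorm H x"
  using bop[of f] unfolding bounded_op_def by simp_all

lemma difference_bound:
  assumes f: "holo_on f pentablock" and g: "holo_on g pentablock" and x: "x \<in> hcarrier H"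
  shows "hnorm H (\<Theta> f x - \<Theta> g x) \<le> op_norm H (\<lambda>x. \<Theta> f x - \<Theta> g x) * hnorm H x"
proof -
  obtain B C where BC: "\<And>x. x \<in> hcarrier H \<Longrightarrow> hnorm H (\<Theta> f x) \<le> B * hnorm H x"
    "\<And>x. x \<in> hcarrier H \<Longrightarrow> hnorm H (\<Theta> g x) \<le> C * hnorm H x" using bop_bound[OF f] bop_bound[OF g] by blast
  show ?thesis
  proof (rule op_norm_bound[of "\<lambda>x. \<Theta> f x - \<Theta> g x" "B + C", OF _ _ _ x])
    fix x assume x: "x \<in> hcarrier H"
    show "\<Theta> f x - \<Theta> g x \<in> hcarrier H" using bop_mem f g x by simp
    show "\<Theta> f (cscale c x) - \<Theta> g (cscale c x) = cscale c (\<Theta> f x - \<Theta> g x)" for c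
      using bop_scale f g x by (simp add: cscale_def fun_eq_iff algebra_simps)
    have "hnorm H (\<Theta> f x - \<Theta> g x) \<le> hnorm H (\<Theta> f x) + hnorm H (cscale (-1) (\<Theta> g x))"
      unfolding diff_eq using bop_mem f g x by (intro hnorm_triangle) auto
    also have "hnorm H (cscale (-1) (\<Theta> g x)) = hnorm H (\<Theta> g x)" using bop_mem g x by (simp add: hnorm_scale)
    finally show "hnorm H (\<Theta> f x - \<Theta> g x) \<le> (B + C) * hnorm H x" using add_mono[OF BC(1)[OF x] BC(2)[OF x]]
      unfolding distrib_right by linarith
  qed
qed

text \<open>Functions with equal values on the pentablock: the constant sequence \<open>f\<close>
  converges to \<open>g\<close> there, so continuity of the calculus makes the difference of the
  operators 0.\<close>

lemma calculus_cong:
  assumes f: "holo_on f pentablock" and g: "holo_on g pentablock" and eq: "\<And>z. z \<in> pentablock \<Longrightarrow> f z = g z"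
    and x: "x \<in> hcarrier H"
  shows "\<Theta> f x = \<Theta> g x"
proof -
  have "uniform_limit K (\<lambda>m. f) g sequentially" if "K \<subseteq> pentablock" for K
    using eq that by (auto intro!: uniform_limitI always_eventually simp: subset_iff)
  then have "(\<lambda>m. op_norm H (\<lambda>x. \<Theta> f x - \<Theta> g x)) \<longlonglongrightarrow> 0" using f g by (intro climit) auto
  then have "op_norm H (\<lambda>x. \<Theta> f x - \<Theta> g x) = 0" by (simp add: LIMSEQ_const_iff)
  then have "hnorm H (\<Theta> f x - \<Theta> g x) \<le> 0" using difference_bound[OF f g x] by simp
  moreover have m: "\<Theta> f x - \<Theta> g x \<in> hcarrier H" using bop_mem f g x by simp
  ultimately have "\<Theta> f x - \<Theta> g x = 0" using inner_self(2)[OF m] hnorm_eq_0[OF m] by simp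
  then show ?thesis by simp
qed

text \<open>The identities \<open>D (1 / D) = 1\<close> and \<open>(1 / D) D = 1\<close> hold on the
  pentablock and pass through the calculus, so the inverse function in the definitions of
  \<open>Phi_op\<close> and \<open>psi_op\<close> is the operator of \<open>1 / D\<close>.\<close>

lemma op_inverse_eq:
  assumes D: "holo_on D pentablock" and nz: "\<And>z. z \<in> pentablock \<Longrightarrow> D z \<noteq> 0"
    and A: "\<And>x. x \<in> hcarrier H \<Longrightarrow> A x = \<Theta> D x" and y: "y \<in> hcarrier H"
  shows "op_inverse H A y = \<Theta> (\<lambda>z. inverse (D z)) y"
proof -
  let ?R = "\<lambda>z. inverse (D z)"
  have R: "holo_on ?R pentablock" using D nz by (rule holo_on_inverse)
  have "\<Theta> (\<lambda>z. D z * ?R z) x = \<Theta> (\<lambda>z. 1) x" "\<Theta> (\<lambda>z. ?R z * D z) x = \<Theta> (\<lambda>z. 1) x" if "x \<in> hcarrier H" for x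
    using nz by (intro calculus_cong holo_on_mult holo_on_const D R that; simp)+
  then have inv: "\<Theta> D (\<Theta> ?R x) = x" "\<Theta> ?R (\<Theta> D x) = x" if "x \<in> hcarrier H" for x
    using that D R by (simp_all add: cmult cone)
  have "inj_on A (hcarrier H)"
    by (rule inj_onI) (metis A inv(2))
  moreover have "A (\<Theta> ?R y) = y" using A inv(1) y bop_mem[OF R y] by simp
  ultimately show ?thesis unfolding op_inverse_def using bop_mem[OF R y] by (metis inv_into_f_f)
qed

lemma calculus_norm_le:
  assumes f: "holo_on f pentablock" and A: "\<And>x. x \<in> hcarrier H \<Longrightarrow> A x = \<Theta> f x" and n: "op_norm H A \<le> 1"
    and x: "x \<in> hcarrier H"
  shows "hnorm H (\<Theta> f x) \<le> hnorm H x"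
proof -
  have "op_norm H A = op_norm H (\<Theta> f)" unfolding op_norm_def by (rule SUP_cong) (auto simp: A)
  moreover obtain B where "\<And>x. x \<in> hcarrier H \<Longrightarrow> hnorm H (\<Theta> f x) \<le> B * hnorm H x" using bop_bound[OF f] by blast
  then have "hnorm H (\<Theta> f x) \<le> op_norm H (\<Theta> f) * hnorm H x"
    using f x bop_mem bop_scale by (intro op_norm_bound) auto
  ultimately show ?thesis using n mult_right_mono[of "op_norm H (\<Theta> f)" 1 "hnorm H x"] inner_self(2)[OF x] by simp
qed

lemma calculus_lin: 
  assumes "x \<in> hcarrier H"
  shows "\<Theta> (\<lambda>z. c * z $ i) x = cscale c (T i x)" "T i x \<in> hcarrier H"
  using assms by (simp_all add: ccmult holo_on_nth ccoord bop_mem flip: ccoord)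

text \<open>The operators in \<open>M_class\<close> are the values of the calculus at the test
  functions, so its norm conditions are the contractivity asked of a representation.\<close>

lemma calculus_contractive:
  assumes \<alpha>: "cmod \<alpha> \<le> 1" and x: "x \<in> hcarrier H"
  shows "hnorm H (\<Theta> (test_fun t \<alpha>) x) \<le> hnorm H x"
proof -
  have Mn: "op_norm H (T 2) < 2" "op_norm H (Phi_op H \<alpha> (T 2) (T 3)) < 1" "op_norm H (psi_op H \<alpha> T) < 1"
    using M \<alpha> unfolding M_class_def by auto
  have hol: "holo_on (test_fun s \<alpha>) pentablock" for s by (rule holo_on_test_fun[OF \<alpha>])
  have hcz: "holo_on (\<lambda>z. c * z $ i) pentablock" for c i by (intro holo_on_mult holo_on_const holo_on_nth)
  have psi: "psi_op H \<alpha> T y = \<Theta> (test_fun 0 \<alpha>) y" if y: "y \<in> hcarrier H" for y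
  proof -
    let ?D = "\<lambda>z::complex^3. (1 + (- \<alpha>) * z $ 2) + \<alpha>\<^sup>2 * z $ 3"
    have D: "holo_on ?D pentablock" by (intro holo_on_add holo_on_const hcz)
    have nz: "?D z \<noteq> 0" if "z \<in> pentablock" for z using pentablock_denominators(3)[OF that \<alpha>] by simp
    have A: "psi_denom \<alpha> T x = \<Theta> ?D x" if "x \<in> hcarrier H" for x
    proof -
      have "\<Theta> ?D x = (x + cscale (- \<alpha>) (T 2 x)) + cscale (\<alpha>\<^sup>2) (T 3 x)"
        using that by (simp only: cadd holo_on_add holo_on_const hcz calculus_lin cone simp_thms)
      then show ?thesis by (simp add: psi_denom_def cscale_def fun_eq_iff)
    qed
    define R where "R = (\<lambda>z. inverse (?D z))"
    have R: "holo_on R pentablock" unfolding R_def using D nz by (rule holo_on_inverse)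
    define c where "c = (1 - complex_of_real ((cmod \<alpha>)\<^sup>2))"
    have "psi_op H \<alpha> T y = cscale c (T 1 (\<Theta> R y))"
      unfolding psi_op_def o_def c_def R_def using op_inverse_eq[of ?D "psi_denom \<alpha> T", OF D nz A y] by simp
    also have "\<dots> = \<Theta> (\<lambda>z. (c * z $ 1) * R z) y"
      using y R hcz by (simp add: cmult calculus_lin bop_mem)
    also have "\<dots> = \<Theta> (test_fun 0 \<alpha>) y"
      by (rule calculus_cong[OF holo_on_mult[OF hcz R] hol _ y]) (simp add: test_fun_def psi_def c_def R_def divide_inverse)
    finally show ?thesis .
  qed
  have Phi: "Phi_op H \<alpha> (T 2) (T 3) y = \<Theta> (test_fun 1 \<alpha>) y" if y: "y \<in> hcarrier H" for y
  proof -
    let ?D = "\<lambda>z::complex^3. 2 * 1 + (- \<alpha>) * z $ 2"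
    have D: "holo_on ?D pentablock" by (intro holo_on_add holo_on_const hcz)
    have nz: "?D z \<noteq> 0" if "z \<in> pentablock" for z using pentablock_denominators(2)[OF that \<alpha>] by simp
    have A: "cscale 2 x - cscale \<alpha> (T 2 x) = \<Theta> ?D x" if "x \<in> hcarrier H" for x
    proof -
      have "\<Theta> ?D x = \<Theta> (\<lambda>z. 2 * 1) x + \<Theta> (\<lambda>z. (- \<alpha>) * z $ 2) x"
        by (rule cadd[OF conjI[OF holo_on_const hcz] that])
      also have "\<Theta> (\<lambda>z. 2 * 1) x = cscale 2 x" using ccmult[of "\<lambda>z. 1" x 2] that by (simp add: holo_on_const cone)
      finally have "\<Theta> ?D x = cscale 2 x + cscale (- \<alpha>) (T 2 x)" unfolding calculus_lin(1)[OF that] .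
      then show ?thesis by (simp only:) (simp add: cscale_def fun_eq_iff)
    qed
    define R where "R = (\<lambda>z. inverse (?D z))"
    have R: "holo_on R pentablock" unfolding R_def using D nz by (rule holo_on_inverse)
    let ?N = "\<lambda>z::complex^3. (2 * \<alpha>) * z $ 3 + (-1) * z $ 2"
    have N: "holo_on ?N pentablock" by (intro holo_on_add hcz)
    have "Phi_op H \<alpha> (T 2) (T 3) y = cscale (2 * \<alpha>) (T 3 (\<Theta> R y)) - T 2 (\<Theta> R y)"
      unfolding Phi_op_def o_def R_def using op_inverse_eq[of ?D "\<lambda>x. cscale 2 x - cscale \<alpha> (T 2 x)", OF D nz A y] by simp
    also have "\<dots> = cscale (2 * \<alpha>) (T 3 (\<Theta> R y)) + cscale (-1) (T 2 (\<Theta> R y))" by (simp add: diff_eq)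
    also have "\<dots> = \<Theta> ?N (\<Theta> R y)"
      using y R by (simp only: cadd hcz calculus_lin bop_mem simp_thms)
    also have "\<dots> = \<Theta> (\<lambda>z. ?N z * R z) y" using N R y by (simp only: cmult simp_thms)
    also have "\<dots> = \<Theta> (test_fun 1 \<alpha>) y"
      by (rule calculus_cong[OF holo_on_mult[OF N R] hol _ y]) (simp add: test_fun_def Phi_def R_def divide_inverse)
    finally show ?thesis .
  qed
  have Z: "hnorm H (\<Theta> (test_fun 2 \<alpha>) x) \<le> hnorm H x"
  proof -
    have "\<Theta> (test_fun 2 \<alpha>) x = \<Theta> (\<lambda>z. (1/2) * z $ 2) x"
      by (rule calculus_cong[OF hol hcz _ x]) (simp add: test_fun_2)
    then have "\<Theta> (test_fun 2 \<alpha>) x = cscale (1/2) (T 2 x)" unfolding calculus_lin(1)[OF x] .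
    then have e: "hnorm H (\<Theta> (test_fun 2 \<alpha>) x) = hnorm H (T 2 x) / 2"
      using calculus_lin(2)[OF x] by (simp add: hnorm_scale norm_divide)
    have "op_norm H (T 2) = op_norm H (\<Theta> (\<lambda>z. z $ 2))" unfolding op_norm_def by (rule SUP_cong) (auto simp: ccoord)
    moreover obtain B where "\<And>x. x \<in> hcarrier H \<Longrightarrow> hnorm H (\<Theta> (\<lambda>z. z $ 2) x) \<le> B * hnorm H x"
      using bop_bound[OF holo_on_nth] by blast
    then have "hnorm H (\<Theta> (\<lambda>z. z $ 2) x) \<le> op_norm H (\<Theta> (\<lambda>z. z $ 2)) * hnorm H x"
      using x bop_mem[OF holo_on_nth] bop_scale[OF holo_on_nth] by (intro op_norm_bound) auto
    ultimately have "hnorm H (T 2 x) \<le> op_norm H (T 2) * hnorm H x" using x by (simp add: ccoord)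
    also have "\<dots> \<le> 2 * hnorm H x" using Mn(1) inner_self(2)[OF x] by (intro mult_right_mono) auto
    finally show ?thesis unfolding e by simp
  qed
  have "test_fun t \<alpha> = test_fun 0 \<alpha> \<or> test_fun t \<alpha> = test_fun 1 \<alpha> \<or> test_fun t \<alpha> = test_fun 2 \<alpha>"
    by (auto simp: test_fun_def fun_eq_iff)
  then show ?thesis
    using Z calculus_norm_le[OF hol psi _ x] calculus_norm_le[OF hol Phi _ x] Mn(2,3) by fastforce
qed

lemma calculus_rep: "contractive_rep H \<Theta>"
  unfolding contractive_rep_def
  using ips by (auto simp: bop_mem bop_add cone cadd ccmult cmult calculus_contractive intro: calculus_cong)

text \<open>The way in which the norm bounds of approximate solutions survive Montel's
  limit.\<close>

lemma calculus_tendsto: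
  assumes F: "\<And>m. holo_on (F m) pentablock" and f: "holo_on f pentablock"
    and lim: "\<And>K. compact K \<Longrightarrow> K \<subseteq> pentablock \<Longrightarrow> uniform_limit K F f sequentially" and x: "x \<in> hcarrier H"
  shows "(\<lambda>m. hnorm H (\<Theta> (F m) x)) \<longlonglongrightarrow> hnorm H (\<Theta> f x)"
proof -
  have "(\<lambda>m. op_norm H (\<lambda>x. \<Theta> (F m) x - \<Theta> f x)) \<longlonglongrightarrow> 0" using F f lim by (intro climit) auto
  then have "(\<lambda>m. op_norm H (\<lambda>x. \<Theta> (F m) x - \<Theta> f x) * hnorm H x) \<longlonglongrightarrow> 0 * hnorm H x"
    by (intro tendsto_intros)
  then have l: "(\<lambda>m. op_norm H (\<lambda>x. \<Theta> (F m) x - \<Theta> f x) * hnorm H x) \<longlonglongrightarrow> 0" by simp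
  have "norm (hnorm H (\<Theta> (F m) x) - hnorm H (\<Theta> f x)) \<le> op_norm H (\<lambda>x. \<Theta> (F m) x - \<Theta> f x) * hnorm H x" for m
  proof -
    let ?a = "\<Theta> (F m) x" and ?b = "\<Theta> f x"
    have m: "?a \<in> hcarrier H" "?b \<in> hcarrier H" using bop_mem F f x by auto
    have "hnorm H ((?a - ?b) + ?b) \<le> hnorm H (?a - ?b) + hnorm H ?b"
      by (rule hnorm_triangle) (use m in auto)
    moreover have "hnorm H (cscale (-1) (?a - ?b) + ?a) \<le> hnorm H (cscale (-1) (?a - ?b)) + hnorm H ?a"
      by (rule hnorm_triangle) (use m in auto)
    moreover have "(?a - ?b) + ?b = ?a" "cscale (-1) (?a - ?b) + ?a = ?b" by (simp_all add: cscale_def fun_eq_iff)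
    moreover have "hnorm H (cscale (-1) (?a - ?b)) = hnorm H (?a - ?b)" using m by (simp add: hnorm_scale)
    ultimately have "\<bar>hnorm H ?a - hnorm H ?b\<bar> \<le> hnorm H (?a - ?b)" by simp
    then show ?thesis using difference_bound[OF F[of m] f x] by simp
  qed
  then have "(\<lambda>m. hnorm H (\<Theta> (F m) x) - hnorm H (\<Theta> f x)) \<longlonglongrightarrow> 0"
    by (intro Lim_null_comparison[OF _ l] always_eventually allI)
  then show ?thesis by (simp add: LIM_zero_iff)
qed

end

section \<open>Passage to a solution on the whole domain\<close>

lemma certified_imp_corona:
  fixes \<phi> :: "nat \<Rightarrow> complex ^ 3 \<Rightarrow> complex" and n :: nat
  assumes cert: "\<And>F \<delta>. finite F \<Longrightarrow> F \<subseteq> pentablock \<Longrightarrow> 0 < \<delta> \<Longrightarrow>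
      certified F (\<lambda>z w. (\<Sum>j=1..n. \<phi> j z * cnj (\<phi> j w)) - of_real (\<epsilon>\<^sup>2) + of_bool (z = w) * of_real \<delta>)"
    and \<phi>: "\<And>j. j \<in> {1..n} \<Longrightarrow> continuous_on pentablock (\<phi> j)" and \<epsilon>: "0 < \<epsilon>"
  shows "\<exists>f. (\<forall>j\<in>{1..n}. f j \<in> Hinf pentablock) \<and> (\<lambda>j z. of_real \<epsilon> * f j z) \<in> SA n \<and>
           (\<forall>z\<in>pentablock. (\<Sum>j=1..n. \<phi> j z * f j z) = 1)"
proof -
  obtain Q where Q: "countable Q" "Q \<subseteq> pentablock" "pentablock \<subseteq> closure Q" by (rule separable)
  \<comment> \<open>Increasing finite sets that exhaust the dense set; the intersection gives
    \<open>F m \<subseteq> Q\<close> without a case distinction on \<open>Q\<close> being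
    empty.\<close>
  define F where "F = (\<lambda>m::nat. Q \<inter> from_nat_into Q ` {..m})"
  have F: "finite (F m)" "F m \<subseteq> pentablock" for m using Q(2) by (auto simp: F_def)
  \<comment> \<open>The square makes the error \<open>sqrt \<delta>\<close> equal to
    \<open>1 / (m + 1)\<close>.\<close>
  have "\<forall>m. \<exists>f. matrix_contraction n 1 (\<lambda>i j. f i) \<and>
    (\<forall>z\<in>F m. cmod ((\<Sum>i<n. \<phi> (Suc i) z * f i z) - of_real \<epsilon>) \<le> sqrt ((1 / (real m + 1))\<^sup>2))"
    by (intro allI certified_imp_column F cert) auto
  from choice[OF this] obtain f0 where f0: "\<And>m. matrix_contraction n 1 (\<lambda>i j. f0 m i)"
    "\<And>m z. z \<in> F m \<Longrightarrow> cmod ((\<Sum>i<n. \<phi> (Suc i) z * f0 m i z) - of_real \<epsilon>) \<le> 1 / (real m + 1)"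
    by auto
  \<comment> \<open>Continued by 0 beyond \<open>n\<close>, so that Montel's theorem applies with
    all naturals as index type.\<close>
  define G where "G = (\<lambda>m j z. if j < n then f0 m j z else 0)"
  have Ghol: "holo_on (G m j) pentablock" for m j
    using f0(1)[of m] unfolding matrix_contraction_def G_def by (cases "j < n") (auto simp: holo_on_const)
  have Gb: "cmod (G m j z) \<le> 1" if "z \<in> pentablock" for m j z
    using matrix_contraction_bound[OF f0(1) that, of j 0 m] by (simp add: G_def)
  obtain k f where k: "strict_mono (k :: nat \<Rightarrow> nat)" and fhol: "\<And>j. holo_on (f j) pentablock"
    and ul: "\<And>j K. compact K \<Longrightarrow> K \<subseteq> pentablock \<Longrightarrow> uniform_limit K (\<lambda>m. G (k m) j) (f j) sequentially"
    using montel_holo_on[of G pentablock 1, OF Ghol open_pentablock Gb] by metis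
  have pt: "(\<lambda>m. G (k m) j z) \<longlonglongrightarrow> f j z" if "z \<in> pentablock" for j z
    using ul[of "{z}" j] that by (simp add: tendsto_uniform_limitI)
  have fb: "cmod (f j z) \<le> 1" if "z \<in> pentablock" for j z
    by (rule tendsto_upperbound[OF tendsto_norm[OF pt[OF that]]]) (use Gb that in auto)
  define s where "s = (\<lambda>z. (\<Sum>i<n. \<phi> (Suc i) z * f i z))"
  have sQ: "s q = of_real \<epsilon>" if q: "q \<in> Q" for q
  proof -
    have qP: "q \<in> pentablock" using q Q by blast
    have "(\<lambda>m. (\<Sum>i<n. \<phi> (Suc i) q * G (k m) i q) - of_real \<epsilon>) \<longlonglongrightarrow> s q - of_real \<epsilon>"
      unfolding s_def by (intro tendsto_intros pt qP)
    moreover have "(\<lambda>m. (\<Sum>i<n. \<phi> (Suc i) q * G (k m) i q) - of_real \<epsilon>) \<longlonglongrightarrow> 0"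
    proof (rule Lim_null_comparison)
      have "(\<lambda>m. 1 / (real m + 1)) \<longlonglongrightarrow> 0" using LIMSEQ_inverse_real_of_nat by (simp add: inverse_eq_divide add.commute)
      then show "(\<lambda>m. 1 / (real (k m) + 1)) \<longlonglongrightarrow> 0" using LIMSEQ_subseq_LIMSEQ[OF _ k] by (simp add: o_def)
      have "q \<in> F (k m)" if "m \<ge> to_nat_on Q q" for m
      proof -
        have "to_nat_on Q q \<le> k m" using seq_suble[OF k, of m] that by simp
        then have "from_nat_into Q (to_nat_on Q q) \<in> from_nat_into Q ` {..k m}" by (intro imageI) simp
        then show ?thesis using q Q(1) by (simp add: F_def)
      qed
      moreover have "(\<Sum>i<n. \<phi> (Suc i) q * G m i q) = (\<Sum>i<n. \<phi> (Suc i) q * f0 m i q)" for m by (simp add: G_def)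
      ultimately show "\<forall>\<^sub>F m in sequentially. norm ((\<Sum>i<n. \<phi> (Suc i) q * G (k m) i q) - of_real \<epsilon>) \<le> 1 / (real (k m) + 1)"
        unfolding eventually_sequentially using f0(2) by (intro exI[of _ "to_nat_on Q q"]) simp
    qed
    ultimately show ?thesis using LIMSEQ_unique by fastforce
  qed
  have cs: "continuous_on pentablock s" unfolding s_def
    by (intro continuous_intros \<phi> holo_on_imp_continuous_on fhol) auto
  \<comment> \<open>The identity is known on the dense set \<open>Q\<close> only; continuity carries
    it to the whole pentablock.\<close>
  have sP: "s z = of_real \<epsilon>" if z: "z \<in> pentablock" for z
  proof -
    have "z \<in> closure Q" using Q(3) z by blast
    then obtain x where x: "\<forall>i. x i \<in> Q" "x \<longlonglongrightarrow> z" unfolding closure_sequential by blast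
    have "(\<lambda>i. s (x i)) \<longlonglongrightarrow> s z"
      by (rule continuous_on_tendsto_compose[OF cs x(2) z], rule always_eventually) (use x(1) Q(2) in blast)
    then show ?thesis using x(1) sQ by (simp add: LIMSEQ_const_iff)
  qed
  \<comment> \<open>Rows of a matrix contraction are numbered from 0, the functions of the corona
    problem from 1; the limit solves the problem with right hand side \<epsilon>, hence the
    division.\<close>
  define f' where "f' = (\<lambda>j z. of_real (1 / \<epsilon>) * f (j - 1) z)"
  have e: "(\<lambda>z. of_real \<epsilon> * f' j z) = f (j - 1)" for j
    using \<epsilon> by (simp add: f'_def fun_eq_iff)
  show ?thesis
  proof (intro exI[of _ f'] conjI ballI)
    fix j assume "j \<in> {1..n}"
    show "f' j \<in> Hinf pentablock" unfolding Hinf_def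
    proof (intro CollectI conjI)
      show "holo_on (f' j) pentablock" unfolding f'_def by (intro holo_on_mult holo_on_const fhol)
      show "bounded (f' j ` pentablock)"
        unfolding bounded_iff f'_def using fb \<epsilon> by (intro exI[of _ "1 / \<epsilon>"]) (auto simp: norm_mult norm_divide divide_right_mono)
    qed
  next
    fix z assume z: "z \<in> pentablock"
    have "(\<Sum>j=1..n. \<phi> j z * f' j z) = of_real (1 / \<epsilon>) * s z"
      unfolding s_def f'_def sum_distrib_left by (simp add: sum.atLeast1_atMost_eq mult_ac)
    then show "(\<Sum>j=1..n. \<phi> j z * f' j z) = 1" using sP[OF z] \<epsilon> by (simp flip: of_real_mult)
  next
    show "(\<lambda>j z. of_real \<epsilon> * f' j z) \<in> SA n"
      unfolding SA_def mem_Collect_eq e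
    proof (intro conjI ballI allI impI fhol)
      fix H T \<Theta> assume a: "hilbert_space H \<and> M_class H T \<and> hol_calculus H T pentablock \<Theta>"
      interpret pent_calculus H T \<Theta> using a by unfold_locales auto
      show "column_norm H n (\<lambda>i. \<Theta> (f (i - 1))) \<le> 1"
        unfolding column_norm_def
      proof (rule cSUP_least)
        have "0 \<in> {x \<in> hcarrier H. hnorm H x \<le> 1}" by simp
        then show "{x \<in> hcarrier H. hnorm H x \<le> 1} \<noteq> {}" by blast
        fix x assume x: "x \<in> {x \<in> hcarrier H. hnorm H x \<le> 1}"
        have "(\<lambda>m. \<Sum>i<n. (hnorm H (\<Theta> (G (k m) i) x))\<^sup>2) \<longlonglongrightarrow> (\<Sum>i<n. (hnorm H (\<Theta> (f i) x))\<^sup>2)"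
          using x by (intro tendsto_intros calculus_tendsto Ghol fhol ul) auto
        moreover have "(\<Sum>i<n. (hnorm H (\<Theta> (G (k m) i) x))\<^sup>2) \<le> 1" for m
        proof -
          have "(\<Sum>i<n. (hnorm H (\<Sum>j<(1::nat). \<Theta> (f0 (k m) i) x))\<^sup>2) \<le> (\<Sum>j<(1::nat). (hnorm H x)\<^sup>2)"
            by (rule f0(1)[of "k m", unfolded matrix_contraction_def, THEN conjunct2, rule_format, of H \<Theta> "\<lambda>_. x"])
              (use calculus_rep x in simp)
          moreover have "G (k m) i = f0 (k m) i" if "i < n" for i using that by (simp add: G_def)
          moreover have "(hnorm H x)\<^sup>2 \<le> 1" using x inner_self(2)[of x] by (simp add: power_le_one)
          ultimately show ?thesis by simp
        qed
        ultimately have "(\<Sum>i<n. (hnorm H (\<Theta> (f i) x))\<^sup>2) \<le> 1"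
          by (intro tendsto_upperbound[OF _ _ sequentially_bot]) auto
        then show "sqrt (\<Sum>i=1..n. (hnorm H (\<Theta> (f (i - 1)) x))\<^sup>2) \<le> 1"
          by (simp add: sum.atLeast1_atMost_eq)
      qed
    qed
  qed
qed

section \<open>From a solution of the corona problem to admissible kernels\<close>

text \<open>The reproducing kernel Hilbert space of a positive definite matrix \<open>K\<close>: its inner product
  has the Gram matrix \<open>K\<^sup>-\<^sup>1 = \<Sum>\<^sub>s e\<^sub>s e\<^sub>s\<^sup>*\<close>, and multiplication operators are diagonal.\<close>

locale finite_rkhs =
  fixes N :: nat and K :: "nat \<Rightarrow> nat \<Rightarrow> complex" and S :: nat and e :: "nat \<Rightarrow> nat \<Rightarrow> complex"
  assumes psd: "psd N K"
    and definite: "\<And>x i. qform N K x x = 0 \<Longrightarrow> i < N \<Longrightarrow> x i = 0"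
    and orthonormal: "\<forall>s<S. \<forall>t<S. qform N K (e s) (e t) = of_bool (s = t)"
    and basis: "\<forall>k<N. \<forall>y. qform N K (\<lambda>i. of_bool (i = k)) y =
       (\<Sum>s<S. qform N K (\<lambda>i. of_bool (i = k)) (e s) * qform N K (e s) y)"
begin

text \<open>The vectors \<open>KE s\<close> turn out to be an orthonormal basis of \<open>H\<close>,
  and \<open>co s x\<close> is the coefficient of \<open>x\<close> at \<open>KE s\<close>.\<close>

definition co :: "nat \<Rightarrow> cseq \<Rightarrow> complex" where "co s x = (\<Sum>i<N. cnj (e s i) * x i)"

definition KE :: "nat \<Rightarrow> nat \<Rightarrow> complex" where "KE s i = (\<Sum>j<N. K i j * e s j)"

definition H :: hspace where
  "H = \<lparr>hcarrier = {x. \<forall>i\<ge>N. x i = 0}, hinner = (\<lambda>x y. \<Sum>s<S. co s x * cnj (co s y))\<rparr>"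

definition dg :: "(nat \<Rightarrow> complex) \<Rightarrow> cseq \<Rightarrow> cseq" where "dg g x = (\<lambda>i. if i < N then g i * x i else 0)"

lemma mem_iff: "x \<in> hcarrier H \<longleftrightarrow> (\<forall>i\<ge>N. x i = 0)"
  by (simp add: H_def)

lemma co_add: "co s (x + y) = co s x + co s y"
  and co_diff: "co s (x - y) = co s x - co s y"
  and co_scale: "co s (cscale c x) = c * co s x"
  by (simp_all add: co_def cscale_def algebra_simps sum.distrib sum_subtractf sum_distrib_left)

lemma sum_delta: "k < N \<Longrightarrow> (\<Sum>i<N. of_bool (i = k) * f i) = f k" for f :: "nat \<Rightarrow> complex"
proof -
  assume k: "k < N"
  have "(\<Sum>i<N. of_bool (i = k) * f i) = (\<Sum>i<N. if i = k then f i else 0)" by (intro sum.cong) auto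
  then show ?thesis using k by simp
qed

lemma qform_e: "qform N K c (e s) = (\<Sum>j<N. c j * cnj (KE s j))"
proof -
  have "qform N K c (e s) = (\<Sum>j<N. \<Sum>i<N. K i j * c j * cnj (e s i))" unfolding qform_def by (rule sum.swap)
  also have "\<dots> = (\<Sum>j<N. c j * cnj (KE s j))"
  proof (intro sum.cong refl)
    fix j assume j: "j \<in> {..<N}"
    have "(\<Sum>i<N. K i j * c j * cnj (e s i)) = (\<Sum>i<N. c j * cnj (K j i * e s i))"
    proof (intro sum.cong refl)
      fix i assume "i \<in> {..<N}"
      then have "K i j = cnj (K j i)" using j psd_hermitian[OF psd, of j i] by simp
      then show "K i j * c j * cnj (e s i) = c j * cnj (K j i * e s i)" by simp
    qed
    then show "(\<Sum>i<N. K i j * c j * cnj (e s i)) = c j * cnj (KE s j)"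
      by (simp add: KE_def sum_distrib_left cnj_sum)
  qed
  finally show ?thesis .
qed

text \<open>The expansion of a unit vector holds modulo null vectors of the form; definiteness turns
  it into an identity of entries, which says that \<open>K\<close> times the sum of the
  \<open>e\<^sub>s e\<^sub>s\<^sup>*\<close> is the identity.\<close>

lemma resolution: assumes k: "k < N" and l: "l < N" shows "(\<Sum>s<S. KE s k * cnj (e s l)) = of_bool (k = l)"
proof -
  let ?d = "\<lambda>i. of_bool (i = k) :: complex"
  define r where "r = (\<lambda>i. ?d i - (\<Sum>s<S. qform N K ?d (e s) * e s i))"
  have "qform N K r y = 0" for y
    unfolding r_def qform_diff_left qform_sum_left qform_scale_left
    by (rule right_minus_eq[THEN iffD2, OF basis[rule_format, OF k]])
  then have "r l = 0" using definite l by blast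
  moreover have "qform N K ?d (e s) = cnj (KE s k)" for s unfolding qform_e by (rule sum_delta[OF k])
  ultimately have "(\<Sum>s<S. cnj (KE s k) * e s l) = of_bool (l = k)" by (simp add: r_def)
  then have "cnj (\<Sum>s<S. cnj (KE s k) * e s l) = of_bool (l = k)" by simp
  then show ?thesis by (simp add: cnj_sum eq_commute)
qed

lemma reconstruct: assumes "x \<in> hcarrier H" "k < N" shows "x k = (\<Sum>s<S. KE s k * co s x)"
proof -
  have "(\<Sum>s<S. KE s k * co s x) = (\<Sum>s<S. \<Sum>l<N. KE s k * cnj (e s l) * x l)"
    by (simp add: co_def sum_distrib_left mult.assoc)
  also have "\<dots> = (\<Sum>l<N. (\<Sum>s<S. KE s k * cnj (e s l)) * x l)"
    by (subst sum.swap) (simp add: sum_distrib_right)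
  also have "\<dots> = (\<Sum>l<N. of_bool (l = k) * x l)" by (intro sum.cong refl) (use assms resolution in auto)
  finally show ?thesis using sum_delta[OF assms(2)] by simp
qed

lemma co_KE: assumes "s < S" "t < S" shows "(\<Sum>i<N. cnj (e t i) * KE s i) = of_bool (s = t)"
proof -
  have "(\<Sum>i<N. cnj (e t i) * KE s i) = qform N K (e s) (e t)"
    unfolding qform_def KE_def sum_distrib_left by (simp add: mult_ac)
  then show ?thesis using orthonormal assms by simp
qed

lemma co_synthesis: assumes "t < S" shows "co t (\<lambda>i. if i < N then (\<Sum>s<S. KE s i * v s) else 0) = v t"
proof -
  have "co t (\<lambda>i. if i < N then (\<Sum>s<S. KE s i * v s) else 0) = (\<Sum>i<N. \<Sum>s<S. cnj (e t i) * KE s i * v s)"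
    unfolding co_def by (intro sum.cong) (auto simp: sum_distrib_left mult.assoc)
  also have "\<dots> = (\<Sum>s<S. (\<Sum>i<N. cnj (e t i) * KE s i) * v s)"
    by (subst sum.swap) (simp add: sum_distrib_right)
  also have "\<dots> = (\<Sum>s<S. if s = t then v s else 0)" by (intro sum.cong refl) (use assms co_KE in auto)
  finally show ?thesis using assms by simp
qed

lemma hnorm_H: "hnorm H x = L2_set (\<lambda>s. cmod (co s x)) {..<S}"
  unfolding hnorm_def H_def hspace.simps L2_set_def complex_norm_square[symmetric] Re_sum Re_complex_of_real ..

lemma hnorm_sq: "(hnorm H x)\<^sup>2 = (\<Sum>s<S. (cmod (co s x))\<^sup>2)"
  unfolding hnorm_H L2_set_def by (simp add: sum_nonneg)

lemma hnorm_nonneg: "0 \<le> hnorm H x"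
  unfolding hnorm_H by (rule L2_set_nonneg)

lemma co_le: "s < S \<Longrightarrow> cmod (co s x) \<le> hnorm H x"
  unfolding hnorm_H by (rule member_le_L2_set) auto

lemma inner_product: "inner_product_space H"
proof -
  have pos: "0 < Re (hinner H x x)" if x: "x \<in> hcarrier H" "x \<noteq> 0" for x
  proof (rule ccontr)
    assume "\<not> 0 < Re (hinner H x x)"
    then have "(\<Sum>s<S. (cmod (co s x))\<^sup>2) \<le> 0"
      unfolding H_def hspace.simps complex_norm_square[symmetric] Re_sum Re_complex_of_real by simp
    then have "hnorm H x = 0" unfolding hnorm_sq[symmetric] by simp
    then have "co s x = 0" if "s < S" for s using co_le[OF that, of x] by simp
    then have "x k = 0" for k using reconstruct[OF x(1), of k] x(1) by (cases "k < N") (auto simp: mem_iff)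
    then show False using x(2) by (auto simp: fun_eq_iff)
  qed
  show ?thesis unfolding inner_product_space_def
  proof (intro conjI allI ballI impI)
    fix x y assume "x \<in> hcarrier H" "y \<in> hcarrier H"
    show "hinner H y x = cnj (hinner H x y)" by (simp add: H_def cnj_sum mult.commute)
  qed (use pos in \<open>auto simp: mem_iff cscale_def\<close>,
       auto simp: H_def co_add co_scale[unfolded cscale_def] cscale_def sum.distrib sum_distrib_left algebra_simps)
qed

sublocale ips H by unfold_locales (rule inner_product)

lemma hilbert: "hilbert_space H"
  unfolding hilbert_space_def
proof (intro conjI allI impI inner_product)
  fix X assume X: "(\<forall>n. X n \<in> hcarrier H) \<and> (\<forall>e>0. \<exists>N::nat. \<forall>m\<ge>N. \<forall>n\<ge>N. hnorm H (X m - X n) < e)"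
  have "convergent (\<lambda>m. co s (X m))" if "s < S" for s
  proof (rule Cauchy_convergent, rule metric_CauchyI)
    fix \<epsilon> :: real assume "0 < \<epsilon>"
    then obtain M where M: "\<forall>m\<ge>M. \<forall>n\<ge>M. hnorm H (X m - X n) < \<epsilon>" using X by blast
    have "dist (co s (X m)) (co s (X n)) \<le> hnorm H (X m - X n)" for m n
      using co_le[OF that, of "X m - X n"] by (simp add: dist_norm co_diff)
    then show "\<exists>M. \<forall>m\<ge>M. \<forall>n\<ge>M. dist (co s (X m)) (co s (X n)) < \<epsilon>" using M le_less_trans by blast
  qed
  then obtain v where v: "\<And>s. s < S \<Longrightarrow> (\<lambda>m. co s (X m)) \<longlonglongrightarrow> v s" unfolding convergent_def by metis
  define x where "x = (\<lambda>i. if i < N then (\<Sum>s<S. KE s i * v s) else 0)"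
  have "(\<lambda>n. sqrt (\<Sum>s<S. (cmod (co s (X n) - v s))\<^sup>2)) \<longlonglongrightarrow> sqrt (\<Sum>s<S. (cmod (v s - v s))\<^sup>2)"
    by (intro tendsto_intros v) simp
  moreover have "hnorm H (X n - x) = sqrt (\<Sum>s<S. (cmod (co s (X n) - v s))\<^sup>2)" for n
    unfolding hnorm_H L2_set_def co_diff
    by (intro arg_cong[of _ _ sqrt] sum.cong refl) (simp add: x_def co_synthesis)
  ultimately have "(\<lambda>n. hnorm H (X n - x)) \<longlonglongrightarrow> 0" by simp
  moreover have "x \<in> hcarrier H" by (simp add: mem_iff x_def)
  ultimately show "\<exists>x\<in>hcarrier H. (\<lambda>n. hnorm H (X n - x)) \<longlonglongrightarrow> 0" by blast
next
  obtain Q where Q: "countable Q" "(UNIV :: complex set) \<subseteq> closure Q" using separable[of "UNIV :: complex set"] by metis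
  \<comment> \<open>Vectors with entries from a countable dense set, encoded by lists. Lists of any
    length are allowed, as only countability matters; the approximation uses one of length
    \<open>N\<close>.\<close>
  define D where "D = (\<lambda>l i. if i < N then (l ! i :: complex) else 0) ` lists Q"
  have "countable D" unfolding D_def by (intro countable_image countable_lists Q)
  moreover have "D \<subseteq> hcarrier H" by (auto simp: D_def mem_iff)
  moreover have "\<exists>d\<in>D. hnorm H (x - d) < \<epsilon>" if x: "x \<in> hcarrier H" and \<epsilon>: "0 < \<epsilon>" for x \<epsilon>
  proof -
    define C where "C = (\<Sum>s<S. \<Sum>i<N. cmod (e s i))"
    have C: "C \<ge> 0" unfolding C_def by (intro sum_nonneg) auto
    define \<delta> where "\<delta> = \<epsilon> / (C + 1)"
    have \<delta>: "\<delta> > 0" "\<delta> * C < \<epsilon>" using \<epsilon> C by (auto simp: \<delta>_def field_simps)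
    have "\<exists>q\<in>Q. dist q (x i) < \<delta>" for i using Q(2) \<delta>(1) closure_approachable[of "x i" Q] by blast
    then obtain q where q: "\<And>i. q i \<in> Q" "\<And>i. dist (q i) (x i) < \<delta>" by metis
    define d where "d = (\<lambda>i. if i < N then map q [0..<N] ! i else 0)"
    have "d \<in> D" unfolding D_def d_def by (rule imageI) (use q in auto)
    moreover have "hnorm H (x - d) \<le> \<delta> * C"
    proof -
      have "hnorm H (x - d) \<le> (\<Sum>s<S. cmod (co s (x - d)))" unfolding hnorm_H by (rule L2_set_le_sum) auto
      also have "\<dots> \<le> (\<Sum>s<S. \<Sum>i<N. \<delta> * cmod (e s i))"
        unfolding co_def
      proof (intro sum_mono order_trans[OF norm_sum])
        fix s i assume "i \<in> {..<N}"
        then have "cmod ((x - d) i) \<le> \<delta>" using q(2)[of i] by (simp add: d_def dist_norm norm_minus_commute)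
        then show "cmod (cnj (e s i) * (x - d) i) \<le> \<delta> * cmod (e s i)"
          unfolding norm_mult complex_mod_cnj by (subst mult.commute) (intro mult_right_mono, auto)
      qed
      also have "\<dots> = \<delta> * C" by (simp add: C_def sum_distrib_left)
      finally show ?thesis .
    qed
    ultimately show ?thesis using \<delta>(2) by (intro bexI[of _ d]) auto
  qed
  ultimately show "\<exists>D. countable D \<and> D \<subseteq> hcarrier H \<and> (\<forall>x\<in>hcarrier H. \<forall>e>0. \<exists>d\<in>D. hnorm H (x - d) < e)"
    by blast
qed

lemma dg_mem [simp]: "dg g x \<in> hcarrier H"
  by (simp add: mem_iff dg_def)

lemma dg_add: "dg g (x + y) = dg g x + dg g y"
  and dg_scale: "dg g (cscale c x) = cscale c (dg g x)"
  and dg_dg: "dg g (dg h x) = dg (\<lambda>i. g i * h i) x"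
  by (auto simp: dg_def cscale_def fun_eq_iff algebra_simps)

lemma dg_one: "x \<in> hcarrier H \<Longrightarrow> dg (\<lambda>i. 1) x = x"
  by (auto simp: dg_def mem_iff fun_eq_iff)

lemma dg_cong: "(\<And>i. i < N \<Longrightarrow> g i = h i) \<Longrightarrow> dg g x = dg h x"
  by (auto simp: dg_def fun_eq_iff)

text \<open>A crude constant from passing to coordinates and back. It serves boundedness and norm
  continuity; the sharp bounds come from \<open>dg_contraction\<close>.\<close>

definition CC :: real where "CC = (\<Sum>s<S. \<Sum>i<N. cmod (e s i) * (\<Sum>t<S. cmod (KE t i)))"

lemma CC_nonneg: "CC \<ge> 0"
  unfolding CC_def by (intro sum_nonneg mult_nonneg_nonneg) auto

lemma dg_bound:
  assumes "x \<in> hcarrier H" "\<And>i. i < N \<Longrightarrow> cmod (g i) \<le> b" "0 \<le> b"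
  shows "hnorm H (dg g x) \<le> (b * CC) * hnorm H x"
proof -
  have xk: "cmod (x i) \<le> (\<Sum>t<S. cmod (KE t i)) * hnorm H x" if "i < N" for i
    unfolding reconstruct[OF assms(1) that] sum_distrib_right norm_mult[symmetric]
    by (intro order_trans[OF norm_sum] sum_mono) (auto simp: norm_mult intro!: mult_left_mono co_le)
  have "hnorm H (dg g x) \<le> (\<Sum>s<S. cmod (co s (dg g x)))" unfolding hnorm_H by (rule L2_set_le_sum) auto
  also have "\<dots> \<le> (\<Sum>s<S. \<Sum>i<N. b * (cmod (e s i) * (\<Sum>t<S. cmod (KE t i))) * hnorm H x)"
    unfolding co_def
  proof (intro sum_mono order_trans[OF norm_sum])
    fix s i assume i: "i \<in> {..<N}"
    have "cmod (cnj (e s i) * dg g x i) = cmod (e s i) * (cmod (g i) * cmod (x i))"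
      using i by (simp add: dg_def norm_mult)
    also have "\<dots> \<le> cmod (e s i) * (b * ((\<Sum>t<S. cmod (KE t i)) * hnorm H x))"
      using i assms(2)[of i] assms(3) xk[of i] by (intro mult_left_mono mult_mono) auto
    finally show "cmod (cnj (e s i) * dg g x i) \<le> b * (cmod (e s i) * (\<Sum>t<S. cmod (KE t i))) * hnorm H x"
      by (simp add: mult_ac)
  qed
  also have "\<dots> = (b * CC) * hnorm H x" by (simp add: CC_def sum_distrib_left sum_distrib_right)
  finally show ?thesis .
qed

lemma dg_bounded_op: "bounded_op H (dg g)"
proof -
  have "cmod (g i) \<le> (\<Sum>i<N. cmod (g i))" if "i < N" for i by (rule member_le_sum) (use that in auto)
  then have "hnorm H (dg g x) \<le> ((\<Sum>i<N. cmod (g i)) * CC) * hnorm H x" if "x \<in> hcarrier H" for x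
    by (intro dg_bound that sum_nonneg) auto
  then show ?thesis unfolding bounded_op_def by (auto simp: dg_add dg_scale)
qed

lemma bounded_op_cong:
  assumes "bounded_op H A" "\<And>x. x \<in> hcarrier H \<Longrightarrow> A x = B x" shows "bounded_op H B"
proof -
  from assms(1) have 1: "\<And>x. x \<in> hcarrier H \<Longrightarrow> A x \<in> hcarrier H"
    "\<And>x y. x \<in> hcarrier H \<Longrightarrow> y \<in> hcarrier H \<Longrightarrow> A (x + y) = A x + A y"
    "\<And>c x. x \<in> hcarrier H \<Longrightarrow> A (cscale c x) = cscale c (A x)"
    "\<exists>B. \<forall>x\<in>hcarrier H. hnorm H (A x) \<le> B * hnorm H x" unfolding bounded_op_def by auto
  note AB = assms(2)[symmetric]
  have "\<forall>x\<in>hcarrier H. B x \<in> hcarrier H" using 1(1) by (simp add: AB)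
  moreover have "\<forall>x\<in>hcarrier H. \<forall>y\<in>hcarrier H. B (x + y) = B x + B y" using 1(2) by (simp add: AB)
  moreover have "\<forall>c. \<forall>x\<in>hcarrier H. B (cscale c x) = cscale c (B x)" using 1(3) by (simp add: AB)
  moreover have "\<exists>b. \<forall>x\<in>hcarrier H. hnorm H (B x) \<le> b * hnorm H x" using 1(4) by (simp add: AB)
  ultimately show ?thesis unfolding bounded_op_def by blast
qed

lemma op_norm_le:
  assumes "\<And>x. x \<in> hcarrier H \<Longrightarrow> hnorm H (A x) \<le> b * hnorm H x" "0 \<le> b"
  shows "op_norm H A \<le> b"
  unfolding op_norm_def
proof (rule cSUP_least)
  have "0 \<in> {x \<in> hcarrier H. hnorm H x \<le> 1}" by simp
  then show "{x \<in> hcarrier H. hnorm H x \<le> 1} \<noteq> {}" by blast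
  fix x assume "x \<in> {x \<in> hcarrier H. hnorm H x \<le> 1}"
  then have "hnorm H (A x) \<le> b * hnorm H x" "b * hnorm H x \<le> b * 1"
    using assms(1) mult_left_mono[OF _ assms(2), of "hnorm H x" 1] by auto
  then show "hnorm H (A x) \<le> b" by simp
qed

lemma dg_inverse:
  assumes nz: "\<And>i. i < N \<Longrightarrow> g i \<noteq> 0" and A: "\<And>x. x \<in> hcarrier H \<Longrightarrow> A x = dg g x"
  shows "bij_betw A (hcarrier H) (hcarrier H)" "\<And>y. y \<in> hcarrier H \<Longrightarrow> op_inverse H A y = dg (\<lambda>i. 1 / g i) y"
proof -
  have inv: "dg g (dg (\<lambda>i. 1 / g i) x) = x" "dg (\<lambda>i. 1 / g i) (dg g x) = x" if x: "x \<in> hcarrier H" for x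
  proof -
    have "dg (\<lambda>i. g i * (1 / g i)) x = dg (\<lambda>i. 1) x" "dg (\<lambda>i. 1 / g i * g i) x = dg (\<lambda>i. 1) x"
      by (rule dg_cong; use nz in simp)+
    then show "dg g (dg (\<lambda>i. 1 / g i) x) = x" "dg (\<lambda>i. 1 / g i) (dg g x) = x" unfolding dg_dg dg_one[OF x] .
  qed
  have inj: "inj_on A (hcarrier H)" by (rule inj_onI) (metis A inv(2))
  moreover have "A ` hcarrier H = hcarrier H"
  proof
    show "A ` hcarrier H \<subseteq> hcarrier H" using A by auto
    show "hcarrier H \<subseteq> A ` hcarrier H"
    proof
      fix y assume y: "y \<in> hcarrier H"
      then have "y = A (dg (\<lambda>i. 1 / g i) y)" using A inv(1) by simp
      then show "y \<in> A ` hcarrier H" using dg_mem by (rule image_eqI)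
    qed
  qed
  ultimately show "bij_betw A (hcarrier H) (hcarrier H)" by (simp add: bij_betw_def)
  fix y assume y: "y \<in> hcarrier H"
  then have "A (dg (\<lambda>i. 1 / g i) y) = y" using A inv(1) by simp
  then show "op_inverse H A y = dg (\<lambda>i. 1 / g i) y"
    unfolding op_inverse_def using inj by (metis dg_mem inv_into_f_f)
qed

lemma parseval: "qform N K c c = (\<Sum>s<S. qform N K c (e s) * qform N K (e s) c)"
proof -
  have c: "qform N K c y = qform N K (\<lambda>i. \<Sum>k<N. c k * of_bool (i = k)) y" for y
  proof (rule qform_cong)
    fix i assume i: "i < N"
    have "(\<Sum>k<N. c k * of_bool (i = k)) = (\<Sum>k<N. of_bool (k = i) * c k)" by (intro sum.cong) auto
    then show "c i = (\<Sum>k<N. c k * of_bool (i = k))" using sum_delta[OF i, of c] by simp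
  qed auto
  have cy: "qform N K c y = (\<Sum>k<N. c k * qform N K (\<lambda>i. of_bool (i = k)) y)" for y
    unfolding c[of y] qform_sum_left qform_scale_left ..
  have "qform N K c c = (\<Sum>k<N. \<Sum>s<S. c k * qform N K (\<lambda>i. of_bool (i = k)) (e s) * qform N K (e s) c)"
    unfolding cy[of c]
  proof (intro sum.cong refl)
    fix k assume "k \<in> {..<N}"
    then have b: "qform N K (\<lambda>i. of_bool (i = k)) c = (\<Sum>s<S. qform N K (\<lambda>i. of_bool (i = k)) (e s) * qform N K (e s) c)"
      using basis by blast
    show "c k * qform N K (\<lambda>i. of_bool (i = k)) c = (\<Sum>s<S. c k * qform N K (\<lambda>i. of_bool (i = k)) (e s) * qform N K (e s) c)"
      by (subst b) (simp only: sum_distrib_left mult.assoc)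
  qed
  also have "\<dots> = (\<Sum>s<S. (\<Sum>k<N. c k * qform N K (\<lambda>i. of_bool (i = k)) (e s)) * qform N K (e s) c)"
    by (subst sum.swap) (simp add: sum_distrib_right)
  finally show ?thesis unfolding cy[symmetric] .
qed

lemma parseval_norm: "Re (qform N K c c) = (\<Sum>s<S. (cmod (qform N K c (e s)))\<^sup>2)"
proof -
  have "qform N K c c = (\<Sum>s<S. of_real ((cmod (qform N K c (e s)))\<^sup>2))"
    unfolding parseval[of c] complex_norm_square by (intro sum.cong refl) (simp add: psd_qform_hermitian[OF psd, of c])
  then show ?thesis by (simp del: of_real_power flip: of_real_sum)
qed

text \<open>For the plain pairing of sequences the norm of \<open>H\<close>, given by the inverse of
  \<open>K\<close>, is dual to the form of \<open>K\<close>; in coordinates this is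
  Cauchy-Schwarz.\<close>

lemma pairing:
  assumes "y \<in> hcarrier H"
  shows "cmod (\<Sum>i<N. y i * cnj (c i)) \<le> hnorm H y * sqrt (Re (qform N K c c))"
proof -
  have "(\<Sum>i<N. y i * cnj (c i)) = (\<Sum>i<N. \<Sum>s<S. co s y * (KE s i * cnj (c i)))"
    by (intro sum.cong refl) (simp add: reconstruct[OF assms] sum_distrib_left sum_distrib_right mult_ac)
  also have "\<dots> = (\<Sum>s<S. co s y * cnj (qform N K c (e s)))"
    unfolding qform_e cnj_sum sum_distrib_left by (subst sum.swap) (simp add: mult_ac)
  also have "cmod \<dots> \<le> (\<Sum>s<S. \<bar>cmod (co s y)\<bar> * \<bar>cmod (qform N K c (e s))\<bar>)"
    by (rule order_trans[OF norm_sum]) (simp add: norm_mult)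
  also have "\<dots> \<le> L2_set (\<lambda>s. cmod (co s y)) {..<S} * L2_set (\<lambda>s. cmod (qform N K c (e s))) {..<S}"
    by (rule L2_set_mult_ineq)
  also have "\<dots> = hnorm H y * sqrt (Re (qform N K c c))"
    unfolding hnorm_H parseval_norm by (simp add: L2_set_def)
  finally show ?thesis .
qed

text \<open>Positivity says that multiplication by \<open>cnj g\<close>, in effect the adjoint on
  kernel functions, is contractive for the form of \<open>K\<close>. Duality carries this over to
  multiplication by \<open>g\<close> on \<open>H\<close>.\<close>

lemma dg_contraction:
  assumes pos: "\<And>c. qform N (\<lambda>i j. (1 - g i * cnj (g j)) * K i j) c c \<in> \<real>\<^sub>\<ge>\<^sub>0" and x: "x \<in> hcarrier H"
  shows "hnorm H (dg g x) \<le> hnorm H x"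
proof -
  define y where "y = dg g x"
  \<comment> \<open>The image of \<open>y\<close> under the inverse of \<open>K\<close>, so that
    pairing \<open>y\<close> with \<open>b\<close> gives the squared norm of
    \<open>y\<close>.\<close>
  define b where "b = (\<lambda>i. \<Sum>s<S. co s y * e s i)"
  define c where "c = (\<lambda>i. cnj (g i) * b i)"
  have be: "qform N K b (e t) = co t y" if "t < S" for t
  proof -
    have "qform N K b (e t) = (\<Sum>s<S. co s y * qform N K (e s) (e t))"
      unfolding b_def qform_sum_left qform_scale_left ..
    also have "\<dots> = (\<Sum>s<S. if s = t then co s y else 0)" by (intro sum.cong refl) (use orthonormal that in auto)
    finally show ?thesis using that by simp
  qed
  have bb: "Re (qform N K b b) = (hnorm H y)\<^sup>2" unfolding parseval_norm hnorm_sq by (intro sum.cong) (auto simp: be)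
  have "qform N (\<lambda>i j. (1 - g i * cnj (g j)) * K i j) b b = qform N K b b - qform N K c c"
    unfolding qform_def c_def sum_subtractf[symmetric] by (intro sum.cong refl) (simp add: algebra_simps)
  then have cc: "Re (qform N K c c) \<le> (hnorm H y)\<^sup>2"
    using pos[of b] bb by (simp add: complex_nonneg_Reals_iff)
  have "complex_of_real ((hnorm H y)\<^sup>2) = (\<Sum>s<S. co s y * cnj (co s y))"
    unfolding hnorm_sq of_real_sum complex_norm_square ..
  also have "\<dots> = (\<Sum>s<S. cnj (co s y) * (\<Sum>i<N. cnj (e s i) * y i))" by (simp add: co_def mult.commute)
  also have "\<dots> = (\<Sum>i<N. y i * cnj (b i))"
    unfolding sum_distrib_left b_def cnj_sum by (subst sum.swap) (simp add: mult_ac)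
  also have "\<dots> = (\<Sum>i<N. x i * cnj (c i))" by (intro sum.cong) (auto simp: y_def dg_def c_def)
  finally have "(hnorm H y)\<^sup>2 = cmod (\<Sum>i<N. x i * cnj (c i))" by (metis norm_of_real abs_of_nonneg zero_le_power2)
  also have "\<dots> \<le> hnorm H x * sqrt (Re (qform N K c c))" by (rule pairing[OF x])
  also have "\<dots> \<le> hnorm H x * hnorm H y"
    using cc hnorm_nonneg by (intro mult_left_mono real_le_lsqrt) auto
  finally have "hnorm H y * hnorm H y \<le> hnorm H x * hnorm H y" by (simp add: power2_eq_square)
  then have "hnorm H y \<le> hnorm H x" using hnorm_nonneg[of y] hnorm_nonneg[of x] by (cases "hnorm H y = 0") auto
  then show ?thesis by (simp add: y_def)
qed

text \<open>Take \<open>x = K c\<close>, whose squared norm is \<open>B\<close>, the form at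
  \<open>c\<close>. Inserting \<open>1 = \<Sum> p\<^sub>j f\<^sub>j\<close> splits \<open>B\<close>
  into pairings of \<open>f\<^sub>j x\<close> with \<open>cnj p\<^sub>j c\<close>; Cauchy-Schwarz
  and the column bound give \<open>B \<le> sqrt (C B) sqrt R\<close>, and a factor \<open>B\<close>
  cancels.\<close>

lemma row_lower_bound:
  assumes col: "\<And>x. x \<in> hcarrier H \<Longrightarrow> (\<Sum>j\<in>J. (hnorm H (dg (f j) x))\<^sup>2) \<le> C * (hnorm H x)\<^sup>2" and C: "0 \<le> C"
    and one: "\<And>i. i < N \<Longrightarrow> (\<Sum>j\<in>J. p j i * f j i) = 1"
  shows "Re (qform N K c c) \<le> C * (\<Sum>j\<in>J. Re (qform N K (\<lambda>i. cnj (p j i) * c i) (\<lambda>i. cnj (p j i) * c i)))"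
proof -
  define x where "x = (\<lambda>i. if i < N then (\<Sum>j<N. K i j * c j) else 0)"
  have x: "x \<in> hcarrier H" by (simp add: x_def mem_iff)
  define B where "B = Re (qform N K c c)"
  define R where "R = (\<Sum>j\<in>J. Re (qform N K (\<lambda>i. cnj (p j i) * c i) (\<lambda>i. cnj (p j i) * c i)))"
  have cox: "co s x = qform N K c (e s)" for s
    unfolding co_def qform_def x_def by (intro sum.cong) (auto simp: sum_distrib_left mult_ac)
  have nx: "(hnorm H x)\<^sup>2 = B" unfolding hnorm_sq cox B_def parseval_norm ..
  have B0: "B \<ge> 0" unfolding B_def by (rule psd_qform_real(2)[OF psd])
  have R0: "R \<ge> 0" unfolding R_def by (intro sum_nonneg psd_qform_real(2)[OF psd])
  have "complex_of_real B = qform N K c c" unfolding B_def by (rule psd_qform_real(1)[OF psd, symmetric])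
  also have "\<dots> = (\<Sum>i<N. x i * cnj (c i))"
    unfolding qform_def x_def by (intro sum.cong refl) (simp add: sum_distrib_right)
  also have "\<dots> = (\<Sum>i<N. \<Sum>j\<in>J. dg (f j) x i * cnj (cnj (p j i) * c i))"
  proof (intro sum.cong refl)
    fix i assume i: "i \<in> {..<N}"
    have "(\<Sum>j\<in>J. dg (f j) x i * cnj (cnj (p j i) * c i)) = (\<Sum>j\<in>J. p j i * f j i) * (x i * cnj (c i))"
      unfolding sum_distrib_right using i by (intro sum.cong refl) (simp add: dg_def mult_ac)
    then show "x i * cnj (c i) = (\<Sum>j\<in>J. dg (f j) x i * cnj (cnj (p j i) * c i))" using one i by simp
  qed
  also have "\<dots> = (\<Sum>j\<in>J. \<Sum>i<N. dg (f j) x i * cnj (cnj (p j i) * c i))" by (rule sum.swap)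
  finally have "B = cmod (\<Sum>j\<in>J. \<Sum>i<N. dg (f j) x i * cnj (cnj (p j i) * c i))"
    using B0 by (metis norm_of_real abs_of_nonneg)
  also have "\<dots> \<le> (\<Sum>j\<in>J. \<bar>hnorm H (dg (f j) x)\<bar> * \<bar>sqrt (Re (qform N K (\<lambda>i. cnj (p j i) * c i) (\<lambda>i. cnj (p j i) * c i)))\<bar>)"
  proof (rule order_trans[OF norm_sum], rule sum_mono)
    fix j
    have "0 \<le> Re (qform N K (\<lambda>i. cnj (p j i) * c i) (\<lambda>i. cnj (p j i) * c i))" by (rule psd_qform_real(2)[OF psd])
    then show "cmod (\<Sum>i<N. dg (f j) x i * cnj (cnj (p j i) * c i)) \<le>
      \<bar>hnorm H (dg (f j) x)\<bar> * \<bar>sqrt (Re (qform N K (\<lambda>i. cnj (p j i) * c i) (\<lambda>i. cnj (p j i) * c i)))\<bar>"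
      using pairing[of "dg (f j) x" "\<lambda>i. cnj (p j i) * c i"] hnorm_nonneg by simp
  qed
  also have "\<dots> \<le> L2_set (\<lambda>j. hnorm H (dg (f j) x)) J * 
    L2_set (\<lambda>j. sqrt (Re (qform N K (\<lambda>i. cnj (p j i) * c i) (\<lambda>i. cnj (p j i) * c i)))) J"
    by (rule L2_set_mult_ineq)
  also have "\<dots> = sqrt (\<Sum>j\<in>J. (hnorm H (dg (f j) x))\<^sup>2) * sqrt R"
    unfolding L2_set_def R_def using psd_qform_real(2)[OF psd] by simp
  also have "\<dots> \<le> sqrt (C * B) * sqrt R"
    using col[OF x] R0 unfolding nx by (intro mult_right_mono real_sqrt_le_mono) auto
  finally have "B\<^sup>2 \<le> (sqrt (C * B) * sqrt R)\<^sup>2" using B0 by (intro power_mono)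
  also have "\<dots> = C * B * R" using C B0 R0 by (simp add: power_mult_distrib)
  finally have "B * B \<le> B * (C * R)" by (simp add: power2_eq_square mult_ac)
  then have "B \<le> C * R" using B0 C R0 by (cases "B = 0") auto
  then show ?thesis by (simp add: B_def R_def)
qed

text \<open>Where the symbols have no common zero there are multipliers with
  \<open>u a + v b + t c = 1\<close>, and they define a contracting homotopy of the Koszul complex.
  The witnesses below are this homotopy, with the signs of the differentials.\<close>

lemma diagonal_koszul:
  assumes "\<And>i. i < N \<Longrightarrow> a i \<noteq> 0 \<or> b i \<noteq> 0 \<or> c i \<noteq> 0"
    and A: "\<And>x. x \<in> hcarrier H \<Longrightarrow> A x = dg a x" and B: "\<And>x. x \<in> hcarrier H \<Longrightarrow> B x = dg b x"
    and C: "\<And>x. x \<in> hcarrier H \<Longrightarrow> C x = dg c x"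
  shows "koszul_exact H A B C"
proof -
  define m where "m = (\<lambda>i. a i * cnj (a i) + b i * cnj (b i) + c i * cnj (c i))"
  have m: "m i \<noteq> 0" if "i < N" for i
  proof -
    have "m i = of_real ((cmod (a i))\<^sup>2 + (cmod (b i))\<^sup>2 + (cmod (c i))\<^sup>2)"
      unfolding m_def of_real_add complex_norm_square ..
    moreover have "(cmod (a i))\<^sup>2 + (cmod (b i))\<^sup>2 + (cmod (c i))\<^sup>2 > 0"
    proof -
      have "0 < (cmod (a i))\<^sup>2 \<or> 0 < (cmod (b i))\<^sup>2 \<or> 0 < (cmod (c i))\<^sup>2" using assms(1)[OF that] by simp
      then show ?thesis
        using zero_le_power2[of "cmod (a i)"] zero_le_power2[of "cmod (b i)"] zero_le_power2[of "cmod (c i)"]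
        by linarith
    qed
    ultimately show ?thesis by (metis less_irrefl of_real_eq_0_iff)
  qed
  \<comment> \<open>The conjugates divided by the sum of squares \<open>m\<close>, which is nonzero
    at every index below \<open>N\<close>.\<close>
  define u v t where "u = (\<lambda>i. cnj (a i) / m i)" "v = (\<lambda>i. cnj (b i) / m i)" "t = (\<lambda>i. cnj (c i) / m i)"
  have uvt: "u i * a i + v i * b i + t i * c i = 1" if "i < N" for i
  proof -
    have "u i * a i + v i * b i + t i * c i = (a i * cnj (a i) + b i * cnj (b i) + c i * cnj (c i)) / m i"
      unfolding u_v_t_def by (simp add: add_divide_distrib mult.commute)
    then have "u i * a i + v i * b i + t i * c i = m i / m i" by (simp only: m_def)
    then show ?thesis using m[OF that] by simp
  qed
  have ext: "x = y" if "x \<in> hcarrier H" "y \<in> hcarrier H" "\<And>i. i < N \<Longrightarrow> x i = y i" for x y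
    using that unfolding mem_iff fun_eq_iff by (metis not_le)
  have split: "x i = (u i * a i + v i * b i + t i * c i) * x i" if "i < N" for x :: cseq and i using uvt[OF that] by simp
  show ?thesis
    unfolding koszul_exact_def Let_def
  proof (intro conjI ballI impI)
    fix x assume x: "x \<in> hcarrier H" and z: "A x = 0 \<and> B x = 0 \<and> C x = 0"
    show "x = 0"
    proof (rule ext[OF x zero_mem])
      fix i assume i: "i < N"
      have "a i * x i = 0" "b i * x i = 0" "c i * x i = 0"
        using z i unfolding A[OF x] B[OF x] C[OF x] by (auto simp: dg_def fun_eq_iff dest: spec[of _ i])
      have "x i = u i * (a i * x i) + v i * (b i * x i) + t i * (c i * x i)"
        by (rule trans[OF split[OF i]]) (simp only: distrib_right mult.assoc)
      then show "x i = 0 i" unfolding \<open>a i * x i = 0\<close> \<open>b i * x i = 0\<close> \<open>c i * x i = 0\<close> by simp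
    qed
  next
    fix x y z assume x: "x \<in> hcarrier H" and y: "y \<in> hcarrier H" and z: "z \<in> hcarrier H"
      and eq: "A y - B x = 0 \<and> A z - C x = 0 \<and> B z - C y = 0"
    define w where "w = (\<lambda>i. if i < N then u i * x i + v i * y i + t i * z i else 0)"
    have w: "w \<in> hcarrier H" by (simp add: w_def mem_iff)
    have e: "a i * y i = b i * x i" "a i * z i = c i * x i" "b i * z i = c i * y i" if i: "i < N" for i
      using eq i unfolding A[OF y] A[OF z] B[OF x] B[OF z] C[OF x] C[OF y]
      by (auto simp: dg_def fun_eq_iff dest: spec[of _ i])
    have "x = A w"
      unfolding A[OF w]
    proof (rule ext[OF x dg_mem])
      fix i assume i: "i < N"
      have "dg a w i = u i * a i * x i + v i * (a i * y i) + t i * (a i * z i)" using i by (simp add: dg_def w_def algebra_simps)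
      then show "x i = dg a w i" unfolding e[OF i] using split[OF i, of x] by (simp add: algebra_simps)
    qed
    moreover have "y = B w"
      unfolding B[OF w]
    proof (rule ext[OF y dg_mem])
      fix i assume i: "i < N"
      have "dg b w i = u i * (b i * x i) + v i * b i * y i + t i * (b i * z i)" using i by (simp add: dg_def w_def algebra_simps)
      then show "y i = dg b w i" unfolding e(1)[OF i, symmetric] e(3)[OF i] using split[OF i, of y] by (simp add: algebra_simps)
    qed
    moreover have "z = C w"
      unfolding C[OF w]
    proof (rule ext[OF z dg_mem])
      fix i assume i: "i < N"
      have "dg c w i = u i * (c i * x i) + v i * (c i * y i) + t i * c i * z i" using i by (simp add: dg_def w_def algebra_simps)
      then show "z i = dg c w i" unfolding e(2,3)[OF i, symmetric] using split[OF i, of z] by (simp add: algebra_simps)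
    qed
    ultimately show "\<exists>u\<in>hcarrier H. x = A u \<and> y = B u \<and> z = C u" using w by blast
  next
    fix p q r assume p: "p \<in> hcarrier H" and q: "q \<in> hcarrier H" and r: "r \<in> hcarrier H"
      and eq: "A r - B q + C p = 0"
    have e: "c i * p i = b i * q i - a i * r i" if i: "i < N" for i
    proof -
      have "(A r - B q + C p) i = 0" using eq by simp
      then show ?thesis using i unfolding A[OF r] B[OF q] C[OF p] by (simp add: dg_def algebra_simps)
    qed
    define x y z where "x = (\<lambda>i. if i < N then - (v i * p i + t i * q i) else 0)"
      "y = (\<lambda>i. if i < N then u i * p i - t i * r i else 0)"
      "z = (\<lambda>i. if i < N then u i * q i + v i * r i else 0)"
    have m: "x \<in> hcarrier H" "y \<in> hcarrier H" "z \<in> hcarrier H" by (auto simp: x_y_z_def mem_iff)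
    have "p = A y - B x"
      unfolding A[OF m(2)] B[OF m(1)]
    proof (rule ext[OF p diff_mem[OF dg_mem dg_mem]])
      fix i assume i: "i < N"
      have "(dg a y - dg b x) i = (u i * a i + v i * b i) * p i + t i * (b i * q i - a i * r i)" using i by (simp add: dg_def x_y_z_def algebra_simps)
      then show "p i = (dg a y - dg b x) i" unfolding e[OF i, symmetric] using split[OF i, of p] by (simp add: algebra_simps)
    qed
    moreover have "q = A z - C x"
      unfolding A[OF m(3)] C[OF m(1)]
    proof (rule ext[OF q diff_mem[OF dg_mem dg_mem]])
      fix i assume i: "i < N"
      have "(dg a z - dg c x) i = (u i * a i + t i * c i) * q i + v i * (a i * r i + c i * p i)" using i by (simp add: dg_def x_y_z_def algebra_simps)
      then show "q i = (dg a z - dg c x) i" unfolding e[OF i] using split[OF i, of q] by (simp add: algebra_simps)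
    qed
    moreover have "r = B z - C y"
      unfolding B[OF m(3)] C[OF m(2)]
    proof (rule ext[OF r diff_mem[OF dg_mem dg_mem]])
      fix i assume i: "i < N"
      have "(dg b z - dg c y) i = (v i * b i + t i * c i) * r i + u i * (b i * q i - c i * p i)" using i by (simp add: dg_def x_y_z_def algebra_simps)
      then show "r i = (dg b z - dg c y) i" unfolding e[OF i] using split[OF i, of r] by (simp add: algebra_simps)
    qed
    ultimately show "\<exists>x\<in>hcarrier H. \<exists>y\<in>hcarrier H. \<exists>z\<in>hcarrier H. p = A y - B x \<and> q = A z - C x \<and> r = B z - C y"
      using m by blast
  next
    fix w assume w: "w \<in> hcarrier H"
    have "w = A (dg u w) - B (dg (\<lambda>i. - v i) w) + C (dg t w)"
      unfolding A[OF dg_mem] B[OF dg_mem] C[OF dg_mem]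
    proof (rule ext[OF w add_mem[OF diff_mem[OF dg_mem dg_mem] dg_mem]])
      fix i assume i: "i < N"
      show "w i = (dg a (dg u w) - dg b (dg (\<lambda>i. - v i) w) + dg c (dg t w)) i"
        using i split[OF i, of w] by (simp add: dg_def algebra_simps)
    qed
    then show "\<exists>p\<in>hcarrier H. \<exists>q\<in>hcarrier H. \<exists>r\<in>hcarrier H. w = A r - B q + C p" using dg_mem by blast
  qed
qed

end

section \<open>The dilated coordinate multipliers of an admissible kernel\<close>

lemma qform_kform: "qform N P c c = kform {..<N} P (\<lambda>i. cnj (c i))"
  unfolding qform_def kform_def by (simp add: mult_ac)

locale pent_rkhs = finite_rkhs N K S e for N K S e +
  fixes p :: "nat \<Rightarrow> complex ^ 3" and r :: real
  assumes p: "\<And>i. p i \<in> pentablock" and r: "0 < r" "r < 1"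
    and test_pos: "\<And>t \<alpha> c. cmod \<alpha> \<le> 1 \<Longrightarrow>
      qform N (\<lambda>i j. (1 - test_fun t \<alpha> (p i) * cnj (test_fun t \<alpha> (p j))) * K i j) c c \<in> \<real>\<^sub>\<ge>\<^sub>0"
begin

text \<open>The kernel matrix belongs to the points \<open>p i\<close>, while the operators multiply
  by the coordinates of the dilated points \<open>w i\<close>.\<close>

definition w :: "nat \<Rightarrow> complex ^ 3" where "w i = dilate r (p i)"

definition T :: "3 \<Rightarrow> cseq \<Rightarrow> cseq" where "T l = dg (\<lambda>i. w i $ l)"

definition calc :: "(complex ^ 3 \<Rightarrow> complex) \<Rightarrow> cseq \<Rightarrow> cseq" where "calc f = dg (\<lambda>i. f (w i))"

lemma w_mem: "w i \<in> pentablock"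
  unfolding w_def using p r by (intro dilate_pentablock) auto

lemma test_norm: "cmod \<alpha> \<le> 1 \<Longrightarrow> x \<in> hcarrier H \<Longrightarrow> hnorm H (dg (\<lambda>i. test_fun t \<alpha> (p i)) x) \<le> hnorm H x"
  by (rule dg_contraction[OF test_pos])

lemma scaled_test_op_norm:
  assumes "cmod \<alpha> \<le> 1" and A: "\<And>x. x \<in> hcarrier H \<Longrightarrow> A x = dg (\<lambda>i. of_real b * test_fun t \<alpha> (p i)) x" and b: "0 \<le> b"
  shows "op_norm H A \<le> b"
proof (rule op_norm_le[OF _ b])
  fix x assume x: "x \<in> hcarrier H"
  have "A x = cscale (of_real b) (dg (\<lambda>i. test_fun t \<alpha> (p i)) x)"
    unfolding A[OF x] by (auto simp: dg_def cscale_def fun_eq_iff)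
  then show "hnorm H (A x) \<le> b * hnorm H x"
    using test_norm[OF assms(1) x] b by (simp add: hnorm_scale mult_left_mono)
qed

text \<open>Positivity against the test functions at the points \<open>p i\<close> gives
  contractions. Passing to \<open>w i\<close> multiplies them by factors at most
  \<open>r < 1\<close>, which yields the strict inequalities for every \<alpha>.\<close>

lemma M_class: "M_class H T"
  unfolding M_class_def
proof (intro conjI ballI)
  show "commuting_ops H T" unfolding commuting_ops_def T_def
    by (simp add: dg_bounded_op dg_dg mult.commute)
  \<comment> \<open>\<open>T 2\<close> is \<open>2 r\<close> times multiplication by the test
    function of index 2; the parameter 0 is a dummy.\<close>
  have "op_norm H (T 2) \<le> 2 * r"
    using r by (intro scaled_test_op_norm[of 0 _ _ 2]) (auto simp: T_def w_def test_fun_2 intro: dg_cong)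
  then show "op_norm H (T 2) < 2" using r by simp
  fix \<alpha> :: complex assume "\<alpha> \<in> cball 0 1"
  then have \<alpha>: "cmod \<alpha> \<le> 1" by simp
  have r\<alpha>: "cmod (of_real r * \<alpha>) \<le> 1" using \<alpha> r by (simp add: norm_mult mult_le_one)
  let ?D = "\<lambda>i. 2 - \<alpha> * w i $ 2"
  have D: "op_inverse H (\<lambda>x. cscale 2 x - cscale \<alpha> (T 2 x)) y = dg (\<lambda>i. 1 / ?D i) y" if "y \<in> hcarrier H" for y
    by (rule dg_inverse(2)[OF _ _ that])
      (use pentablock_denominators(2)[OF w_mem \<alpha>] in \<open>auto simp: T_def dg_def cscale_def fun_eq_iff mem_iff algebra_simps\<close>)
  have "op_norm H (Phi_op H \<alpha> (T 2) (T 3)) \<le> r"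
  proof (rule scaled_test_op_norm[OF r\<alpha>, of _ _ 1])
    fix x assume x: "x \<in> hcarrier H"
    have "Phi_op H \<alpha> (T 2) (T 3) x = dg (\<lambda>i. Phi \<alpha> (w i $ 2) (w i $ 3)) x"
    proof -
      have "Phi_op H \<alpha> (T 2) (T 3) x =
        cscale (2 * \<alpha>) (T 3 (dg (\<lambda>i. 1 / ?D i) x)) - T 2 (dg (\<lambda>i. 1 / ?D i) x)"
        unfolding Phi_op_def o_def D[OF x] ..
      also have "\<dots> = dg (\<lambda>i. Phi \<alpha> (w i $ 2) (w i $ 3)) x" unfolding T_def
        by (auto simp: dg_def cscale_def fun_eq_iff Phi_def diff_divide_distrib algebra_simps)
      finally show ?thesis .
    qed
    also have "\<dots> = dg (\<lambda>i. of_real r * test_fun 1 (of_real r * \<alpha>) (p i)) x"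
      unfolding w_def using Phi_dilate[OF p \<alpha>, of r] r by (intro dg_cong) (simp add: test_fun_def)
    finally show "Phi_op H \<alpha> (T 2) (T 3) x = dg (\<lambda>i. of_real r * test_fun 1 (of_real r * \<alpha>) (p i)) x" .
  qed (use r in simp)
  then show "op_norm H (Phi_op H \<alpha> (T 2) (T 3)) < 1" using r by simp
  let ?E = "\<lambda>i. 1 - \<alpha> * w i $ 2 + \<alpha>\<^sup>2 * w i $ 3"
  have nz: "?E i \<noteq> 0" for i by (rule pentablock_denominators(3)[OF w_mem \<alpha>])
  have A: "psi_denom \<alpha> T x = dg ?E x" if "x \<in> hcarrier H" for x
    using that by (auto simp: psi_denom_def T_def dg_def cscale_def fun_eq_iff mem_iff algebra_simps)
  have E: "bij_betw (psi_denom \<alpha> T) (hcarrier H) (hcarrier H)"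
    by (rule dg_inverse(1)[of ?E]) (use nz A in auto)
  have E': "op_inverse H (psi_denom \<alpha> T) y = dg (\<lambda>i. 1 / ?E i) y" if "y \<in> hcarrier H" for y
    by (rule dg_inverse(2)[of ?E, OF _ _ that]) (use nz A in auto)
  show "op_invertible H (psi_denom \<alpha> T)" unfolding op_invertible_def
    using E bounded_op_cong[OF dg_bounded_op E'[symmetric]] by blast
  \<comment> \<open>The factor in \<open>psi_dilate\<close>; it is at most \<open>r\<close> because
    \<open>(r |\<alpha>|)^2 \<le> |\<alpha>|^2\<close>.\<close>
  define b where "b = r * (1 - (cmod \<alpha>)\<^sup>2) / (1 - (r * cmod \<alpha>)\<^sup>2)"
  have "r * cmod \<alpha> \<le> cmod \<alpha>" using r by (simp add: mult_left_le_one_le)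
  then have "(r * cmod \<alpha>)\<^sup>2 \<le> (cmod \<alpha>)\<^sup>2" using r by (intro power_mono) auto
  moreover have "r * cmod \<alpha> < 1" using \<alpha> r by (metis mult.commute mult_le_cancel_left1 mult_left_le not_less norm_ge_zero less_le_trans order_le_less_trans less_eq_real_def)
  then have "(r * cmod \<alpha>)\<^sup>2 < 1" using r by (simp add: abs_square_less_1)
  moreover have "(cmod \<alpha>)\<^sup>2 \<le> 1" using \<alpha> by (simp add: power_le_one)
  ultimately have b: "0 \<le> b" "b \<le> r"
    unfolding b_def using r by (auto simp: divide_simps)
  have "op_norm H (psi_op H \<alpha> T) \<le> b"
  proof (rule scaled_test_op_norm[OF r\<alpha>, of _ _ 0])
    fix x assume x: "x \<in> hcarrier H"
    have "psi_op H \<alpha> T x = dg (\<lambda>i. psi \<alpha> (w i)) x"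
      unfolding psi_op_def o_def E'[OF x] T_def
      by (auto simp: dg_def cscale_def fun_eq_iff psi_def diff_divide_distrib algebra_simps)
    also have "\<dots> = dg (\<lambda>i. of_real b * test_fun 0 (of_real r * \<alpha>) (p i)) x"
      unfolding w_def b_def using psi_dilate[of r \<alpha>] \<alpha> r by (intro dg_cong) (simp add: test_fun_def)
    finally show "psi_op H \<alpha> T x = dg (\<lambda>i. of_real b * test_fun 0 (of_real r * \<alpha>) (p i)) x" .
  qed (rule b)
  then show "op_norm H (psi_op H \<alpha> T) < 1" using b(2) r by simp
qed

text \<open>For diagonal operators the calculus is evaluation at the points \<open>w i\<close>. A
  point outside the pentablock differs from each \<open>w i\<close> in some coordinate, so the
  Koszul complex is exact there; norm continuity is convergence at finitely many points.\<close>

lemma calculus: "hol_calculus H T pentablock calc"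
  unfolding hol_calculus_def
proof (intro conjI allI impI ballI)
  show "taylor_spectrum H T \<subseteq> pentablock"
  proof (rule ccontr)
    assume "\<not> taylor_spectrum H T \<subseteq> pentablock"
    then obtain l where l: "l \<in> taylor_spectrum H T" "l \<notin> pentablock" by blast
    have "koszul_exact H (\<lambda>x. T 1 x - cscale (l $ 1) x) (\<lambda>x. T 2 x - cscale (l $ 2) x) (\<lambda>x. T 3 x - cscale (l $ 3) x)"
    proof (rule diagonal_koszul)
      show "w i $ 1 - l $ 1 \<noteq> 0 \<or> w i $ 2 - l $ 2 \<noteq> 0 \<or> w i $ 3 - l $ 3 \<noteq> 0" for i
        using vec3_eqI[of "w i" l] w_mem[of i] l(2) by auto
    qed (auto simp: T_def dg_def cscale_def fun_eq_iff mem_iff algebra_simps)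
    then show False using l(1) unfolding taylor_spectrum_def by blast
  qed
  fix F f
  assume F: "(\<forall>m. holo_on (F m) pentablock) \<and> holo_on f pentablock \<and>
        (\<forall>K. compact K \<and> K \<subseteq> pentablock \<longrightarrow> uniform_limit K F f sequentially)"
  define b where "b = (\<lambda>m. \<Sum>i<N. cmod (F m (w i) - f (w i)))"
  have lim: "(\<lambda>m. F m (w i)) \<longlonglongrightarrow> f (w i)" for i
  proof -
    have "compact {w i} \<and> {w i} \<subseteq> pentablock" using w_mem by simp
    then have "uniform_limit {w i} F f sequentially" using F by blast
    then show ?thesis by (rule tendsto_uniform_limitI) simp
  qed
  have "b \<longlonglongrightarrow> (\<Sum>i<N. cmod (f (w i) - f (w i)))" unfolding b_def by (intro tendsto_intros lim)
  then have "(\<lambda>m. b m * CC) \<longlonglongrightarrow> 0 * CC" by (intro tendsto_intros) simp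
  then have bl: "(\<lambda>m. b m * CC) \<longlonglongrightarrow> 0" by simp
  have bound: "hnorm H (calc (F m) x - calc f x) \<le> b m * CC * hnorm H x" if "x \<in> hcarrier H" for m x
  proof -
    have "calc (F m) x - calc f x = dg (\<lambda>i. F m (w i) - f (w i)) x"
      by (auto simp: calc_def dg_def fun_eq_iff algebra_simps)
    moreover have "cmod (F m (w i) - f (w i)) \<le> b m" if "i < N" for i
      unfolding b_def by (rule member_le_sum) (use that in auto)
    moreover have "0 \<le> b m" unfolding b_def by (intro sum_nonneg) auto
    ultimately show ?thesis using dg_bound[OF that] by simp
  qed
  have nn: "0 \<le> b m * CC" for m unfolding b_def by (intro mult_nonneg_nonneg sum_nonneg CC_nonneg) auto
  have up: "op_norm H (\<lambda>x. calc (F m) x - calc f x) \<le> b m * CC" for m by (rule op_norm_le[OF bound nn])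
  have lo: "0 \<le> op_norm H (\<lambda>x. calc (F m) x - calc f x)" for m
    unfolding op_norm_def
  proof (rule cSUP_upper2[of _ _ 0])
    show "bdd_above ((\<lambda>x. hnorm H (calc (F m) x - calc f x)) ` {x \<in> hcarrier H. hnorm H x \<le> 1})"
    proof (rule bdd_aboveI2)
      fix x assume x: "x \<in> {x \<in> hcarrier H. hnorm H x \<le> 1}"
      then have "b m * CC * hnorm H x \<le> b m * CC * 1" using nn by (intro mult_left_mono) auto
      then show "hnorm H (calc (F m) x - calc f x) \<le> b m * CC" using bound[of x m] x by simp
    qed
  qed (auto simp: hnorm_nonneg)
  show "(\<lambda>m. op_norm H (\<lambda>x. calc (F m) x - calc f x)) \<longlonglongrightarrow> 0"
    by (rule tendsto_sandwich[OF _ _ tendsto_const bl]) (use up lo in auto)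
qed (auto simp: calc_def T_def dg_bounded_op dg_one dg_dg, auto simp: dg_def cscale_def fun_eq_iff algebra_simps)

lemma SA_column_bound:
  assumes g: "g \<in> SA n" and x: "x \<in> hcarrier H"
  shows "(\<Sum>i=1..n. (hnorm H (dg (\<lambda>k. g i (w k)) x))\<^sup>2) \<le> 1 * (hnorm H x)\<^sup>2"
proof (cases "x = 0")
  case True
  have "dg h 0 = 0" for h by (simp add: dg_def fun_eq_iff)
  then show ?thesis by (simp add: True)
next
  case False
  have nx: "hnorm H x > 0" using hnorm_eq_0[OF x] False hnorm_nonneg[of x] by fastforce
  have col: "column_norm H n (\<lambda>i. calc (g i)) \<le> 1"
    using g hilbert M_class calculus unfolding SA_def by blast
  have "\<exists>B. \<forall>x\<in>hcarrier H. hnorm H (calc (g i) x) \<le> B * hnorm H x" for i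
    using dg_bounded_op unfolding calc_def bounded_op_def by blast
  then obtain B where B: "\<And>i x. x \<in> hcarrier H \<Longrightarrow> hnorm H (calc (g i) x) \<le> B i * hnorm H x" by metis
  have bdd: "bdd_above ((\<lambda>x. sqrt (\<Sum>i=1..n. (hnorm H (calc (g i) x))\<^sup>2)) ` {x \<in> hcarrier H. hnorm H x \<le> 1})"
  proof (rule bdd_aboveI2)
    fix y assume y: "y \<in> {x \<in> hcarrier H. hnorm H x \<le> 1}"
    show "sqrt (\<Sum>i=1..n. (hnorm H (calc (g i) y))\<^sup>2) \<le> sqrt (\<Sum>i=1..n. \<bar>B i\<bar>\<^sup>2)"
    proof (intro real_sqrt_le_mono sum_mono power_mono hnorm_nonneg)
      fix i
      have "hnorm H (calc (g i) y) \<le> \<bar>B i\<bar> * hnorm H y"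
        using B[of y i] y mult_right_mono[OF abs_ge_self[of "B i"] hnorm_nonneg[of y]] by simp
      also have "\<dots> \<le> \<bar>B i\<bar> * 1" using y by (intro mult_left_mono) auto
      finally show "hnorm H (calc (g i) y) \<le> \<bar>B i\<bar>" by simp
    qed
  qed
  define y where "y = cscale (of_real (1 / hnorm H x)) x"
  have y: "y \<in> {x \<in> hcarrier H. hnorm H x \<le> 1}" using x nx by (simp add: y_def hnorm_scale norm_divide)
  have "sqrt (\<Sum>i=1..n. (hnorm H (calc (g i) y))\<^sup>2) \<le> 1"
    using cSUP_upper[OF y bdd] col unfolding column_norm_def by linarith
  then have "(\<Sum>i=1..n. (hnorm H (calc (g i) y))\<^sup>2) \<le> 1" by simp
  moreover have "hnorm H (calc (g i) y) = hnorm H (dg (\<lambda>k. g i (w k)) x) / hnorm H x" for i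
    using nx by (simp add: y_def calc_def dg_scale hnorm_scale norm_divide)
  ultimately have "(\<Sum>i=1..n. (hnorm H (dg (\<lambda>k. g i (w k)) x))\<^sup>2) / (hnorm H x)\<^sup>2 \<le> 1"
    by (simp add: power_divide sum_divide_distrib)
  then show ?thesis using nx by (simp add: field_simps)
qed

lemma corona_matrix_positive:
  fixes \<phi> f :: "nat \<Rightarrow> complex ^ 3 \<Rightarrow> complex"
  assumes g: "(\<lambda>j z. of_real \<epsilon> * f j z) \<in> SA n" and \<epsilon>: "0 < \<epsilon>"
    and one: "\<And>z. z \<in> pentablock \<Longrightarrow> (\<Sum>j=1..n. \<phi> j z * f j z) = 1"
  shows "qform N (\<lambda>i j. ((\<Sum>l=1..n. \<phi> l (w i) * cnj (\<phi> l (w j))) - of_real (\<epsilon>\<^sup>2)) * K i j) c c \<in> \<real>\<^sub>\<ge>\<^sub>0"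
proof -
  \<comment> \<open>The factor \<open>1 / \<epsilon>\<close> compensates the \<epsilon> in front of
    \<open>f\<close>, so that the column bound can be used with constant 1.\<close>
  define q where "q = (\<lambda>l i. \<phi> l (w i) * of_real (1 / \<epsilon>))"
  define Q where "Q = (\<lambda>l. qform N K (\<lambda>i. cnj (\<phi> l (w i)) * c i) (\<lambda>i. cnj (\<phi> l (w i)) * c i))"
  have "Re (qform N K c c) \<le> 1 * (\<Sum>l=1..n. Re (qform N K (\<lambda>i. cnj (q l i) * c i) (\<lambda>i. cnj (q l i) * c i)))"
  proof (rule row_lower_bound[where J = "{1..n}" and f = "\<lambda>l i. of_real \<epsilon> * f l (w i)"])
    show "(\<Sum>l=1..n. (hnorm H (dg (\<lambda>i. of_real \<epsilon> * f l (w i)) x))\<^sup>2) \<le> 1 * (hnorm H x)\<^sup>2" if "x \<in> hcarrier H" for x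
      by (rule SA_column_bound[OF g that])
    show "(\<Sum>l=1..n. q l i * (of_real \<epsilon> * f l (w i))) = 1" for i
      using one[OF w_mem[of i]] \<epsilon> by (simp add: q_def)
  qed simp
  moreover have "qform N K (\<lambda>i. cnj (q l i) * c i) (\<lambda>i. cnj (q l i) * c i) = of_real (1 / \<epsilon>\<^sup>2) * Q l" for l
  proof -
    have eq: "(\<lambda>i. cnj (q l i) * c i) = (\<lambda>i. of_real (1 / \<epsilon>) * (cnj (\<phi> l (w i)) * c i))" by (simp add: q_def mult_ac)
    show ?thesis unfolding eq Q_def qform_scale_left qform_scale_right by (simp add: power2_eq_square)
  qed
  ultimately have "Re (qform N K c c) \<le> (\<Sum>l=1..n. (1 / \<epsilon>\<^sup>2) * Re (Q l))" by simp
  then have "\<epsilon>\<^sup>2 * Re (qform N K c c) \<le> (\<Sum>l=1..n. Re (Q l))"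
    unfolding sum_distrib_left[symmetric] using \<epsilon> by (simp add: field_simps)
  moreover have "qform N (\<lambda>i j. ((\<Sum>l=1..n. \<phi> l (w i) * cnj (\<phi> l (w j))) - of_real (\<epsilon>\<^sup>2)) * K i j) c c =
    (\<Sum>l=1..n. Q l) - of_real (\<epsilon>\<^sup>2) * qform N K c c"
  proof -
    have "(\<Sum>l=1..n. Q l) = (\<Sum>i<N. \<Sum>j<N. \<Sum>l=1..n. \<phi> l (w i) * cnj (\<phi> l (w j)) * K i j * c j * cnj (c i))"
      unfolding Q_def qform_def
      by (subst sum.swap, rule sum.cong[OF refl], subst sum.swap, intro sum.cong refl) (simp add: mult_ac)
    then show ?thesis unfolding qform_def sum_distrib_left
      by (simp add: sum_subtractf[symmetric] left_diff_distrib sum_distrib_right mult.assoc)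
  qed
  moreover have "Im (Q l) = 0" for l unfolding Q_def using psd_qform_real(1)[OF psd] by (metis Im_complex_of_real)
  moreover have "Im (qform N K c c) = 0" using psd_qform_real(1)[OF psd] by (metis Im_complex_of_real)
  ultimately show ?thesis by (simp add: complex_nonneg_Reals_iff)
qed

end

text \<open>Two regularizations are removed at the end: adding \<eta> times the identity makes the
  matrix definite, and the dilation makes the norm bounds strict. In the limit only the functions
  \<phi> are evaluated at moving points, so their continuity suffices.\<close>

lemma corona_imp_weak_kernel:
  fixes \<phi> f :: "nat \<Rightarrow> complex ^ 3 \<Rightarrow> complex"
  assumes g: "(\<lambda>j z. of_real \<epsilon> * f j z) \<in> SA n" and \<epsilon>: "0 < \<epsilon>"
    and one: "\<And>z. z \<in> pentablock \<Longrightarrow> (\<Sum>j=1..n. \<phi> j z * f j z) = 1"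
    and \<phi>: "\<And>j. j \<in> {1..n} \<Longrightarrow> continuous_on pentablock (\<phi> j)" and k: "k \<in> AK"
  shows "weak_kernel (\<lambda>z w. ((\<Sum>j=1..n. \<phi> j z * cnj (\<phi> j w)) - of_real (\<epsilon>\<^sup>2)) * k z w)"
  unfolding weak_kernel_def
proof (intro allI impI)
  fix N :: nat and z :: "nat \<Rightarrow> complex ^ 3" and c assume z: "\<forall>i<N. z i \<in> pentablock"
  \<comment> \<open>The origin, the point of the zero matrix, is the default value, so that every
    index names a point of the pentablock.\<close>
  define p where "p = (\<lambda>i. if i < N then z i else 0)"
  have "(0 :: complex ^ 3) = pent_of 0" by (rule vec3_eqI) (simp_all add: pent_of_nth)
  then have "(0 :: complex ^ 3) \<in> pentablock" unfolding pentablock_iff by (intro exI[of _ 0] exI[of _ 0]) auto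
  then have p: "p i \<in> pentablock" for i using z by (simp add: p_def)
  have kpos: "qform N (\<lambda>i j. Q (p i) (p j)) x x \<in> \<real>\<^sub>\<ge>\<^sub>0" if "weak_kernel Q" for Q x
    using that p unfolding weak_kernel_def qform_def by blast
  have tk: "weak_kernel (\<lambda>z w. (1 - test_fun t \<alpha> z * cnj (test_fun t \<alpha> w)) * k z w)" if "cmod \<alpha> \<le> 1" for t \<alpha>
    using k that unfolding AK_def test_fun_def by (cases "t = 0"; cases "t = 1") auto
  have diag: "qform N (\<lambda>i j. of_bool (i = j) * of_real (d i)) x x = of_real (\<Sum>i<N. d i * (cmod (x i))\<^sup>2)" for d x
    unfolding qform_kform kform_diagonal[OF finite_lessThan] by simp
  have qadd: "qform N (\<lambda>i j. P i j + R i j) x x = qform N P x x + qform N R x x" for P R x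
    unfolding qform_kform kform_add ..
  define \<eta> where "\<eta> = (\<lambda>m. 1 / (real m + 1))"
  \<comment> \<open>The 2 in the denominator keeps \<open>r\<close> positive also for
    \<open>m = 0\<close>.\<close>
  define r where "r = (\<lambda>m. 1 - 1 / (real m + 2))"
  \<comment> \<open>The identity is added with respect to indices, not points, so the matrix is
    definite even if points of the list coincide.\<close>
  define K where "K = (\<lambda>m i j. k (p i) (p j) + of_bool (i = j) * of_real (\<eta> m))"
  define M where "M = (\<lambda>z w. (\<Sum>j=1..n. \<phi> j z * cnj (\<phi> j w)) - of_real (\<epsilon>\<^sup>2))"
  have step: "qform N (\<lambda>i j. M (dilate (r m) (p i)) (dilate (r m) (p j)) * K m i j) c c \<in> \<real>\<^sub>\<ge>\<^sub>0" for m
  proof -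
    have \<eta>: "\<eta> m > 0" by (simp add: \<eta>_def)
    have k0: "qform N (\<lambda>i j. k (p i) (p j)) x x \<in> \<real>\<^sub>\<ge>\<^sub>0" for x by (rule kpos) (use k in \<open>simp add: AK_def\<close>)
    have Kx: "qform N (K m) x x = qform N (\<lambda>i j. k (p i) (p j)) x x + of_real (\<Sum>i<N. \<eta> m * (cmod (x i))\<^sup>2)" for x
      unfolding K_def qadd diag ..
    have s0: "0 \<le> (\<Sum>i<N. d i * (cmod (x i))\<^sup>2)" if "\<And>i. 0 \<le> d i" for x :: "nat \<Rightarrow> complex" and d
      using that by (intro sum_nonneg mult_nonneg_nonneg) auto
    have psd: "psd N (K m)" unfolding psd_def Kx using k0 s0[of "\<lambda>_. \<eta> m"] \<eta>
      by (intro allI nonneg_Reals_add_I) (simp_all only: nonneg_Reals_of_real_iff less_imp_le)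
    have def: "x i = 0" if "qform N (K m) x x = 0" "i < N" for x i
    proof -
      have "Re (qform N (\<lambda>i j. k (p i) (p j)) x x) \<ge> 0" using k0[of x] by (simp add: complex_nonneg_Reals_iff)
      moreover have "Re (qform N (K m) x x) = Re (qform N (\<lambda>i j. k (p i) (p j)) x x) + (\<Sum>i<N. \<eta> m * (cmod (x i))\<^sup>2)"
        unfolding Kx by (simp del: of_real_sum)
      ultimately have "(\<Sum>i<N. \<eta> m * (cmod (x i))\<^sup>2) = 0" using that(1) s0[of "\<lambda>_. \<eta> m" x] \<eta> by simp
      then have "\<forall>i\<in>{..<N}. \<eta> m * (cmod (x i))\<^sup>2 = 0" using \<eta> by (subst (asm) sum_nonneg_eq_0_iff) auto
      then show ?thesis using that(2) \<eta> by simp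
    qed
    have test: "qform N (\<lambda>i j. (1 - test_fun t \<alpha> (p i) * cnj (test_fun t \<alpha> (p j))) * K m i j) x x \<in> \<real>\<^sub>\<ge>\<^sub>0"
      if \<alpha>: "cmod \<alpha> \<le> 1" for t \<alpha> x
    proof -
      have "qform N (\<lambda>i j. (1 - test_fun t \<alpha> (p i) * cnj (test_fun t \<alpha> (p j))) * K m i j) x x =
        qform N (\<lambda>i j. (1 - test_fun t \<alpha> (p i) * cnj (test_fun t \<alpha> (p j))) * k (p i) (p j) +
          of_bool (i = j) * of_real (\<eta> m * (1 - (cmod (test_fun t \<alpha> (p i)))\<^sup>2))) x x"
        by (rule qform_cong) (auto simp: K_def of_bool_def complex_norm_square algebra_simps simp del: of_real_power)
      also have "\<dots> \<in> \<real>\<^sub>\<ge>\<^sub>0" unfolding qadd diag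
      proof (intro nonneg_Reals_add_I kpos[OF tk[OF \<alpha>]])
        have "0 \<le> \<eta> m * (1 - (cmod (test_fun t \<alpha> (p i)))\<^sup>2)" for i
          using test_fun_bound[OF p \<alpha>, of t i] \<eta> by (simp add: power_le_one)
        then show "complex_of_real (\<Sum>i<N. \<eta> m * (1 - (cmod (test_fun t \<alpha> (p i)))\<^sup>2) * (cmod (x i))\<^sup>2) \<in> \<real>\<^sub>\<ge>\<^sub>0"
          unfolding nonneg_Reals_of_real_iff by (rule s0)
      qed
      finally show ?thesis .
    qed
    obtain S :: nat and e where e: "\<forall>s<S. \<forall>t<S. qform N (K m) (e s) (e t) = of_bool (s = t)"
      "\<forall>k<N. \<forall>y. qform N (K m) (\<lambda>i. of_bool (i = k)) y =
       (\<Sum>s<S. qform N (K m) (\<lambda>i. of_bool (i = k)) (e s) * qform N (K m) (e s) y)"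
      by (rule psd_orthonormal_basis[OF psd])
    have "0 < r m" "r m < 1" by (auto simp: r_def)
    then interpret pent_rkhs N "K m" S e p "r m"
      by unfold_locales (use psd def e p test in blast)+
    show ?thesis using corona_matrix_positive[OF g \<epsilon> one, of c] unfolding w_def M_def .
  qed
  have rlim: "r \<longlonglongrightarrow> 1"
  proof -
    have "(\<lambda>m. 1 / (real (Suc m) + 1)) \<longlonglongrightarrow> 0"
      using LIMSEQ_Suc[OF LIMSEQ_inverse_real_of_nat] by (simp add: inverse_eq_divide add.commute)
    then have "(\<lambda>m. 1 - 1 / (real (Suc m) + 1)) \<longlonglongrightarrow> 1 - 0" by (intro tendsto_intros)
    then show ?thesis unfolding r_def by (simp add: add.commute add.left_commute)
  qed
  have \<eta>lim: "\<eta> \<longlonglongrightarrow> 0" unfolding \<eta>_def using LIMSEQ_inverse_real_of_nat by (simp add: inverse_eq_divide add.commute)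
  have dlim: "(\<lambda>m. dilate (r m) (p i)) \<longlonglongrightarrow> p i" for i
  proof (rule vec_tendstoI)
    fix l :: 3
    have "(\<lambda>m. of_real (r m) * p i $ 1) \<longlonglongrightarrow> of_real 1 * p i $ 1" "(\<lambda>m. of_real (r m) * p i $ 2) \<longlonglongrightarrow> of_real 1 * p i $ 2"
      "(\<lambda>m. (of_real (r m))\<^sup>2 * p i $ 3) \<longlonglongrightarrow> (of_real 1)\<^sup>2 * p i $ 3" by (intro tendsto_intros rlim)+
    then show "(\<lambda>m. dilate (r m) (p i) $ l) \<longlonglongrightarrow> p i $ l" using exhaust_3[of l] by auto
  qed
  have \<phi>lim: "(\<lambda>m. \<phi> j (dilate (r m) (p i))) \<longlonglongrightarrow> \<phi> j (p i)" if "j \<in> {1..n}" for i j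
  proof (rule continuous_on_tendsto_compose[OF \<phi>[OF that] dlim p], rule always_eventually, rule allI)
    show "dilate (r m) (p i) \<in> pentablock" for m by (rule dilate_pentablock[OF p]) (auto simp: r_def)
  qed
  have "(\<lambda>m. qform N (\<lambda>i j. M (dilate (r m) (p i)) (dilate (r m) (p j)) * K m i j) c c) \<longlonglongrightarrow>
    qform N (\<lambda>i j. M (p i) (p j) * (k (p i) (p j) + of_bool (i = j) * of_real 0)) c c"
    unfolding qform_def K_def M_def by (intro tendsto_intros \<phi>lim \<eta>lim)
  note lim = this
  have "qform N (\<lambda>i j. M (p i) (p j) * (k (p i) (p j) + of_bool (i = j) * of_real 0)) c c \<in> \<real>\<^sub>\<ge>\<^sub>0"
    by (rule closed_sequentially[OF closed_nonneg_Reals_complex _ lim]) (rule step)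
  moreover have "qform N (\<lambda>i j. M (p i) (p j) * (k (p i) (p j) + of_bool (i = j) * of_real 0)) c c =
    (\<Sum>i<N. \<Sum>j<N. M (z i) (z j) * k (z i) (z j) * c j * cnj (c i))"
    unfolding qform_def by (intro sum.cong refl) (simp add: p_def)
  ultimately show "(\<Sum>i<N. \<Sum>j<N. ((\<Sum>l=1..n. \<phi> l (z i) * cnj (\<phi> l (z j))) - of_real (\<epsilon>\<^sup>2)) * k (z i) (z j) * c j * cnj (c i)) \<in> \<real>\<^sub>\<ge>\<^sub>0"
    by (simp add: M_def)
qed

section \<open>The corona theorem\<close>

theorem theorem3p2:
  fixes n :: nat and \<phi> :: "nat \<Rightarrow> complex ^ 3 \<Rightarrow> complex" and \<epsilon> :: real
  assumes "1 \<le> n" and "\<forall>j\<in>{1..n}. \<phi> j \<in> Hinf pentablock" and "0 < \<epsilon>"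
  shows
    "((\<exists>f. (\<forall>j\<in>{1..n}. f j \<in> Hinf pentablock) \<and>
           (\<lambda>j z. of_real \<epsilon> * f j z) \<in> SA n \<and>
           (\<forall>z\<in>pentablock. (\<Sum>j=1..n. \<phi> j z * f j z) = 1))
      \<longleftrightarrow>
      (\<forall>k\<in>AK. weak_kernel
         (\<lambda>z w. ((\<Sum>j=1..n. \<phi> j z * cnj (\<phi> j w)) - of_real (\<epsilon>\<^sup>2)) * k z w)))
     \<and>
     ((\<forall>k\<in>AK. weak_kernel
         (\<lambda>z w. ((\<Sum>j=1..n. \<phi> j z * cnj (\<phi> j w)) - of_real (\<epsilon>\<^sup>2)) * k z w))
      \<longleftrightarrow>
      (\<exists>\<xi> \<eta> \<delta>. positive_kernel \<xi> \<and> positive_kernel \<eta> \<and> weak_kernel \<delta> \<and>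
         (\<forall>z\<in>pentablock. \<forall>w\<in>pentablock.
            (\<Sum>j=1..n. \<phi> j z * cnj (\<phi> j w)) - of_real (\<epsilon>\<^sup>2) =
              \<xi> z w (\<lambda>\<alpha>. 1 - J_fun z \<alpha> * cnj (J_fun w \<alpha>)) +
              \<eta> z w (\<lambda>\<alpha>. 1 - j_fun z \<alpha> * cnj (j_fun w \<alpha>)) +
              (1 - z $ 2 * cnj (w $ 2) / 4) * \<delta> z w)))"
proof -
  let ?M = "\<lambda>z w. (\<Sum>j=1..n. \<phi> j z * cnj (\<phi> j w)) - of_real (\<epsilon>\<^sup>2)"
  let ?one = "\<exists>f. (\<forall>j\<in>{1..n}. f j \<in> Hinf pentablock) \<and> (\<lambda>j z. of_real \<epsilon> * f j z) \<in> SA n \<and>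
           (\<forall>z\<in>pentablock. (\<Sum>j=1..n. \<phi> j z * f j z) = 1)"
  let ?two = "\<forall>k\<in>AK. weak_kernel (\<lambda>z w. ?M z w * k z w)"
  let ?three = "\<exists>\<xi> \<eta> \<delta>. positive_kernel \<xi> \<and> positive_kernel \<eta> \<and> weak_kernel \<delta> \<and>
         (\<forall>z\<in>pentablock. \<forall>w\<in>pentablock. ?M z w =
              \<xi> z w (\<lambda>\<alpha>. 1 - J_fun z \<alpha> * cnj (J_fun w \<alpha>)) +
              \<eta> z w (\<lambda>\<alpha>. 1 - j_fun z \<alpha> * cnj (j_fun w \<alpha>)) +
              (1 - z $ 2 * cnj (w $ 2) / 4) * \<delta> z w)"
  have cont: "continuous_on pentablock (\<phi> j)" if "j \<in> {1..n}" for j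
    using assms(2) that by (intro holo_on_imp_continuous_on) (auto simp: Hinf_def)
  have herm: "?M w z = cnj (?M z w)" for z w by (simp add: cnj_sum mult.commute)
  have cert: "certified F (\<lambda>z w. ?M z w + of_bool (z = w) * of_real \<delta>)"
    if two: ?two and F: "finite F" "F \<subseteq> pentablock" "0 < \<delta>" for F \<delta>
    by (rule certificate[OF herm _ F]) (use two in blast)
  have 12: ?two if one: ?one
  proof
    fix k assume k: "k \<in> AK"
    obtain f where f: "(\<lambda>j z. of_real \<epsilon> * f j z) \<in> SA n" "\<forall>z\<in>pentablock. (\<Sum>j=1..n. \<phi> j z * f j z) = 1"
      using one by blast
    show "weak_kernel (\<lambda>z w. ?M z w * k z w)"
      by (rule corona_imp_weak_kernel[OF f(1) assms(3) f(2)[rule_format] cont k])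
  qed
  have 21: ?one if two: ?two
    by (rule certified_imp_corona[OF cert[OF two] cont assms(3)])
  have 23: ?three if two: ?two
    by (rule certified_imp_decomposition[OF cert[OF two]])
  have 32: ?two if three: ?three
  proof
    fix k assume k: "k \<in> AK"
    obtain \<xi> \<eta> \<delta> where d: "positive_kernel \<xi>" "positive_kernel \<eta>" "weak_kernel \<delta>"
      "\<forall>z\<in>pentablock. \<forall>w\<in>pentablock. ?M z w =
              \<xi> z w (\<lambda>\<alpha>. 1 - J_fun z \<alpha> * cnj (J_fun w \<alpha>)) +
              \<eta> z w (\<lambda>\<alpha>. 1 - j_fun z \<alpha> * cnj (j_fun w \<alpha>)) +
              (1 - z $ 2 * cnj (w $ 2) / 4) * \<delta> z w"
      using three by blast
    show "weak_kernel (\<lambda>z w. ?M z w * k z w)"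
      by (rule decomposition_imp_weak_kernel[OF d(1-3) d(4)[rule_format] k])
  qed
  show ?thesis
    by (intro conjI iffI) (fact 12 21 23 32)+
qed

end
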